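(* Let $G$ be a partially dynamic graph and let $\mathcal{P}$ be the paw, the diamond, the 4-clique, or a $k$-cycle with $k\ge 3$. Assuming the OMv Conjecture, there is no partially dynamic algorithm that maintains whether $\mathbf{c}(G,\mathcal{P})>0$ with polynomial preprocessing time, worst-case update time $O(m^{1/2-\delta})$ and query time $O(m^{1-\delta})$ with error probability at most $1/3$, for any $\delta>0$. This also holds for fully dynamic algorithms with amortized update time; for detecting paws, diamonds, 4-cliques, or odd $k$-cycles containing a specific vertex $s$; for maintaining the number of length-3 paths; and for maintaining the number of length-3 paths containing a specific vertex $s$.
   Context: A partially dynamic graph is a simple undirected graph on a fixed vertex set that undergoes only edge insertions or only edge deletions; fully dynamic allows both; $m$ denotes the number of edges. $\mathbf{c}(G,\mathcal{P})$ is the number of (not necessarily induced) subgraphs of $G$ isomorphic to $\mathcal{P}$. Paw: triangle plus a pendant edge at one triangle vertex; diamond: $K_4$ minus an edge; length-3 path: path with three edges. OMv Conjecture: in the Online Boolean Matrix-Vector Multiplication problem one is given an $n\times n$ Boolean matrix $M$ that may be preprocessed, then Boolean vectors $v_1,\dots,v_n$ arrive online and each Boolean product $Mv_i$ must be output before $v_{i+1}$ is revealed; the conjecture states that for any constant $\delta>0$ there is no $O(n^{3-\delta})$-time algorithm solving OMv with error probability at most $1/3$ in the word-RAM model with $O(\log n)$-bit words. *)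

theory Defs
  imports
    "HOL-Probability.SPMF"
    "HOL-Library.Landau_Symbols"
    "HOL-Library.Log_Nat"
begin

text \<open>
  Randomised word-RAM programs are structured while-programs over registers, a word-addressed memory, a read-only
  random-access input array and an append-only output. Every primitive instruction and every
  branch or loop test costs one step; jump programs with unit-cost instructions are simulated
  with constant overhead. Words are naturals below \<open>2 ^ w\<close>, and all arithmetic is modulo \<open>2 ^ w\<close>.
\<close>

datatype binop = Add | Sub | Mul | Div | Mod | And | Or | Xor | Shl | Shr | Lt | Eq

datatype com =
    Skip
  | Const nat nat
  | Bin binop nat nat nat
  | Load nat nat
  | Store nat nat
  | Rand nat
  | Read nat nat
  | Write nat
  | Seq com com
  | If_NZ nat com com
  | While_NZ nat com

record ram =
  reg :: "nat \<Rightarrow> nat"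
  mem :: "nat \<Rightarrow> nat"
  out :: "nat list"

fun eval_binop :: "nat \<Rightarrow> binop \<Rightarrow> nat \<Rightarrow> nat \<Rightarrow> nat" where
  "eval_binop w Add a b = take_bit w (a + b)"
| "eval_binop w Sub a b = take_bit w (2 ^ w + a - b)"
| "eval_binop w Mul a b = take_bit w (a * b)"
| "eval_binop w Div a b = take_bit w (a div b)"
| "eval_binop w Mod a b = take_bit w (a mod b)"
| "eval_binop w And a b = take_bit w (Bit_Operations.and a b)"
| "eval_binop w Or a b = take_bit w (Bit_Operations.or a b)"
| "eval_binop w Xor a b = take_bit w (Bit_Operations.xor a b)"
| "eval_binop w Shl a b = take_bit w (push_bit b a)"
| "eval_binop w Shr a b = take_bit w (drop_bit b a)"
| "eval_binop w Lt a b = take_bit w (of_bool (a < b))"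
| "eval_binop w Eq a b = take_bit w (of_bool (a = b))"

definition set_reg :: "nat \<Rightarrow> nat \<Rightarrow> ram \<Rightarrow> ram" where
  "set_reg x a s = s\<lparr>reg := (reg s)(x := a)\<rparr>"

text \<open>Results are pairs of running time and final state; missing mass is non-termination.\<close>

partial_function (spmf) loop ::
    "('s \<Rightarrow> bool) \<Rightarrow> ('s \<Rightarrow> (nat \<times> 's) spmf) \<Rightarrow> 's \<Rightarrow> (nat \<times> 's) spmf" where
  "loop b f s =
     (if b s
      then bind_spmf (f s) (\<lambda>r. map_spmf (\<lambda>r'. (Suc (fst r + fst r'), snd r')) (loop b f (snd r)))
      else return_spmf (1, s))"

primrec exec :: "nat \<Rightarrow> nat list \<Rightarrow> com \<Rightarrow> ram \<Rightarrow> (nat \<times> ram) spmf" where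
  "exec w inp Skip s = return_spmf (1, s)"
| "exec w inp (Const x k) s = return_spmf (1, set_reg x (take_bit w k) s)"
| "exec w inp (Bin f x y z) s =
     return_spmf (1, set_reg x (eval_binop w f (reg s y) (reg s z)) s)"
| "exec w inp (Load x y) s = return_spmf (1, set_reg x (mem s (reg s y)) s)"
| "exec w inp (Store x y) s = return_spmf (1, s\<lparr>mem := (mem s)(reg s x := reg s y)\<rparr>)"
| "exec w inp (Rand x) s = map_spmf (\<lambda>a. (1, set_reg x a s)) (spmf_of_set {..<2 ^ w})"
| "exec w inp (Read x y) s =
     return_spmf (1, set_reg x
       (if reg s y < length inp then take_bit w (inp ! reg s y) else 0) s)"
| "exec w inp (Write x) s = return_spmf (1, s\<lparr>out := out s @ [reg s x]\<rparr>)"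
| "exec w inp (Seq c d) s =
     bind_spmf (exec w inp c s) (\<lambda>r. map_spmf (\<lambda>r'. (fst r + fst r', snd r')) (exec w inp d (snd r)))"
| "exec w inp (If_NZ x c d) s =
     map_spmf (\<lambda>r. (Suc (fst r), snd r))
       (if reg s x \<noteq> 0 then exec w inp c s else exec w inp d s)"
| "exec w inp (While_NZ x c) s = loop (\<lambda>s. reg s x \<noteq> 0) (exec w inp c) s"

text \<open>
  An online computation is a sequence of procedure calls, each with its own input, that
  communicate only through the memory. Its trace lists running time and output of each call.
\<close>

primrec session ::
    "nat \<Rightarrow> (com \<times> nat list) list \<Rightarrow> (nat \<Rightarrow> nat) \<Rightarrow> (nat \<times> nat list) list spmf" where
  "session w [] m = return_spmf []"
| "session w (call # calls) m =
     bind_spmf (exec w (snd call) (fst call) \<lparr>reg = (\<lambda>_. 0), mem = m, out = []\<rparr>)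
       (\<lambda>r. map_spmf (\<lambda>tr. (fst r, out (snd r)) # tr) (session w calls (mem (snd r))))"

definition word_size :: "nat \<Rightarrow> nat \<Rightarrow> nat" where
  "word_size c n = c * (floorlog 2 n + 1)"

record omv_alg =
  omv_pre :: com
  omv_mult :: com
  omv_word :: nat

definition bool_mult :: "nat \<Rightarrow> (nat \<Rightarrow> nat \<Rightarrow> bool) \<Rightarrow> (nat \<Rightarrow> bool) \<Rightarrow> nat \<Rightarrow> bool" where
  "bool_mult n M v i \<longleftrightarrow> (\<exists>j<n. M i j \<and> v j)"

definition encode_vec :: "nat \<Rightarrow> (nat \<Rightarrow> bool) \<Rightarrow> nat list" where
  "encode_vec n v = map (\<lambda>j. of_bool (v j)) [0..<n]"

definition omv_run ::
    "omv_alg \<Rightarrow> nat \<Rightarrow> (nat \<Rightarrow> nat \<Rightarrow> bool) \<Rightarrow> (nat \<Rightarrow> nat \<Rightarrow> bool) \<Rightarrow> (nat \<times> nat list) list spmf" where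
  "omv_run A n M v =
     session (word_size (omv_word A) n)
       ((omv_pre A, n # concat (map (\<lambda>i. encode_vec n (M i)) [0..<n]))
        # map (\<lambda>t. (omv_mult A, encode_vec n (v t))) [0..<n])
       (\<lambda>_. 0)"

definition omv_correct ::
    "nat \<Rightarrow> (nat \<Rightarrow> nat \<Rightarrow> bool) \<Rightarrow> (nat \<Rightarrow> nat \<Rightarrow> bool) \<Rightarrow> (nat \<times> nat list) list \<Rightarrow> bool" where
  "omv_correct n M v tr \<longleftrightarrow>
     (\<forall>t<n. snd (tr ! Suc t) = encode_vec n (bool_mult n M (v t)))"

definition solves_omv :: "omv_alg \<Rightarrow> bool" where
  "solves_omv A \<longleftrightarrow>
     (\<forall>n M v. lossless_spmf (omv_run A n M v) \<and>
        measure (measure_spmf (omv_run A n M v)) {tr. \<not> omv_correct n M v tr} \<le> 1 / 3)"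

text \<open>Total time over all calls, including the preprocessing of the matrix.\<close>

definition omv_time :: "omv_alg \<Rightarrow> (nat \<Rightarrow> real) \<Rightarrow> bool" where
  "omv_time A g \<longleftrightarrow>
     (\<exists>T \<in> O(g). \<forall>n M v. \<forall>tr \<in> set_spmf (omv_run A n M v).
        real (sum_list (map fst tr)) \<le> T n)"

definition OMv_conjecture :: bool where
  "OMv_conjecture \<longleftrightarrow>
     (\<forall>\<delta>>0. \<not> (\<exists>A. solves_omv A \<and> omv_time A (\<lambda>n. real n powr (3 - \<delta>))))"

type_synonym ugraph = "nat set \<times> nat set set"

definition subgraph :: "ugraph \<Rightarrow> ugraph \<Rightarrow> bool" where
  "subgraph H G \<longleftrightarrow> fst H \<subseteq> fst G \<and> snd H \<subseteq> snd G \<and> \<Union> (snd H) \<subseteq> fst H"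

definition isomorphic :: "ugraph \<Rightarrow> ugraph \<Rightarrow> bool" where
  "isomorphic H P \<longleftrightarrow> (\<exists>f. bij_betw f (fst H) (fst P) \<and> (\<lambda>e. f ` e) ` snd H = snd P)"

definition subgraph_count :: "ugraph \<Rightarrow> ugraph \<Rightarrow> nat" where
  "subgraph_count G P = card {H. subgraph H G \<and> isomorphic H P}"

definition subgraph_count_at :: "nat \<Rightarrow> ugraph \<Rightarrow> ugraph \<Rightarrow> nat" where
  "subgraph_count_at s G P = card {H. subgraph H G \<and> isomorphic H P \<and> s \<in> fst H}"

definition paw :: ugraph where
  "paw = ({0, 1, 2, 3}, {{0, 1}, {1, 2}, {0, 2}, {0, 3}})"

definition diamond :: ugraph where
  "diamond = ({0, 1, 2, 3}, {{0, 1}, {0, 2}, {0, 3}, {1, 2}, {1, 3}})"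

definition clique4 :: ugraph where
  "clique4 = ({0, 1, 2, 3}, {{0, 1}, {0, 2}, {0, 3}, {1, 2}, {1, 3}, {2, 3}})"

definition cycle :: "nat \<Rightarrow> ugraph" where
  "cycle k = ({..<k}, {{i, Suc i mod k} | i. i < k})"

definition path3 :: ugraph where
  "path3 = ({0, 1, 2, 3}, {{0, 1}, {1, 2}, {2, 3}})"

datatype update_mode = Incremental | Decremental | Fully_Dynamic

datatype graph_op = Insert nat nat | Delete nat nat | Query

text \<open>The \<open>_At\<close> problems receive the distinguished vertex as part of the preprocessing input.\<close>

datatype problem = Detect ugraph | Detect_At ugraph | Count ugraph | Count_At ugraph

fun root_input :: "problem \<Rightarrow> nat \<Rightarrow> nat list" where
  "root_input (Detect P) s = []"
| "root_input (Detect_At P) s = [s]"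
| "root_input (Count P) s = []"
| "root_input (Count_At P) s = [s]"

fun answer :: "problem \<Rightarrow> nat \<Rightarrow> ugraph \<Rightarrow> nat" where
  "answer (Detect P) s G = of_bool (subgraph_count G P > 0)"
| "answer (Detect_At P) s G = of_bool (subgraph_count_at s G P > 0)"
| "answer (Count P) s G = subgraph_count G P"
| "answer (Count_At P) s G = subgraph_count_at s G P"

definition uedge :: "nat \<times> nat \<Rightarrow> nat set" where
  "uedge p = {fst p, snd p}"

definition edge_list :: "nat \<Rightarrow> (nat \<times> nat) list \<Rightarrow> bool" where
  "edge_list n es \<longleftrightarrow>
     (\<forall>(u, v) \<in> set es. u < n \<and> v < n \<and> u \<noteq> v) \<and> distinct (map uedge es)"

fun apply_op :: "graph_op \<Rightarrow> nat set set \<Rightarrow> nat set set" where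
  "apply_op (Insert u v) E = insert {u, v} E"
| "apply_op (Delete u v) E = E - {{u, v}}"
| "apply_op Query E = E"

fun legal_op :: "update_mode \<Rightarrow> nat \<Rightarrow> nat set set \<Rightarrow> graph_op \<Rightarrow> bool" where
  "legal_op md n E (Insert u v) \<longleftrightarrow>
     md \<noteq> Decremental \<and> u < n \<and> v < n \<and> u \<noteq> v \<and> {u, v} \<notin> E"
| "legal_op md n E (Delete u v) \<longleftrightarrow> md \<noteq> Incremental \<and> {u, v} \<in> E"
| "legal_op md n E Query \<longleftrightarrow> True"

definition edges_before :: "(nat \<times> nat) list \<Rightarrow> graph_op list \<Rightarrow> nat \<Rightarrow> nat set set" where
  "edges_before es ops i = fold apply_op (take i ops) (uedge ` set es)"

definition valid_instance ::
    "update_mode \<Rightarrow> problem \<Rightarrow> nat \<Rightarrow> nat \<Rightarrow> (nat \<times> nat) list \<Rightarrow> graph_op list \<Rightarrow> bool" where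
  "valid_instance md p n s es ops \<longleftrightarrow>
     edge_list n es \<and> (root_input p s \<noteq> [] \<longrightarrow> s < n) \<and>
     (\<forall>i<length ops. legal_op md n (edges_before es ops i) (ops ! i))"

record dyn_alg =
  preprocess :: com
  insertion :: com
  deletion :: com
  query :: com
  dyn_word :: nat

fun op_call :: "dyn_alg \<Rightarrow> graph_op \<Rightarrow> com \<times> nat list" where
  "op_call A (Insert u v) = (insertion A, [u, v])"
| "op_call A (Delete u v) = (deletion A, [u, v])"
| "op_call A Query = (query A, [])"

text \<open>In the trace, entry \<open>0\<close> is the preprocessing and entry \<open>Suc i\<close> the \<open>i\<close>-th operation.\<close>

definition dyn_run ::
    "dyn_alg \<Rightarrow> problem \<Rightarrow> nat \<Rightarrow> nat \<Rightarrow> (nat \<times> nat) list \<Rightarrow> graph_op list \<Rightarrow>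
     (nat \<times> nat list) list spmf" where
  "dyn_run A p n s es ops =
     session (word_size (dyn_word A) n)
       ((preprocess A,
         root_input p s @ n # length es # concat (map (\<lambda>(u, v). [u, v]) es))
        # map (op_call A) ops)
       (\<lambda>_. 0)"

text \<open>The operation sequence is fixed in advance, and the error bound holds for each query.\<close>

definition maintains :: "update_mode \<Rightarrow> problem \<Rightarrow> dyn_alg \<Rightarrow> bool" where
  "maintains md p A \<longleftrightarrow>
     (\<forall>n s es ops. valid_instance md p n s es ops \<longrightarrow>
        lossless_spmf (dyn_run A p n s es ops) \<and>
        (\<forall>i<length ops. ops ! i = Query \<longrightarrow>
           measure (measure_spmf (dyn_run A p n s es ops))
             {tr. snd (tr ! Suc i) \<noteq> [answer p s ({..<n}, edges_before es ops i)]} \<le> 1 / 3))"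

definition polynomial_preprocessing :: "update_mode \<Rightarrow> problem \<Rightarrow> dyn_alg \<Rightarrow> bool" where
  "polynomial_preprocessing md p A \<longleftrightarrow>
     (\<exists>d::nat. \<exists>T \<in> O(\<lambda>n. real n ^ d). \<forall>n s es ops. valid_instance md p n s es ops \<longrightarrow>
        (\<forall>tr \<in> set_spmf (dyn_run A p n s es ops). real (fst (tr ! 0)) \<le> T n))"

text \<open>Operation times are bounded in terms of the number of edges of the current graph.\<close>

definition worst_case_update_time ::
    "update_mode \<Rightarrow> problem \<Rightarrow> dyn_alg \<Rightarrow> (nat \<Rightarrow> real) \<Rightarrow> bool" where
  "worst_case_update_time md p A g \<longleftrightarrow>
     (\<exists>U \<in> O(g). \<forall>n s es ops. valid_instance md p n s es ops \<longrightarrow>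
        (\<forall>tr \<in> set_spmf (dyn_run A p n s es ops). \<forall>i<length ops. ops ! i \<noteq> Query \<longrightarrow>
           real (fst (tr ! Suc i)) \<le> U (card (edges_before es ops i))))"

definition amortized_update_time ::
    "update_mode \<Rightarrow> problem \<Rightarrow> dyn_alg \<Rightarrow> (nat \<Rightarrow> real) \<Rightarrow> bool" where
  "amortized_update_time md p A g \<longleftrightarrow>
     (\<exists>U \<in> O(g). \<forall>n s es ops. valid_instance md p n s es ops \<longrightarrow>
        (\<forall>tr \<in> set_spmf (dyn_run A p n s es ops).
           (\<Sum>i | i < length ops \<and> ops ! i \<noteq> Query. real (fst (tr ! Suc i)))
           \<le> (\<Sum>i | i < length ops \<and> ops ! i \<noteq> Query. U (card (edges_before es ops i)))))"

definition query_time ::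
    "update_mode \<Rightarrow> problem \<Rightarrow> dyn_alg \<Rightarrow> (nat \<Rightarrow> real) \<Rightarrow> bool" where
  "query_time md p A g \<longleftrightarrow>
     (\<exists>Q \<in> O(g). \<forall>n s es ops. valid_instance md p n s es ops \<longrightarrow>
        (\<forall>tr \<in> set_spmf (dyn_run A p n s es ops). \<forall>i<length ops. ops ! i = Query \<longrightarrow>
           real (fst (tr ! Suc i)) \<le> Q (card (edges_before es ops i))))"

end

theory Submission
  imports Defs
begin

text \<open>
  Cut the matrix into square blocks of side \<open>k\<close>, a small power of \<open>n\<close>, and preprocess a graph for each block:
  a vertex for every row, every column and, where the pattern needs it, every entry, together with
  isolated dummy edges that keep the number of edges of order \<open>k\<^sup>2\<close> whatever the matrix is. For vectors \<open>u\<close>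
  and \<open>v\<close>, at most \<open>2 k\<close> updates attach the rows in \<open>u\<close> and the columns in \<open>v\<close> to a root, and one query
  tells whether \<open>u\<^sup>T M v\<close> is nonzero. For paths with three edges, doubling the rows and columns makes the
  matrix part regular, so that the count differs from the number of entries hit by a function of
  \<open>k\<close>, \<open>|u|\<close> and \<open>|v|\<close>.

  After every query the simulated memory is rolled back to the state after preprocessing by
  changing a time stamp; hence insertions and deletions are both covered, and amortised bounds are
  as good as worst-case ones. A product \<open>M v\<close> asks, for every block, whether some row whose answer is not
  yet known is hit, and searches the block by brute force if so; every search but the
  erroneous ones resolves a row, and the number of searches is capped at \<open>n\<close>. Errors are driven down by a
  majority vote among \<open>O(log n)\<close> independently preprocessed copies. Since the answers given so far influence
  later queries, the copies are not independent of the queries; the error analysis therefore follows the expected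
  value of a product over the copies, which only refers to the memories after preprocessing.
\<close>

subsection \<open>Expected values of randomised programs\<close>

text \<open>The saving must survive preprocessing of an arbitrary polynomial degree
  \<open>d\<close>. The graphs have order k^2 vertices, and with \<open>D = 4 d + 4\<close> blocks
  of side about \<open>n powr (1 / D)\<close> keep k^(2d+2) below order sqrt n, so that
  preprocessing costs about n^(5/2) up to small factors. The online phase takes about n^3 k^(-2 eps)
  per copy, and half of the gain in the exponent pays for the logarithmic number of copies.

  The error bound 1/3 averages over preprocessing, so one particular memory may always be wrong;
  repetition needs independent preprocessing. Adaptivity is removed by comparison with the
  error-free run, whose queries depend on the matrix and the vector only: a wrong result requires a
  first block where the actual run leaves it. There the weight \<open>2 ^ (wrong votes)\<close> has
  expectation at most the product of \<open>1 + e\<close> over the copies, \<open>e\<close> being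
  the error given the memory. Averaging over preprocessing gives \<open>(4 / 3) ^ r\<close>, and the
  majority threshold \<open>rho = r / 2\<close> leaves \<open>(8 / 9) ^ rho\<close>, small enough
  for a union bound over all products and blocks.\<close>

abbreviation Ex :: "'a spmf => ('a => ennreal) => ennreal" where
  "Ex p f \<equiv> nn_integral (measure_spmf p) f"

lemma Ex_bind: "Ex (bind_spmf p f) g = Ex p (%x. Ex (f x) g)"
  by (simp add: measure_spmf_bind o_def
      nn_integral_bind[where B="count_space UNIV"] space_subprob_algebra)

lemma Ex_return [simp]: "Ex (return_spmf x) g = g x"
  by (simp add: measure_spmf_return_spmf nn_integral_return)

lemma Ex_mono: "(\<And>x. x \<in> set_spmf p ==> f x \<le> g x) ==> Ex p f \<le> Ex p g"
  by (rule nn_integral_mono_AE) (simp add: AE_measure_spmf_iff)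

lemma Ex_cong: "(\<And>x. x \<in> set_spmf p ==> f x = g x) ==> Ex p f = Ex p g"
  by (rule antisym; rule Ex_mono) auto

lemma Ex_le_const: "(\<And>x. x \<in> set_spmf p ==> f x \<le> b) ==> Ex p f \<le> b"
proof -
  assume *: "\<And>x. x \<in> set_spmf p ==> f x \<le> b"
  have "Ex p f \<le> Ex p (%_. b)" by (rule Ex_mono) (rule *)
  also have "\<dots> = b * emeasure (measure_spmf p) UNIV" by (simp add: space_measure_spmf)
  also have "\<dots> \<le> b * 1"
    by (rule mult_left_mono) (simp_all add: measure_spmf.emeasure_eq_measure measure_spmf.subprob_measure_le_1)
  finally show ?thesis by simp
qed

lemma Ex_of_bool: "Ex p (%x. of_bool (P x)) = ennreal (measure (measure_spmf p) {x. P x})"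
proof -
  have "Ex p (%x. of_bool (P x)) = Ex p (indicator {x. P x})"
    by (rule nn_integral_cong) (simp add: indicator_def)
  also have "\<dots> = emeasure (measure_spmf p) {x. P x}" by simp
  finally show ?thesis by (simp add: measure_spmf.emeasure_eq_measure)
qed

text \<open>Monotone convergence, applied on the countable support of the supremum; chain members
  give mass 0 to points outside their own support, so all integrals may run over this larger
  set.\<close>

lemma Ex_lub_spmf:
  assumes chain: "Complete_Partial_Order.chain (ord_spmf (=)) Y" and Y: "Y \<noteq> {}"
  shows "Ex (lub_spmf Y) f = (SUP p\<in>Y. Ex p f)"
proof -
  let ?M = "count_space (set_spmf (lub_spmf Y))"
  have chain': "Complete_Partial_Order.chain (\<le>) ((%p x. ennreal (spmf p x) * f x) ` Y)"
    using chain by (rule chain_imageI) (auto simp: le_fun_def intro!: mult_right_mono ennreal_leI intro: ord_spmf_eq_leD)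
  have "Ex (lub_spmf Y) f = \<integral>\<^sup>+ x. ennreal (spmf (lub_spmf Y) x) * f x \<partial>?M"
    by (simp add: nn_integral_measure_spmf')
  also have "\<dots> = \<integral>\<^sup>+ x. (SUP p\<in>Y. ennreal (spmf p x) * f x) \<partial>?M"
    by (subst ennreal_spmf_lub_spmf[OF chain Y]) (subst SUP_mult_right_ennreal, simp_all add: Y)
  also have "\<dots> = (SUP p\<in>Y. \<integral>\<^sup>+ x. ennreal (spmf p x) * f x \<partial>?M)"
    using Y chain' by (rule nn_integral_monotone_convergence_SUP_countable) simp
  also have "\<dots> = (SUP p\<in>Y. Ex p f)"
    by (auto simp: nn_integral_measure_spmf nn_integral_count_space_indicator set_lub_spmf[OF chain]
        in_set_spmf_iff_spmf intro!: arg_cong [of _ _ Sup] image_cong nn_integral_cong split: split_indicator)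
  finally show ?thesis .
qed

text \<open>Upper bounds on expectations pass to suprema of chains. This is why \<open>sim\<close>
  puts the process that is approximated on the smaller side.\<close>

lemma admissible_Ex_le: "ccpo.admissible lub_spmf (ord_spmf (=)) (%p. Ex p f \<le> c)"
  by (rule ccpo.admissibleI) (simp add: Ex_lub_spmf SUP_le_iff)

text \<open>
  A coupling would make \<open>sim R p q\<close> hold; this dual formulation is used instead because it is
  closed under suprema of chains, hence under \<open>loop\<close>.
\<close>

definition sim :: "('a => 'b => bool) => 'a spmf => 'b spmf => bool" where
  "sim R p q \<longleftrightarrow> (\<forall>f g. (\<forall>x y. R x y --> f y \<le> g x) --> Ex q f \<le> Ex p g)"

lemma simD: "sim R p q ==> (\<And>x y. R x y ==> f y \<le> g x) ==> Ex q f \<le> Ex p g"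
  by (auto simp: sim_def)

lemma sim_return: "R x y ==> sim R (return_spmf x) (return_spmf y)"
  by (simp add: sim_def)

lemma sim_mono: "sim R p q ==> (\<And>x y. R x y ==> S x y) ==> sim S p q"
  by (auto simp: sim_def)

lemma sim_bind:
  assumes "sim R p q" "\<And>x y. R x y ==> sim S (f x) (f' y)"
  shows "sim S (bind_spmf p f) (bind_spmf q f')"
  unfolding sim_def Ex_bind
proof (intro allI impI)
  fix g h assume *: "\<forall>x y. S x y --> g y \<le> (h x :: ennreal)"
  show "Ex q (%x. Ex (f' x) g) \<le> Ex p (%x. Ex (f x) h)"
    by (rule simD[OF assms(1)]) (use assms(2) * in \<open>auto simp: sim_def\<close>)
qed

lemma sim_map: "sim (%x y. R (f x) (g y)) p q ==> sim R (map_spmf f p) (map_spmf g q)"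
  unfolding sim_def nn_integral_map_spmf
proof (intro allI impI)
  fix h k assume "\<forall>h k. (\<forall>x y. R (f x) (g y) --> h y \<le> (k x::ennreal)) --> Ex q h \<le> Ex p k"
    "\<forall>x y. R x y --> h y \<le> (k x::ennreal)"
  then show "Ex q (h \<circ> g) \<le> Ex p (k \<circ> f)" by (auto simp: o_def)
qed

text \<open>The test functions are the indicator of \<open>y\<close> and the indicator of the points
  related to \<open>y\<close>: without a related point in the support of \<open>p\<close>, the
  latter has expectation 0.\<close>

lemma sim_set:
  assumes "sim R p q" "y \<in> set_spmf q"
  obtains x where "x \<in> set_spmf p" "R x y"
proof (rule ccontr)
  assume "\<not> thesis"
  with that have *: "\<And>x. x \<in> set_spmf p ==> \<not> R x y" by blast
  have "Ex q (%z. of_bool (z = y)) \<le> Ex p (%x. of_bool (R x y))"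
    by (rule simD[OF assms(1)]) auto
  also have "\<dots> = Ex p (%_. 0)" by (rule Ex_cong) (simp add: *)
  finally have "measure (measure_spmf q) {y} = 0" by (simp add: Ex_of_bool measure_le_0_iff)
  then show False using assms(2) by (simp add: in_set_spmf_iff_spmf spmf_conv_measure_spmf)
qed

text \<open>Non-termination is missing mass and contributes 0 to \<open>Ex\<close>, so the
  expectation of the constant 1 is the termination probability.\<close>

lemma lossless_iff_Ex: "lossless_spmf p \<longleftrightarrow> 1 \<le> Ex p (%_. 1)"
proof -
  have "Ex p (%_. 1) = ennreal (weight_spmf p)"
    by (simp add: measure_spmf.emeasure_eq_measure space_measure_spmf)
  then show ?thesis using weight_spmf_le_1[of p] by (auto simp: lossless_spmf_def ennreal_ge_1 intro: antisym)
qed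

lemma sim_lossless: "sim R q p ==> lossless_spmf p ==> lossless_spmf q"
  unfolding lossless_iff_Ex using simD[of R q p "%_. 1" "%_. 1"] by (meson order_trans order_refl)

text \<open>\<open>T\<close> relates running times; its closure property matches the way
  \<open>loop\<close> adds the times of one round and of the rest.\<close>

lemma sim_loop:
  fixes b :: "'s => bool" and b' :: "'r => bool"
  assumes b: "\<And>s s'. R s s' ==> b s = b' s'"
    and f: "\<And>s s'. R s s' ==> b s ==> sim (%r r'. T (fst r) (fst r') \<and> R (snd r) (snd r')) (f s) (f' s')"
    and T: "T 1 1" "\<And>i i' j j'. T i i' ==> T j j' ==> T (Suc (i + j)) (Suc (i' + j'))"
    and s: "R s s'"
  shows "sim (%r r'. T (fst r) (fst r') \<and> R (snd r) (snd r')) (loop b f s) (loop b' f' s')"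
proof -
  let ?R = "%r r'. T (fst r) (fst r') \<and> R (snd r) (snd r')"
  have "\<forall>s s'. R s s' --> sim ?R (loop b f s) (loop b' f' s')"
  \<comment> \<open>Induction over the approximations of the right-hand loop only; the left-hand
    loop is kept whole and unfolded once per step.\<close>
  proof (rule loop.fixp_induct[where P="%l. \<forall>s s'. R s s' --> sim ?R (loop b f s) (l b' f' s')"], goal_cases)
    case 1 then show ?case unfolding sim_def curry_def
      by (intro admissible_all admissible_imp) (rule admissible_subst[OF admissible_Ex_le], simp)
  next
    case 2 then show ?case by (simp add: sim_def)
  next
    case (3 l)
    have "sim ?R (loop b f s) (if b' s'
         then bind_spmf (f' s') (%r. map_spmf (%r'. (Suc (fst r + fst r'), snd r')) (l b' f' (snd r)))
         else return_spmf (1, s'))" if "R s s'" for s s'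
    proof (cases "b s")
      case True
      have "sim ?R (bind_spmf (f s) (%r. map_spmf (%r'. (Suc (fst r + fst r'), snd r')) (loop b f (snd r))))
        (bind_spmf (f' s') (%r. map_spmf (%r'. (Suc (fst r + fst r'), snd r')) (l b' f' (snd r))))"
      proof (rule sim_bind[OF f[OF that True]])
        fix r r' assume r: "?R r r'"
        then have "sim ?R (loop b f (snd r)) (l b' f' (snd r'))" using 3 by blast
        then show "sim ?R (map_spmf (%r'. (Suc (fst r + fst r'), snd r')) (loop b f (snd r)))
          (map_spmf (%r''. (Suc (fst r' + fst r''), snd r'')) (l b' f' (snd r')))"
          by (intro sim_map) (erule sim_mono, use r T(2) in auto)
      qed
      then show ?thesis using True b[OF that] by (subst loop.simps) simp
    next
      case False
      then show ?thesis using b[OF that] T(1) that by (subst loop.simps) (auto intro: sim_return)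
    qed
    then show ?case by blast
  qed
  then show ?thesis using s by blast
qed

section \<open>Sure postconditions and pre-expectations of commands\<close>

definition sure :: "nat => nat list => com => ram => (nat => ram => bool) => bool" where
  "sure w inp c s Q \<longleftrightarrow> lossless_spmf (exec w inp c s) \<and> (\<forall>r \<in> set_spmf (exec w inp c s). Q (fst r) (snd r))"

lemma sure_return: "exec w inp c s = return_spmf r ==> Q (fst r) (snd r) ==> sure w inp c s Q"
  by (simp add: sure_def)

lemma sure_Seq [simp]:
  "sure w inp (Seq c d) s Q \<longleftrightarrow> sure w inp c s (%t s'. sure w inp d s' (%t'. Q (t + t')))"
  by (auto simp: sure_def set_bind_spmf bind_UNION)

lemma sure_If [simp]:
  "sure w inp (If_NZ x c d) s Q \<longleftrightarrow>
    (if reg s x \<noteq> 0 then sure w inp c s (%t. Q (Suc t)) else sure w inp d s (%t. Q (Suc t)))"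
  by (auto simp: sure_def)

lemma sure_mono:
  "sure w inp c s Q ==> (\<And>t s'. Q t s' ==> Q' t s') ==> sure w inp c s Q'"
  by (auto simp: sure_def)

lemma sure_While:
  "sure w inp (While_NZ x c) s Q \<longleftrightarrow>
    (if reg s x \<noteq> 0 then sure w inp c s (%t s'. sure w inp (While_NZ x c) s' (%t'. Q (Suc (t + t'))))
     else Q 1 s)"
proof (cases "reg s x = 0")
  case True then show ?thesis by (simp add: sure_def loop.simps)
next
  case False
  then show ?thesis
    unfolding sure_def exec.simps
    by (subst (1 2) loop.simps) (auto simp: set_bind_spmf bind_UNION)
qed

text \<open>The weakest pre-expectation of \<open>f\<close>. Running times are ignored here because
  time bounds are always established surely, by \<open>sure\<close>.\<close>

definition ew :: "nat => nat list => com => ram => (ram => ennreal) => ennreal" where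
  "ew w inp c s f = Ex (exec w inp c s) (%r. f (snd r))"

lemma ew_Seq: "ew w inp (Seq c d) s f = ew w inp c s (%s'. ew w inp d s' f)"
  by (simp add: ew_def Ex_bind o_def)

lemma ew_If: "ew w inp (If_NZ x c d) s f = (if reg s x \<noteq> 0 then ew w inp c s f else ew w inp d s f)"
  by (simp add: ew_def o_def)

lemma ew_While: "ew w inp (While_NZ x c) s f =
   (if reg s x \<noteq> 0 then ew w inp c s (%s'. ew w inp (While_NZ x c) s' f) else f s)"
  unfolding ew_def exec.simps by (subst loop.simps) (simp add: Ex_bind o_def)

text \<open>A sure postcondition restricts the support, so \<open>f\<close> and \<open>g\<close>
  need to be compared only on states that satisfy it.\<close>

lemma ew_sure_mono:
  "sure w inp c s Q ==> (\<And>t s'. Q t s' ==> f s' \<le> g s') ==> ew w inp c s f \<le> ew w inp c s g"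
  unfolding ew_def sure_def by (rule Ex_mono) auto

lemma ew_sure_le:
  "sure w inp c s Q ==> (\<And>t s'. Q t s' ==> f s' \<le> b) ==> ew w inp c s f \<le> b"
  unfolding ew_def sure_def by (rule Ex_le_const) auto

subsection \<open>A small imperative language\<close>

notation Seq (infixr ";;" 60)

datatype expr = V nat | C nat | B binop expr expr

text \<open>Exact arithmetic without wrap-around, which agrees with the machine wherever
  \<open>bnd\<close> holds. The operations outside the fragment get the value 0 and are excluded by
  \<open>bnd\<close>.\<close>

fun nop :: "binop => nat => nat => nat" where
  "nop Add a b = a + b"
| "nop Mul a b = a * b"
| "nop Div a b = a div b"
| "nop Mod a b = a mod b"
| "nop Shl a b = a * 2 ^ b"
| "nop Lt a b = of_bool (a < b)"
| "nop Eq a b = of_bool (a = b)"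
| "nop _ a b = 0"

primrec nv :: "(nat => nat) => expr => nat" where
  "nv sg (V x) = sg x"
| "nv sg (C n) = n"
| "nv sg (B f a b) = nop f (nv sg a) (nv sg b)"

primrec bnd :: "nat => (nat => nat) => expr => bool" where
  "bnd W sg (V x) \<longleftrightarrow> x < 64 \<and> sg x < W"
| "bnd W sg (C n) \<longleftrightarrow> n < W"
| "bnd W sg (B f a b) \<longleftrightarrow> bnd W sg a \<and> bnd W sg b \<and> f \<in> {Add, Mul, Div, Mod, Shl, Lt, Eq} \<and>
     nop f (nv sg a) (nv sg b) < W"

primrec small :: "nat => (nat => nat) => expr => bool" where
  "small q sg (V x) \<longleftrightarrow> x < 64 \<and> sg x < q"
| "small q sg (C n) \<longleftrightarrow> n < q"
| "small q sg (B f a b) \<longleftrightarrow> small q sg a \<and> small q sg b \<and> f \<in> {Add, Mul, Div, Mod, Lt, Eq}"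

text \<open>If every leaf is below \<open>q\<close>, the value is below \<open>q ^ deg e\<close>. A
  sum may double the larger operand, and \<open>2 \<le> q\<close> absorbs this in one extra factor.
  Overflow is thereby excluded syntactically.\<close>

primrec deg :: "expr => nat" where
  "deg (V x) = 1"
| "deg (C n) = 1"
| "deg (B f a b) = (if f = Add then Suc (max (deg a) (deg b)) else if f = Mul then deg a + deg b
     else max (deg a) (deg b))"

primrec ecost :: "expr => nat" where
  "ecost (V x) = 1"
| "ecost (C n) = 1"
| "ecost (B f a b) = ecost a + ecost b + 1"

text \<open>Registers from \<open>d\<close> on serve as an evaluation stack. Program variables stay
  below 64 and evaluation starts at 64 or above, so it never disturbs them;
  \<open>Bin Or d x x\<close> is a move.\<close>

primrec comp :: "nat => expr => com" where
  "comp d (V x) = Bin Or d x x"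
| "comp d (C n) = Const d n"
| "comp d (B f a b) = comp d a ;; comp (Suc d) b ;; Bin f d d (Suc d)"

lemma deg_pos: "1 \<le> deg e"
  by (induction e) auto

lemma small_bnd_nv:
  assumes "2 \<le> q"
  shows "small q sg e ==> nv sg e < q ^ deg e \<and> (q ^ deg e \<le> W --> bnd W sg e)"
proof (induction e)
  case (B f a b)
  let ?m = "max (deg a) (deg b)"
  have a: "nv sg a < q ^ deg a" and b: "nv sg b < q ^ deg b" using B by auto
  have am: "nv sg a < q ^ ?m" and bm: "nv sg b < q ^ ?m"
    using a b assms by (auto intro: less_le_trans power_increasing)
  have m: "q \<le> q ^ ?m" using assms deg_pos[of a] by (intro self_le_power) (auto simp: le_max_iff_disj)
  have "f \<in> {Add, Mul, Div, Mod, Lt, Eq}" using B.prems by simp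
  then have r: "nop f (nv sg a) (nv sg b) < q ^ deg (B f a b)"
  proof (elim insertE emptyE)
    assume "f = Add"
    moreover have "nv sg a + nv sg b < 2 * q ^ ?m" using am bm by simp
    moreover have "2 * q ^ ?m \<le> q * q ^ ?m" using assms by (rule mult_le_mono1)
    ultimately have "nv sg a + nv sg b < q * q ^ ?m" by linarith
    with \<open>f = Add\<close> show ?thesis by simp
  next
    assume "f = Mul" then show ?thesis using a b by (auto simp: power_add intro: mult_strict_mono')
  next
    assume "f = Div" then show ?thesis using am by (auto intro: le_less_trans[OF div_le_dividend])
  next
    assume "f = Mod" then show ?thesis using am by (auto intro: le_less_trans[OF mod_less_eq_dividend])
  next
    assume "f = Lt" then show ?thesis using m assms by auto
  next
    assume "f = Eq" then show ?thesis using m assms by auto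
  qed
  have "q ^ deg a \<le> q ^ deg (B f a b)" "q ^ deg b \<le> q ^ deg (B f a b)"
    using assms by (auto intro!: power_increasing)
  then show ?case using B r by (auto dest: order_trans less_le_trans)
qed (use assms in auto)

lemma small_bnd: "small q sg e ==> 2 \<le> q ==> q ^ deg e \<le> W ==> bnd W sg e"
  using small_bnd_nv by blast

lemma bnd_nv: "bnd W sg e ==> nv sg e < W"
  by (cases e) auto

lemma take_bit_small: "a < 2 ^ w ==> take_bit w (a::nat) = a"
  by (simp add: take_bit_nat_eq_self)

lemma exec_comp:
  assumes "bnd (2 ^ w) sg e" "64 \<le> d" "\<And>x. x < 64 ==> reg s x = sg x"
  shows "\<exists>s'. exec w inp (comp d e) s = return_spmf (ecost e, s') \<and> reg s' d = nv sg e \<and>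
     (\<forall>x<d. reg s' x = reg s x) \<and> mem s' = mem s \<and> out s' = out s"
  using assms
proof (induction e arbitrary: d s)
  case (V x)
  then show ?case by (auto simp: set_reg_def take_bit_small)
next
  case (C n)
  then show ?case by (auto simp: set_reg_def take_bit_small)
next
  case (B f a b)
  from B.prems have ba: "bnd (2 ^ w) sg a" "bnd (2 ^ w) sg b" by auto
  obtain s1 where s1: "exec w inp (comp d a) s = return_spmf (ecost a, s1)" "reg s1 d = nv sg a"
     "\<forall>x<d. reg s1 x = reg s x" "mem s1 = mem s" "out s1 = out s"
    using B.IH(1)[OF ba(1) B.prems(2,3)] by blast
  have "\<And>x. x < 64 ==> reg s1 x = sg x" using s1(3) B.prems by auto
  with B.prems obtain s2 where s2: "exec w inp (comp (Suc d) b) s1 = return_spmf (ecost b, s2)" "reg s2 (Suc d) = nv sg b"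
     "\<forall>x<Suc d. reg s2 x = reg s1 x" "mem s2 = mem s1" "out s2 = out s1"
    using B.IH(2)[OF ba(2), of "Suc d" s1] by auto
  have "eval_binop w f (nv sg a) (nv sg b) = nop f (nv sg a) (nv sg b)"
    using B.prems(1) by (auto simp: take_bit_small push_bit_eq_mult)
  then show ?case using s1 s2 by (auto simp: set_reg_def)
qed

text \<open>The abstract state: 64 variables and eight arrays interleaved in memory by the address
  modulo 8, so that every array is unbounded and no layout has to be planned. Truncation to 0
  elsewhere makes equality of abstract states ignore scratch registers.\<close>

definition rg :: "ram => nat => nat" where "rg s x = (if x < 64 then reg s x else 0)"
definition ar :: "ram => nat => nat => nat" where "ar s g i = (if g < 8 then mem s (8 * i + g) else 0)"

lemma rg_set_reg [simp]: "rg (set_reg x a s) = (if x < 64 then (rg s)(x := a) else rg s)"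
  by (auto simp: rg_def set_reg_def fun_eq_iff)
lemma ar_set_reg [simp]: "ar (set_reg x a s) = ar s"
  by (auto simp: ar_def set_reg_def fun_eq_iff)
lemma set_reg_sel [simp]: "mem (set_reg x a s) = mem s" "out (set_reg x a s) = out s"
  "reg (set_reg x a s) = (reg s)(x := a)"
  by (auto simp: set_reg_def)
lemma rg_upd [simp]: "rg (s\<lparr>mem := m\<rparr>) = rg s" "rg (s\<lparr>out := l\<rparr>) = rg s"
  by (auto simp: rg_def fun_eq_iff)
lemma ar_out [simp]: "ar (s\<lparr>out := l\<rparr>) = ar s"
  by (auto simp: ar_def fun_eq_iff)

text \<open>Quantifying over all concrete states with the given abstraction lets every rule speak of
  variables and arrays only, with arbitrary scratch registers.\<close>

definition hsure :: "nat => nat list => com => (nat => nat) => (nat => nat => nat) => nat list =>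
    (nat => (nat => nat) => (nat => nat => nat) => nat list => bool) => bool" where
  "hsure w inp c sg al z Q \<longleftrightarrow> (\<forall>s. rg s = sg \<and> ar s = al \<and> out s = z -->
     sure w inp c s (%t s'. Q t (rg s') (ar s') (out s')))"

definition hew :: "nat => nat list => com => (nat => nat) => (nat => nat => nat) => nat list =>
    ((nat => nat) => (nat => nat => nat) => nat list => ennreal) => ennreal => bool" where
  "hew w inp c sg al z f b \<longleftrightarrow> (\<forall>s. rg s = sg \<and> ar s = al \<and> out s = z -->
     ew w inp c s (%s'. f (rg s') (ar s') (out s')) \<le> b)"

lemma hsure_mono:
  "hsure w inp c sg al z Q ==> (\<And>t sg al z. Q t sg al z ==> Q' t sg al z) ==> hsure w inp c sg al z Q'"
  unfolding hsure_def by (intro allI impI, drule spec, drule (1) mp, erule sure_mono) simp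

lemma hsure_Seq:
  "hsure w inp c sg al z (%t sg' al' z'. hsure w inp d sg' al' z' (%t'. Q (t + t'))) ==>
   hsure w inp (c ;; d) sg al z Q"
  unfolding hsure_def sure_Seq by (intro allI impI, drule spec, drule (1) mp, erule sure_mono) simp

text \<open>The sure postcondition of \<open>c\<close> carries the invariants, so the bound for
  \<open>d\<close> is required only in states that \<open>c\<close> can reach, while
  \<open>g\<close> carries the expectation.\<close>

lemma hew_Seq:
  assumes "hsure w inp c sg al z Q"
    and "\<And>t sg' al' z'. Q t sg' al' z' ==> hew w inp d sg' al' z' f (g sg' al' z')"
    and "hew w inp c sg al z g b"
  shows "hew w inp (c ;; d) sg al z f b"
  unfolding hew_def ew_Seq
proof (intro allI impI)
  fix s assume s: "rg s = sg \<and> ar s = al \<and> out s = z"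
  have "ew w inp c s (%s'. ew w inp d s' (%s'. f (rg s') (ar s') (out s')))
     \<le> ew w inp c s (%s'. g (rg s') (ar s') (out s'))"
    by (rule ew_sure_mono[OF assms(1)[unfolded hsure_def, rule_format, OF s]])
      (rule assms(2)[unfolded hew_def, rule_format], assumption, simp)
  also have "\<dots> \<le> b" using assms(3) s by (auto simp: hew_def)
  finally show "ew w inp c s (%s'. ew w inp d s' (%s'. f (rg s') (ar s') (out s'))) \<le> b" .
qed

lemma hew_sure:
  "hsure w inp c sg al z Q ==> (\<And>t sg' al' z'. Q t sg' al' z' ==> f sg' al' z' \<le> b) ==> hew w inp c sg al z f b"
  unfolding hew_def hsure_def by (intro allI impI, drule spec, drule (1) mp, erule ew_sure_le) simp

lemma hew_sure_mono:
  assumes "hsure w inp c sg al z Q" "\<And>t sg' al' z'. Q t sg' al' z' ==> f sg' al' z' \<le> g sg' al' z'"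
    "hew w inp c sg al z g b" "b \<le> b'"
  shows "hew w inp c sg al z f b'"
  unfolding hew_def
proof (intro allI impI)
  fix s assume s: "rg s = sg \<and> ar s = al \<and> out s = z"
  have "ew w inp c s (%s'. f (rg s') (ar s') (out s')) \<le> ew w inp c s (%s'. g (rg s') (ar s') (out s'))"
    by (rule ew_sure_mono[OF assms(1)[unfolded hsure_def, rule_format, OF s]]) (rule assms(2))
  also have "\<dots> \<le> b" using assms(3) s by (simp add: hew_def)
  finally show "ew w inp c s (%s'. f (rg s') (ar s') (out s')) \<le> b'" using assms(4) by simp
qed

text \<open>For a prefix that does not affect the bound: \<open>b\<close> is the same in all states
  that it reaches.\<close>

lemma hew_Seq_det:
  "hsure w inp c sg al z (%t sg' al' z'. hew w inp d sg' al' z' f b) ==> hew w inp (c ;; d) sg al z f b"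
  by (rule hew_Seq[where g="%_ _ _. b"]) (assumption, assumption, erule hew_sure, simp)

text \<open>Sequencing associates to the right; this family of lemmas regroups a straight-line
  prefix so that one specification covers it.\<close>

lemma hsure_assoc2: "hsure w inp ((a ;; b) ;; e) sg al z Q ==> hsure w inp (a ;; b ;; e) sg al z Q"
  by (simp add: hsure_def add.assoc)
lemma hew_assoc2: "hew w inp ((a ;; b) ;; e) sg al z f x ==> hew w inp (a ;; b ;; e) sg al z f x"
  by (simp add: hew_def ew_Seq)
lemma hsure_assoc3: "hsure w inp ((a ;; b ;; c) ;; e) sg al z Q ==> hsure w inp (a ;; b ;; c ;; e) sg al z Q"
  by (simp add: hsure_def add.assoc)
lemma hew_assoc3: "hew w inp ((a ;; b ;; c) ;; e) sg al z f x ==> hew w inp (a ;; b ;; c ;; e) sg al z f x"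
  by (simp add: hew_def ew_Seq)
lemma hsure_assoc4: "hsure w inp ((a ;; b ;; c ;; d) ;; e) sg al z Q ==> hsure w inp (a ;; b ;; c ;; d ;; e) sg al z Q"
  by (simp add: hsure_def add.assoc)
lemma hew_assoc4: "hew w inp ((a ;; b ;; c ;; d) ;; e) sg al z f x ==> hew w inp (a ;; b ;; c ;; d ;; e) sg al z f x"
  by (simp add: hew_def ew_Seq)
lemma hsure_assoc6: "hsure w inp ((a ;; b ;; c ;; d ;; e ;; f) ;; h) sg al z Q ==> hsure w inp (a ;; b ;; c ;; d ;; e ;; f ;; h) sg al z Q"
  by (simp add: hsure_def add.assoc)
lemma hew_assoc6: "hew w inp ((a ;; b ;; c ;; d ;; e ;; f) ;; h) sg al z ff x ==> hew w inp (a ;; b ;; c ;; d ;; e ;; f ;; h) sg al z ff x"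
  by (simp add: hew_def ew_Seq)

section \<open>Derived commands and their proof rules\<close>

definition assign :: "nat => expr => com" where
  "assign x e = comp 64 e ;; Bin Or x 64 64"
definition aload :: "nat => nat => expr => com" where
  "aload x g e = comp 64 (B Add (B Mul (C 8) e) (C g)) ;; Load x 64"
definition astore :: "nat => expr => expr => com" where
  "astore g e e' = comp 64 (B Add (B Mul (C 8) e) (C g)) ;; comp 65 e' ;; Store 64 65"
definition aread :: "nat => expr => com" where
  "aread x e = comp 64 e ;; Read x 64"
definition awrite :: "expr => com" where
  "awrite e = comp 64 e ;; Write 64"
definition ife :: "expr => com => com => com" where
  "ife e c d = comp 64 e ;; If_NZ 64 c d"
text \<open>The test is evaluated before entry and again at the end of every round, so the body may
  overwrite register 64, which holds its result.\<close>

definition For :: "nat => nat => com => com" where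
  "For x y c = assign x (C 0) ;; comp 64 (B Lt (V x) (V y)) ;;
     While_NZ 64 (c ;; assign x (B Add (V x) (C 1)) ;; comp 64 (B Lt (V x) (V y)))"

lemma sure_comp:
  assumes "bnd (2 ^ w) (rg s) e" "64 \<le> d"
    "\<And>s'. reg s' d = nv (rg s) e ==> (\<forall>x<d. reg s' x = reg s x) ==> rg s' = rg s ==> ar s' = ar s ==>
       mem s' = mem s ==> out s' = out s ==> Q (ecost e) s'"
  shows "sure w inp (comp d e) s Q"
proof -
  obtain s' where s': "exec w inp (comp d e) s = return_spmf (ecost e, s')" "reg s' d = nv (rg s) e"
     "\<forall>x<d. reg s' x = reg s x" "mem s' = mem s" "out s' = out s"
    using exec_comp[OF assms(1,2), of s inp] by (auto simp: rg_def)
  moreover have "rg s' = rg s" using s' assms(2) by (auto simp: rg_def fun_eq_iff)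
  moreover have "ar s' = ar s" using s' by (auto simp: ar_def fun_eq_iff)
  ultimately show ?thesis using assms(3) by (intro sure_return[OF s'(1)]) simp
qed

lemma add_5: "t + 5 = Suc (Suc (Suc (Suc (Suc t))))"
  by simp

lemma hsure_assign:
  assumes "bnd (2 ^ w) sg e" "x < 64" "Q (ecost e + 1) (sg(x := nv sg e)) al z"
  shows "hsure w inp (assign x e) sg al z Q"
  unfolding hsure_def assign_def
proof (intro allI impI)
  fix s assume s: "rg s = sg \<and> ar s = al \<and> out s = z"
  show "sure w inp (comp 64 e ;; Bin Or x 64 64) s (%t s'. Q t (rg s') (ar s') (out s'))"
    unfolding sure_Seq
  proof (rule sure_comp)
    fix s' assume s': "reg s' 64 = nv (rg s) e" "rg s' = rg s" "ar s' = ar s" "out s' = out s"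
    let ?s = "set_reg x (nv sg e) s'"
    have "exec w inp (Bin Or x 64 64) s' = return_spmf (1, ?s)"
      using s s' bnd_nv[OF assms(1)] by (simp add: take_bit_small)
    moreover have "rg ?s = sg(x := nv sg e)" "ar ?s = al" "out ?s = z"
      using s s' assms(2) by auto
    ultimately show "sure w inp (Bin Or x 64 64) s' (%t s'. Q (ecost e + t) (rg s') (ar s') (out s'))"
      using assms(3) by (intro sure_return) auto
  qed (use assms s in auto)
qed

lemma hsure_aload:
  assumes "bnd (2 ^ w) sg (B Add (B Mul (C 8) e) (C g))" "x < 64" "g < 8"
    "Q (ecost e + 5) (sg(x := al g (nv sg e))) al z"
  shows "hsure w inp (aload x g e) sg al z Q"
  unfolding hsure_def aload_def
proof (intro allI impI)
  fix s assume s: "rg s = sg \<and> ar s = al \<and> out s = z"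
  let ?e = "B Add (B Mul (C 8) e) (C g)"
  show "sure w inp (comp 64 ?e ;; Load x 64) s (%t s'. Q t (rg s') (ar s') (out s'))"
    unfolding sure_Seq
  proof (rule sure_comp)
    fix s' assume s': "reg s' 64 = nv (rg s) ?e" "rg s' = rg s" "ar s' = ar s" "out s' = out s" "mem s' = mem s"
    let ?s = "set_reg x (al g (nv sg e)) s'"
    have "exec w inp (Load x 64) s' = return_spmf (1, ?s)"
      using s s' assms(3) by (auto simp: ar_def)
    moreover have "rg ?s = sg(x := al g (nv sg e))" "ar ?s = al" "out ?s = z"
      using s s' assms(2) by auto
    ultimately show "sure w inp (Load x 64) s' (%t s'. Q (ecost ?e + t) (rg s') (ar s') (out s'))"
      using assms(4) by (intro sure_return) (auto simp: add_5)
  qed (use assms s in auto)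
qed

lemma tag_eq:
  assumes "h < 8" "g < (8::nat)"
  shows "8 * j + h = 8 * i + g \<longleftrightarrow> j = i \<and> h = g"
proof
  assume *: "8 * j + h = 8 * i + g"
  have "h = (8 * j + h) mod 8" "g = (8 * i + g) mod 8" using assms by simp_all
  with * have "h = g" by metis
  with * show "j = i \<and> h = g" by simp
qed simp

lemma ar_upd:
  assumes "g < 8"
  shows "ar (s\<lparr>mem := (mem s)(8 * i + g := a)\<rparr>) = (ar s)(g := (ar s g)(i := a))"
proof (intro ext)
  fix h j
  show "ar (s\<lparr>mem := (mem s)(8 * i + g := a)\<rparr>) h j = ((ar s)(g := (ar s g)(i := a))) h j"
    using tag_eq[of h g j i] assms by (simp add: ar_def)
qed

lemma hsure_astore:
  assumes "bnd (2 ^ w) sg (B Add (B Mul (C 8) e) (C g))" "bnd (2 ^ w) sg e'" "g < 8"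
    "Q (ecost e + ecost e' + 5) sg (al(g := (al g)(nv sg e := nv sg e'))) z"
  shows "hsure w inp (astore g e e') sg al z Q"
  unfolding hsure_def astore_def
proof (intro allI impI)
  fix s assume s: "rg s = sg \<and> ar s = al \<and> out s = z"
  let ?e = "B Add (B Mul (C 8) e) (C g)"
  show "sure w inp (comp 64 ?e ;; comp 65 e' ;; Store 64 65) s (%t s'. Q t (rg s') (ar s') (out s'))"
    unfolding sure_Seq
  proof (rule sure_comp)
    fix s' assume s': "reg s' 64 = nv (rg s) ?e" "rg s' = rg s" "ar s' = ar s" "out s' = out s" "mem s' = mem s"
    show "sure w inp (comp 65 e') s' (%t s'. sure w inp (Store 64 65) s'
             (%t' s'. Q (ecost ?e + (t + t')) (rg s') (ar s') (out s')))"
    proof (rule sure_comp)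
      fix s'' assume s'': "reg s'' 65 = nv (rg s') e'" "\<forall>x<65. reg s'' x = reg s' x" "rg s'' = rg s'" "ar s'' = ar s'" "out s'' = out s'" "mem s'' = mem s'"
      let ?s = "s''\<lparr>mem := (mem s'')(8 * nv sg e + g := nv sg e')\<rparr>"
      have "exec w inp (Store 64 65) s'' = return_spmf (1, ?s)"
        using s s' s'' by simp
      moreover have "rg ?s = sg" "ar ?s = al(g := (al g)(nv sg e := nv sg e'))" "out ?s = z"
        using s s' s'' ar_upd[OF assms(3), of s'' "nv sg e" "nv sg e'"] by simp_all
      ultimately show "sure w inp (Store 64 65) s''
             (%t' s'. Q (ecost ?e + (ecost e' + t')) (rg s') (ar s') (out s'))"
        using assms(4) by (intro sure_return) (auto simp: add_5)
    qed (use assms s s' in auto)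
  qed (use assms s in auto)
qed

lemma hsure_aread:
  assumes "bnd (2 ^ w) sg e" "x < 64"
    "Q (ecost e + 1) (sg(x := if nv sg e < length inp then take_bit w (inp ! nv sg e) else 0)) al z"
  shows "hsure w inp (aread x e) sg al z Q"
  unfolding hsure_def aread_def
proof (intro allI impI)
  fix s assume s: "rg s = sg \<and> ar s = al \<and> out s = z"
  show "sure w inp (comp 64 e ;; Read x 64) s (%t s'. Q t (rg s') (ar s') (out s'))"
    unfolding sure_Seq
  proof (rule sure_comp)
    fix s' assume s': "reg s' 64 = nv (rg s) e" "rg s' = rg s" "ar s' = ar s" "out s' = out s"
    let ?v = "if nv sg e < length inp then take_bit w (inp ! nv sg e) else 0"
    let ?s = "set_reg x ?v s'"
    have "exec w inp (Read x 64) s' = return_spmf (1, ?s)" using s s' by simp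
    moreover have "rg ?s = sg(x := ?v)" "ar ?s = al" "out ?s = z"
      using s s' assms(2) by auto
    ultimately show "sure w inp (Read x 64) s' (%t s'. Q (ecost e + t) (rg s') (ar s') (out s'))"
      using assms(3) by (intro sure_return) auto
  qed (use assms s in auto)
qed

lemma hsure_awrite:
  assumes "bnd (2 ^ w) sg e" "Q (ecost e + 1) sg al (z @ [nv sg e])"
  shows "hsure w inp (awrite e) sg al z Q"
  unfolding hsure_def awrite_def
proof (intro allI impI)
  fix s assume s: "rg s = sg \<and> ar s = al \<and> out s = z"
  show "sure w inp (comp 64 e ;; Write 64) s (%t s'. Q t (rg s') (ar s') (out s'))"
    unfolding sure_Seq
  proof (rule sure_comp)
    fix s' assume s': "reg s' 64 = nv (rg s) e" "rg s' = rg s" "ar s' = ar s" "out s' = out s"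
    let ?s = "s'\<lparr>out := out s' @ [nv sg e]\<rparr>"
    have "exec w inp (Write 64) s' = return_spmf (1, ?s)" using s s' by simp
    moreover have "rg ?s = sg" "ar ?s = al" "out ?s = z @ [nv sg e]"
      using s s' by auto
    ultimately show "sure w inp (Write 64) s' (%t s'. Q (ecost e + t) (rg s') (ar s') (out s'))"
      using assms(2) by (intro sure_return) auto
  qed (use assms s in auto)
qed

lemma hsure_ife:
  assumes "bnd (2 ^ w) sg e"
    "nv sg e \<noteq> 0 ==> hsure w inp c sg al z (%t. Q (t + ecost e + 1))"
    "nv sg e = 0 ==> hsure w inp d sg al z (%t. Q (t + ecost e + 1))"
  shows "hsure w inp (ife e c d) sg al z Q"
  unfolding hsure_def ife_def
proof (intro allI impI)
  fix s assume s: "rg s = sg \<and> ar s = al \<and> out s = z"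
  show "sure w inp (comp 64 e ;; If_NZ 64 c d) s (%t s'. Q t (rg s') (ar s') (out s'))"
    unfolding sure_Seq
  proof (rule sure_comp)
    fix s' assume s': "reg s' 64 = nv (rg s) e" "rg s' = rg s" "ar s' = ar s" "out s' = out s"
    show "sure w inp (If_NZ 64 c d) s' (%t' s'. Q (ecost e + t') (rg s') (ar s') (out s'))"
    proof (cases "nv sg e = 0")
      case True
      from assms(3)[OF this] s s' have "sure w inp d s' (%t s'. Q (t + ecost e + 1) (rg s') (ar s') (out s'))"
        by (simp add: hsure_def)
      then show ?thesis using True s s' by (simp add: add.commute)
    next
      case False
      from assms(2)[OF this] s s' have "sure w inp c s' (%t s'. Q (t + ecost e + 1) (rg s') (ar s') (out s'))"
        by (simp add: hsure_def)
      then show ?thesis using False s s' by (simp add: add.commute)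
    qed
  qed (use assms(1) s in simp_all)
qed

lemma hew_ife:
  assumes "bnd (2 ^ w) sg e"
    "nv sg e \<noteq> 0 ==> hew w inp c sg al z f b"
    "nv sg e = 0 ==> hew w inp d sg al z f b"
  shows "hew w inp (ife e c d) sg al z f b"
  unfolding hew_def ife_def ew_Seq
proof (intro allI impI)
  fix s assume s: "rg s = sg \<and> ar s = al \<and> out s = z"
  have "sure w inp (comp 64 e) s (%t s'. reg s' 64 = nv sg e \<and> rg s' = sg \<and> ar s' = al \<and> out s' = z)"
    by (rule sure_comp) (use assms s in auto)
  then show "ew w inp (comp 64 e) s (%s'. ew w inp (If_NZ 64 c d) s' (%s'. f (rg s') (ar s') (out s'))) \<le> b"
  proof (rule ew_sure_le)
    fix t s' assume s': "reg s' 64 = nv sg e \<and> rg s' = sg \<and> ar s' = al \<and> out s' = z"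
    show "ew w inp (If_NZ 64 c d) s' (%s'. f (rg s') (ar s') (out s')) \<le> b"
      using assms(2,3)[unfolded hew_def, rule_format, of s'] s' by (simp add: ew_If)
  qed
qed

lemma hsure_Skip: "Q 1 sg al z ==> hsure w inp Skip sg al z Q"
  by (auto simp: hsure_def sure_def)

text \<open>Each round adds 8 steps to the body: 4 to increment the counter, 3 to evaluate the test
  and 1 for the loop itself. The remaining 6 are 2 for the initialisation, 3 for the first test and
  1 for leaving the loop.\<close>

lemma hsure_For:
  assumes y: "sg y = n" and n: "n < 2 ^ w" "1 < (2::nat) ^ w" and xy: "x < 64" "y < 64" "x \<noteq> y"
    and init: "Inv 0 0 (sg(x := 0)) al z"
    and step: "\<And>i T sg al z. i < n ==> Inv i T sg al z ==> sg x = i ==> sg y = n ==>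
       hsure w inp c sg al z (%t sg' al' z'. sg' x = i \<and> sg' y = n \<and> Inv (Suc i) (T + t + 8) (sg'(x := Suc i)) al' z')"
    and fin: "\<And>T sg al z. Inv n T sg al z ==> sg x = n ==> sg y = n ==> Q (T + 6) sg al z"
  shows "hsure w inp (For x y c) sg al z Q"
proof -
  let ?c = "c ;; assign x (B Add (V x) (C 1)) ;; comp 64 (B Lt (V x) (V y))"
  \<comment> \<open>Induction on the number \<open>j\<close> of rounds left; the 5 steps before the
    loop are already added.\<close>
  have main: "sure w inp (While_NZ 64 ?c) s (%t s'. Q (T + t + 5) (rg s') (ar s') (out s'))"
    if "Inv i T (rg s) (ar s) (out s)" "i + j = n" "rg s x = i" "rg s y = n" "reg s 64 = of_bool (i < n)" for i j T s
    using that
  proof (induction j arbitrary: i T s)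
    case 0
    then show ?case using fin[of T "rg s" "ar s" "out s"] by (subst sure_While) (simp add: algebra_simps)
  next
    case (Suc j)
    have i: "i < n" using Suc.prems by simp
    have "hsure w inp c (rg s) (ar s) (out s) (%t sg' al' z'. sg' x = i \<and> sg' y = n \<and> Inv (Suc i) (T + t + 8) (sg'(x := Suc i)) al' z')"
      by (rule step[OF i]) (use Suc.prems in auto)
    then have c: "sure w inp c s (%t s'. rg s' x = i \<and> rg s' y = n \<and> Inv (Suc i) (T + t + 8) ((rg s')(x := Suc i)) (ar s') (out s'))"
      by (simp add: hsure_def)
    have "sure w inp ?c s (%t s'. sure w inp (While_NZ 64 ?c) s' (%t'. %s'. Q (T + Suc (t + t') + 5) (rg s') (ar s') (out s')))"
      unfolding sure_Seq
    proof (rule sure_mono[OF c])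
      fix t s'
      assume s': "rg s' x = i \<and> rg s' y = n \<and> Inv (Suc i) (T + t + 8) ((rg s')(x := Suc i)) (ar s') (out s')"
      have "hsure w inp (assign x (B Add (V x) (C 1))) (rg s') (ar s') (out s')
         (%t' sg al z. t' = 4 \<and> sg = (rg s')(x := Suc i) \<and> al = ar s' \<and> z = out s')"
        by (rule hsure_assign) (use s' xy n i in auto)
      then have "sure w inp (assign x (B Add (V x) (C 1))) s'
         (%t' s''. t' = 4 \<and> rg s'' = (rg s')(x := Suc i) \<and> ar s'' = ar s' \<and> out s'' = out s')"
        by (simp add: hsure_def)
      then show "sure w inp (assign x (B Add (V x) (C 1))) s' (%(t1::nat) s'. sure w inp (comp 64 (B Lt (V x) (V y))) s'
          (%(t2::nat) s'. sure w inp (While_NZ 64 ?c) s' (%t' s'. Q (T + Suc (t + (t1 + t2) + t') + 5) (rg s') (ar s') (out s'))))"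
      proof (rule sure_mono)
        fix t1 :: nat and s''
        assume s'': "t1 = 4 \<and> rg s'' = (rg s')(x := Suc i) \<and> ar s'' = ar s' \<and> out s'' = out s'"
        show "sure w inp (comp 64 (B Lt (V x) (V y))) s''
          (%(t2::nat) s'. sure w inp (While_NZ 64 ?c) s' (%t' s'. Q (T + Suc (t + (t1 + t2) + t') + 5) (rg s') (ar s') (out s')))"
        proof (rule sure_comp)
          fix s3 assume s3: "reg s3 64 = nv (rg s'') (B Lt (V x) (V y))" "rg s3 = rg s''" "ar s3 = ar s''" "out s3 = out s''"
          have "sure w inp (While_NZ 64 ?c) s3 (%t' s'. Q ((T + t + 8) + t' + 5) (rg s') (ar s') (out s'))"
          proof (rule Suc.IH[of "Suc i"])
            show "Inv (Suc i) (T + t + 8) (rg s3) (ar s3) (out s3)" using s' s'' s3 by metis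
          qed (use s' s'' s3 xy Suc.prems i in auto)
          then show "sure w inp (While_NZ 64 ?c) s3
             (%t' s'. Q (T + Suc (t + (t1 + ecost (B Lt (V x) (V y))) + t') + 5) (rg s') (ar s') (out s'))"
            using s'' by (simp add: algebra_simps)
        qed (use s' s'' xy n i in auto)
      qed
    qed
    then show ?case using Suc.prems i
      by (subst sure_While) (simp add: algebra_simps)
  qed
  show ?thesis unfolding For_def
    apply (rule hsure_Seq, rule hsure_assign)
    subgoal using n by simp
    subgoal by (rule xy)
    unfolding hsure_def sure_Seq
    apply (intro allI impI, rule sure_comp)
    subgoal using n xy y by simp
    subgoal by simp
    subgoal for s s'
      using main[of 0 0 s' n] init xy y by (simp add: add_5)
    done
qed

text \<open>\<open>F\<close> is a supermartingale: its expected value does not grow from one round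
  to the next. The number of rounds is known, so induction on the rounds left suffices.\<close>

lemma hew_For:
  assumes y: "sg y = n" and n: "n < 2 ^ w" "1 < (2::nat) ^ w" and xy: "x < 64" "y < 64" "x \<noteq> y"
    and init: "Inv 0 (sg(x := 0)) al z"
    and step: "\<And>i sg al z. i < n ==> Inv i sg al z ==> sg x = i ==> sg y = n ==>
       hsure w inp c sg al z (%t sg' al' z'. sg' x = i \<and> sg' y = n \<and> Inv (Suc i) (sg'(x := Suc i)) al' z')"
    and ew: "\<And>i sg al z. i < n ==> Inv i sg al z ==> sg x = i ==> sg y = n ==>
       hew w inp c sg al z (%sg'. F (Suc i) (sg'(x := Suc i))) (F i sg al z)"
    and b: "F 0 (sg(x := 0)) al z \<le> b"
  shows "hew w inp (For x y c) sg al z (F n) b"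
proof -
  let ?inc = "assign x (B Add (V x) (C 1)) ;; comp 64 (B Lt (V x) (V y))"
  let ?c = "c ;; ?inc"
  have main: "ew w inp (While_NZ 64 ?c) s (%s'. F n (rg s') (ar s') (out s')) \<le> F i (rg s) (ar s) (out s)"
    if "Inv i (rg s) (ar s) (out s)" "i + j = n" "rg s x = i" "rg s y = n" "reg s 64 = of_bool (i < n)" for i j s
    using that
  proof (induction j arbitrary: i s)
    case 0
    then show ?case by (subst ew_While) simp
  next
    case (Suc j)
    have i: "i < n" using Suc.prems by simp
    have "hsure w inp c (rg s) (ar s) (out s) (%t sg' al' z'. sg' x = i \<and> sg' y = n \<and> Inv (Suc i) (sg'(x := Suc i)) al' z')"
      by (rule step[OF i]) (use Suc.prems in auto)
    then have c: "sure w inp c s (%t s'. rg s' x = i \<and> rg s' y = n \<and> Inv (Suc i) ((rg s')(x := Suc i)) (ar s') (out s'))"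
      by (simp add: hsure_def)
    have 1: "ew w inp ?inc s' (%s'. ew w inp (While_NZ 64 ?c) s' (%s'. F n (rg s') (ar s') (out s')))
        \<le> F (Suc i) ((rg s')(x := Suc i)) (ar s') (out s')"
      if s': "rg s' x = i \<and> rg s' y = n \<and> Inv (Suc i) ((rg s')(x := Suc i)) (ar s') (out s')" for s'
    proof -
      have "hsure w inp (assign x (B Add (V x) (C 1))) (rg s') (ar s') (out s')
         (%t' sg al z. sg = (rg s')(x := Suc i) \<and> al = ar s' \<and> z = out s')"
        by (rule hsure_assign) (use s' xy n i in auto)
      then have a: "sure w inp (assign x (B Add (V x) (C 1))) s'
         (%t' s''. rg s'' = (rg s')(x := Suc i) \<and> ar s'' = ar s' \<and> out s'' = out s')"
        by (simp add: hsure_def)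
      have "sure w inp ?inc s'
         (%t' s''. rg s'' = (rg s')(x := Suc i) \<and> ar s'' = ar s' \<and> out s'' = out s' \<and> reg s'' 64 = of_bool (Suc i < n))"
        unfolding sure_Seq
      proof (rule sure_mono[OF a])
        fix t s''
        assume s'': "rg s'' = (rg s')(x := Suc i) \<and> ar s'' = ar s' \<and> out s'' = out s'"
        show "sure w inp (comp 64 (B Lt (V x) (V y))) s'' (%t' s''. rg s'' = (rg s')(x := Suc i) \<and> ar s'' = ar s' \<and> out s'' = out s' \<and> reg s'' 64 = of_bool (Suc i < n))"
          by (rule sure_comp) (use s' s'' xy n i in auto)
      qed
      then show ?thesis
      proof (rule ew_sure_le)
        fix t s''
        assume s'': "rg s'' = (rg s')(x := Suc i) \<and> ar s'' = ar s' \<and> out s'' = out s' \<and> reg s'' 64 = of_bool (Suc i < n)"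
        have "ew w inp (While_NZ 64 ?c) s'' (%s'. F n (rg s') (ar s') (out s')) \<le> F (Suc i) (rg s'') (ar s'') (out s'')"
        proof (rule Suc.IH)
          show "Inv (Suc i) (rg s'') (ar s'') (out s'')" using s' s'' by metis
        qed (use s' s'' xy Suc.prems i in auto)
        then show "ew w inp (While_NZ 64 ?c) s'' (%s'. F n (rg s') (ar s') (out s')) \<le> F (Suc i) ((rg s')(x := Suc i)) (ar s') (out s')"
          using s'' by simp
      qed
    qed
    have "ew w inp (While_NZ 64 ?c) s (%s'. F n (rg s') (ar s') (out s'))
        \<le> ew w inp c s (%s'. F (Suc i) ((rg s')(x := Suc i)) (ar s') (out s'))"
      using Suc.prems i by (subst ew_While, simp only: ew_Seq[of _ _ c]) (use ew_sure_mono[OF c 1] in simp)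
    also have "\<dots> \<le> F i (rg s) (ar s) (out s)"
      using ew[OF i Suc.prems(1,3,4)] by (simp add: hew_def)
    finally show ?case .
  qed
  have pre: "hsure w inp (assign x (C 0)) sg al z (%t sg' al' z'. sg' = sg(x := 0) \<and> al' = al \<and> z' = z)"
    by (rule hsure_assign) (use n xy in auto)
  show ?thesis unfolding For_def
  proof (rule hew_Seq_det, rule hsure_mono[OF pre], clarify)
    show "hew w inp (comp 64 (B Lt (V x) (V y)) ;; While_NZ 64 ?c) (sg(x := 0)) al z (F n) b"
      unfolding hew_def ew_Seq[of _ _ "comp 64 (B Lt (V x) (V y))"]
    proof (intro allI impI)
      fix s assume s: "rg s = sg(x := 0) \<and> ar s = al \<and> out s = z"
      have "sure w inp (comp 64 (B Lt (V x) (V y))) s (%t s'. rg s' = rg s \<and> ar s' = al \<and> out s' = z \<and> reg s' 64 = of_bool (0 < n))"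
        by (rule sure_comp) (use s n xy y in auto)
      then show "ew w inp (comp 64 (B Lt (V x) (V y))) s
          (%s'. ew w inp (While_NZ 64 ?c) s' (%s'. F n (rg s') (ar s') (out s'))) \<le> b"
      proof (rule ew_sure_le)
        fix t s'
        assume s': "rg s' = rg s \<and> ar s' = al \<and> out s' = z \<and> reg s' 64 = of_bool (0 < n)"
        have "ew w inp (While_NZ 64 ?c) s' (%s'. F n (rg s') (ar s') (out s')) \<le> F 0 (rg s') (ar s') (out s')"
          by (rule main) (use s s' init xy y in auto)
        then show "ew w inp (While_NZ 64 ?c) s' (%s'. F n (rg s') (ar s') (out s')) \<le> b"
          using s s' b by simp
      qed
    qed
  qed
qed

subsection \<open>Simulating a program on stamped memory\<close>

text \<open>One direction bounds expectations of the simulating machine by those of the simulated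
  one, the other transfers termination.\<close>

definition bsim :: "('a => 'b => bool) => 'a spmf => 'b spmf => bool" where
  "bsim R p q \<longleftrightarrow> sim R p q \<and> sim (%y x. R x y) q p"

lemma bsim_return: "R x y ==> bsim R (return_spmf x) (return_spmf y)"
  by (simp add: bsim_def sim_return)

lemma bsim_bind:
  "bsim R p q ==> (\<And>x y. R x y ==> bsim S (f x) (f' y)) ==> bsim S (bind_spmf p f) (bind_spmf q f')"
  unfolding bsim_def by (auto intro: sim_bind)

lemma bsim_map: "bsim (%x y. R (f x) (g y)) p q ==> bsim R (map_spmf f p) (map_spmf g q)"
  unfolding bsim_def by (auto intro: sim_map)

lemma bsim_mono: "bsim R p q ==> (\<And>x y. R x y ==> S x y) ==> bsim S p q"
  unfolding bsim_def by (auto elim: sim_mono)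

lemma bsim_loop:
  assumes b: "\<And>s s'. R s s' ==> b s = b' s'"
    and f: "\<And>s s'. R s s' ==> b s ==> bsim (%r r'. T (fst r) (fst r') \<and> R (snd r) (snd r')) (f s) (f' s')"
    and T: "T 1 1" "\<And>i i' j j'. T i i' ==> T j j' ==> T (Suc (i + j)) (Suc (i' + j'))"
    and s: "R s s'"
  shows "bsim (%r r'. T (fst r) (fst r') \<and> R (snd r) (snd r')) (loop b f s) (loop b' f' s')"
  unfolding bsim_def
proof
  show "sim (%r r'. T (fst r) (fst r') \<and> R (snd r) (snd r')) (loop b f s) (loop b' f' s')"
    by (rule sim_loop[where R=R and T=T]) (use assms in \<open>auto simp: bsim_def\<close>)
  show "sim (%y x. T (fst x) (fst y) \<and> R (snd x) (snd y)) (loop b' f' s') (loop b f s)"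
    by (rule sim_loop[where R="%y x. R x y" and T="%j i. T i j"]) (use assms in \<open>auto simp: bsim_def\<close>)
qed

lemma sum_mod:
  fixes f :: "nat => ennreal"
  assumes "0 < m"
  shows "(\<Sum>b<m * n. f (b mod m)) = of_nat n * (\<Sum>a<m. f a)"
proof (induction n)
  case (Suc n)
  have "(\<Sum>b<m * Suc n. f (b mod m)) = (\<Sum>b<m * n. f (b mod m)) + (\<Sum>b=m*n..<m*n + m. f (b mod m))"
    using sum.atLeastLessThan_concat[of 0 "m * n" "m * n + m" "%b. f (b mod m)"]
    by (simp add: lessThan_atLeast0 add.commute)
  also have "(\<Sum>b=m*n..<m*n + m. f (b mod m)) = (\<Sum>a<m. f a)"
    using sum.shift_bounds_nat_ivl[of "%b. f (b mod m)" 0 "m * n" m]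
    by (simp add: lessThan_atLeast0 add.commute)
  finally show ?case using Suc by (simp add: algebra_simps)
qed simp

text \<open>Reduction modulo \<open>2 ^ w\<close> maps a uniform word of \<open>w'\<close> bits to a
  uniform word of \<open>w\<close> bits because \<open>2 ^ w\<close> divides \<open>2 ^ w'\<close>:
  every residue has equally many preimages.\<close>

lemma bsim_rand:
  assumes "w \<le> w'"
  shows "bsim (%a b. a = b mod 2 ^ w) (spmf_of_set {..<2 ^ w}) (spmf_of_set {..<(2::nat) ^ w'})"
proof -
  have "Ex (spmf_of_set {..<(2::nat) ^ w'}) (%b. f (b mod 2 ^ w)) = Ex (spmf_of_set {..<2 ^ w}) f" for f
  proof -
    obtain v where v: "w' = w + v" using assms le_Suc_ex by blast
    have "Ex (spmf_of_set {..<(2::nat) ^ w'}) (%b. f (b mod 2 ^ w))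
        = (\<Sum>b<2 ^ w * 2 ^ v. f (b mod 2 ^ w)) / ennreal (2 ^ w * 2 ^ v)"
      by (simp add: nn_integral_spmf_of_set v power_add ennreal_of_nat_eq_real_of_nat)
    also have "\<dots> = (ennreal (2 ^ v) * (\<Sum>a<2 ^ w. f a)) / (ennreal (2 ^ v) * ennreal (2 ^ w))"
      by (subst sum_mod) (simp_all add: ennreal_of_nat_eq_real_of_nat ennreal_mult mult.commute)
    also have "\<dots> = (\<Sum>a<2 ^ w. f a) / ennreal (2 ^ w)"
      using divide_mult_eq[of "ennreal (2 ^ v)" "\<Sum>a<2 ^ w. f a" "ennreal (2 ^ w)"] by (simp add: mult.commute)
    also have "\<dots> = Ex (spmf_of_set {..<2 ^ w}) f"
      by (simp add: nn_integral_spmf_of_set ennreal_of_nat_eq_real_of_nat)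
    finally show ?thesis .
  qed
  note eq = this
  show ?thesis unfolding bsim_def sim_def
  proof (intro conjI allI impI)
    fix f g :: "nat => ennreal" assume "\<forall>x y. x = y mod 2 ^ w --> f y \<le> g x"
    then have "Ex (spmf_of_set {..<2 ^ w'}) f \<le> Ex (spmf_of_set {..<2 ^ w'}) (%b. g (b mod 2 ^ w))"
      by (intro Ex_mono) auto
    then show "Ex (spmf_of_set {..<2 ^ w'}) f \<le> Ex (spmf_of_set {..<2 ^ w}) g" by (simp add: eq)
  next
    fix f g :: "nat => ennreal" assume "\<forall>x y. y = x mod 2 ^ w --> f y \<le> g x"
    then have "Ex (spmf_of_set {..<2 ^ w'}) (%b. f (b mod 2 ^ w)) \<le> Ex (spmf_of_set {..<2 ^ w'}) g"
      by (intro Ex_mono) auto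
    then show "Ex (spmf_of_set {..<2 ^ w}) f \<le> Ex (spmf_of_set {..<2 ^ w'}) g" by (simp add: eq)
  qed
qed

section \<open>Translation of programs to stamped memory\<close>

primrec regs_below :: "nat => com => bool" where
  "regs_below n Skip \<longleftrightarrow> True"
| "regs_below n (Const x k) \<longleftrightarrow> x < n"
| "regs_below n (Bin f x y z) \<longleftrightarrow> x < n \<and> y < n \<and> z < n"
| "regs_below n (Load x y) \<longleftrightarrow> x < n \<and> y < n"
| "regs_below n (Store x y) \<longleftrightarrow> x < n \<and> y < n"
| "regs_below n (Rand x) \<longleftrightarrow> x < n"
| "regs_below n (Read x y) \<longleftrightarrow> x < n \<and> y < n"
| "regs_below n (Write x) \<longleftrightarrow> x < n"
| "regs_below n (Seq c d) \<longleftrightarrow> regs_below n c \<and> regs_below n d"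
| "regs_below n (If_NZ x c d) \<longleftrightarrow> x < n \<and> regs_below n c \<and> regs_below n d"
| "regs_below n (While_NZ x c) \<longleftrightarrow> x < n \<and> regs_below n c"

lemma regs_below_mono: "regs_below n c ==> n \<le> m ==> regs_below m c"
  by (induction c) auto

lemma regs_below_ex: "\<exists>n. regs_below n c"
proof (induction c)
  case (Seq c d)
  then obtain m n where "regs_below m c" "regs_below n d" by auto
  then have "regs_below (max m n) (Seq c d)" by (auto intro: regs_below_mono)
  then show ?case by blast
next
  case (If_NZ x c d)
  then obtain m n where "regs_below m c" "regs_below n d" by auto
  then have "regs_below (max (Suc x) (max m n)) (If_NZ x c d)" by (auto intro: regs_below_mono)
  then show ?case by blast
next
  case (While_NZ x c)
  then obtain m where "regs_below m c" by auto
  then have "regs_below (max (Suc x) m) (While_NZ x c)" by (auto intro: regs_below_mono)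
  then show ?case by blast
next
  case (Bin f x y z)
  have "regs_below (Suc (max x (max y z))) (Bin f x y z)" by auto
  then show ?case by blast
next
  case (Load x y)
  have "regs_below (Suc (max x y)) (Load x y)" by auto
  then show ?case by blast
next
  case (Store x y)
  have "regs_below (Suc (max x y)) (Store x y)" by auto
  then show ?case by blast
next
  case (Read x y)
  have "regs_below (Suc (max x y)) (Read x y)" by auto
  then show ?case by blast
qed auto

text \<open>
  Register 9 holds the modulus \<open>2 ^ w\<close> of the simulated words, 19 the offset of the simulated memory,
  12 the stamp of the current run, 11 the array that takes the writes, 25 the length of the simulated
  input (array 7) and 26 the last word written. Array 6 holds stamps: a simulated cell whose
  stamp differs from the current one is read from array 4, so that changing the stamp undoes a run.
\<close>

primrec cmp :: "com => com" where
  "cmp Skip = Skip"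
| "cmp (Const x k) = Const (100 + x) k ;; Bin Mod (100 + x) (100 + x) 9"
| "cmp (Bin f x y z) = Bin f (100 + x) (100 + y) (100 + z) ;; Bin Mod (100 + x) (100 + x) 9"
| "cmp (Load x y) = Bin Add 64 19 (100 + y) ;; Const 65 8 ;; Bin Mul 64 64 65 ;; Const 65 6 ;; Bin Add 65 64 65 ;;
     Load 65 65 ;; Bin Eq 65 65 12 ;; If_NZ 65 (Bin Add 65 64 11) (Const 65 4 ;; Bin Add 65 64 65) ;;
     Load (100 + x) 65"
| "cmp (Store x y) = Bin Add 64 19 (100 + x) ;; Const 65 8 ;; Bin Mul 64 64 65 ;; Const 65 6 ;; Bin Add 65 64 65 ;;
     Store 65 12 ;; Bin Add 65 64 11 ;; Store 65 (100 + y)"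
| "cmp (Rand x) = Rand (100 + x) ;; Bin Mod (100 + x) (100 + x) 9"
| "cmp (Read x y) = Bin Lt 64 (100 + y) 25 ;; If_NZ 64 (Const 65 8 ;; Bin Mul 64 (100 + y) 65 ;; Const 65 7 ;;
     Bin Add 64 64 65 ;; Load (100 + x) 64 ;; Bin Mod (100 + x) (100 + x) 9) (Const (100 + x) 0)"
| "cmp (Write x) = Bin Or 26 (100 + x) (100 + x)"
| "cmp (Seq c d) = cmp c ;; cmp d"
| "cmp (If_NZ x c d) = If_NZ (100 + x) (cmp c) (cmp d)"
| "cmp (While_NZ x c) = While_NZ (100 + x) (cmp c)"

text \<open>The memory that the simulated program sees. Addresses from \<open>2 ^ w\<close> on
  cannot occur in its registers; the value 0 is their initial content.\<close>

definition imem :: "nat => (nat => nat) => (nat => nat => nat) => nat => nat" where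
  "imem w sg al a = (if a < 2 ^ w then if al 6 (sg 19 + a) = sg 12 then al (sg 11) (sg 19 + a) else al 4 (sg 19 + a) else 0)"

text \<open>The footprint of a simulated call: stamps and the array that takes the writes, within
  the region of the copy. The last two clauses preserve that stamps never exceed the current one and
  that cells hold words of \<open>w\<close> bits.\<close>

definition frame :: "nat => (nat => nat) => (nat => nat => nat) => (nat => nat => nat) => bool" where
  "frame w sg al al' \<longleftrightarrow> (\<forall>g. g \<noteq> 6 --> g \<noteq> sg 11 --> al' g = al g) \<and>
     (\<forall>i. i < sg 19 \<or> sg 19 + 2 ^ w \<le> i --> al' 6 i = al 6 i \<and> al' (sg 11) i = al (sg 11) i) \<and>
     (\<forall>i. al' 6 i = al 6 i \<or> al' 6 i = sg 12) \<and> (\<forall>i. al' (sg 11) i = al (sg 11) i \<or> al' (sg 11) i < 2 ^ w)"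

text \<open>The factor 8 and the summand 8 in the address bounds account for the eight interleaved
  arrays and the array tag.\<close>

locale simu =
  fixes w w' :: nat and inp inp' :: "nat list" and sg :: "nat => nat" and al :: "nat => nat => nat"
    and z :: "nat list" and bd :: nat
  assumes ww: "w \<le> w'" and W2: "sg 9 = 2 ^ w" and W2': "2 ^ w < (2::nat) ^ w'"
    and base: "8 * (sg 19 + 2 ^ w) + 8 \<le> 2 ^ w'"
    and ph: "sg 12 < 2 ^ w'" and ovt: "sg 11 = 4 \<or> sg 11 = 5"
    and len: "sg 25 = length inp" "8 * length inp + 8 \<le> 2 ^ w'"
    and buf: "\<And>i. i < length inp ==> al 7 i = inp ! i"
begin

lemma base_le: "a < 2 ^ w ==> 8 * (sg 19 + a) + 8 \<le> 2 ^ w'"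
  by (rule order_trans[OF _ base]) simp

lemma W_ge_16: "16 \<le> (2::nat) ^ w'"
proof -
  have "1 \<le> sg 19 + 2 ^ w" by (simp add: trans_le_add2)
  then have "16 \<le> 8 * (sg 19 + 2 ^ w) + 8" using mult_le_mono2[of 1 "sg 19 + 2 ^ w" 8] by simp
  then show ?thesis using base by (rule order_trans)
qed

text \<open>Simulated register \<open>x\<close> is register \<open>100 + x\<close>. Of the output
  only the last word is kept, in register 26: if the simulated output is \<open>[a]\<close>,
  register 26 ends as \<open>a\<close>, which is all that the error analysis uses.\<close>

definition R :: "ram => ram => bool" where
  "R s s' \<longleftrightarrow> (\<forall>x. reg s x < 2 ^ w) \<and> (\<forall>x<bd. reg s' (100 + x) = reg s x) \<and>
     (\<forall>a. mem s a < 2 ^ w) \<and> mem s = imem w sg (ar s') \<and> rg s' = sg(26 := rg s' 26) \<and> out s' = z \<and>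
     frame w sg al (ar s') \<and> (out s \<noteq> [] --> rg s' 26 = last (out s)) \<and>
     (rg s' 26 = sg 26 \<or> rg s' 26 < 2 ^ w)"

text \<open>The factor 12 covers the longest translation, that of a load, which takes at most 11
  steps.\<close>

abbreviation TR :: "nat \<times> ram => nat \<times> ram => bool" where
  "TR r r' \<equiv> fst r' \<le> 12 * fst r \<and> R (snd r) (snd r')"

lemma R_reg:
  assumes "R s s'"
  shows "reg s' 9 = 2 ^ w" "reg s' 11 = sg 11" "reg s' 12 = sg 12" "reg s' 19 = sg 19" "reg s' 25 = length inp"
    "x < bd ==> reg s' (100 + x) = reg s x" "reg s x < 2 ^ w" "reg s x < 2 ^ w'"
proof -
  have *: "rg s' = sg(26 := rg s' 26)" using assms by (simp add: R_def)
  have "reg s' y = sg y" if "y < 64" "y \<noteq> 26" for y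
    using fun_cong[OF *, of y] that by (simp add: rg_def)
  then show "reg s' 9 = 2 ^ w" "reg s' 11 = sg 11" "reg s' 12 = sg 12" "reg s' 19 = sg 19" "reg s' 25 = length inp"
    using W2 len by simp_all
  show "x < bd ==> reg s' (100 + x) = reg s x" "reg s x < 2 ^ w" using assms by (auto simp: R_def)
  then show "reg s x < 2 ^ w'" using W2' by (meson less_trans)
qed

lemma R_set:
  assumes "R s s'" "a < 2 ^ w" "reg t (100 + x) = a" "\<And>y. y < bd ==> y \<noteq> x ==> reg t (100 + y) = reg s' (100 + y)"
    "rg t = rg s'" "mem t = mem s'" "out t = out s'"
  shows "R (set_reg x a s) t"
proof -
  have "ar t = ar s'" using assms(6) by (simp add: ar_def fun_eq_iff)
  then show ?thesis using assms unfolding R_def by auto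
qed

text \<open>Both machines truncate the same natural number for every operation except
  \<open>Sub\<close>, where the added moduli differ by a multiple of \<open>2 ^ w\<close>.\<close>

lemma eval_mod:
  assumes "a < 2 ^ w" "b < 2 ^ w"
  shows "eval_binop w' f a b mod 2 ^ w = eval_binop w f a b"
proof -
  have 1: "take_bit w' x mod 2 ^ w = take_bit w x" for x :: nat
    using ww by (simp add: take_bit_eq_mod[symmetric] take_bit_take_bit)
  have 2: "take_bit w (2 ^ w' + a - b) = take_bit w (2 ^ w + a - b)"
  proof -
    obtain v where v: "w' = w + v" using ww le_Suc_ex by blast
    have "(2::nat) ^ w' = 2 ^ w * (2 ^ v - 1) + 2 ^ w" by (simp add: v power_add algebra_simps)
    then have "2 ^ w' + a - b = 2 ^ w * (2 ^ v - 1) + (2 ^ w + a - b)" using assms by simp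
    then show ?thesis by (simp add: take_bit_eq_mod)
  qed
  show ?thesis using 1 2 by (cases f) (simp_all only: eval_binop.simps)
qed

lemma bsim_prim:
  assumes "exec w inp c s = return_spmf (1, t)" "exec w' inp' (cmp c) s' = return_spmf (n, t')"
    "n \<le> 12" "R t t'"
  shows "bsim TR (exec w inp c s) (exec w' inp' (cmp c) s')"
  using assms by (simp add: bsim_return)

lemma mod_small: "x mod 2 ^ w < (2::nat) ^ w" by simp

lemma cmp_bsim:
  assumes "regs_below bd c" "R s s'"
  shows "bsim TR (exec w inp c s) (exec w' inp' (cmp c) s')"
  using assms
proof (induction c arbitrary: s s')
  case Skip
  then show ?case by (simp add: bsim_return)
next
  case (Const x k)
  note r = R_reg[OF Const(2)]
  let ?s = "set_reg (100 + x) (take_bit w k) (set_reg (100 + x) (take_bit w' k) s')"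
  have "take_bit w' k mod 2 ^ w = take_bit w k"
    using ww by (simp add: take_bit_eq_mod[symmetric] take_bit_take_bit)
  moreover have "take_bit w' (take_bit w k) = take_bit w k" using ww by (simp add: take_bit_take_bit)
  ultimately have e: "exec w' inp' (cmp (Const x k)) s' = return_spmf (2, ?s)" using r by simp
  show ?case by (rule bsim_prim[OF _ e]) (auto intro!: R_set[OF Const(2)] simp: take_bit_nat_less_exp)
next
  case (Bin f x y z)
  note r = R_reg[OF Bin(2)]
  have yz: "y < bd" "z < bd" "x < bd" using Bin.prems by auto
  let ?v = "eval_binop w f (reg s y) (reg s z)"
  let ?s = "set_reg (100 + x) ?v (set_reg (100 + x) (eval_binop w' f (reg s y) (reg s z)) s')"
  have v: "?v < 2 ^ w" by (cases f) (simp_all only: eval_binop.simps take_bit_nat_less_exp)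
  have "eval_binop w' f (reg s y) (reg s z) mod 2 ^ w = ?v" by (rule eval_mod) (use r in auto)
  moreover have "take_bit w' ?v = ?v" using v W2' by (intro take_bit_small) linarith
  ultimately have e: "exec w' inp' (cmp (Bin f x y z)) s' = return_spmf (2, ?s)" using r yz by simp
  show ?case by (rule bsim_prim[OF _ e]) (auto intro!: R_set[OF Bin(2)] simp: v)
next
  case (Load x y)
  note r = R_reg[OF Load(2)]
  have yz: "y < bd" "x < bd" using Load.prems by auto
  let ?a = "sg 19 + reg s y"
  have a: "8 * ?a + 8 \<le> 2 ^ w'" using r(7) by (rule base_le)
  have tb: "take_bit w' ?a = ?a" "take_bit w' (8::nat) = 8" "take_bit w' (?a * 8) = ?a * 8" "take_bit w' (6::nat) = 6"
    "take_bit w' (?a * 8 + 6) = ?a * 8 + 6"  "take_bit w' (4::nat) = 4" "take_bit w' (?a * 8 + 4) = ?a * 8 + 4"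
    "take_bit w' (?a * 8 + sg 11) = ?a * 8 + sg 11" "take_bit w' (of_bool P) = (of_bool P::nat)" for P
    using a ovt W_ge_16 by (auto intro!: take_bit_small)
  have m: "mem s' (?a * 8 + 6) = ar s' 6 ?a" "mem s' (?a * 8 + 4) = ar s' 4 ?a" "mem s' (?a * 8 + sg 11) = ar s' (sg 11) ?a"
    using ovt by (auto simp: ar_def mult.commute)
  have ms: "mem s (reg s y) = (if ar s' 6 ?a = sg 12 then ar s' (sg 11) ?a else ar s' 4 ?a)"
    using Load(2) r(7)[of y] by (simp add: R_def imem_def)
  have mb: "mem s (reg s y) < 2 ^ w" using Load(2) unfolding R_def by blast
  have "\<exists>n t. n \<le> 12 \<and> exec w' inp' (cmp (Load x y)) s' = return_spmf (n, t) \<and> R (set_reg x (mem s (reg s y)) s) t"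
  proof (cases "ar s' 6 ?a = sg 12")
    case True
    then show ?thesis using r(1-6) yz tb m ms mb
      by (auto intro!: R_set[OF Load(2)])
  next
    case False
    then show ?thesis using r(1-6) yz tb m ms mb
      by (auto intro!: R_set[OF Load(2)])
  qed
  then show ?case by (auto intro!: bsim_return)
next
  case (Store x y)
  note r = R_reg[OF Store(2)]
  have yz: "y < bd" "x < bd" using Store.prems by auto
  let ?a = "sg 19 + reg s x"
  have a: "8 * ?a + 8 \<le> 2 ^ w'" using r(7) by (rule base_le)
  have tb: "take_bit w' ?a = ?a" "take_bit w' (8::nat) = 8" "take_bit w' (?a * 8) = ?a * 8" "take_bit w' (6::nat) = 6"
    "take_bit w' (?a * 8 + 6) = ?a * 8 + 6"
    "take_bit w' (?a * 8 + sg 11) = ?a * 8 + sg 11"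
    using a ovt W_ge_16 by (auto intro!: take_bit_small)
  define t where "t = set_reg 65 (?a * 8 + sg 11) (set_reg 65 (?a * 8 + 6) (set_reg 65 6 (set_reg 64 (?a * 8) (set_reg 65 8 (set_reg 64 ?a s')))))"
  define t' where "t' = t\<lparr>mem := (mem t)(8 * ?a + 6 := sg 12)\<rparr>"
  define t'' where "t'' = t'\<lparr>mem := (mem t')(8 * ?a + sg 11 := reg s y)\<rparr>"
  have e: "exec w' inp' (cmp (Store x y)) s' = return_spmf (8, t'')"
    using r(1-6) yz tb by (simp add: t_def t'_def t''_def set_reg_def algebra_simps)
  have art: "ar t'' = (ar s')(6 := (ar s' 6)(?a := sg 12), sg 11 := (ar s' (sg 11))(?a := reg s y))"
    unfolding t''_def t'_def using ovt by (subst ar_upd, force)+ (auto simp: t_def fun_eq_iff)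
  have rgt: "rg t'' = rg s'" "out t'' = out s'" "\<And>x. reg t'' (100 + x) = reg s' (100 + x)"
    by (simp_all add: t''_def t'_def t_def)
  have "imem w sg (ar t'') = (imem w sg (ar s'))(reg s x := reg s y)"
  proof
    fix a show "imem w sg (ar t'') a = ((imem w sg (ar s'))(reg s x := reg s y)) a"
      using ovt r(7)[of x] by (elim disjE) (simp_all add: imem_def art)
  qed
  moreover have "frame w sg al (ar t'')"
  proof -
    have "frame w sg al (ar s')" using Store(2) unfolding R_def by blast
    then show ?thesis
      using ovt r(7)[of x] r(7)[of y] by (elim disjE) (simp_all add: frame_def art)
  qed
  ultimately have "R (s\<lparr>mem := (mem s)(reg s x := reg s y)\<rparr>) t''"
    using Store(2) rgt r(7) unfolding R_def by auto
  then show ?case using e by (auto intro!: bsim_return)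
next
  case (Rand x)
  note r = R_reg[OF Rand(2)]
  have e: "exec w' inp' (cmp (Rand x)) s' = map_spmf (%a. (2, set_reg (100 + x) (a mod 2 ^ w) (set_reg (100 + x) a s')))
      (spmf_of_set {..<2 ^ w'})"
  proof -
    have "take_bit w' (b mod 2 ^ w) = b mod 2 ^ w" for b :: nat
      using mod_small[of b] W2' by (intro take_bit_small) linarith
    then show ?thesis using r(1) by (simp add: map_spmf_conv_bind_spmf numeral_2_eq_2)
  qed
  show ?case unfolding e unfolding exec.simps
    by (intro bsim_map bsim_mono[OF bsim_rand[OF ww]]) (auto intro!: R_set[OF Rand(2)])
next
  case (Read x y)
  note r = R_reg[OF Read(2)]
  have yz: "y < bd" "x < bd" using Read.prems by auto
  let ?v = "if reg s y < length inp then take_bit w (inp ! reg s y) else 0"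
  have tb: "take_bit w' (of_bool P) = (of_bool P::nat)" "take_bit w' (8::nat) = 8" "take_bit w' (7::nat) = 7" for P
    using W_ge_16 by (auto intro!: take_bit_small)
  have "\<exists>n t. n \<le> 12 \<and> exec w' inp' (cmp (Read x y)) s' = return_spmf (n, t) \<and> R (set_reg x ?v s) t"
  proof (cases "reg s y < length inp")
    case True
    then have tb': "take_bit w' (reg s y * 8) = reg s y * 8" "take_bit w' (reg s y * 8 + 7) = reg s y * 8 + 7"
      using len by (auto intro!: take_bit_small)
    have "ar s' 7 = al 7" using Read(2) ovt unfolding R_def frame_def by auto
    then have m: "mem s' (reg s y * 8 + 7) = inp ! reg s y"
      using buf[OF True] by (auto simp: ar_def mult.commute fun_eq_iff)
    have "inp ! reg s y mod 2 ^ w = take_bit w (inp ! reg s y)" by (simp add: take_bit_eq_mod)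
    moreover have "take_bit w' (take_bit w (inp ! reg s y)) = take_bit w (inp ! reg s y)"
      using ww by (simp add: take_bit_take_bit)
    ultimately show ?thesis using True r(1-6) yz tb tb' m
      by (auto intro!: R_set[OF Read(2)] simp: take_bit_nat_less_exp)
  next
    case False
    then show ?thesis using r(1-6) yz tb
      by (auto intro!: R_set[OF Read(2)])
  qed
  then show ?case by (auto intro!: bsim_return)
next
  case (Write x)
  note r = R_reg[OF Write(2)]
  have x: "x < bd" using Write.prems by auto
  have "R (s\<lparr>out := out s @ [reg s x]\<rparr>) (set_reg 26 (reg s x) s')"
  proof -
    have "\<forall>x. reg s x < 2 ^ w" "\<forall>x<bd. reg s' (100 + x) = reg s x" "\<forall>a. mem s a < 2 ^ w" "mem s = imem w sg (ar s')"
      "out s' = z" "frame w sg al (ar s')" using Write(2) unfolding R_def by blast+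
    moreover have "(rg s')(26 := reg s x) = sg(26 := reg s x)"
      using Write(2) unfolding R_def by (metis fun_upd_upd)
    ultimately show ?thesis unfolding R_def using r(7)[of x] by simp
  qed
  then show ?case using r(6)[OF x] r(8)[of x] by (auto intro!: bsim_return simp: take_bit_small)
next
  case (Seq c d)
  show ?case unfolding cmp.simps exec.simps
    by (intro bsim_bind[OF Seq.IH(1)] bsim_map, use Seq.prems in \<open>simp_all\<close>)
      (rule bsim_mono[OF Seq.IH(2)], use Seq.prems in auto)
next
  case (If_NZ x c d)
  note r = R_reg[OF If_NZ.prems(2)]
  have x: "x < bd" using If_NZ.prems by auto
  show ?case
  proof (cases "reg s x = 0")
    case True
    then show ?thesis using r(6)[OF x] If_NZ.prems
      by (auto intro!: bsim_map bsim_mono[OF If_NZ.IH(2)])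
  next
    case False
    then show ?thesis using r(6)[OF x] If_NZ.prems
      by (auto intro!: bsim_map bsim_mono[OF If_NZ.IH(1)])
  qed
next
  case (While_NZ x c)
  have x: "x < bd" using While_NZ.prems by auto
  show ?case unfolding cmp.simps exec.simps
    by (rule bsim_loop[where T="%t t'. t' \<le> 12 * t"])
      (use While_NZ R_reg(6)[OF _ x] in auto)
qed

end

primrec reset :: "nat => com" where
  "reset 0 = Skip"
| "reset (Suc n) = reset n ;; Const (100 + n) 0"

text \<open>A session starts each procedure with zero registers; clearing the simulated registers
  reproduces this.\<close>

definition call :: "nat => com => com" where
  "call n c = reset n ;; cmp c"

lemma exec_reset:
  "\<exists>s'. exec w inp (reset n) s = return_spmf (Suc n, s') \<and> (\<forall>i<n. reg s' (100 + i) = 0) \<and>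
    rg s' = rg s \<and> ar s' = ar s \<and> out s' = out s"
proof (induction n)
  case (Suc n)
  then obtain s' where "exec w inp (reset n) s = return_spmf (Suc n, s')" "\<forall>i<n. reg s' (100 + i) = 0"
    "rg s' = rg s" "ar s' = ar s" "out s' = out s" by blast
  then show ?case by (intro exI[of _ "set_reg (100 + n) 0 s'"]) (auto simp: less_Suc_eq)
qed auto

abbreviation ini :: "(nat => nat) => ram" where
  "ini m \<equiv> \<lparr>reg = (%_. 0), mem = m, out = []\<rparr>"

lemma imem_upd [simp]: "imem w (sg(26 := l)) = imem w sg"
  by (simp add: imem_def fun_eq_iff)

context simu
begin

lemma call_bsim:
  assumes "regs_below bd c" "\<And>a. imem w sg al a < 2 ^ w" "rg s' = sg" "ar s' = al" "out s' = z"
  shows "bsim (%r r'. fst r' \<le> 12 * fst r + bd + 1 \<and> R (snd r) (snd r'))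
    (exec w inp c (ini (imem w sg al))) (exec w' inp' (call bd c) s')"
proof -
  obtain t where t: "exec w' inp' (reset bd) s' = return_spmf (Suc bd, t)" "\<forall>i<bd. reg t (100 + i) = 0"
    "rg t = sg" "ar t = al" "out t = z" using exec_reset[of w' inp' bd s'] assms(3-5) by metis
  have "frame w sg al al" by (simp add: frame_def)
  then have "R (ini (imem w sg al)) t"
    using t assms(2) unfolding R_def by simp
  from cmp_bsim[OF assms(1) this]
  have "bsim (%r r'. fst r' \<le> 12 * fst r + bd + 1 \<and> R (snd r) (snd r')) (map_spmf id (exec w inp c (ini (imem w sg al))))
     (map_spmf (%r. (Suc bd + fst r, snd r)) (exec w' inp' (cmp c) t))"
    by (intro bsim_map) (rule bsim_mono, auto)
  then show ?thesis by (simp add: call_def t(1))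
qed

lemma hsure_call:
  assumes "regs_below bd c" "\<And>a. imem w sg al a < 2 ^ w"
    "lossless_spmf (exec w inp c (ini (imem w sg al)))"
    "\<And>t1 s1 t al' l. (t1, s1) \<in> set_spmf (exec w inp c (ini (imem w sg al))) ==> t \<le> 12 * t1 + bd + 1 ==>
       mem s1 = imem w sg al' ==> (\<And>a. mem s1 a < 2 ^ w) ==> frame w sg al al' ==>
       (out s1 \<noteq> [] ==> l = last (out s1)) ==> l = sg 26 \<or> l < 2 ^ w ==> Q t (sg(26 := l)) al' z"
  shows "hsure w' inp' (call bd c) sg al z Q"
  unfolding hsure_def
proof (intro allI impI)
  fix s' assume s': "rg s' = sg \<and> ar s' = al \<and> out s' = z"
  have b: "bsim (%r r'. fst r' \<le> 12 * fst r + bd + 1 \<and> R (snd r) (snd r'))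
    (exec w inp c (ini (imem w sg al))) (exec w' inp' (call bd c) s')"
    by (rule call_bsim[OF assms(1,2)]) (use s' in auto)
  note b1 = b[unfolded bsim_def, THEN conjunct1] and b2 = b[unfolded bsim_def, THEN conjunct2]
  show "sure w' inp' (call bd c) s' (%t s'. Q t (rg s') (ar s') (out s'))"
    unfolding sure_def
  proof
    show "lossless_spmf (exec w' inp' (call bd c) s')"
      by (rule sim_lossless[OF b2 assms(3)])
    show "\<forall>r\<in>set_spmf (exec w' inp' (call bd c) s'). Q (fst r) (rg (snd r)) (ar (snd r)) (out (snd r))"
    proof
      fix r assume "r \<in> set_spmf (exec w' inp' (call bd c) s')"
      then obtain q where q: "q \<in> set_spmf (exec w inp c (ini (imem w sg al)))" "fst r \<le> 12 * fst q + bd + 1" "R (snd q) (snd r)"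
        by (rule sim_set[OF b1]) auto
      have "Q (fst r) (sg(26 := rg (snd r) 26)) (ar (snd r)) z"
        by (rule assms(4)[of "fst q" "snd q"]) (use q(1,2) q(3)[unfolded R_def] in \<open>simp, simp, blast+\<close>)
      then show "Q (fst r) (rg (snd r)) (ar (snd r)) (out (snd r))"
        using q(3) unfolding R_def by metis
    qed
  qed
qed

text \<open>An expectation over the simulating call is bounded by one over the simulated program,
  for any \<open>g\<close> on its final states that dominates \<open>f\<close> across the
  simulation.\<close>

lemma hew_call:
  assumes "regs_below bd c" "\<And>a. imem w sg al a < 2 ^ w"
    "\<And>s1 al' l. mem s1 = imem w sg al' ==> (\<And>a. mem s1 a < 2 ^ w) ==> frame w sg al al' ==>
       (out s1 \<noteq> [] ==> l = last (out s1)) ==> f (sg(26 := l)) al' z \<le> g s1"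
    "Ex (exec w inp c (ini (imem w sg al))) (%r. g (snd r)) \<le> b"
  shows "hew w' inp' (call bd c) sg al z f b"
  unfolding hew_def ew_def
proof (intro allI impI)
  fix s' assume s': "rg s' = sg \<and> ar s' = al \<and> out s' = z"
  have "sim (%r r'. fst r' \<le> 12 * fst r + bd + 1 \<and> R (snd r) (snd r')) (exec w inp c (ini (imem w sg al))) (exec w' inp' (call bd c) s')"
    by (rule call_bsim[OF assms(1,2), unfolded bsim_def, THEN conjunct1]) (use s' in auto)
  then have "Ex (exec w' inp' (call bd c) s') (%r. f (rg (snd r)) (ar (snd r)) (out (snd r)))
      \<le> Ex (exec w inp c (ini (imem w sg al))) (%r. g (snd r))"
  proof (rule simD)
    fix q r :: "nat \<times> ram" assume "fst r \<le> 12 * fst q + bd + 1 \<and> R (snd q) (snd r)"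
    then have q: "R (snd q) (snd r)" by simp
    have "f (sg(26 := rg (snd r) 26)) (ar (snd r)) z \<le> g (snd q)"
      by (rule assms(3)) (use q[unfolded R_def] in blast)+
    then show "f (rg (snd r)) (ar (snd r)) (out (snd r)) \<le> g (snd q)"
      using q unfolding R_def by metis
  qed
  also note assms(4)
  finally show "Ex (exec w' inp' (call bd c) s') (%r. f (rg (snd r)) (ar (snd r)) (out (snd r))) \<le> b" .
qed

end

subsection \<open>The reduction as a program\<close>

text \<open>
  A template \<open>(c, e, f)\<close> contributes one edge for each entry \<open>x = i k + j\<close> of a block: \<open>e\<close> if the condition \<open>c\<close> holds
  at \<open>x\<close> and otherwise \<open>f\<close>, usually a dummy edge, so that the length of the edge list does not depend on the matrix.
\<close>

datatype sel = SZ | SI | SJ | SX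
datatype cnd = KA | KM | KJ | KX

type_synonym tedge = "nat \<times> sel \<times> nat \<times> sel"
type_synonym tmpl = "cnd \<times> tedge \<times> tedge"

fun selv :: "nat => nat => sel => nat" where
  "selv k x SZ = 0" | "selv k x SI = x div k" | "selv k x SJ = x mod k" | "selv k x SX = x"

text \<open>\<open>KJ\<close> holds for exactly one entry of each row of the block and
  \<open>KX\<close> for one entry in all; this yields families of \<open>k\<close> edges and single
  edges from templates over \<open>k * k\<close> entries.\<close>

fun cndv :: "nat => (nat => nat => bool) => nat => cnd => bool" where
  "cndv k M x KA = True" | "cndv k M x KM = M (x div k) (x mod k)" | "cndv k M x KJ = (x mod k = 0)" | "cndv k M x KX = (x = 0)"

text \<open>Class \<open>a\<close> of vertices occupies the numbers from \<open>a * (k * k)\<close>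
  on, with room for one vertex per matrix entry.\<close>

fun tev :: "nat => nat => tedge => nat \<times> nat" where
  "tev k x (a, s, b, t) = (a * (k * k) + selv k x s, b * (k * k) + selv k x t)"

fun tedge :: "nat => (nat => nat => bool) => nat => tmpl => nat \<times> nat" where
  "tedge k M x (c, e, f) = tev k x (if cndv k M x c then e else f)"

definition tedges :: "tmpl list => nat => (nat => nat => bool) => (nat \<times> nat) list" where
  "tedges tms k M = concat (map (%x. map (tedge k M x) tms) [0..<k * k])"

text \<open>Error probability of the final answer as a function of the starting memory; this is what
  allows conditioning on the outcome of preprocessing.\<close>

definition serr :: "nat => (com \<times> nat list) list => nat => (nat => nat) => ennreal" where
  "serr w cs a m = Ex (session w cs m) (%tr. of_bool (snd (last tr) \<noteq> [a]))"

definition stm :: "nat => (com \<times> nat list) list => (nat => nat) => nat => bool" where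
  "stm w cs m b \<longleftrightarrow> lossless_spmf (session w cs m) \<and> (\<forall>tr \<in> set_spmf (session w cs m). sum_list (map fst tr) \<le> b)"

lemma session_nonempty: "tr \<in> set_spmf (session w cs m) ==> length tr = length cs"
  by (induction cs arbitrary: tr m) (auto simp: set_bind_spmf bind_UNION)

lemma serr_Cons:
  assumes "cs \<noteq> []"
  shows "serr w ((c, i) # cs) a m = Ex (exec w i c (ini m)) (%r. serr w cs a (mem (snd r)))"
proof -
  have "Ex (session w cs m') (%tr. of_bool (snd (last (x # tr)) \<noteq> [a])) = serr w cs a m'" for m' x
    unfolding serr_def using assms session_nonempty by (intro Ex_cong) force
  then show ?thesis unfolding serr_def session.simps Ex_bind nn_integral_map_spmf by (simp add: o_def serr_def)
qed

lemma serr_single: "serr w [(c, i)] a m = Ex (exec w i c (ini m)) (%r. of_bool (out (snd r) \<noteq> [a]))"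
  by (simp add: serr_def Ex_bind)

lemma stm_Cons:
  assumes "stm w ((c, i) # cs) m b"
  shows "lossless_spmf (exec w i c (ini m))"
    and "(t, s) \<in> set_spmf (exec w i c (ini m)) ==> stm w cs (mem s) (b - t)"
    and "(t, s) \<in> set_spmf (exec w i c (ini m)) ==> t \<le> b"
proof -
  show "lossless_spmf (exec w i c (ini m))" using assms by (auto simp: stm_def)
  assume ts: "(t, s) \<in> set_spmf (exec w i c (ini m))"
  then have l: "lossless_spmf (session w cs (mem s))" using assms by (auto simp: stm_def)
  have *: "t + sum_list (map fst tr) \<le> b" if "tr \<in> set_spmf (session w cs (mem s))" for tr
  proof -
    have "(t, out s) # tr \<in> set_spmf (session w ((c, i) # cs) m)"
      using ts that by (force simp: set_bind_spmf bind_UNION)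
    then show ?thesis using assms by (force simp: stm_def)
  qed
  obtain tr where "tr \<in> set_spmf (session w cs (mem s))"
    using l measure_spmf_zero_iff[of "session w cs (mem s)" UNIV] by (auto simp: lossless_spmf_def space_measure_spmf)
  then show "t \<le> b" using *[of tr] by linarith
  show "stm w cs (mem s) (b - t)" unfolding stm_def using l * by fastforce
qed

text \<open>Only an inequality, since mass may be missing. The shape \<open>A * (1 + h)\<close> is
  that of the product over copies with one factor still open.\<close>

lemma Ex_affine: "Ex p (%r. A * (1 + h r)) \<le> A * (1 + Ex p h)"
proof -
  have "Ex p (%r. A * (1 + h r)) = A * (Ex p (%_. 1) + Ex p h)"
    by (subst nn_integral_cmult) (simp_all add: nn_integral_add)
  also have "\<dots> \<le> A * (1 + Ex p h)"
    by (intro mult_left_mono add_right_mono Ex_le_const) auto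
  finally show ?thesis .
qed

text \<open>\<open>md\<close> says whether updates insert the edges of chosen vertices or delete
  those of the others. \<open>ta\<close> is the class of the vertex to which columns are attached: 0
  for the root, another class for paths. \<open>rt\<close> is the length of the root input,
  \<open>NA\<close> the number of vertex classes, and \<open>c1\<close>, \<open>c2\<close>,
  \<open>c3\<close> switch on the terms that are compared with a count.\<close>

locale red =
  fixes cpre cupd cqry :: com and bd cw :: nat and tms :: "tmpl list" and NA rt ta c1 c2 c3 D :: nat and md :: bool
    and val :: "nat => (nat => nat => bool) => (nat => bool) => (nat => bool) => nat"
    and Bp Bs :: "nat => nat"
  assumes bd: "regs_below bd cpre" "regs_below bd cupd" "regs_below bd cqry"
    and NA: "1 \<le> NA" "ta < NA" "3 \<le> NA" and rt: "rt \<le> 1" and c: "c1 \<le> 1" "c2 \<le> 1" "c3 \<le> 1" and D: "1 \<le> D"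
    and tms: "\<And>c a s b t a' s' b' t'. (c, (a, s, b, t), (a', s', b', t')) \<in> set tms ==> a < NA \<and> b < NA \<and> a' < NA \<and> b' < NA"
begin

definition wk :: "nat => nat" where "wk k = word_size cw (NA * (k * k))"

definition pinp :: "nat => (nat => nat => bool) => nat list" where
  "pinp k M = replicate rt 0 @ (NA * (k * k)) # (length tms * (k * k)) # concat (map (%(u, v). [u, v]) (tedges tms k M))"

text \<open>Comparison with \<open>md\<close> covers both cases: insert the edges of members, or
  start with all edges and delete those of non-members.\<close>

definition upd1 :: "nat => (nat => bool) => nat => (com \<times> nat list) list" where
  "upd1 k u i = (if u i = md then [(cupd, [0, k * k + i])] else [])"
definition upd2 :: "nat => (nat => bool) => nat => (com \<times> nat list) list" where
  "upd2 k v i = (if v i = md then [(cupd, [ta * (k * k), 2 * (k * k) + i])] else [])"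

definition rest :: "nat => (nat => bool) => (nat => bool) => nat => (com \<times> nat list) list" where
  "rest k u v i = concat (map (%i. upd1 k u i @ upd2 k v i) [i..<k]) @ [(cqry, [])]"

lemma rest_step: "i < k ==> rest k u v i = upd1 k u i @ upd2 k v i @ rest k u v (Suc i)"
  by (simp add: rest_def upt_conv_Cons)

lemma rest_end: "rest k u v k = [(cqry, [])]"
  by (simp add: rest_def)

lemma rest_nonempty [simp]: "rest k u v i \<noteq> []"
  by (simp add: rest_def)

text \<open>The number of paths is compared with a polynomial in \<open>k\<close>, \<open>a\<close>,
  \<open>b\<close> that has terms of both signs; the negative ones stand here and the positive ones
  in \<open>rhs\<close>, so that no subtraction of naturals occurs. For detection all three switches
  are 0 and the comparison is with 0.\<close>

definition lhs :: "nat => nat => nat => nat" where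
  "lhs k a b = 4 * c1 * (k * (k * k)) + (2 * c2 * (k * a) + 2 * c3 * (k * b))"
definition rhs :: "nat => nat => nat => nat" where
  "rhs k a b = 2 * c1 * (k * k * (k * k) + k * k) + (c2 * (k * (a * (k + a))) + c3 * (k * (b * (k + b))))"

definition hit :: "nat => (nat => nat => bool) => (nat => bool) => (nat => bool) => bool" where
  "hit k M u v \<longleftrightarrow> (\<exists>i<k. \<exists>j<k. u i \<and> M i j \<and> v j)"

abbreviation eplus :: "expr => expr => expr" where "eplus a b \<equiv> B Add a b"
abbreviation etimes :: "expr => expr => expr" where "etimes a b \<equiv> B Mul a b"

text \<open>
  Registers: 0 \<open>n\<close>, 1 \<open>lg\<close>, 2 \<open>log k\<close>, 3 \<open>k\<close>, 4 \<open>k\<^sup>2\<close>, 5 \<open>g\<close> (blocks per row), 6 \<open>g\<^sup>2\<close>, 7 \<open>r\<close> (copies per block), 8 simulated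
  word length, 9 its modulus, 10 \<open>g k\<close>, 11 array for simulated writes, 12 stamp, 13 number of searches,
  14 block or copy, 15 and 16 its row and column, 17 votes, 18 copy within the block, 19 offset of the copy, 20 \<open>|u|\<close>,
  21 \<open>|v|\<close>, 22 to 31 loop indices, communication with the simulated program and temporaries. Arrays: 0 parameters, 1 matrix,
  2 vector, 3 result, 4 memories after preprocessing, 5 current memories, 6 stamps, 7 input buffer.
\<close>

definition params :: com where
  "params = assign 1 (C 0) ;; assign 2 (C 1) ;;
     For 12 0 (ife (B Lt (V 0) (V 2)) Skip (assign 1 (eplus (V 1) (C 1)) ;; assign 2 (eplus (V 2) (V 2)))) ;;
     assign 2 (B Div (V 1) (C D)) ;; assign 3 (B Shl (C 1) (V 2)) ;; assign 4 (etimes (V 3) (V 3)) ;;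
     assign 5 (eplus (B Div (V 0) (V 3)) (C 1)) ;; assign 6 (etimes (V 5) (V 5)) ;;
     assign 7 (eplus (etimes (C 36) (V 1)) (C 24)) ;;
     assign 8 (etimes (C cw) (eplus (C (floorlog 2 NA + 1)) (etimes (C 2) (V 2)))) ;;
     assign 9 (B Shl (C 1) (V 8)) ;; assign 10 (etimes (V 5) (V 3))"

fun cexp :: "cnd => expr" where
  "cexp KA = C 1" | "cexp KM = V 29" | "cexp KJ = B Eq (V 31) (C 0)" | "cexp KX = B Eq (V 28) (C 0)"
fun sexp :: "sel => expr" where
  "sexp SZ = C 0" | "sexp SI = V 30" | "sexp SJ = V 31" | "sexp SX = V 28"
definition aexp :: "nat => nat => expr" where
  "aexp h d = eplus (etimes (C 2) (eplus (etimes (V 28) (C (length tms))) (C h))) (C (rt + 2 + d))"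
fun emit1 :: "nat => tedge => com" where
  "emit1 h (a, s, b, t) = astore 7 (aexp h 0) (eplus (etimes (C a) (V 4)) (sexp s)) ;;
     astore 7 (aexp h 1) (eplus (etimes (C b) (V 4)) (sexp t))"
fun emit :: "nat => tmpl => com" where
  "emit h (c, e, f) = ife (cexp c) (emit1 h e) (emit1 h f)"
primrec emits :: "nat => tmpl list => com" where
  "emits h [] = Skip"
| "emits h (x # xs) = emit h x ;; emits (Suc h) xs"

text \<open>Array 1 stores the matrix with rows of length \<open>g k\<close>, padded by zeros, so
  that every block is full.\<close>

definition mexp :: expr where
  "mexp = eplus (etimes (eplus (etimes (V 15) (V 3)) (V 30)) (V 10)) (eplus (etimes (V 16) (V 3)) (V 31))"

definition build :: com where
  "build = assign 30 (B Div (V 28) (V 3)) ;; assign 31 (B Mod (V 28) (V 3)) ;; aload 29 1 mexp ;; emits 0 tms"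

definition instc :: com where
  "instc = assign 15 (B Div (V 14) (V 7)) ;; assign 16 (B Mod (V 15) (V 5)) ;; assign 15 (B Div (V 15) (V 5)) ;;
     assign 19 (etimes (V 14) (V 9)) ;; astore 7 (C 0) (C 0) ;; astore 7 (C rt) (etimes (C NA) (V 4)) ;;
     astore 7 (C (rt + 1)) (etimes (C (length tms)) (V 4)) ;; For 28 4 build ;;
     assign 25 (eplus (C (rt + 2)) (etimes (C (2 * length tms)) (V 4))) ;; call bd cpre"

definition copym :: com where
  "copym = aread 15 (eplus (V 14) (C 1)) ;;
     astore 1 (eplus (etimes (B Div (V 14) (V 0)) (V 10)) (B Mod (V 14) (V 0))) (V 15)"

text \<open>With stamp 0 and writes directed to array 4, preprocessing is permanent: all stamps are
  0, so both cases of a simulated read consult array 4. Later runs use positive stamps and array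
  5.\<close>

definition prec :: com where
  "prec = aread 0 (C 0) ;; astore 0 (C 0) (V 0) ;; params ;; assign 13 (etimes (V 0) (V 0)) ;; For 14 13 copym ;;
     assign 12 (C 0) ;; assign 11 (C 4) ;; assign 13 (etimes (V 6) (V 7)) ;; For 14 13 instc"

definition updc :: "nat => nat => com" where
  "updc a b = astore 7 (C 0) (etimes (C a) (V 4)) ;; astore 7 (C 1) (eplus (etimes (C b) (V 4)) (V 22)) ;;
     assign 25 (C 2) ;; call bd cupd"

definition mdc :: nat where "mdc = of_bool md"

text \<open>A row counts as chosen while its result is still 0. Hence a right positive answer
  announces a new row, which is what bounds the number of searches.\<close>

definition stepc :: com where
  "stepc = aload 23 3 (eplus (etimes (V 15) (V 3)) (V 22)) ;; assign 23 (B Eq (V 23) (C 0)) ;;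
     aload 24 2 (eplus (etimes (V 16) (V 3)) (V 22)) ;; assign 24 (B Lt (C 0) (V 24)) ;;
     assign 20 (eplus (V 20) (V 23)) ;; assign 21 (eplus (V 21) (V 24)) ;;
     ife (B Eq (V 23) (C mdc)) (updc 0 1) Skip ;; ife (B Eq (V 24) (C mdc)) (updc ta 2) Skip"

definition lexp :: expr where
  "lexp = eplus (V 26) (eplus (etimes (C (4 * c1)) (etimes (V 3) (V 4)))
     (eplus (etimes (C (2 * c2)) (etimes (V 3) (V 20))) (etimes (C (2 * c3)) (etimes (V 3) (V 21)))))"
definition rexp :: expr where
  "rexp = eplus (etimes (C (2 * c1)) (eplus (etimes (V 4) (V 4)) (V 4)))
     (eplus (etimes (C c2) (etimes (V 3) (etimes (V 20) (eplus (V 3) (V 20)))))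
       (etimes (C c3) (etimes (V 3) (etimes (V 21) (eplus (V 3) (V 21))))))"

definition copyc :: com where
  "copyc = assign 12 (eplus (V 12) (C 1)) ;; assign 19 (etimes (eplus (etimes (V 14) (V 7)) (V 18)) (V 9)) ;;
     assign 20 (C 0) ;; assign 21 (C 0) ;; For 22 3 stepc ;; assign 25 (C 0) ;; assign 26 (C 0) ;; call bd cqry ;;
     assign 17 (eplus (V 17) (B Eq (B Eq lexp rexp) (C 0)))"

definition brute :: com where
  "brute = assign 30 (B Div (V 28) (V 3)) ;; assign 31 (B Mod (V 28) (V 3)) ;; aload 29 1 mexp ;;
     aload 27 2 (eplus (etimes (V 16) (V 3)) (V 31)) ;;
     ife (etimes (V 29) (V 27)) (astore 3 (eplus (etimes (V 15) (V 3)) (V 30)) (C 1)) Skip"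

definition blk :: com where
  "blk = assign 15 (B Div (V 14) (V 5)) ;; assign 16 (B Mod (V 14) (V 5)) ;; assign 17 (C 0) ;; For 18 7 copyc ;;
     ife (etimes (B Lt (V 7) (etimes (C 2) (V 17))) (B Lt (V 13) (V 0)))
       (assign 13 (eplus (V 13) (C 1)) ;; For 28 4 brute) Skip"

definition readv :: com where
  "readv = aread 15 (V 14) ;; astore 2 (V 14) (V 15) ;; astore 3 (V 14) (C 0)"

definition outv :: com where
  "outv = aload 15 3 (V 14) ;; awrite (V 15)"

text \<open>Registers are cleared between calls; \<open>n\<close> and the stamp counter survive in
  cells 0 and 1 of array 0.\<close>

definition multc :: com where
  "multc = aload 0 0 (C 0) ;; params ;; aload 12 0 (C 1) ;; assign 11 (C 5) ;; For 14 0 readv ;;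
     assign 13 (C 0) ;; For 14 6 blk ;; For 14 0 outv ;; astore 0 (C 1) (V 12)"

text \<open>Leaves of expressions stay below \<open>q = 2 ^ (Qc * (lg + 1))\<close>, and expressions
  other than shifts have degree at most 12; the word size with constant \<open>12 * Qc\<close> makes
  the modulus exactly \<open>q ^ 12\<close>.\<close>

definition Qc :: nat where
  "Qc = cw * (NA + 3) + NA + 2 * length tms + D + cw + 100"

definition omv :: omv_alg where
  "omv = \<lparr>omv_pre = prec, omv_mult = multc, omv_word = 12 * Qc\<rparr>"

end

section \<open>Sizes of the numbers that are stored\<close>

lemma pow_le_floorlog: "2 ^ l \<le> n \<longleftrightarrow> l < floorlog 2 n"
proof (cases "n = 0")
  case False
  then have *: "2 ^ (floorlog 2 n - 1) \<le> n \<and> n < 2 ^ floorlog 2 n" and "0 < floorlog 2 n"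
    using floorlog_bounds[of n 2] floorlog_eq_zero_iff[of 2 n] by auto
  show ?thesis
  proof
    assume "2 ^ l \<le> n"
    then have "(2::nat) ^ l < 2 ^ floorlog 2 n" using * by linarith
    then show "l < floorlog 2 n" by simp
  next
    assume "l < floorlog 2 n"
    then have "(2::nat) ^ l \<le> 2 ^ (floorlog 2 n - 1)" by (intro power_increasing) auto
    then show "2 ^ l \<le> n" using * by linarith
  qed
qed (simp add: floorlog_def)

lemma less_floorlog: "n < 2 ^ floorlog 2 n"
  using pow_le_floorlog[of "floorlog 2 n" n] by (simp add: not_le)

lemma floorlog_le_self: "floorlog 2 n \<le> n"
  using pow_le_floorlog[of n n] less_exp[of n] by linarith

lemma floorlog_mult_pow: "1 \<le> a ==> floorlog 2 (a * 2 ^ j) = floorlog 2 a + j"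
proof (rule antisym)
  assume a: "1 \<le> a"
  have "a * 2 ^ j < 2 ^ floorlog 2 a * 2 ^ j" using less_floorlog[of a] by simp
  then show "floorlog 2 (a * 2 ^ j) \<le> floorlog 2 a + j"
    using pow_le_floorlog[of "floorlog 2 a + j" "a * 2 ^ j"] by (simp add: power_add not_le not_less)
  have "0 < floorlog 2 a" using a pow_le_floorlog[of 0 a] by simp
  then have "2 ^ (floorlog 2 a - 1) \<le> a" using pow_le_floorlog[of "floorlog 2 a - 1" a] by simp
  then have "2 ^ (floorlog 2 a - 1 + j) \<le> a * 2 ^ j" by (simp add: power_add)
  then have "floorlog 2 a - 1 + j < floorlog 2 (a * 2 ^ j)" by (simp add: pow_le_floorlog)
  then show "floorlog 2 a + j \<le> floorlog 2 (a * 2 ^ j)" by linarith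
qed

locale redn = red +
  fixes n :: nat
begin

definition lg where "lg = floorlog 2 n"
definition k :: nat where "k = 2 ^ (lg div D)"
definition g where "g = n div k + 1"
definition r where "r = 36 * lg + 24"
definition w where "w = wk k"
definition W where "W = word_size (12 * Qc) n"
definition q :: nat where "q = 2 ^ (Qc * (lg + 1))"

lemma W_q: "2 ^ W = q ^ 12"
  by (simp add: W_def word_size_def q_def lg_def power_mult[symmetric] algebra_simps)

lemma q_le: "2 ^ e < q" if "e < Qc * (lg + 1)" for e
  using that by (simp add: q_def)

lemma Qc100: "100 \<le> Qc" by (simp add: Qc_def)

lemma q_const: "c < q" if "c \<le> Qc" for c
proof -
  have "c < 2 ^ c" by (rule less_exp)
  also have "\<dots> \<le> q" unfolding q_def using that by (intro power_increasing) (auto intro: order_trans[OF that])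
  finally show ?thesis .
qed

lemma q2: "2 \<le> q" using q_const[of 2] Qc100 by simp

lemma sb: "small q sg e ==> deg e \<le> 12 ==> bnd (2 ^ W) sg e"
  using q2 by (intro small_bnd[of q]) (auto simp: W_q intro!: power_increasing)

lemma qW: "x < q ==> x < 2 ^ W"
proof -
  assume "x < q"
  also have "q \<le> q ^ 12" using q2 by (intro self_le_power) auto
  finally show ?thesis by (simp add: W_q)
qed

lemma one_lt_W: "1 < (2::nat) ^ W" using qW[of 1] q2 by simp

lemma w_eq: "w = cw * (floorlog 2 NA + 1 + 2 * (lg div D))"
proof -
  have "NA * (k * k) = NA * 2 ^ (2 * (lg div D))" by (simp add: k_def power_add[symmetric] mult_2)
  then show ?thesis using NA(1) by (simp add: w_def wk_def word_size_def floorlog_mult_pow algebra_simps)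
qed

lemma n_lt: "n < 2 ^ lg" using less_floorlog by (simp add: lg_def)
lemma k_le: "k \<le> 2 ^ lg" by (simp add: k_def)
lemma k_pos: "0 < k" by (simp add: k_def)
lemma g_pos: "0 < g" by (simp add: g_def)
lemma g_le: "g \<le> 2 ^ lg"
proof -
  have "n div k \<le> n" by (rule div_le_dividend)
  then show ?thesis using n_lt unfolding g_def by linarith
qed
lemma n_lt_gk: "n < g * k"
proof -
  have "n = n div k * k + n mod k" by (rule div_mult_mod_eq[symmetric])
  also have "\<dots> < n div k * k + k" using k_pos by simp
  finally show ?thesis by (simp add: g_def algebra_simps)
qed

lemma r_le: "r \<le> 2 ^ (6 + lg)"
proof -
  have "lg + 1 \<le> 2 ^ lg" using less_exp[of lg] by linarith
  then have "64 * (lg + 1) \<le> 64 * 2 ^ lg" by (rule mult_le_mono2)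
  then show ?thesis by (simp add: r_def power_add)
qed

lemma w_le: "w \<le> cw * (NA + 3) * (lg + 1)"
proof -
  have "floorlog 2 NA + 1 + 2 * (lg div D) \<le> NA + 1 + 2 * lg"
    using floorlog_le_self[of NA] div_le_dividend[of lg D] by linarith
  also have "\<dots> \<le> (NA + 3) * (lg + 1)" by (simp add: algebra_simps)
  finally have "cw * (floorlog 2 NA + 1 + 2 * (lg div D)) \<le> cw * ((NA + 3) * (lg + 1))" by (rule mult_le_mono2)
  then show ?thesis by (simp only: w_eq mult.assoc)
qed

text \<open>A common budget: the stored quantities are bounded by products of a few factors
  \<open>2 ^ lg\<close> with \<open>2 ^ w\<close>, and the exponent is below
  \<open>Qc * (lg + 1)\<close> because \<open>w\<close> is linear in \<open>lg\<close>.\<close>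

lemma q_bound: "x \<le> 2 ^ (w + 30 * lg + 30) ==> x < q"
proof -
  assume x: "x \<le> 2 ^ (w + 30 * lg + 30)"
  have "w + 30 * lg + 30 < Qc * (lg + 1)" using w_le by (simp add: Qc_def algebra_simps)
  then show ?thesis using x q_le by fastforce
qed

lemma pow_prod_le:
  assumes "(a::nat) \<le> 2 ^ i" "b \<le> 2 ^ j" shows "a * b \<le> 2 ^ (i + j)"
  using mult_le_mono[OF assms] by (simp add: power_add)

lemma gg_le: "g * g \<le> 2 ^ (lg + lg)" by (rule pow_prod_le[OF g_le g_le])
lemma ggr_le: "g * g * r \<le> 2 ^ (lg + lg + (6 + lg))" by (rule pow_prod_le[OF gg_le r_le])

lemma pow2_mono: "i \<le> j ==> (2::nat) ^ i \<le> 2 ^ j" by simp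

lemma q_facts: "n < q" "k < q" "k * k < q" "g < q" "g * g < q" "r < q" "2 ^ w < q" "g * k < q" "n * n < q"
  "lg < q" "g * g * r < q" "g * g * r * 2 ^ w + 2 ^ w < q" "n * (g * g * r) + 1 < q" "2 ^ lg < q" "lg div D < q" "w < q" "2 * 2 ^ lg < q"
proof -
  note m = order_trans[OF _ pow2_mono]
  have n: "n \<le> 2 ^ lg" using n_lt by simp
  show "n < q" "k < q" "g < q" "r < q" "2 ^ w < q" "g * g < q" "g * g * r < q" "2 ^ lg < q"
    by (rule q_bound, rule m[OF n] m[OF k_le] m[OF g_le] m[OF r_le] m[OF gg_le] m[OF ggr_le] pow2_mono, simp)+
  show "k * k < q" "g * k < q" "n * n < q"
    by (rule q_bound, rule m[OF pow_prod_le[OF k_le k_le]] m[OF pow_prod_le[OF g_le k_le]] m[OF pow_prod_le[OF n n]], simp)+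
  have l: "lg \<le> 2 ^ lg" using less_exp[of lg] by linarith
  show "lg < q" by (rule q_bound, rule m[OF l]) simp
  then show "lg div D < q" using div_le_dividend[of lg D] by linarith
  have l: "w \<le> 2 ^ w" using less_exp[of w] by linarith
  show "w < q" by (rule q_bound, rule m[OF l]) simp
  have a: "g * g * r * 2 ^ w \<le> 2 ^ (lg + lg + (6 + lg) + w)" by (rule pow_prod_le[OF ggr_le]) simp
  have b: "g * g * r * 2 ^ w + 2 ^ w \<le> 2 ^ (lg + lg + (6 + lg) + w) * 2"
    using a by (simp add: mult_2_right add_mono)
  have "(2::nat) ^ (lg + lg + (6 + lg) + w) * 2 = 2 ^ (lg + lg + (6 + lg) + w + 1)" by (simp only: power_add power_one_right)
  with b have b': "g * g * r * 2 ^ w + 2 ^ w \<le> 2 ^ (lg + lg + (6 + lg) + w + 1)" by simp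
  show "g * g * r * 2 ^ w + 2 ^ w < q" by (rule q_bound, rule m[OF b']) simp
  have "n * (g * g * r) + 1 \<le> 2 ^ (lg + (lg + lg + (6 + lg))) + 2 ^ (lg + (lg + lg + (6 + lg)))"
    by (rule add_mono[OF pow_prod_le[OF n ggr_le]]) simp
  then have c: "n * (g * g * r) + 1 \<le> 2 ^ (lg + (lg + lg + (6 + lg)) + 1)" by (simp only: power_add power_one_right)
  show "n * (g * g * r) + 1 < q" by (rule q_bound, rule m[OF c]) simp
  have l: "2 * 2 ^ lg \<le> (2::nat) ^ (lg + 1)" by simp
  show "2 * 2 ^ lg < q" by (rule q_bound, rule m[OF l]) simp
qed

lemma q_consts: "length tms < q" "2 * length tms < q" "NA < q" "ta < q" "D < q" "cw < q" "floorlog 2 NA + 1 < q" "Suc (floorlog 2 NA) < q"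
  "j \<le> 100 ==> j < q" "4 * c1 < q" "2 * c1 < q" "2 * c2 < q" "2 * c3 < q" "c2 < q" "c3 < q" "h < length tms ==> h < q"
  "rt < q" "rt + 1 < q" "Suc rt < q" "rt + 2 < q" "Suc (Suc rt) < q" "rt + 3 < q" "Suc (Suc (Suc rt)) < q"  "a < NA ==> a < q" "mdc < q"
  using NA floorlog_le_self[of NA] rt c by (auto intro!: q_const simp: Qc_def mdc_def)

definition par :: "(nat => nat) => bool" where
  "par sg \<longleftrightarrow> sg 0 = n \<and> sg 3 = k \<and> sg 4 = k * k \<and> sg 5 = g \<and> sg 6 = g * g \<and> sg 7 = r \<and> sg 9 = 2 ^ w \<and> sg 10 = g * k"

lemmas hrules = hsure_Seq hsure_assign hsure_aload hsure_astore hsure_aread hsure_awrite hsure_ife hsure_Skip sb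

lemma hsure_assign':
  "bnd (2 ^ W) sg e ==> nv sg e = v ==> x < 64 ==> Q (ecost e + 1) (sg(x := v)) al z ==> hsure W inp (assign x e) sg al z Q"
  using hsure_assign[of W sg e x Q al z inp] by simp

lemma hsure_params:
  assumes "sg 0 = n"
  shows "hsure W inp params sg al z (%t sg' al' z'. t \<le> 30 * n + 100 \<and> par sg' \<and> al' = al \<and> z' = z)"
proof -
  let ?Inv = "%(i::nat) T (sg'::nat => nat) al' z'. T \<le> 30 * i \<and> sg' 0 = n \<and> sg' 1 = min i lg \<and> sg' 2 = 2 ^ min i lg \<and> al' = al \<and> z' = z"
  let ?P = "%t sg' al' z'. t \<le> 30 * n + 6 \<and> sg' 0 = n \<and> sg' 1 = lg \<and> al' = al \<and> z' = z"
  have loop: "hsure W inp (For 12 0 (ife (B Lt (V 0) (V 2)) Skip (assign 1 (eplus (V 1) (C 1)) ;; assign 2 (eplus (V 2) (V 2)))))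
      (sg(1 := 0, 2 := 1)) al z ?P"
  proof (rule hsure_For[where Inv="?Inv" and n=n])
    fix i T sg' al' z' assume i: "i < n" "?Inv i T sg' al' z'" "sg' 12 = i" "sg' 0 = n"
    have mp: "(2::nat) ^ min i lg \<le> 2 ^ lg" by simp
    have mq: "2 ^ min i lg < q" "min i lg < q" using le_less_trans[OF mp q_facts(14)] q_facts(10) by simp_all
    have "2 ^ min i lg \<le> n \<longleftrightarrow> min i lg < lg" by (simp add: pow_le_floorlog lg_def)
    then show "hsure W inp (ife (B Lt (V 0) (V 2)) Skip (assign 1 (eplus (V 1) (C 1)) ;; assign 2 (eplus (V 2) (V 2)))) sg' al' z'
       (%t sg'' al'' z''. sg'' 12 = i \<and> sg'' 0 = n \<and> ?Inv (Suc i) (T + t + 8) (sg''(12 := Suc i)) al'' z'')"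
      using i mq q_facts(1) q2
      by (intro hrules) (auto simp: min_def not_less split: if_splits)
  next
    fix T sg' al' z' assume "?Inv n T sg' al' z'"
    moreover have "min n lg = lg" using floorlog_le_self[of n] by (simp add: lg_def)
    ultimately show "?P (T + 6) sg' al' z'" by simp
  qed (use assms one_lt_W qW[OF q_facts(1)] in auto)
  have s1: "bnd (2 ^ W) sg' (B Shl (C 1) (V 2))" if "sg' 2 = lg div D" for sg'
    using that qW[OF q_facts(2)] qW[OF q_facts(15)] one_lt_W by (simp add: k_def)
  have s2: "bnd (2 ^ W) sg' (B Shl (C 1) (V 8))" if "sg' 8 = w" for sg'
    using that qW[OF q_facts(16)] qW[OF q_facts(7)] one_lt_W by simp
  show ?thesis unfolding params_def
    apply (rule hsure_Seq, rule hsure_assign'[where v=0], rule sb, simp add: q_consts, simp, simp, simp)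
    apply (rule hsure_Seq, rule hsure_assign'[where v=1], rule sb, simp add: q_consts, simp, simp, simp)
    apply (rule hsure_Seq, rule hsure_mono, rule loop)
    apply (elim conjE)
    apply (rule hsure_Seq, rule hsure_assign'[where v="lg div D"], rule sb, simp add: q_facts q_consts, simp, simp, simp)
    apply (rule hsure_Seq, rule hsure_assign'[where v=k], rule s1, simp, simp add: k_def, simp)
    apply (rule hsure_Seq, rule hsure_assign'[where v="k * k"], rule sb, simp add: q_facts q_consts, simp, simp, simp)
    apply (rule hsure_Seq, rule hsure_assign'[where v=g], rule sb, simp add: q_facts q_consts, simp, simp add: g_def, simp)
    apply (rule hsure_Seq, rule hsure_assign'[where v="g * g"], rule sb, simp add: q_facts q_consts, simp, simp, simp)
    apply (rule hsure_Seq, rule hsure_assign'[where v=r], rule sb, simp add: q_facts q_consts, simp, simp add: r_def, simp)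
    apply (rule hsure_Seq, rule hsure_assign'[where v=w], rule sb, simp add: q_facts q_consts, simp, simp add: w_eq, simp)
    apply (rule hsure_Seq, rule hsure_assign'[where v="2 ^ w"], rule s2, simp, simp, simp)
    apply (rule hsure_assign'[where v="g * k"], rule sb, simp add: q_facts q_consts, simp, simp, simp)
    apply (simp add: par_def)
    done
qed

end

lemma imem_cong: "sg' 19 = sg 19 ==> sg' 12 = sg 12 ==> sg' 11 = sg 11 ==> imem w sg' = imem w sg"
  by (simp add: imem_def fun_eq_iff)

lemma imem_buf: "sg 11 = 4 \<or> sg 11 = 5 ==> imem w sg (al(7 := f)) = imem w sg al"
  by (auto simp: imem_def fun_eq_iff)

context redn
begin

text \<open>Stamps bounded by the counter make its successor fresh. The bounds on arrays 4 and 5 say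
  that simulated cells hold words of \<open>w\<close> bits, whichever array they are read
  from.\<close>

definition IC :: "nat => (nat => nat => nat) => bool" where
  "IC ph al \<longleftrightarrow> (\<forall>i. al 6 i \<le> ph) \<and> (\<forall>i. al 4 i < 2 ^ w) \<and> (\<forall>i. al 5 i < 2 ^ w)"

lemma IC_buf [simp]: "IC ph (al(7 := f)) = IC ph al"
  by (simp add: IC_def)

lemma IC_imem: "IC ph al ==> sg 11 = 4 \<or> sg 11 = 5 ==> imem w sg al a < 2 ^ w"
  by (auto simp: imem_def IC_def)

lemma IC_frame:
  assumes "IC (sg 12) al" "frame w sg al al'" "sg 11 = 4 \<or> sg 11 = 5"
  shows "IC (sg 12) al'"
proof -
  have f: "\<And>g. g \<noteq> 6 ==> g \<noteq> sg 11 ==> al' g = al g" "\<And>i. al' 6 i = al 6 i \<or> al' 6 i = sg 12"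
    "\<And>i. al' (sg 11) i = al (sg 11) i \<or> al' (sg 11) i < 2 ^ w"
    using assms(2) unfolding frame_def by blast+
  have ic: "\<And>i. al 6 i \<le> sg 12" "\<And>i. al 4 i < 2 ^ w" "\<And>i. al 5 i < 2 ^ w" using assms(1) by (auto simp: IC_def)
  have "al' 6 i \<le> sg 12" for i using f(2)[of i] ic(1)[of i] by auto
  moreover have "al' 4 i < 2 ^ w" for i
    using f(1)[of 4] f(3)[of i] ic(2)[of i] assms(3) by (cases "sg 11 = 4") auto
  moreover have "al' 5 i < 2 ^ w" for i
    using f(1)[of 5] f(3)[of i] ic(3)[of i] assms(3) by (cases "sg 11 = 5") auto
  ultimately show ?thesis by (simp add: IC_def)
qed

lemma simuI:
  assumes "sg 9 = 2 ^ w" "sg 19 + 2 ^ w < q" "sg 12 < q" "sg 11 = 4 \<or> sg 11 = 5" "sg 25 = length inp" "length inp < q"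
    "\<And>i. i < length inp ==> al 7 i = inp ! i"
  shows "simu w W inp sg al"
proof
  have 8: "8 * x + 8 \<le> 2 ^ W" if "x < q" for x
  proof -
    have "8 * x + 8 \<le> 8 * q" using that by simp
    also have "\<dots> \<le> q * q" using q_consts(9)[of 8] by (intro mult_le_mono1) simp
    also have "\<dots> = q ^ 2" by (simp add: power2_eq_square)
    also have "\<dots> \<le> 2 ^ W" unfolding W_q using q2 by (intro power_increasing) auto
    finally show ?thesis .
  qed
  show "8 * (sg 19 + 2 ^ w) + 8 \<le> 2 ^ W" "8 * length inp + 8 \<le> 2 ^ W" using 8 assms by blast+
  show W: "2 ^ w < (2::nat) ^ W" using qW q_facts(7) by blast
  then show "w \<le> W" by (metis less_imp_le_nat nat_power_less_imp_less zero_less_numeral)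
qed (use assms qW in auto)

text \<open>Arrays 0 to 4, among them the memories after preprocessing in array 4, are constant
  while the copies are queried.\<close>

definition ka :: "(nat => nat => nat) => (nat => nat => nat) => bool" where
  "ka al al' \<longleftrightarrow> (\<forall>g<5. al' g = al g)"

lemma ka_refl [simp]: "ka al al" by (simp add: ka_def)
lemma ka_trans: "ka al al' ==> ka al' al'' ==> ka al al''" by (simp add: ka_def)
lemma ka_buf [simp]: "ka al (al(7 := f))" by (simp add: ka_def)

lemma ka_frame:
  assumes "frame w sg (al(7 := f)) al'" "sg 11 = 5"
  shows "ka al al'"
  unfolding ka_def
proof (intro allI impI)
  fix g :: nat assume "g < 5"
  then show "al' g = al g" using assms unfolding frame_def by auto
qed

definition SC :: "(nat => nat) => (nat => nat => nat) => bool" where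
  "SC sg al \<longleftrightarrow> par sg \<and> sg 11 = 5 \<and> sg 19 + 2 ^ w < q \<and> sg 12 < q \<and> IC (sg 12) al"

definition agr :: "nat => (nat => nat) => (nat => nat) => bool" where
  "agr u sg sg' \<longleftrightarrow> (\<forall>x<u. sg' x = sg x)"

lemma agr_refl [simp]: "agr u sg sg" by (simp add: agr_def)
lemma agr_trans: "agr u sg sg' ==> agr v sg' sg'' ==> u \<le> v ==> agr u sg sg''" by (simp add: agr_def)
lemma agr_upd [simp]: "u \<le> x ==> agr u sg (sg'(x := a)) = agr u sg sg'" by (auto simp: agr_def)

lemma SC_agr: "SC sg al ==> agr 20 sg sg' ==> IC (sg 12) al' ==> SC sg' al'"
  unfolding SC_def par_def agr_def by simp

lemma updc_pre:
  assumes "SC sg al" "sg 22 < k" "a < NA" "b < NA"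
  shows "hsure W inp (astore 7 (C 0) (etimes (C a) (V 4)) ;; astore 7 (C 1) (eplus (etimes (C b) (V 4)) (V 22)) ;; assign 25 (C 2)) sg al z
     (%t sg' al' z'. t \<le> 40 \<and> sg' = sg(25 := 2) \<and> z' = z \<and> al' = al(7 := (al 7)(0 := a * (k * k), 1 := b * (k * k) + sg 22)))"
  using assms q_facts q_consts less_trans[OF assms(2) q_facts(2)]
  unfolding SC_def par_def by (intro hrules) (auto simp: fun_eq_iff)

context
  fixes sg al a b
  assumes A: "SC sg al" "sg 22 < k" "a < NA" "b < NA"
begin

abbreviation "uin \<equiv> [a * (k * k), b * (k * k) + sg 22]"
abbreviation "alu \<equiv> al(7 := (al 7)(0 := a * (k * k), 1 := b * (k * k) + sg 22))"

lemma updc_simu: "simu w W uin (sg(25 := 2)) alu"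
proof (rule simuI)
  fix i assume "i < length uin"
  then have "i = 0 \<or> i = 1" by auto
  then show "alu 7 i = uin ! i" by auto
qed (use A q_consts(9)[of 2] in \<open>auto simp: SC_def par_def\<close>)

lemma updc_imem: "imem w (sg(25 := 2)) alu = imem w sg al"
  using A(1) by (subst imem_buf) (auto simp: SC_def intro!: fun_cong[OF imem_cong])

lemma updc_frame:
  assumes "frame w (sg(25 := 2)) alu al'"
  shows "IC (sg 12) al'" "ka al al'"
  using IC_frame[of "sg(25 := 2)" alu al'] ka_frame[of "sg(25 := 2)" al _ al'] assms A(1) by (auto simp: SC_def)

text \<open>\<open>bb\<close> is a time budget for the whole remaining session, and each call passes
  on what it leaves; 12 is the slowdown of the simulation. Only the total over a session is ever
  used, so amortised update times suffice.\<close>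

lemma hsure_updc:
  assumes stm: "stm w ((cupd, uin) # cs) (imem w sg al) bb"
  shows "hsure W inp (updc a b) sg al z (%t sg' al' z'. (\<exists>bb'. t + 12 * bb' \<le> 12 * bb + bd + 60 \<and> stm w cs (imem w sg al') bb') \<and>
     (\<exists>l. sg' = sg(25 := 2, 26 := l)) \<and> ka al al' \<and> IC (sg 12) al' \<and> z' = z)"
  unfolding updc_def
proof (rule hsure_assoc3, rule hsure_Seq, rule hsure_mono[OF updc_pre[OF A]], clarify)
  fix t :: nat assume t: "t \<le> 40"
  show "hsure W inp (call bd cupd) (sg(25 := 2)) alu z
       (%t' sg' al' z'. (\<exists>bb'. t + t' + 12 * bb' \<le> 12 * bb + bd + 60 \<and> stm w cs (imem w sg al') bb') \<and>
          (\<exists>l. sg' = sg(25 := 2, 26 := l)) \<and> ka al al' \<and> IC (sg 12) al' \<and> z' = z)"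
  proof (rule simu.hsure_call[OF updc_simu bd(2)])
    show "\<And>a'. imem w (sg(25 := 2)) alu a' < 2 ^ w"
      unfolding updc_imem using A(1) by (auto simp: SC_def intro: IC_imem)
    show "lossless_spmf (exec w uin cupd (ini (imem w (sg(25 := 2)) alu)))"
      unfolding updc_imem by (rule stm_Cons(1)[OF stm])
  next
    fix t1 s1 t' al' l
    assume s1: "(t1, s1) \<in> set_spmf (exec w uin cupd (ini (imem w (sg(25 := 2)) alu)))" "t' \<le> 12 * t1 + bd + 1"
      "mem s1 = imem w (sg(25 := 2)) al'" "frame w (sg(25 := 2)) alu al'"
    note s1' = s1(1)[unfolded updc_imem]
    have i: "imem w (sg(25 := 2)) al' = imem w sg al'" by (rule fun_cong[OF imem_cong]) auto
    have "stm w cs (imem w sg al') (bb - t1)" using stm_Cons(2)[OF stm s1'] s1(3) i by simp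
    moreover have "t + t' + 12 * (bb - t1) \<le> 12 * bb + bd + 60"
      using stm_Cons(3)[OF stm s1'] s1(2) t by simp
    ultimately show "(\<exists>bb'. t + t' + 12 * bb' \<le> 12 * bb + bd + 60 \<and> stm w cs (imem w sg al') bb') \<and>
        (\<exists>la. (sg(25 := 2))(26 := l) = sg(25 := 2, 26 := la)) \<and> ka al al' \<and> IC (sg 12) al' \<and> z = z"
      using updc_frame[OF s1(4)] by blast
  qed
qed

text \<open>The remaining error probability is averaged over the random choices of this update;
  \<open>Aa\<close> collects the factors of the other copies.\<close>

lemma hew_updc:
  assumes cs: "cs \<noteq> []"
    and f: "\<And>l al'. ka al al' ==> IC (sg 12) al' ==>
       f (sg(25 := 2, 26 := l)) al' z \<le> Aa * (1 + serr w cs a0 (imem w sg al'))"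
  shows "hew W inp (updc a b) sg al z f (Aa * (1 + serr w ((cupd, uin) # cs) a0 (imem w sg al)))"
  unfolding updc_def
proof (rule hew_assoc3, rule hew_Seq_det, rule hsure_mono[OF updc_pre[OF A]], clarify)
  show "hew W inp (call bd cupd) (sg(25 := 2)) alu z f (Aa * (1 + serr w ((cupd, uin) # cs) a0 (imem w sg al)))"
  proof (rule simu.hew_call[OF updc_simu bd(2), where g="%s. Aa * (1 + serr w cs a0 (mem s))"])
    show "\<And>a'. imem w (sg(25 := 2)) alu a' < 2 ^ w"
      unfolding updc_imem using A(1) by (auto simp: SC_def intro: IC_imem)
    show "Ex (exec w uin cupd (ini (imem w (sg(25 := 2)) alu))) (%r. Aa * (1 + serr w cs a0 (mem (snd r))))
       \<le> Aa * (1 + serr w ((cupd, uin) # cs) a0 (imem w sg al))"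
      unfolding updc_imem serr_Cons[OF cs] by (rule Ex_affine)
  next
    fix s1 al' l
    assume s1: "mem s1 = imem w (sg(25 := 2)) al'" "frame w (sg(25 := 2)) alu al'"
    have i: "imem w (sg(25 := 2)) al' = imem w sg al'" by (rule fun_cong[OF imem_cong]) auto
    show "f ((sg(25 := 2))(26 := l)) al' z \<le> Aa * (1 + serr w cs a0 (mem s1))"
      unfolding s1(1) i by (rule f) (use updc_frame[OF s1(2)] in auto)
  qed
qed

end

lemma mdc_iff: "(of_bool P = mdc) = (P = md)"
  by (auto simp: mdc_def)

lemma hsure_opt:
  assumes A: "SC sg al" "sg 22 < k" "a < NA" "b < NA" and x: "sg x = of_bool P" "x < 64"
    and stm: "stm w ((if P = md then [(cupd, [a * (k * k), b * (k * k) + sg 22])] else []) @ cs) (imem w sg al) bb"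
  shows "hsure W inp (ife (B Eq (V x) (C mdc)) (updc a b) Skip) sg al z
    (%t sg' al' z'. (\<exists>bb'. t + 12 * bb' \<le> 12 * bb + bd + 70 \<and> stm w cs (imem w sg al') bb') \<and>
     (\<forall>y. y \<noteq> 25 --> y \<noteq> 26 --> sg' y = sg y) \<and> ka al al' \<and> IC (sg 12) al' \<and> z' = z)"
proof (rule hsure_ife)
  show "bnd (2 ^ W) sg (B Eq (V x) (C mdc))"
    by (rule sb) (use x q_consts(9)[of 1] q_consts(9)[of 0] q_consts(25) in \<open>auto\<close>)
  assume "nv sg (B Eq (V x) (C mdc)) \<noteq> 0"
  then have "P = md" using x by (simp add: mdc_iff)
  then show "hsure W inp (updc a b) sg al z
     (%t sg' al' z'. (\<exists>bb'. t + ecost (B Eq (V x) (C mdc)) + 1 + 12 * bb' \<le> 12 * bb + bd + 70 \<and> stm w cs (imem w sg al') bb') \<and>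
     (\<forall>y. y \<noteq> 25 --> y \<noteq> 26 --> sg' y = sg y) \<and> ka al al' \<and> IC (sg 12) al' \<and> z' = z)"
  proof (intro hsure_mono[OF hsure_updc[OF A, of cs bb]])
    fix t sg' al' z'
    assume "(\<exists>bb'. t + 12 * bb' \<le> 12 * bb + bd + 60 \<and> stm w cs (imem w sg al') bb') \<and>
     (\<exists>l. sg' = sg(25 := 2, 26 := l)) \<and> ka al al' \<and> IC (sg 12) al' \<and> z' = z"
    then obtain bb' l where *: "t + 12 * bb' \<le> 12 * bb + bd + 60" "stm w cs (imem w sg al') bb'"
      "sg' = sg(25 := 2, 26 := l)" "ka al al'" "IC (sg 12) al'" "z' = z" by blast
    have "t + ecost (B Eq (V x) (C mdc)) + 1 + 12 * bb' \<le> 12 * bb + bd + 70" using *(1) by simp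
    then show "(\<exists>bb'. t + ecost (B Eq (V x) (C mdc)) + 1 + 12 * bb' \<le> 12 * bb + bd + 70 \<and> stm w cs (imem w sg al') bb') \<and>
     (\<forall>y. y \<noteq> 25 --> y \<noteq> 26 --> sg' y = sg y) \<and> ka al al' \<and> IC (sg 12) al' \<and> z' = z"
      using *(2-6) by auto
  qed (use stm in simp)
next
  assume "nv sg (B Eq (V x) (C mdc)) = 0"
  then have "P \<noteq> md" using x by (auto simp: mdc_iff)
  then show "hsure W inp Skip sg al z
     (%t sg' al' z'. (\<exists>bb'. t + ecost (B Eq (V x) (C mdc)) + 1 + 12 * bb' \<le> 12 * bb + bd + 70 \<and> stm w cs (imem w sg al') bb') \<and>
     (\<forall>y. y \<noteq> 25 --> y \<noteq> 26 --> sg' y = sg y) \<and> ka al al' \<and> IC (sg 12) al' \<and> z' = z)"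
    using stm A by (intro hsure_Skip) (auto simp: SC_def intro!: exI[of _ bb])
qed

lemma hew_opt:
  assumes A: "SC sg al" "sg 22 < k" "a < NA" "b < NA" and x: "sg x = of_bool P" "x < 64"
    and cs: "cs \<noteq> []"
    and f: "\<And>sg' al'. (\<forall>y. y \<noteq> 25 --> y \<noteq> 26 --> sg' y = sg y) ==> ka al al' ==> IC (sg 12) al' ==>
       f sg' al' z \<le> Aa * (1 + serr w cs a0 (imem w sg al'))"
  shows "hew W inp (ife (B Eq (V x) (C mdc)) (updc a b) Skip) sg al z f
    (Aa * (1 + serr w ((if P = md then [(cupd, [a * (k * k), b * (k * k) + sg 22])] else []) @ cs) a0 (imem w sg al)))"
proof (rule hew_ife)
  show "bnd (2 ^ W) sg (B Eq (V x) (C mdc))"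
    by (rule sb) (use x q_consts(9)[of 1] q_consts(9)[of 0] q_consts(25) in \<open>auto\<close>)
  assume "nv sg (B Eq (V x) (C mdc)) \<noteq> 0"
  then have "P = md" using x by (simp add: mdc_iff)
  then show "hew W inp (updc a b) sg al z f (Aa * (1 + serr w ((if P = md then [(cupd, [a * (k * k), b * (k * k) + sg 22])] else []) @ cs) a0 (imem w sg al)))"
    by simp (rule hew_updc[OF A cs], rule f, auto)
next
  assume "nv sg (B Eq (V x) (C mdc)) = 0"
  then have "P \<noteq> md" using x by (auto simp: mdc_iff)
  then show "hew W inp Skip sg al z f (Aa * (1 + serr w ((if P = md then [(cupd, [a * (k * k), b * (k * k) + sg 22])] else []) @ cs) a0 (imem w sg al)))"
    using A(1) by (intro hew_sure[OF hsure_Skip[where Q="%t sg' al' z'. sg' = sg \<and> al' = al \<and> z' = z"]]) (auto simp: SC_def intro: f)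
qed

definition RV :: "(nat => nat => nat) => bool" where
  "RV al \<longleftrightarrow> (\<forall>i. al 1 i \<le> 1 \<and> al 2 i \<le> 1 \<and> al 3 i \<le> 1)"

lemma RV_ka: "RV al ==> ka al al' ==> RV al'"
  by (simp add: RV_def ka_def)

definition Uf :: "(nat => nat) => (nat => nat => nat) => nat => bool" where
  "Uf sg al i \<longleftrightarrow> al 3 (sg 15 * k + i) = 0"
definition Vf :: "(nat => nat) => (nat => nat => nat) => nat => bool" where
  "Vf sg al i \<longleftrightarrow> 0 < al 2 (sg 16 * k + i)"

lemma UV_cong: "agr 20 sg sg' ==> ka al al' ==> Uf sg' al' = Uf sg al" "agr 20 sg sg' ==> ka al al' ==> Vf sg' al' = Vf sg al"
  by (auto simp: Uf_def Vf_def fun_eq_iff ka_def agr_def)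

context
  fixes sg :: "nat => nat" and al i
  assumes S: "SC sg al" "RV al" "sg 22 = i" "i < k" "sg 15 < g" "sg 16 < g" "sg 20 \<le> i" "sg 21 \<le> i"
begin

abbreviation "sgs \<equiv> sg(23 := of_bool (Uf sg al i), 24 := of_bool (Vf sg al i), 20 := sg 20 + of_bool (Uf sg al i), 21 := sg 21 + of_bool (Vf sg al i))"

lemma stepc_pre:
  "hsure W inp (aload 23 3 (eplus (etimes (V 15) (V 3)) (V 22)) ;; assign 23 (B Eq (V 23) (C 0)) ;;
     aload 24 2 (eplus (etimes (V 16) (V 3)) (V 22)) ;; assign 24 (B Lt (C 0) (V 24)) ;;
     assign 20 (eplus (V 20) (V 23)) ;; assign 21 (eplus (V 21) (V 24))) sg al z
     (%t sg' al' z'. t \<le> 80 \<and> sg' = sgs \<and> al' = al \<and> z' = z)"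
proof -
  have q: "i < q" "sg 15 < q" "sg 16 < q" "sg 20 < q" "sg 21 < q"
    using S q_facts(2,4) by linarith+
  have v: "al 3 j < q" "al 2 j < q" for j
    using S(2) q2 by (auto simp: RV_def intro: le_less_trans)
  show ?thesis
    using S q v q_facts q_consts(9) unfolding SC_def par_def
    by (intro hrules) (auto simp: Uf_def Vf_def fun_eq_iff)
qed

lemma stepc_rest: "rest k (Uf sg al) (Vf sg al) i =
   (if Uf sg al i = md then [(cupd, [0 * (k * k), 1 * (k * k) + sgs 22])] else []) @
   (if Vf sg al i = md then [(cupd, [ta * (k * k), 2 * (k * k) + sgs 22])] else []) @ rest k (Uf sg al) (Vf sg al) (Suc i)"
  using S by (simp add: rest_step upd1_def upd2_def)

lemma SC_s: "SC sgs al" by (rule SC_agr[OF S(1)]) (use S(1) in \<open>auto simp: SC_def\<close>)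

lemma imem_s: "imem w sgs = imem w sg" by (rule imem_cong) auto

lemma hsure_stepc:
  assumes stm: "stm w (rest k (Uf sg al) (Vf sg al) i) (imem w sg al) bb"
  shows "hsure W inp stepc sg al z (%t sg' al' z'.
     (\<exists>bb'. t + 12 * bb' \<le> 12 * bb + 2 * bd + 300 \<and> stm w (rest k (Uf sg al) (Vf sg al) (Suc i)) (imem w sg al') bb') \<and>
     sg' 20 = sg 20 + of_bool (Uf sg al i) \<and> sg' 21 = sg 21 + of_bool (Vf sg al i) \<and> sg' 22 = i \<and> agr 20 sg sg' \<and>
     ka al al' \<and> IC (sg 12) al' \<and> z' = z)"
  unfolding stepc_def
proof (rule hsure_assoc6, rule hsure_Seq, rule hsure_mono[OF stepc_pre], clarify, rule hsure_Seq)
  fix t :: nat assume t: "t \<le> 80"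
  let ?cs = "(if Vf sg al i = md then [(cupd, [ta * (k * k), 2 * (k * k) + sgs 22])] else []) @ rest k (Uf sg al) (Vf sg al) (Suc i)"
  let ?Q = "%t sg' al' z'. (\<exists>bb'. t + 12 * bb' \<le> 12 * bb + bd + 70 \<and> stm w ?cs (imem w sgs al') bb') \<and>
     (\<forall>y. y \<noteq> 25 --> y \<noteq> 26 --> sg' y = sgs y) \<and> ka al al' \<and> IC (sgs 12) al' \<and> z' = z"
  have 1: "hsure W inp (ife (B Eq (V 23) (C mdc)) (updc 0 1) Skip) sgs al z ?Q"
    by (rule hsure_opt[where P="Uf sg al i"]) (use SC_s S NA stm in \<open>auto simp: stepc_rest imem_s\<close>)
  show "hsure W inp (ife (B Eq (V 23) (C mdc)) (updc 0 1) Skip) sgs al z (%t' sg' al' z'.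
     hsure W inp (ife (B Eq (V 24) (C mdc)) (updc ta 2) Skip) sg' al' z' (%t'' sg' al' z'.
     (\<exists>bb'. t + (t' + t'') + 12 * bb' \<le> 12 * bb + 2 * bd + 300 \<and> stm w (rest k (Uf sg al) (Vf sg al) (Suc i)) (imem w sg al') bb') \<and>
     sg' 20 = sg 20 + of_bool (Uf sg al i) \<and> sg' 21 = sg 21 + of_bool (Vf sg al i) \<and> sg' 22 = i \<and> agr 20 sg sg' \<and>
     ka al al' \<and> IC (sg 12) al' \<and> z' = z))"
  proof (rule hsure_mono[OF 1], elim conjE exE)
    fix t' sg' al' z' bb'
    assume p: "t' + 12 * bb' \<le> 12 * bb + bd + 70" "stm w ?cs (imem w sgs al') bb'"
      "\<forall>y. y \<noteq> 25 --> y \<noteq> 26 --> sg' y = sgs y" "ka al al'" "IC (sgs 12) al'" "z' = z"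
    have i: "imem w sg' = imem w sg" by (rule imem_cong) (use p(3) in auto)
    have s: "SC sg' al'" by (rule SC_agr[OF S(1)]) (use p(3,5) in \<open>auto simp: agr_def\<close>)
    have e: "sg' 22 = i" "sg' 24 = of_bool (Vf sg al i)" "sg' 12 = sg 12" "sgs 22 = sg' 22" using p(3) S by auto
    have st: "stm w ((if Vf sg al i = md then [(cupd, [ta * (k * k), 2 * (k * k) + sg' 22])] else []) @ rest k (Uf sg al) (Vf sg al) (Suc i)) (imem w sg' al') bb'"
      using p(2) unfolding i imem_s e(4) .
    have "hsure W inp (ife (B Eq (V 24) (C mdc)) (updc ta 2) Skip) sg' al' z
      (%t sg'' al'' z'. (\<exists>bb''. t + 12 * bb'' \<le> 12 * bb' + bd + 70 \<and> stm w (rest k (Uf sg al) (Vf sg al) (Suc i)) (imem w sg' al'') bb'') \<and>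
       (\<forall>y. y \<noteq> 25 --> y \<noteq> 26 --> sg'' y = sg' y) \<and> ka al' al'' \<and> IC (sg' 12) al'' \<and> z' = z)"
      by (rule hsure_opt[where P="Vf sg al i", OF s _ _ _ _ _ st]) (use e S NA in auto)
    then show "hsure W inp (ife (B Eq (V 24) (C mdc)) (updc ta 2) Skip) sg' al' z' (%t'' sg' al' z'.
     (\<exists>bb'. t + (t' + t'') + 12 * bb' \<le> 12 * bb + 2 * bd + 300 \<and> stm w (rest k (Uf sg al) (Vf sg al) (Suc i)) (imem w sg al') bb') \<and>
     sg' 20 = sg 20 + of_bool (Uf sg al i) \<and> sg' 21 = sg 21 + of_bool (Vf sg al i) \<and> sg' 22 = i \<and> agr 20 sg sg' \<and>
     ka al al' \<and> IC (sg 12) al' \<and> z' = z)"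
      unfolding p(6) e(3) i
    proof (rule hsure_mono, elim conjE exE)
      fix t'' sg'' al'' z'' bb''
      assume p': "t'' + 12 * bb'' \<le> 12 * bb' + bd + 70" "stm w (rest k (Uf sg al) (Vf sg al) (Suc i)) (imem w sg al'') bb''"
         "\<forall>y. y \<noteq> 25 --> y \<noteq> 26 --> sg'' y = sg' y" "ka al' al''" "IC (sg 12) al''" "z'' = z"
      have "t + (t' + t'') + 12 * bb'' \<le> 12 * bb + 2 * bd + 300" using p(1) p'(1) t by linarith
      moreover have "ka al al''" using p(4) p'(4) by (rule ka_trans)
      moreover have "sg'' 20 = sg 20 + of_bool (Uf sg al i) \<and> sg'' 21 = sg 21 + of_bool (Vf sg al i) \<and> sg'' 22 = i \<and> agr 20 sg sg''"
        using p(3) p'(3) S(3) by (simp add: agr_def)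
      ultimately show "(\<exists>bb'. t + (t' + t'') + 12 * bb' \<le> 12 * bb + 2 * bd + 300 \<and> stm w (rest k (Uf sg al) (Vf sg al) (Suc i)) (imem w sg al'') bb') \<and>
        sg'' 20 = sg 20 + of_bool (Uf sg al i) \<and> sg'' 21 = sg 21 + of_bool (Vf sg al i) \<and> sg'' 22 = i \<and> agr 20 sg sg'' \<and>
        ka al al'' \<and> IC (sg 12) al'' \<and> z'' = z"
        using p'(2,5,6) by blast
    qed
  qed
qed

lemma hew_stepc:
  assumes stm: "stm w (rest k (Uf sg al) (Vf sg al) i) (imem w sg al) bb"
    and f: "\<And>sg' al'. agr 20 sg sg' ==> ka al al' ==>
       f sg' al' z \<le> Aa * (1 + serr w (rest k (Uf sg al) (Vf sg al) (Suc i)) a0 (imem w sg al'))"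
  shows "hew W inp stepc sg al z f (Aa * (1 + serr w (rest k (Uf sg al) (Vf sg al) i) a0 (imem w sg al)))"
  unfolding stepc_def
proof (rule hew_assoc6, rule hew_Seq_det, rule hsure_mono[OF stepc_pre], clarify)
  let ?cs = "(if Vf sg al i = md then [(cupd, [ta * (k * k), 2 * (k * k) + sgs 22])] else []) @ rest k (Uf sg al) (Vf sg al) (Suc i)"
  let ?Q = "%t sg' al' z'. (\<exists>bb'. t + 12 * bb' \<le> 12 * bb + bd + 70 \<and> stm w ?cs (imem w sgs al') bb') \<and>
     (\<forall>y. y \<noteq> 25 --> y \<noteq> 26 --> sg' y = sgs y) \<and> ka al al' \<and> IC (sgs 12) al' \<and> z' = z"
  have 1: "hsure W inp (ife (B Eq (V 23) (C mdc)) (updc 0 1) Skip) sgs al z ?Q"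
    by (rule hsure_opt[where P="Uf sg al i"]) (use SC_s S NA stm in \<open>auto simp: stepc_rest imem_s\<close>)
  show "hew W inp (ife (B Eq (V 23) (C mdc)) (updc 0 1) Skip ;; ife (B Eq (V 24) (C mdc)) (updc ta 2) Skip) sgs al z f
     (Aa * (1 + serr w (rest k (Uf sg al) (Vf sg al) i) a0 (imem w sg al)))"
  proof (rule hew_Seq[OF 1, where g="%sg' al' z'. Aa * (1 + serr w ?cs a0 (imem w sg al'))"], elim conjE exE)
    fix t' sg' al' z' bb'
    assume p: "stm w ?cs (imem w sgs al') bb'"
      "\<forall>y. y \<noteq> 25 --> y \<noteq> 26 --> sg' y = sgs y" "ka al al'" "IC (sgs 12) al'" "z' = z"
    have i: "imem w sg' = imem w sg" by (rule imem_cong) (use p(2) in auto)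
    have s: "SC sg' al'" by (rule SC_agr[OF S(1)]) (use p(2,4) in \<open>auto simp: agr_def\<close>)
    have e: "sg' 22 = i" "sg' 24 = of_bool (Vf sg al i)" "sgs 22 = sg' 22" using p(2) S by auto
    have "hew W inp (ife (B Eq (V 24) (C mdc)) (updc ta 2) Skip) sg' al' z f
      (Aa * (1 + serr w ((if Vf sg al i = md then [(cupd, [ta * (k * k), 2 * (k * k) + sg' 22])] else []) @
         rest k (Uf sg al) (Vf sg al) (Suc i)) a0 (imem w sg' al')))"
    proof (rule hew_opt[where P="Vf sg al i"])
      fix sg'' al'' assume p': "\<forall>y. y \<noteq> 25 --> y \<noteq> 26 --> sg'' y = sg' y" "ka al' al''"
      have "agr 20 sg sg''" using p(2) p'(1) by (simp add: agr_def)
      then show "f sg'' al'' z \<le> Aa * (1 + serr w (rest k (Uf sg al) (Vf sg al) (Suc i)) a0 (imem w sg' al''))"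
        unfolding i using f ka_trans[OF p(3) p'(2)] by blast
    qed (use s e S NA in auto)
    then show "hew W inp (ife (B Eq (V 24) (C mdc)) (updc ta 2) Skip) sg' al' z' f (Aa * (1 + serr w ?cs a0 (imem w sg al')))"
      unfolding i p(5) e(3) .
  next
    have "hew W inp (ife (B Eq (V 23) (C mdc)) (updc 0 1) Skip) sgs al z (%sg' al' z'. Aa * (1 + serr w ?cs a0 (imem w sg al')))
       (Aa * (1 + serr w ((if Uf sg al i = md then [(cupd, [0 * (k * k), 1 * (k * k) + sgs 22])] else []) @ ?cs) a0 (imem w sgs al)))"
      by (rule hew_opt[where P="Uf sg al i"]) (use SC_s S NA in \<open>auto simp: imem_s\<close>)
    then show "hew W inp (ife (B Eq (V 23) (C mdc)) (updc 0 1) Skip) sgs al z (%sg' al' z'. Aa * (1 + serr w ?cs a0 (imem w sg al')))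
      (Aa * (1 + serr w (rest k (Uf sg al) (Vf sg al) i) a0 (imem w sg al)))"
      unfolding stepc_rest imem_s .
  qed
qed

end

end

subsection \<open>Running one copy\<close>

definition cnt :: "(nat => bool) => nat => nat" where
  "cnt P i = card {j. j < i \<and> P j}"

lemma cnt_0 [simp]: "cnt P 0 = 0" by (simp add: cnt_def)

lemma cnt_Suc: "cnt P (Suc i) = cnt P i + of_bool (P i)"
proof -
  have "{j. j < Suc i \<and> P j} = (if P i then insert i {j. j < i \<and> P j} else {j. j < i \<and> P j})"
    by (auto simp: less_Suc_eq)
  then show ?thesis by (simp add: cnt_def)
qed

lemma cnt_le: "cnt P i \<le> i"
  by (induction i) (auto simp: cnt_Suc)

context redn
begin

text \<open>The memory of copy \<open>idx\<close> after preprocessing. It depends on array 4 alone,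
  which the products never write.\<close>

definition bmem :: "(nat => nat => nat) => nat => nat => nat" where
  "bmem al idx a = (if a < 2 ^ w then al 4 (idx * 2 ^ w + a) else 0)"

definition CT :: nat where "CT = 12 * Bs k + k * (2 * bd + 400) + bd + 300"

context
  fixes sg :: "nat => nat" and al idx
  assumes P: "par sg" "sg 11 = 5" "sg 12 + 1 < q" "IC (sg 12) al" "RV al" "sg 14 < g * g" "sg 15 < g" "sg 16 < g"
    "sg 18 < r" "sg 17 \<le> sg 18" "idx = sg 14 * r + sg 18"
    and st: "stm w (rest k (Uf sg al) (Vf sg al) 0) (bmem al idx) (Bs k)"
begin

abbreviation "sgc \<equiv> sg(12 := Suc (sg 12), 19 := idx * 2 ^ w, 20 := 0, 21 := 0)"

lemma idx_lt: "idx < g * g * r"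
proof -
  have "sg 14 * r + sg 18 < sg 14 * r + r" using P by simp
  also have "\<dots> = (sg 14 + 1) * r" by simp
  also have "\<dots> \<le> g * g * r" using P by (intro mult_le_mono1) simp
  finally show ?thesis using P by simp
qed

lemma idx_q: "idx * 2 ^ w + 2 ^ w < q"
proof -
  have "idx * 2 ^ w + 2 ^ w \<le> g * g * r * 2 ^ w + 2 ^ w" using idx_lt by simp
  then show ?thesis using q_facts(12) by linarith
qed

lemma copy_pre:
  "hsure W inp (assign 12 (eplus (V 12) (C 1)) ;; assign 19 (etimes (eplus (etimes (V 14) (V 7)) (V 18)) (V 9)) ;;
     assign 20 (C 0) ;; assign 21 (C 0)) sg al z (%t sg' al' z'. t \<le> 30 \<and> sg' = sgc \<and> al' = al \<and> z' = z)"
proof -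
  have q: "sg 12 < q" "sg 14 < q" "sg 18 < q" "1 < q" "0 < q" using P q_facts(5,6) q2 by linarith+
  have p: "sg 7 = r" "sg 9 = 2 ^ w" using P(1) by (auto simp: par_def)
  show ?thesis
    using q p q_facts(6,7) P(11) by (intro hrules) auto
qed

lemma SC_c: "SC sgc al"
  using P idx_q unfolding SC_def par_def IC_def by (auto simp: le_Suc_eq)

lemma UVc: "Uf sgc al = Uf sg al" "Vf sgc al = Vf sg al"
  by (auto simp: Uf_def Vf_def fun_eq_iff)

text \<open>The new stamp exceeds all stamps present, so no cell carries it and every read falls
  back to array 4: this is the rollback.\<close>

lemma imem_c: "imem w sgc al = bmem al idx"
proof
  fix a
  have "al 6 i \<noteq> Suc (sg 12)" for i using P(4) unfolding IC_def by (metis Suc_n_not_le_n)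
  then show "imem w sgc al a = bmem al idx a" by (simp add: imem_def bmem_def)
qed

abbreviation "R0 i \<equiv> rest k (Uf sg al) (Vf sg al) i"

text \<open>\<open>T\<close> plus 12 times the remaining budget grows only by the overhead of the
  rounds. Registers 20 and 21 count the rows and columns chosen so far, for the later comparison
  with a path count.\<close>

definition LI :: "nat => nat => (nat => nat) => (nat => nat => nat) => bool" where
  "LI i T sg' al' \<longleftrightarrow> (\<exists>bb. T + 12 * bb \<le> 12 * Bs k + i * (2 * bd + 310) \<and> stm w (R0 i) (imem w sgc al') bb) \<and>
     sg' 20 = cnt (Uf sg al) i \<and> sg' 21 = cnt (Vf sg al) i \<and> agr 20 sgc sg' \<and> ka al al' \<and> IC (sg 12 + 1) al'"

lemma LI_step:
  assumes "i < k" "LI i T sg' al'" "sg' 22 = i" "z' = z"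
  shows "hsure W inp stepc sg' al' z' (%t sg'' al'' z''. sg'' 22 = i \<and> sg'' 3 = k \<and> LI (Suc i) (T + t + 8) (sg''(22 := Suc i)) al'' \<and> z'' = z)"
    and "hew W inp stepc sg' al' z' (%sg'' al'' z''. Aa * (1 + serr w (R0 (Suc i)) a0 (imem w sgc al'')))
       (Aa * (1 + serr w (R0 i) a0 (imem w sgc al')))"
proof -
  from assms(2) obtain bb where L: "T + 12 * bb \<le> 12 * Bs k + i * (2 * bd + 310)" "stm w (R0 i) (imem w sgc al') bb"
     "sg' 20 = cnt (Uf sg al) i" "sg' 21 = cnt (Vf sg al) i" "agr 20 sgc sg'" "ka al al'" "IC (sg 12 + 1) al'"
    unfolding LI_def by blast
  have im: "imem w sg' = imem w sgc" by (rule imem_cong) (use L(5) in \<open>auto simp: agr_def\<close>)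
  have UV: "Uf sg' al' = Uf sg al" "Vf sg' al' = Vf sg al" using UV_cong[OF L(5,6)] UVc by auto
  have e: "sg' 15 = sg 15" "sg' 16 = sg 16" "sg' 12 = sg 12 + 1" using L(5) by (auto simp: agr_def)
  have s: "SC sg' al'" by (rule SC_agr[OF SC_c L(5)]) (use L(7) in simp)
  have pre: "SC sg' al'" "RV al'" "sg' 22 = i" "i < k" "sg' 15 < g" "sg' 16 < g" "sg' 20 \<le> i" "sg' 21 \<le> i"
    using s RV_ka[OF P(5) L(6)] assms(1,3) e P L(3,4) by (simp_all add: cnt_le)
  note st' = L(2)[folded im UV]
  show "hsure W inp stepc sg' al' z' (%t sg'' al'' z''. sg'' 22 = i \<and> sg'' 3 = k \<and> LI (Suc i) (T + t + 8) (sg''(22 := Suc i)) al'' \<and> z'' = z)"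
  proof (rule hsure_mono[OF hsure_stepc[OF pre, of bb]], goal_cases)
    case 1 then show ?case using L(2) by (simp only: im UV)
  next
    case (2 t sg'' al'' z'')
    then obtain bb' where B: "t + 12 * bb' \<le> 12 * bb + 2 * bd + 300" "stm w (R0 (Suc i)) (imem w sgc al'') bb'"
       "sg'' 20 = sg' 20 + of_bool (Uf sg al i)" "sg'' 21 = sg' 21 + of_bool (Vf sg al i)" "sg'' 22 = i" "agr 20 sg' sg''"
       "ka al' al''" "IC (sg 12 + 1) al''" "z'' = z'"
      unfolding im UV e by blast
    have "(T + t + 8) + 12 * bb' \<le> 12 * Bs k + Suc i * (2 * bd + 310)" using B(1) L(1) by simp
    moreover have "agr 20 sgc sg''" by (rule agr_trans[OF L(5) B(6)]) simp
    moreover have "sg'' 3 = k" using calculation(2) P(1) by (simp add: agr_def par_def)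
    ultimately show ?case using B ka_trans[OF L(6) B(7)] L(3,4) assms(4)
      unfolding LI_def by (auto simp: cnt_Suc)
  qed
  have "hew W inp stepc sg' al' z' (%sg'' al'' z''. Aa * (1 + serr w (R0 (Suc i)) a0 (imem w sgc al'')))
       (Aa * (1 + serr w (rest k (Uf sg' al') (Vf sg' al') i) a0 (imem w sg' al')))"
    by (rule hew_stepc[OF pre, of bb]) (use L(2) in \<open>simp_all only: im UV order_refl\<close>)
  then show "hew W inp stepc sg' al' z' (%sg'' al'' z''. Aa * (1 + serr w (R0 (Suc i)) a0 (imem w sgc al'')))
       (Aa * (1 + serr w (R0 i) a0 (imem w sgc al')))" unfolding im UV .
qed

lemma LI_init: "LI 0 0 (sgc(22 := 0)) al"
  unfolding LI_def using st P(4) by (auto simp: imem_c IC_def le_Suc_eq intro!: exI[of _ "Bs k"])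

lemma c3: "sgc 3 = k" using P(1) by (simp add: par_def)

lemma copy_loop:
  "hsure W inp (For 22 3 stepc) sgc al z (%t sg' al' z'. LI k (t - 6) sg' al' \<and> z' = z)"
proof (rule hsure_For[where n=k and Inv="%i T sg' al' z'. LI i T sg' al' \<and> z' = z"])
  fix i T sg' al' z'
  assume "i < k" "LI i T sg' al' \<and> z' = z" "sg' 22 = i"
  then show "hsure W inp stepc sg' al' z' (%t sg'' al'' z''. sg'' 22 = i \<and> sg'' 3 = k \<and> LI (Suc i) (T + t + 8) (sg''(22 := Suc i)) al'' \<and> z'' = z)"
    using LI_step(1) by blast
qed (use LI_init c3 qW[OF q_facts(2)] one_lt_W in auto)

text \<open>The supermartingale is the error probability of the remaining calls, as a function of
  the current simulated memory.\<close>

lemma copy_loop_hew: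
  "hew W inp (For 22 3 stepc) sgc al z (%sg' al' z'. Aa * (1 + serr w (R0 k) a0 (imem w sgc al')))
     (Aa * (1 + serr w (R0 0) a0 (bmem al idx)))"
proof (rule hew_For[where n=k and Inv="%i sg' al' z'. (\<exists>T. LI i T sg' al') \<and> z' = z"
      and F="%i sg' al' z'. Aa * (1 + serr w (R0 i) a0 (imem w sgc al'))"])
  fix i sg' al' z'
  assume "i < k" "(\<exists>T. LI i T sg' al') \<and> z' = z" "sg' 22 = i"
  then obtain T where T: "i < k" "LI i T sg' al'" "sg' 22 = i" "z' = z" by blast
  show "hsure W inp stepc sg' al' z' (%t sg'' al'' z''. sg'' 22 = i \<and> sg'' 3 = k \<and> (\<exists>T. LI (Suc i) T (sg''(22 := Suc i)) al'') \<and> z'' = z)"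
    by (rule hsure_mono[OF LI_step(1)[OF T]]) blast
  show "hew W inp stepc sg' al' z' (%sg'' al'' z''. Aa * (1 + serr w (R0 (Suc i)) a0 (imem w sgc al'')))
       (Aa * (1 + serr w (R0 i) a0 (imem w sgc al')))" by (rule LI_step(2)[OF T])
qed (use LI_init c3 qW[OF q_facts(2)] one_lt_W in \<open>auto simp: imem_c\<close>)

definition QI :: "(nat => nat) => (nat => nat => nat) => bool" where
  "QI sg' al' \<longleftrightarrow> sg' 20 = cnt (Uf sg al) k \<and> sg' 21 = cnt (Vf sg al) k \<and> agr 20 sgc sg' \<and> ka al al' \<and> IC (sg 12 + 1) al'"

text \<open>The outer test against 0 negates the inner comparison: the vote is 1 when the two sides
  differ.\<close>

lemma Qc_last:
  assumes "QI sg' al'" "sg' 26 < q"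
  shows "hsure W inp (assign 17 (eplus (V 17) (B Eq (B Eq lexp rexp) (C 0)))) sg' al' z
    (%t sg'' al'' z''. t \<le> 100 \<and> sg'' = sg'(17 := sg 17 + of_bool (sg' 26 + lhs k (cnt (Uf sg al) k) (cnt (Vf sg al) k)
       \<noteq> rhs k (cnt (Uf sg al) k) (cnt (Vf sg al) k))) \<and> al'' = al' \<and> z'' = z)"
proof -
  have q: "sg' 17 < q" "sg' 3 < q" "sg' 4 < q" "sg' 20 < q" "sg' 21 < q"
    "sg' 17 = sg 17" "sg' 3 = k" "sg' 4 = k * k" "sg' 20 = cnt (Uf sg al) k" "sg' 21 = cnt (Vf sg al) k"
    using assms(1) P q_facts(2,3,6) cnt_le[of "Uf sg al" k] cnt_le[of "Vf sg al" k] unfolding QI_def agr_def par_def by auto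
  have l: "nv sg' lexp = sg' 26 + lhs k (cnt (Uf sg al) k) (cnt (Vf sg al) k)"
    "nv sg' rexp = rhs k (cnt (Uf sg al) k) (cnt (Vf sg al) k)"
    by (simp_all add: lexp_def rexp_def q(6-) lhs_def rhs_def)
  have s: "small q sg' lexp" "small q sg' rexp" "deg lexp \<le> 10" "deg rexp \<le> 10" "ecost lexp \<le> 30" "ecost rexp \<le> 30"
    using q(1-5) assms(2) q_consts by (auto simp: lexp_def rexp_def)
  show ?thesis
    by (intro hrules) (use s q(1,6) l q_consts(9)[of 0] in auto)
qed

lemma query_step:
  assumes "LI k T sg' al'"
  shows "hsure W inp (call bd cqry) (sg'(25 := 0, 26 := 0)) al' z (%t sg'' al'' z''.
      T + t \<le> 12 * Bs k + k * (2 * bd + 310) + bd + 1 \<and> QI sg'' al'' \<and> sg'' 26 < q \<and> z'' = z)"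
    and "(\<And>sg'' al''. QI sg'' al'' ==> f sg'' al'' z \<le> Aa * (1 + of_bool (sg'' 26 \<noteq> a0))) ==>
      hew W inp (call bd cqry) (sg'(25 := 0, 26 := 0)) al' z f (Aa * (1 + serr w (R0 k) a0 (imem w sgc al')))"
proof -
  from assms obtain bb where L: "T + 12 * bb \<le> 12 * Bs k + k * (2 * bd + 310)" "stm w (R0 k) (imem w sgc al') bb"
     "sg' 20 = cnt (Uf sg al) k" "sg' 21 = cnt (Vf sg al) k" "agr 20 sgc sg'" "ka al al'" "IC (sg 12 + 1) al'"
    unfolding LI_def by blast
  let ?sg = "sg'(25 := 0, 26 := 0)"
  have im: "imem w ?sg = imem w sgc" by (rule imem_cong) (use L(5) in \<open>auto simp: agr_def\<close>)
  have e: "?sg 11 = 5" "?sg 12 = sg 12 + 1" "?sg 9 = 2 ^ w" "?sg 19 = idx * 2 ^ w"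
    using L(5) P(1,2) by (auto simp: agr_def par_def)
  have sm: "simu w W [] ?sg al'"
    by (rule simuI) (use e P idx_q q2 in auto)
  have ib: "\<And>a. imem w ?sg al' a < 2 ^ w" by (rule IC_imem[OF L(7)]) (use e in auto)
  have post: "QI (?sg(26 := l)) al''" if "frame w ?sg al' al''" for l al''
  proof -
    have "IC (?sg 12) al''" by (rule IC_frame[OF _ that]) (use L(7) e in auto)
    moreover have "ka al' al''" using that e(1) unfolding frame_def ka_def by auto
    ultimately show ?thesis using L e ka_trans[OF L(6)] unfolding QI_def by auto
  qed
  show "hsure W inp (call bd cqry) ?sg al' z (%t sg'' al'' z''.
      T + t \<le> 12 * Bs k + k * (2 * bd + 310) + bd + 1 \<and> QI sg'' al'' \<and> sg'' 26 < q \<and> z'' = z)"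
  proof (rule simu.hsure_call[OF sm bd(3) ib])
    have s2: "stm w [(cqry, [])] (imem w ?sg al') bb" using L(2) by (simp only: rest_end im)
    then show "lossless_spmf (exec w [] cqry (ini (imem w ?sg al')))" by (rule stm_Cons(1))
    fix t1 s1 t al'' l
    assume a: "(t1, s1) \<in> set_spmf (exec w [] cqry (ini (imem w ?sg al')))" "t \<le> 12 * t1 + bd + 1"
       "frame w ?sg al' al''" "l = ?sg 26 \<or> l < 2 ^ w"
    have "t1 \<le> bb" by (rule stm_Cons(3)[OF s2 a(1)])
    then have "T + t \<le> 12 * Bs k + k * (2 * bd + 310) + bd + 1" using a(2) L(1) by simp
    moreover have "l < q" using a(4) q_facts(7) q2 by auto
    ultimately show "T + t \<le> 12 * Bs k + k * (2 * bd + 310) + bd + 1 \<and> QI (?sg(26 := l)) al'' \<and> (?sg(26 := l)) 26 < q \<and> z = z"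
      using post[OF a(3), of l] by simp
  qed
  assume f: "\<And>sg'' al''. QI sg'' al'' ==> f sg'' al'' z \<le> Aa * (1 + of_bool (sg'' 26 \<noteq> a0))"
  show "hew W inp (call bd cqry) ?sg al' z f (Aa * (1 + serr w (R0 k) a0 (imem w sgc al')))"
  proof (rule simu.hew_call[OF sm bd(3) ib, where g="%s. Aa * (1 + of_bool (out s \<noteq> [a0]))"])
    fix s1 al'' l assume a: "frame w ?sg al' al''" "out s1 \<noteq> [] ==> l = last (out s1)"
    have "f (?sg(26 := l)) al'' z \<le> Aa * (1 + of_bool ((?sg(26 := l)) 26 \<noteq> a0))" by (rule f[OF post[OF a(1)]])
    \<comment> \<open>If register 26 differs from the right answer, the output was not exactly that
      answer.\<close>
    also have "\<dots> \<le> Aa * (1 + of_bool (out s1 \<noteq> [a0]))"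
      using a(2) by (intro mult_left_mono add_left_mono) auto
    finally show "f (?sg(26 := l)) al'' z \<le> Aa * (1 + of_bool (out s1 \<noteq> [a0]))" .
  next
    show "Ex (exec w [] cqry (ini (imem w ?sg al'))) (%r. Aa * (1 + of_bool (out (snd r) \<noteq> [a0])))
       \<le> Aa * (1 + serr w (R0 k) a0 (imem w sgc al'))"
      unfolding rest_end serr_single im by (rule Ex_affine)
  qed
qed

definition CP :: "(nat => nat) => (nat => nat => nat) => bool" where
  "CP sg' al' \<longleftrightarrow> (\<forall>x<19. x \<noteq> 12 --> x \<noteq> 17 --> sg' x = sg x) \<and> sg' 12 = sg 12 + 1 \<and> (sg' 17 = sg 17 \<or> sg' 17 = sg 17 + 1) \<and> ka al al' \<and> IC (sg 12 + 1) al'"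

lemma QI_CP: "QI sg' al' ==> CP (sg'(17 := sg 17 + of_bool b)) al'"
  unfolding QI_def CP_def agr_def by auto

lemma clear2:
  "hsure W inp (assign 25 (C 0) ;; assign 26 (C 0)) sg' al' z (%t sg'' al'' z''. t = 4 \<and> sg'' = sg'(25 := 0, 26 := 0) \<and> al'' = al' \<and> z'' = z)"
  by (intro hrules) (use q2 in auto)

lemma hsure_copyc: "hsure W inp copyc sg al z (%t sg' al' z'. t \<le> CT \<and> CP sg' al' \<and> z' = z)"
  unfolding copyc_def
proof (rule hsure_assoc4, rule hsure_Seq, rule hsure_mono[OF copy_pre], clarify, rule hsure_Seq,
    rule hsure_mono[OF copy_loop], clarify, rule hsure_assoc2, rule hsure_Seq, rule hsure_mono[OF clear2], clarify,
    rule hsure_Seq, rule hsure_mono[OF query_step(1)], assumption, elim conjE)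
  fix t1 t2 t3 :: nat and sg1 al1 sg2 al2 z2
  assume a: "t1 \<le> 30" "t2 - 6 + t3 \<le> 12 * Bs k + k * (2 * bd + 310) + bd + 1" "QI sg2 al2" "sg2 26 < q" "z2 = z"
  show "hsure W inp (assign 17 (eplus (V 17) (B Eq (B Eq lexp rexp) (C 0)))) sg2 al2 z2
          (%t' sg' al' z'. t1 + (t2 + (4 + (t3 + t'))) \<le> CT \<and> CP sg' al' \<and> z' = z)"
  proof (subst a(5), rule hsure_mono[OF Qc_last[OF a(3,4)]], elim conjE)
    fix t4 :: nat and sg' al' z'
    assume b: "t4 \<le> 100" "sg' = sg2(17 := sg 17 + of_bool (sg2 26 + lhs k (cnt (Uf sg al) k) (cnt (Vf sg al) k)
       \<noteq> rhs k (cnt (Uf sg al) k) (cnt (Vf sg al) k)))" "al' = al2" "z' = z"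
    have "k * (2 * bd + 310) \<le> k * (2 * bd + 400)" by simp
    then have "t1 + (t2 + (4 + (t3 + t4))) \<le> CT" using a(1,2) b(1) unfolding CT_def by linarith
    then show "t1 + (t2 + (4 + (t3 + t4))) \<le> CT \<and> CP sg' al' \<and> z' = z" using QI_CP[OF a(3)] b by blast
  qed
qed

text \<open>A wrong vote doubles the weight \<open>Aa\<close> and a right one leaves it, so one copy
  multiplies the expected weight by at most 1 plus its error probability.\<close>

lemma hew_copyc:
  assumes f: "\<And>sg' al'. CP sg' al' ==> f sg' al' z \<le> (if sg' 17 = sg 17 + of_bool (a0 + lhs k (cnt (Uf sg al) k) (cnt (Vf sg al) k)
       \<noteq> rhs k (cnt (Uf sg al) k) (cnt (Vf sg al) k)) then Aa else Aa * 2)"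
  shows "hew W inp copyc sg al z f (Aa * (1 + serr w (R0 0) a0 (bmem al idx)))"
  unfolding copyc_def
proof (rule hew_assoc4, rule hew_Seq_det, rule hsure_mono[OF copy_pre], clarify, rule hew_Seq[OF copy_loop _ copy_loop_hew],
    clarify, rule hew_assoc2, rule hew_Seq_det, rule hsure_mono[OF clear2], clarify)
  fix t1 t2 sg1 al1 assume L: "LI k (t2 - 6) sg1 al1"
  show "hew W inp (call bd cqry ;; assign 17 (eplus (V 17) (B Eq (B Eq lexp rexp) (C 0)))) (sg1(25 := 0, 26 := 0)) al1 z f
     (Aa * (1 + serr w (R0 k) a0 (imem w sgc al1)))"
  proof (rule hew_Seq[OF query_step(1)[OF L] _ query_step(2)[OF L]], elim conjE)
    fix t sg2 al2 z2 assume a: "QI sg2 al2" "sg2 26 < q" "z2 = z"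
    show "hew W inp (assign 17 (eplus (V 17) (B Eq (B Eq lexp rexp) (C 0)))) sg2 al2 z2 f (Aa * (1 + of_bool (sg2 26 \<noteq> a0)))"
    proof (subst a(3), rule hew_sure[OF Qc_last[OF a(1,2)]], elim conjE)
      fix t4 sg' al' z'
      assume b: "sg' = sg2(17 := sg 17 + of_bool (sg2 26 + lhs k (cnt (Uf sg al) k) (cnt (Vf sg al) k)
       \<noteq> rhs k (cnt (Uf sg al) k) (cnt (Vf sg al) k)))" "al' = al2" "z' = z"
      have "CP sg' al'" using QI_CP[OF a(1)] b by blast
      note f[OF this]
      also have "(if sg' 17 = sg 17 + of_bool (a0 + lhs k (cnt (Uf sg al) k) (cnt (Vf sg al) k)
       \<noteq> rhs k (cnt (Uf sg al) k) (cnt (Vf sg al) k)) then Aa else Aa * 2) \<le> Aa * (1 + of_bool (sg2 26 \<noteq> a0))"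
        using b(1) by (cases "sg2 26 = a0") (auto simp: mult_left_mono[of 1 2 Aa, simplified])
      finally show "f sg' al' z' \<le> Aa * (1 + of_bool (sg2 26 \<noteq> a0))" using b(3) by simp
    qed
  qed simp
qed

end

end

subsection \<open>Majority votes\<close>

lemma hew_add_const:
  assumes "hew w inp c sg al z f b"
  shows "hew w inp c sg al z (%sg al z. f sg al z + K) (b + K)"
  unfolding hew_def
proof (intro allI impI)
  fix s assume "rg s = sg \<and> ar s = al \<and> out s = z"
  then have "ew w inp c s (%s'. f (rg s') (ar s') (out s')) \<le> b" using assms by (auto simp: hew_def)
  moreover have "ew w inp c s (%s'. f (rg s') (ar s') (out s') + K) = ew w inp c s (%s'. f (rg s') (ar s') (out s')) + ew w inp c s (%s'. K)"
    unfolding ew_def by (rule nn_integral_add) auto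
  moreover have "ew w inp c s (%s'. K) \<le> K" unfolding ew_def by (rule Ex_le_const) simp
  ultimately show "ew w inp c s (%s'. f (rg s') (ar s') (out s') + K) \<le> b + K"
    by (simp add: add_mono)
qed

text \<open>Termination and time bounds hold for every memory that preprocessing can reach and all
  \<open>u\<close>, \<open>v\<close>; the error bound \<open>err\<close> holds only on average over
  preprocessing.\<close>

locale redok = red +
  assumes pre_ll: "1 \<le> kk ==> lossless_spmf (exec (wk kk) (pinp kk M) cpre (ini (%_. 0)))"
    and pre_t: "1 \<le> kk ==> (t, s) \<in> set_spmf (exec (wk kk) (pinp kk M) cpre (ini (%_. 0))) ==> t \<le> Bp kk"
    and ses: "1 \<le> kk ==> (t, s) \<in> set_spmf (exec (wk kk) (pinp kk M) cpre (ini (%_. 0))) ==>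
        stm (wk kk) (rest kk u v 0) (mem s) (Bs kk)"
    and err: "1 \<le> kk ==> Ex (exec (wk kk) (pinp kk M) cpre (ini (%_. 0)))
        (%q. serr (wk kk) (rest kk u v 0) (val kk M u v) (mem (snd q))) \<le> ennreal (1 / 3)"
    and dec: "1 \<le> kk ==> val kk M u v + lhs kk (cnt u kk) (cnt v kk) \<noteq> rhs kk (cnt u kk) (cnt v kk) \<longleftrightarrow> hit kk M u v"

locale runl = redok + redn + fixes M :: "nat => nat => bool"
begin

definition MM where "MM i j \<longleftrightarrow> i < n \<and> j < n \<and> M i j"
definition bM where "bM b i j = MM ((b div g) * k + i) ((b mod g) * k + j)"
text \<open>Half the number of copies, equal to \<open>6 * (3 * lg + 2)\<close>: six factors of 8/9
  are below 1/2, and \<open>3 * lg + 2\<close> halvings outweigh the at most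
  \<open>2 ^ (3 * lg)\<close> pairs of a product and a block.\<close>

definition rho where "rho = 18 * lg + 12"
lemma r_rho: "r = 2 * rho" by (simp add: r_def rho_def)
definition kap :: ennreal where "kap = ennreal ((1 / 2) ^ rho)"

definition MATok :: "(nat => nat => nat) => bool" where
  "MATok al \<longleftrightarrow> (\<forall>i<g * k. \<forall>j<g * k. al 1 (i * (g * k) + j) = of_bool (MM i j))"

definition BO :: "(nat => nat => nat) => bool" where
  "BO al \<longleftrightarrow> (\<forall>idx<g * g * r. \<forall>u v. stm w (rest k u v 0) (bmem al idx) (Bs k))"

lemma bmem_ka: "ka al al' ==> bmem al' = bmem al"
  by (simp add: bmem_def fun_eq_iff ka_def)

definition PT :: nat where "PT = r * (CT + 8) + 6"

context
  fixes sg :: "nat => nat" and al :: "nat => nat => nat" and b :: nat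
  assumes P: "par sg" "sg 11 = 5" "sg 12 + r < q" "IC (sg 12) al" "RV al" "sg 14 = b" "b < g * g" "sg 15 < g" "sg 16 < g"
    "sg 17 = 0" "BO al"
begin

definition PI :: "nat => (nat => nat) => (nat => nat => nat) => bool" where
  "PI c sg' al' \<longleftrightarrow> (\<forall>x<18. x \<noteq> 12 --> x \<noteq> 17 --> sg' x = sg x) \<and> sg' 12 = sg 12 + c \<and> sg' 17 \<le> c \<and> ka al al' \<and> IC (sg 12 + c) al'"

abbreviation "U \<equiv> Uf sg al"
abbreviation "Vv \<equiv> Vf sg al"
abbreviation "a0 \<equiv> val k (bM b) U Vv"
abbreviation "H \<equiv> hit k (bM b) U Vv"

lemma PI_pre:
  assumes "PI c sg' al'" "c < r" "sg' 18 = c"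
  shows "par sg'" "sg' 11 = 5" "sg' 12 + 1 < q" "IC (sg' 12) al'" "RV al'" "sg' 14 < g * g" "sg' 15 < g" "sg' 16 < g"
    "sg' 18 < r" "sg' 17 \<le> sg' 18" "b * r + c = sg' 14 * r + sg' 18"
    "stm w (rest k (Uf sg' al') (Vf sg' al') 0) (bmem al' (b * r + c)) (Bs k)" "Uf sg' al' = U" "Vf sg' al' = Vv"
proof -
  have i: "\<And>x. x < 18 ==> x \<noteq> 12 ==> x \<noteq> 17 ==> sg' x = sg x" "sg' 12 = sg 12 + c" "sg' 17 \<le> c" "ka al al'" "IC (sg 12 + c) al'"
    using assms(1) by (auto simp: PI_def)
  show "par sg'" "sg' 11 = 5" "sg' 12 + 1 < q" "IC (sg' 12) al'" "RV al'" "sg' 14 < g * g" "sg' 15 < g" "sg' 16 < g"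
    "sg' 18 < r" "sg' 17 \<le> sg' 18" "b * r + c = sg' 14 * r + sg' 18"
    using P i assms RV_ka[OF P(5) i(4)] by (auto simp: par_def)
  show "Uf sg' al' = U" "Vf sg' al' = Vv" using i by (auto simp: Uf_def Vf_def fun_eq_iff ka_def)
  have "b * r + c < (b + 1) * r" using assms(2) by simp
  also have "\<dots> \<le> g * g * r" using P(7) by (intro mult_le_mono1) simp
  finally show "stm w (rest k (Uf sg' al') (Vf sg' al') 0) (bmem al' (b * r + c)) (Bs k)"
    using P(11) by (simp add: BO_def bmem_ka[OF i(4)])
qed

lemma PI_step:
  assumes "PI c sg' al'" "c < r" "sg' 18 = c"
  shows "hsure W inp copyc sg' al' z (%t sg'' al'' z''. t \<le> CT \<and> sg'' 18 = c \<and> sg'' 7 = r \<and> PI (Suc c) (sg''(18 := Suc c)) al'' \<and>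
      sg'' 17 \<le> sg' 17 + 1 \<and> z'' = z)"
  unfolding CT_def
proof (rule hsure_mono[OF hsure_copyc[OF PI_pre(1-12)[OF assms], unfolded CT_def CP_def[OF PI_pre(1-12)[OF assms]]]], elim conjE)
  fix t sg'' al'' z''
  assume a: "t \<le> 12 * Bs k + k * (2 * bd + 400) + bd + 300" "z'' = z" "\<forall>x<19. x \<noteq> 12 --> x \<noteq> 17 --> sg'' x = sg' x"
    "sg'' 12 = sg' 12 + 1" "sg'' 17 = sg' 17 \<or> sg'' 17 = sg' 17 + 1" "ka al' al''" "IC (sg' 12 + 1) al''"
  have "sg'' 7 = r" using a(3) PI_pre(1)[OF assms] by (simp add: par_def)
  moreover have "PI (Suc c) (sg''(18 := Suc c)) al''"
    using a assms(1) ka_trans[OF _ a(6)] unfolding PI_def by auto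
  ultimately show "t \<le> 12 * Bs k + k * (2 * bd + 400) + bd + 300 \<and> sg'' 18 = c \<and> sg'' 7 = r \<and> PI (Suc c) (sg''(18 := Suc c)) al'' \<and> sg'' 17 \<le> sg' 17 + 1 \<and> z'' = z"
    using a assms(3) by auto
qed

lemma PI_init: "PI 0 (sg(18 := 0)) al"
  using P by (auto simp: PI_def)

lemma phase_sure:
  "hsure W inp (For 18 7 copyc) sg al z (%t sg' al' z'. t \<le> PT \<and> PI r sg' al' \<and> z' = z)"
proof (rule hsure_For[where n=r and Inv="%c T sg' al' z'. T \<le> c * (CT + 8) \<and> PI c sg' al' \<and> z' = z"])
  fix c T sg' al' z' assume a: "c < r" "T \<le> c * (CT + 8) \<and> PI c sg' al' \<and> z' = z" "sg' 18 = c"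
  have "hsure W inp copyc sg' al' z (%t sg'' al'' z''. t \<le> CT \<and> sg'' 18 = c \<and> sg'' 7 = r \<and> PI (Suc c) (sg''(18 := Suc c)) al'' \<and>
      sg'' 17 \<le> sg' 17 + 1 \<and> z'' = z)" by (rule PI_step) (use a in auto)
  then show "hsure W inp copyc sg' al' z' (%t sg'' al'' z''. sg'' 18 = c \<and> sg'' 7 = r \<and> T + t + 8 \<le> Suc c * (CT + 8) \<and> PI (Suc c) (sg''(18 := Suc c)) al'' \<and> z'' = z)"
    using a by (auto elim!: hsure_mono)
qed (use PI_init P(1) qW[OF q_facts(6)] one_lt_W in \<open>auto simp: par_def PT_def\<close>)

text \<open>The number of wrong votes among the first \<open>c\<close>, of which \<open>x\<close>
  are positive.\<close>

definition wr :: "nat => nat => nat" where "wr c x = (if H then c - x else x)"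

definition ee :: "nat => ennreal" where "ee c = serr w (rest k U Vv 0) a0 (bmem al (b * r + c))"

lemma wrong_wr:
  assumes "(r < 2 * x) \<noteq> H"
  shows "rho \<le> wr r x"
  using assms by (auto simp: wr_def r_rho)

lemma kap_pow: "rho \<le> m ==> 1 \<le> kap * 2 ^ m"
proof -
  assume "rho \<le> m"
  then have "kap * 2 ^ m = ennreal ((1 / 2) ^ rho) * ennreal (2 ^ m)" unfolding kap_def by (simp flip: ennreal_power)
  also have "\<dots> = ennreal ((1 / 2) ^ rho * 2 ^ m)" by (simp add: ennreal_mult)
  also have "(1 / 2) ^ rho * (2::real) ^ m = 2 ^ (m - rho)"
    using \<open>rho \<le> m\<close> by (simp add: power_diff power_one_over field_simps)
  also have "1 \<le> ennreal (2 ^ (m - rho))" by (simp add: one_le_power)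
  finally show ?thesis .
qed

text \<open>Exponential Markov inequality: \<open>kap * 2 ^ wr\<close> is at least 1 whenever the
  majority is wrong, and its expectation is at most \<open>kap\<close> times the product of the
  factors \<open>1 + ee c\<close>.\<close>

lemma phase_hew:
  "hew W inp (For 18 7 copyc) sg al z (%sg' al' z'. of_bool ((r < 2 * sg' 17) \<noteq> H)) (kap * (\<Prod>c<r. 1 + ee c))"
proof -
  \<comment> \<open>The factors of the copies still to be run are kept in the bound; each is a fixed
    number because the memories after preprocessing do not change during the vote.\<close>
  let ?F = "%c (sg'::nat => nat) (al'::nat => nat => nat) (z'::nat list). kap * 2 ^ wr c (sg' 17) * (\<Prod>c'=c..<r. 1 + ee c')"
  have step: "hsure W inp copyc sg' al' z' (%t sg'' al'' z''. sg'' 18 = c \<and> sg'' 7 = r \<and> PI (Suc c) (sg''(18 := Suc c)) al'' \<and> z'' = z)"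
    "hew W inp copyc sg' al' z' (%sg''. ?F (Suc c) (sg''(18 := Suc c))) (?F c sg' al' z')"
    if a: "c < r" "PI c sg' al' \<and> z' = z" "sg' 18 = c" for c sg' al' z'
  proof -
    have p: "PI c sg' al'" using a by simp
    have "hsure W inp copyc sg' al' z (%t sg'' al'' z''. t \<le> CT \<and> sg'' 18 = c \<and> sg'' 7 = r \<and> PI (Suc c) (sg''(18 := Suc c)) al'' \<and>
      sg'' 17 \<le> sg' 17 + 1 \<and> z'' = z)" by (rule PI_step[OF p a(1,3)])
    then show "hsure W inp copyc sg' al' z' (%t sg'' al'' z''. sg'' 18 = c \<and> sg'' 7 = r \<and> PI (Suc c) (sg''(18 := Suc c)) al'' \<and> z'' = z)"
      using a by (auto elim!: hsure_mono)
    note q = PI_pre[OF p a(1,3)]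
    let ?A = "kap * 2 ^ wr c (sg' 17) * (\<Prod>c'=Suc c..<r. 1 + ee c')"
    have ka: "ka al al'" and x: "sg' 17 \<le> c" using p by (auto simp: PI_def)
    have "hew W inp copyc sg' al' z (%sg''. ?F (Suc c) (sg''(18 := Suc c)))
        (?A * (1 + serr w (rest k (Uf sg' al') (Vf sg' al') 0) a0 (bmem al' (b * r + c))))"
    proof (rule hew_copyc[OF q(1-12)])
      fix sg'' al'' assume cp: "CP sg' al' sg'' al''"
      have le: "sg'' 17 = sg' 17 \<or> sg'' 17 = sg' 17 + 1" using cp unfolding CP_def[OF q(1-12)] by simp
      have t: "(a0 + lhs k (cnt (Uf sg' al') k) (cnt (Vf sg' al') k) \<noteq> rhs k (cnt (Uf sg' al') k) (cnt (Vf sg' al') k)) = H"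
        unfolding q(13,14) using dec[of k "bM b" U Vv] k_pos by simp
      have 1: "wr (Suc c) (sg'' 17) = (if sg'' 17 = sg' 17 + of_bool H then wr c (sg' 17) else Suc (wr c (sg' 17)))"
        using le x by (auto simp: wr_def)
      show "?F (Suc c) (sg''(18 := Suc c)) al'' z \<le> (if sg'' 17 = sg' 17 + of_bool (a0 + lhs k (cnt (Uf sg' al') k) (cnt (Vf sg' al') k)
          \<noteq> rhs k (cnt (Uf sg' al') k) (cnt (Vf sg' al') k)) then ?A else ?A * 2)"
        unfolding t using 1 by (simp add: ac_simps)
    qed
    moreover have "?A * (1 + ee c) = ?F c sg' al' z'"
      using a(1) by (simp add: prod.atLeast_Suc_lessThan ac_simps)
    ultimately show "hew W inp copyc sg' al' z' (%sg''. ?F (Suc c) (sg''(18 := Suc c))) (?F c sg' al' z')"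
      using a(2) by (simp add: q(13,14) bmem_ka[OF ka] ee_def)
  qed
  have "hew W inp (For 18 7 copyc) sg al z (?F r) (kap * (\<Prod>c<r. 1 + ee c))"
    by (rule hew_For[where n=r and Inv="%c sg' al' z'. PI c sg' al' \<and> z' = z" and F="?F"])
      (use step PI_init P(1,10) qW[OF q_facts(6)] one_lt_W in \<open>auto simp: par_def wr_def lessThan_atLeast0\<close>)
  then show ?thesis
    by (rule hew_sure_mono[OF phase_sure, rotated]) (use wrong_wr kap_pow in \<open>auto simp: of_bool_def\<close>)
qed

end

end

subsection \<open>Products with the matrix\<close>

context runl
begin

definition bset :: "(nat => nat) => (nat => nat => nat) => nat => nat => bool" where
  "bset sg al x rw \<longleftrightarrow> (\<exists>y<x. sg 15 * k + y div k = rw \<and>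
     al 1 ((sg 15 * k + y div k) * (g * k) + (sg 16 * k + y mod k)) * al 2 (sg 16 * k + y mod k) \<noteq> 0)"

lemma bset_Suc: "bset sg al (Suc x) rw \<longleftrightarrow> bset sg al x rw \<or> sg 15 * k + x div k = rw \<and>
     al 1 ((sg 15 * k + x div k) * (g * k) + (sg 16 * k + x mod k)) * al 2 (sg 16 * k + x mod k) \<noteq> 0"
  unfolding bset_def less_Suc_eq by blast

definition bres :: "(nat => nat) => (nat => nat => nat) => nat => nat => nat => nat" where
  "bres sg al x = al(3 := %rw. if bset sg al x rw then 1 else al 3 rw)"

lemma brute_sure:
  assumes p: "par sg" "sg 15 < g" "sg 16 < g" "RV al"
  shows "hsure W inp (For 28 4 brute) sg al z (%t sg' al' z'. t \<le> 100 * (k * k) + 6 \<and> agr 27 sg sg' \<and> al' = bres sg al (k * k) \<and> z' = z)"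
proof (rule hsure_For[where n="k * k" and Inv="%x T sg' al' z'. T \<le> 100 * x \<and> agr 27 sg sg' \<and> al' = bres sg al x \<and> z' = z"])
  fix x T sg' al' z' assume a: "x < k * k" "T \<le> 100 * x \<and> agr 27 sg sg' \<and> al' = bres sg al x \<and> z' = z" "sg' 28 = x" "sg' 4 = k * k"
  have e: "sg' 3 = k" "sg' 10 = g * k" "sg' 15 = sg 15" "sg' 16 = sg 16" using a(2) p(1) by (auto simp: agr_def par_def)
  have q: "x < q" "k < q" "g * k < q" "sg 15 < q" "sg 16 < q" "x div k < q" "x mod k < q" "1 < q" "0 < q"
    using a(1) p(2,3) q_facts(2,3,4,8) q2 div_le_dividend[of x k] mod_less_eq_dividend[of x k] by linarith+
  have al: "al' 1 = al 1" "al' 2 = al 2" using a(2) by (auto simp: bres_def)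
  have v: "al 1 j < q" "al 2 j < q" for j using p(4) q2 by (auto simp: RV_def intro: le_less_trans)
  let ?R = "(sg 15 * k + x div k) * (g * k) + (sg 16 * k + x mod k)" and ?c = "sg 16 * k + x mod k"
  have pre: "hsure W inp (assign 30 (B Div (V 28) (V 3)) ;; assign 31 (B Mod (V 28) (V 3)) ;; aload 29 1 mexp ;;
     aload 27 2 (eplus (etimes (V 16) (V 3)) (V 31))) sg' al' z' (%t sg'' al'' z''. t \<le> 50 \<and>
       sg'' = sg'(30 := x div k, 31 := x mod k, 29 := al 1 ?R, 27 := al 2 ?c) \<and> al'' = al' \<and> z'' = z')"
    using q e al v a(3) q_consts(9) by (intro hrules) (auto simp: mexp_def)
  have up: "bres sg al (Suc x) = (if al 1 ?R * al 2 ?c \<noteq> 0 then al'(3 := (al' 3)(sg 15 * k + x div k := 1)) else al')"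
    using a(2) unfolding bres_def bset_Suc by (auto simp: fun_eq_iff)
  show "hsure W inp brute sg' al' z' (%t sg'' al'' z''. sg'' 28 = x \<and> sg'' 4 = k * k \<and>
     T + t + 8 \<le> 100 * Suc x \<and> agr 27 sg (sg''(28 := Suc x)) \<and> al'' = bres sg al (Suc x) \<and> z'' = z)"
    unfolding brute_def
  proof (rule hsure_assoc4, rule hsure_Seq, rule hsure_mono[OF pre], clarify)
    fix t :: nat assume t: "t \<le> 50"
    let ?s = "sg'(30 := x div k, 31 := x mod k, 29 := al 1 ?R, 27 := al 2 ?c)"
    have nv: "nv ?s (etimes (V 29) (V 27)) = al 1 ?R * al 2 ?c" "nv ?s (eplus (etimes (V 15) (V 3)) (V 30)) = sg 15 * k + x div k"
      using e by auto
    show "hsure W inp (ife (etimes (V 29) (V 27)) (astore 3 (eplus (etimes (V 15) (V 3)) (V 30)) (C 1)) Skip) ?s al' z'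
       (%t' sg'' al'' z''. sg'' 28 = x \<and> sg'' 4 = k * k \<and> T + (t + t') + 8 \<le> 100 * Suc x \<and> agr 27 sg (sg''(28 := Suc x)) \<and>
          al'' = bres sg al (Suc x) \<and> z'' = z)"
    proof (rule hsure_ife, goal_cases)
      case 1 show ?case by (rule sb) (use v in auto)
    next
      case 2
      then have "bres sg al (Suc x) = al'(3 := (al' 3)(sg 15 * k + x div k := 1))" unfolding nv up by simp
      then show ?case using a t q e q_consts(9)
        by (intro hsure_astore sb) auto
    next
      case 3
      then have "bres sg al (Suc x) = al'" unfolding nv up by simp
      then show ?case using a t by (intro hsure_Skip) auto
    qed
  qed
qed (use p(1) qW[OF q_facts(3)] one_lt_W in \<open>auto simp: par_def bres_def bset_def\<close>)

definition BT :: nat where "BT = 100 * (k * k) + 50"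

definition tailc :: com where
  "tailc = ife (etimes (B Lt (V 7) (etimes (C 2) (V 17))) (B Lt (V 13) (V 0)))
       (assign 13 (eplus (V 13) (C 1)) ;; For 28 4 brute) Skip"

lemma tail_sure:
  assumes p: "par sg" "sg 15 < g" "sg 16 < g" "RV al" "sg 13 \<le> n" "sg 17 \<le> r"
  shows "hsure W inp tailc sg al z (%t sg' al' z'. z' = z \<and> (\<forall>x<27. x \<noteq> 13 --> sg' x = sg x) \<and>
     (if r < 2 * sg 17 \<and> sg 13 < n then t \<le> 40 + BT \<and> sg' 13 = Suc (sg 13) \<and> al' = bres sg al (k * k)
      else t \<le> 40 \<and> sg' 13 = sg 13 \<and> al' = al))"
  unfolding tailc_def
proof (rule hsure_ife, goal_cases)
  have e: "sg 7 = r" "sg 0 = n" using p(1) by (auto simp: par_def)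
  have q: "sg 13 < q" "sg 17 < q" "2 < q" "1 < q" using p(5,6) q_facts(1,6) q_consts(9) by auto
  case 1 show ?case by (rule sb) (use e q q_facts(1,6) in auto)
  case 2
  then have c: "r < 2 * sg 17 \<and> sg 13 < n" using e by auto
  have "hsure W inp (assign 13 (eplus (V 13) (C 1)) ;; For 28 4 brute) sg al z
     (%t sg' al' z'. t \<le> 100 * (k * k) + 30 \<and> agr 27 (sg(13 := Suc (sg 13))) sg' \<and> al' = bres sg al (k * k) \<and> z' = z)"
  proof (rule hsure_Seq, rule hsure_assign', rule sb)
    have b: "bres (sg(13 := Suc (sg 13))) al (k * k) = bres sg al (k * k)" by (simp add: bres_def bset_def)
    have "hsure W inp (For 28 4 brute) (sg(13 := Suc (sg 13))) al z (%t sg' al' z'. t \<le> 100 * (k * k) + 6 \<and> agr 27 (sg(13 := Suc (sg 13))) sg' \<and>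
       al' = bres (sg(13 := Suc (sg 13))) al (k * k) \<and> z' = z)"
      by (rule brute_sure) (use p in \<open>auto simp: par_def\<close>)
    then show "hsure W inp (For 28 4 brute) (sg(13 := Suc (sg 13))) al z
      (%t' sg' al' z'. ecost (eplus (V 13) (C 1)) + 1 + t' \<le> 100 * (k * k) + 30 \<and> agr 27 (sg(13 := Suc (sg 13))) sg' \<and>
         al' = bres sg al (k * k) \<and> z' = z)" unfolding b by (rule hsure_mono) auto
  qed (use q in auto)
  then show ?case
  proof (rule hsure_mono, elim conjE)
    fix t sg' al' z'
    assume h: "t \<le> 100 * (k * k) + 30" "agr 27 (sg(13 := Suc (sg 13))) sg'" "al' = bres sg al (k * k)" "z' = z"
    have "sg' 13 = Suc (sg 13)" "\<forall>x<27. x \<noteq> 13 --> sg' x = sg x" using h(2) by (auto simp: agr_def)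
    then show "z' = z \<and> (\<forall>x<27. x \<noteq> 13 --> sg' x = sg x) \<and>
       (if r < 2 * sg 17 \<and> sg 13 < n then t + ecost (etimes (B Lt (V 7) (etimes (C 2) (V 17))) (B Lt (V 13) (V 0))) + 1 \<le> 40 + BT \<and> sg' 13 = Suc (sg 13) \<and> al' = bres sg al (k * k)
        else t + ecost (etimes (B Lt (V 7) (etimes (C 2) (V 17))) (B Lt (V 13) (V 0))) + 1 \<le> 40 \<and> sg' 13 = sg 13 \<and> al' = al)"
      using c h by (simp add: BT_def)
  qed
next
  have e: "sg 7 = r" "sg 0 = n" using p(1) by (auto simp: par_def)
  case 3
  then have "\<not> (r < 2 * sg 17 \<and> sg 13 < n)" using e by auto
  then show ?case by (intro hsure_Skip) auto
qed

text \<open>The rows known to be hit before block \<open>b\<close> in an error-free run; blocks are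
  scanned one block row after the other. It depends on the matrix and the vector only, not on random
  choices.\<close>

definition ex :: "(nat => bool) => nat => nat => bool" where
  "ex v b rw \<longleftrightarrow> rw < n \<and> (rw div k < b div g \<and> (\<exists>col. MM rw col \<and> v col) \<or>
     rw div k = b div g \<and> (\<exists>col<(b mod g) * k. MM rw col \<and> v col))"
definition us :: "(nat => bool) => nat => nat => bool" where "us v b i = (\<not> ex v b ((b div g) * k + i))"
definition vs :: "(nat => bool) => nat => nat => bool" where "vs v b j = ((b mod g) * k + j < n \<and> v ((b mod g) * k + j))"
text \<open>A bound for the probability of a wrong vote on block \<open>b\<close> in the error-free
  run. The queries \<open>us\<close>, \<open>vs\<close> are those of that run, so random choices
  enter only through the memories after preprocessing.\<close>

definition eps :: "(nat => bool) => nat => (nat => nat => nat) => ennreal" where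
  "eps v b al = kap * (\<Prod>c<r. 1 + serr w (rest k (us v b) (vs v b) 0) (val k (bM b) (us v b) (vs v b)) (bmem al (b * r + c)))"

definition VECok :: "(nat => bool) => (nat => nat => nat) => bool" where
  "VECok v al \<longleftrightarrow> (\<forall>c. al 2 c = of_bool (c < n \<and> v c))"
text \<open>The actual state agrees with the error-free run. The bound on register 13, at most one
  search per resolved row, ensures that the cap on searches does not interfere.\<close>

definition Good :: "(nat => bool) => nat => (nat => nat) => (nat => nat => nat) => bool" where
  "Good v b sg al \<longleftrightarrow> (\<forall>rw. al 3 rw = of_bool (ex v b rw)) \<and> sg 13 \<le> cnt (ex v b) n"

lemma MM_lt: "MM rw col ==> rw < n \<and> col < n" by (simp add: MM_def)

definition newr :: "(nat => bool) => nat => nat => bool" where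
  "newr v b rw \<longleftrightarrow> rw div k = b div g \<and> (\<exists>j<k. MM rw ((b mod g) * k + j) \<and> v ((b mod g) * k + j))"

lemma ex_Suc: "ex v (Suc b) rw \<longleftrightarrow> ex v b rw \<or> newr v b rw"
proof -
  have split: "(\<exists>col<Suc J * k. P col) \<longleftrightarrow> (\<exists>col<J * k. P col) \<or> (\<exists>j<k. P (J * k + j))" for J P
  proof
    assume "\<exists>col<Suc J * k. P col"
    then obtain col where c: "col < Suc J * k" "P col" by blast
    show "(\<exists>col<J * k. P col) \<or> (\<exists>j<k. P (J * k + j))"
    proof (cases "col < J * k")
      case False
      then have "col = J * k + (col - J * k)" "col - J * k < k" using c(1) by auto
      then show ?thesis using c(2) by metis
    qed (use c in blast)
  next
    assume "(\<exists>col<J * k. P col) \<or> (\<exists>j<k. P (J * k + j))"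
    then show "\<exists>col<Suc J * k. P col"
    proof (elim disjE exE conjE)
      fix col assume "col < J * k" "P col" then show ?thesis by (intro exI[of _ col]) simp
    next
      fix j assume "j < k" "P (J * k + j)" then show ?thesis by (intro exI[of _ "J * k + j"]) simp
    qed
  qed
  have new: "newr v b rw ==> rw < n" by (auto simp: newr_def MM_def)
  show ?thesis
  proof (cases "Suc (b mod g) = g")
    case True
    then have e: "Suc b div g = Suc (b div g)" "Suc b mod g = 0" by (simp_all add: div_Suc mod_Suc)
    \<comment> \<open>At the end of a block row the columns below \<open>g * k\<close> have been
      covered, which are all of them.\<close>
    have all: "(\<exists>col. MM rw col \<and> v col) \<longleftrightarrow> (\<exists>col<Suc (b mod g) * k. MM rw col \<and> v col)"
      using n_lt_gk True MM_lt by (metis less_trans)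
    show ?thesis unfolding ex_def e less_Suc_eq all split newr_def using new[unfolded newr_def] by auto
  next
    case False
    then have e: "Suc b div g = b div g" "Suc b mod g = Suc (b mod g)" by (simp_all add: div_Suc mod_Suc)
    show ?thesis unfolding ex_def e split newr_def using new[unfolded newr_def] by auto
  qed
qed

lemma bset_new:
  assumes "sg 15 = b div g" "sg 16 = b mod g" "b < g * g" "MATok al" "VECok v al"
  shows "bset sg al (k * k) rw \<longleftrightarrow> newr v b rw"
proof -
  have I: "b div g < g" using assms(3) by (simp add: less_mult_imp_div_less)
  have J: "b mod g < g" using g_pos by simp
  have lt: "A * k + i < g * k" if "A < g" "i < k" for A i
  proof -
    have "A * k + i < Suc A * k" using that by simp
    also have "\<dots> \<le> g * k" using that by (intro mult_le_mono1) simp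
    finally show ?thesis .
  qed
  have m: "al 1 ((b div g * k + i) * (g * k) + (b mod g * k + j)) * al 2 (b mod g * k + j) \<noteq> 0 \<longleftrightarrow>
     MM (b div g * k + i) (b mod g * k + j) \<and> v (b mod g * k + j)" if "i < k" "j < k" for i j
    using assms(4,5) lt[OF I that(1)] lt[OF J that(2)] by (auto simp: MATok_def VECok_def MM_def)
  show ?thesis
  proof
    assume "bset sg al (k * k) rw"
    then obtain y where y: "y < k * k" "b div g * k + y div k = rw"
      "al 1 ((b div g * k + y div k) * (g * k) + (b mod g * k + y mod k)) * al 2 (b mod g * k + y mod k) \<noteq> 0"
      unfolding bset_def assms(1,2) by blast
    have d: "y div k < k" "y mod k < k" using y(1) k_pos by (simp_all add: less_mult_imp_div_less)
    then have "rw div k = b div g" using y(2) k_pos by auto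
    then show "newr v b rw" using y(2,3) d(2) m[OF d] unfolding newr_def by blast
  next
    assume "newr v b rw"
    then obtain j where j: "rw div k = b div g" "j < k" "MM rw (b mod g * k + j)" "v (b mod g * k + j)"
      unfolding newr_def by blast
    let ?i = "rw mod k" let ?y = "?i * k + j"
    have i: "?i < k" using k_pos by simp
    have rw: "b div g * k + ?i = rw" using j(1) by (metis div_mult_mod_eq)
    have y: "?y < k * k" "?y div k = ?i" "?y mod k = j"
    proof -
      have "?y < Suc ?i * k" using j(2) by simp
      also have "\<dots> \<le> k * k" using i by (intro mult_le_mono1) simp
      finally show "?y < k * k" .
    qed (use j(2) in auto)
    show "bset sg al (k * k) rw" unfolding bset_def assms(1,2)
      by (rule exI[of _ ?y]) (use y rw j m[OF i j(2)] in auto)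
  qed
qed

text \<open>A right positive answer means that searching this block resolves at least one further
  row, which accounts for the search in the bound on register 13.\<close>

lemma hit_new: "hit k (bM b) (us v b) (vs v b) \<longleftrightarrow> (\<exists>rw. newr v b rw \<and> \<not> ex v b rw)"
proof
  assume "hit k (bM b) (us v b) (vs v b)"
  then obtain i j where "i < k" "j < k" "us v b i" "bM b i j" "vs v b j" unfolding hit_def by blast
  then have "newr v b (b div g * k + i)" "\<not> ex v b (b div g * k + i)"
    using k_pos unfolding newr_def us_def vs_def bM_def by auto
  then show "\<exists>rw. newr v b rw \<and> \<not> ex v b rw" by blast
next
  assume "\<exists>rw. newr v b rw \<and> \<not> ex v b rw"
  then obtain rw j where r: "rw div k = b div g" "j < k" "MM rw (b mod g * k + j)" "v (b mod g * k + j)" "\<not> ex v b rw"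
    unfolding newr_def by blast
  have rw: "b div g * k + rw mod k = rw" using r(1) by (metis div_mult_mod_eq)
  have "rw mod k < k" using k_pos by simp
  then show "hit k (bM b) (us v b) (vs v b)" unfolding hit_def us_def vs_def bM_def
    using r rw MM_lt[OF r(3)] by (intro exI[of _ "rw mod k"] exI[of _ j] conjI) auto
qed

lemma cnt_strict:
  assumes "\<And>x. P x ==> Q x" "a < m" "Q a" "\<not> P a"
  shows "cnt P m < cnt Q m"
  unfolding cnt_def by (rule psubset_card_mono) (use assms in auto)

end

context runl
begin

section \<open>One block\<close>

definition BP :: "nat => (nat => nat) => (nat => nat => nat) => bool" where
  "BP b sg al \<longleftrightarrow> par sg \<and> sg 11 = 5 \<and> sg 12 + r < q \<and> IC (sg 12) al \<and> RV al \<and> sg 14 = b \<and> b < g * g \<and> BO al \<and> sg 13 \<le> n \<and>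
     MATok al \<and> (\<forall>i. al 3 i \<noteq> 0 --> i < n)"

text \<open>Searches are charged to the counter in register 13: with \<open>BT\<close> steps per
  search as a potential, only the vote and a constant remain as the cost of a block.\<close>

definition BQ :: "nat => (nat => nat) => (nat => nat => nat) => nat => (nat => nat) => (nat => nat => nat) => bool" where
  "BQ b sg al t sg' al' \<longleftrightarrow> t + sg 13 * BT \<le> PT + 80 + sg' 13 * BT \<and> sg' 13 \<le> n \<and> (\<forall>x<12. sg' x = sg x) \<and> sg' 14 = b \<and>
     sg' 12 = sg 12 + r \<and> al' 0 = al 0 \<and> al' 1 = al 1 \<and> al' 2 = al 2 \<and> al' 4 = al 4 \<and> RV al' \<and> IC (sg 12 + r) al' \<and>
     (\<forall>i. al' 3 i \<noteq> 0 --> i < n)"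

lemma blk_eq: "blk = assign 15 (B Div (V 14) (V 5)) ;; assign 16 (B Mod (V 14) (V 5)) ;; assign 17 (C 0) ;; For 18 7 copyc ;; tailc"
  by (simp add: blk_def tailc_def)

lemma bset_lt:
  assumes "bset sg al (k * k) i" "MATok al" "sg 15 < g" "sg 16 < g"
  shows "i < n"
proof -
  have lt: "A * k + i < g * k" if "A < g" "i < k" for A i
  proof -
    have "A * k + i < Suc A * k" using that by simp
    also have "\<dots> \<le> g * k" using that by (intro mult_le_mono1) simp
    finally show ?thesis .
  qed
  from assms(1) obtain y where y: "y < k * k" "sg 15 * k + y div k = i"
      "al 1 ((sg 15 * k + y div k) * (g * k) + (sg 16 * k + y mod k)) \<noteq> 0" unfolding bset_def by auto
  have d: "y div k < k" "y mod k < k" using y(1) k_pos by (simp_all add: less_mult_imp_div_less)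
  have "MM (sg 15 * k + y div k) (sg 16 * k + y mod k)"
    using y(3) assms(2) lt[OF assms(3) d(1)] lt[OF assms(4) d(2)] by (auto simp: MATok_def)
  then show ?thesis using y(2) by (simp add: MM_def)
qed

context
  fixes b sg al
  assumes bp: "BP b sg al"
begin

abbreviation "sgp \<equiv> sg(15 := b div g, 16 := b mod g, 17 := 0)"

lemma blk_pre:
  "hsure W inp (assign 15 (B Div (V 14) (V 5)) ;; assign 16 (B Mod (V 14) (V 5)) ;; assign 17 (C 0)) sg al z
     (%t sg' al' z'. t \<le> 20 \<and> sg' = sgp \<and> al' = al \<and> z' = z)"
proof -
  have "sg 14 = b" "sg 5 = g" "b < q" "g < q" "0 < q" using bp q_facts(4,5) q2 by (auto simp: BP_def par_def)
  then show ?thesis by (intro hrules) auto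
qed

lemma bp_p: "par sgp" "sgp 11 = 5" "sgp 12 + r < q" "IC (sgp 12) al" "RV al" "sgp 14 = b" "b < g * g" "sgp 15 < g" "sgp 16 < g"
    "sgp 17 = 0" "BO al"
  using bp g_pos by (auto simp: BP_def par_def less_mult_imp_div_less)

lemma after_phase:
  assumes "PI sgp al r sg' al'"
  shows "(\<forall>x<18. x \<noteq> 12 --> x \<noteq> 17 --> sg' x = sgp x)" "sg' 12 = sg 12 + r" "sg' 17 \<le> r" "ka al al'" "IC (sg 12 + r) al'"
    "par sg'" "sg' 15 < g" "sg' 16 < g" "RV al'" "sg' 13 \<le> n" "sg' 13 = sg 13" "MATok al'" "sg' 15 = b div g" "sg' 16 = b mod g"
proof -
  show p: "\<forall>x<18. x \<noteq> 12 --> x \<noteq> 17 --> sg' x = sgp x" "sg' 12 = sg 12 + r" "sg' 17 \<le> r" "ka al al'" "IC (sg 12 + r) al'"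
    using assms unfolding PI_def[OF bp_p] by auto
  show "par sg'" "sg' 15 < g" "sg' 16 < g" "RV al'" "sg' 13 \<le> n" "sg' 13 = sg 13" "sg' 15 = b div g" "sg' 16 = b mod g"
    using p(1) bp_p bp RV_ka[OF bp_p(5) p(4)] by (auto simp: par_def BP_def)
  show "MATok al'" using bp p(4) by (simp add: BP_def MATok_def ka_def)
qed

lemma blk_sure: "hsure W inp blk sg al z (%t sg' al' z'. BQ b sg al t sg' al' \<and> z' = z)"
  unfolding blk_eq
proof (rule hsure_assoc3, rule hsure_Seq, rule hsure_mono[OF blk_pre], clarify, rule hsure_Seq,
    rule hsure_mono[OF phase_sure[OF bp_p]], clarify)
  fix t1 t2 :: nat and sg' al' assume t: "t1 \<le> 20" "t2 \<le> PT" and pi: "PI sgp al r sg' al'"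
  note a = after_phase[OF pi]
  have s3: "\<forall>i. al 3 i \<noteq> 0 --> i < n" using bp by (simp add: BP_def)
  show "hsure W inp tailc sg' al' z (%t' sg' al' z'. BQ b sg al (t1 + (t2 + t')) sg' al' \<and> z' = z)"
  proof (rule hsure_mono[OF tail_sure[OF a(6-10,3)]], elim conjE)
    fix t3 sg2 al2 z2
    assume h: "z2 = z" "\<forall>x<27. x \<noteq> 13 --> sg2 x = sg' x"
      "if r < 2 * sg' 17 \<and> sg' 13 < n then t3 \<le> 40 + BT \<and> sg2 13 = Suc (sg' 13) \<and> al2 = bres sg' al' (k * k)
       else t3 \<le> 40 \<and> sg2 13 = sg' 13 \<and> al2 = al'"
    have x: "\<forall>x<12. sg2 x = sg x" "sg2 14 = b" "sg2 12 = sg 12 + r" using h(2) a(1,2) bp by (auto simp: BP_def)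
    show "BQ b sg al (t1 + (t2 + t3)) sg2 al2 \<and> z2 = z"
    proof (cases "r < 2 * sg' 17 \<and> sg' 13 < n")
      case True
      then have e: "t3 \<le> 40 + BT" "sg2 13 = Suc (sg 13)" "al2 = bres sg' al' (k * k)" using h(3) a(11) by auto
      have "sg 13 < n" using True a(11) by simp
      moreover have "al2 0 = al 0 \<and> al2 1 = al 1 \<and> al2 2 = al 2 \<and> al2 4 = al 4"
        using a(4) unfolding e bres_def ka_def by simp
      moreover have "RV al2" using a(9) unfolding e bres_def RV_def by simp
      moreover have "IC (sg 12 + r) al2" using a(5) unfolding e bres_def IC_def by simp
      moreover have "\<forall>i. al2 3 i \<noteq> 0 --> i < n"
        using s3 a(4) bset_lt[OF _ a(12,7,8)] unfolding e bres_def by (auto simp: ka_def split: if_splits)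
      moreover have "t1 + (t2 + t3) + sg 13 * BT \<le> PT + 80 + sg2 13 * BT" using t e by simp
      ultimately show ?thesis unfolding BQ_def using x e(2) h(1) by auto
    next
      case False
      then have e: "t3 \<le> 40" "sg2 13 = sg 13" "al2 = al'" using h(3) a(11) by auto
      have "al2 0 = al 0 \<and> al2 1 = al 1 \<and> al2 2 = al 2 \<and> al2 3 = al 3 \<and> al2 4 = al 4" using a(4) unfolding e ka_def by simp
      moreover have "t1 + (t2 + t3) + sg 13 * BT \<le> PT + 80 + sg2 13 * BT" using t e by simp
      ultimately show ?thesis unfolding BQ_def using x e a(5,9,10,11) h(1) s3 by auto
    qed
  qed
qed

text \<open>A right vote leads from the error-free state before the block to the one after it, so
  the error-free run is left with at most the probability of a wrong vote.\<close>

lemma blk_hew: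
  assumes v: "VECok v al" and good: "Good v b sg al"
  shows "hew W inp blk sg al z (%sg' al' z'. of_bool (\<not> Good v (Suc b) sg' al')) (eps v b al)"
proof -
  have U: "Uf sgp al = us v b" using good by (auto simp: Uf_def us_def Good_def fun_eq_iff)
  have V: "Vf sgp al = vs v b" using v by (auto simp: Vf_def vs_def VECok_def fun_eq_iff)
  let ?H = "hit k (bM b) (us v b) (vs v b)"
  have ph: "hew W inp (For 18 7 copyc) sgp al z (%sg' al' z'. of_bool ((r < 2 * sg' 17) \<noteq> ?H)) (eps v b al)"
    using phase_hew[OF bp_p, of inp z] unfolding eps_def ee_def[OF bp_p] U V .
  have b: "b < g * g" using bp by (simp add: BP_def)
  show ?thesis unfolding blk_eq
  proof (rule hew_assoc3, rule hew_Seq_det, rule hsure_mono[OF blk_pre], clarify, rule hew_Seq[OF phase_sure[OF bp_p] _ ph], clarify)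
    fix t sg' al' assume pi: "PI sgp al r sg' al'"
    note a = after_phase[OF pi]
    have v': "VECok v al'" using v a(4) by (simp add: VECok_def ka_def)
    have al3: "al' 3 i = of_bool (ex v b i)" for i using good a(4) by (simp add: Good_def ka_def)
    show "hew W inp tailc sg' al' z (%sg' al' z'. of_bool (\<not> Good v (Suc b) sg' al')) (of_bool ((r < 2 * sg' 17) \<noteq> ?H))"
    proof (cases "(r < 2 * sg' 17) = ?H")
      case False
      then show ?thesis by (intro hew_sure[OF tail_sure[OF a(6-10,3)]]) auto
    next
      case True
      have "Good v (Suc b) sg2 al2" if h: "if r < 2 * sg' 17 \<and> sg' 13 < n then t3 \<le> 40 + BT \<and> sg2 13 = Suc (sg' 13) \<and> al2 = bres sg' al' (k * k)
         else t3 \<le> 40 \<and> sg2 13 = sg' 13 \<and> al2 = al'" for t3 sg2 al2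
      proof (cases ?H)
        case H: True
        then obtain i where i: "newr v b i" "\<not> ex v b i" unfolding hit_new by blast
        have "i < n" using i(1) by (auto simp: newr_def MM_def)
        \<comment> \<open>A new row remains, so fewer than \<open>n\<close> searches have been made
          and the cap allows this one.\<close>
        have c: "cnt (ex v b) n < cnt (ex v (Suc b)) n"
          by (rule cnt_strict[OF _ \<open>i < n\<close>]) (use i ex_Suc in auto)
        have "cnt (ex v (Suc b)) n \<le> n" by (rule cnt_le)
        then have "sg' 13 < n" using c good a(11) by (simp add: Good_def)
        then have e: "sg2 13 = Suc (sg 13)" "al2 = bres sg' al' (k * k)" using h True H a(11) by auto
        have "al2 3 j = of_bool (ex v (Suc b) j)" for j
          unfolding e bres_def using bset_new[OF a(13,14) b a(12) v', of j] al3 ex_Suc by simp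
        then show ?thesis using c good e(1) unfolding Good_def by simp
      next
        case H: False
        then have e: "sg2 13 = sg 13" "al2 = al'" using h True a(11) by auto
        have "ex v (Suc b) j = ex v b j" for j using H ex_Suc unfolding hit_new by blast
        then have "ex v (Suc b) = ex v b" by blast
        then show ?thesis using good e al3 unfolding Good_def by simp
      qed
      then have "hew W inp tailc sg' al' z (%sg' al' z'. of_bool (\<not> Good v (Suc b) sg' al')) 0"
        by (intro hew_sure[OF tail_sure[OF a(6-10,3)]]) auto
      then show ?thesis using True by simp
    qed
  qed
qed

end

text \<open>Every product consumes exactly \<open>g * g * r\<close> stamps, one for each run of a
  copy.\<close>

definition MInv :: "nat => (nat => nat => nat) => bool" where
  "MInv T al \<longleftrightarrow> al 0 0 = n \<and> al 0 1 = T * (g * g * r) \<and> MATok al \<and> BO al \<and> RV al \<and> IC (T * (g * g * r)) al \<and>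
     (\<forall>i. al 2 i \<noteq> 0 \<or> al 3 i \<noteq> 0 --> i < n)"

lemma bmem_cong: "al' 4 = al 4 ==> bmem al' = bmem al"
  by (simp add: bmem_def fun_eq_iff)

lemma eps_cong: "al' 4 = al 4 ==> eps v b al' = eps v b al"
  by (simp add: eps_def bmem_cong[of al' al])

lemma BO_cong: "al' 4 = al 4 ==> BO al' = BO al"
  by (simp add: BO_def bmem_cong[of al' al])

definition MT :: nat where "MT = g * g * (PT + 88) + n * BT + 200 * n + 300"

context
  fixes T :: nat and al :: "nat => nat => nat" and v :: "nat => bool" and inp :: "nat list"
  assumes M: "MInv T al" "T < n" and inp: "inp = encode_vec n v"
begin

abbreviation "ph0 \<equiv> T * (g * g * r)"

lemma ph_lt: "c \<le> g * g * r ==> ph0 + c < q"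
proof -
  assume "c \<le> g * g * r"
  then have "ph0 + c \<le> Suc T * (g * g * r)" by simp
  also have "\<dots> \<le> n * (g * g * r)" using M(2) by (intro mult_le_mono1) simp
  finally show ?thesis using q_facts(13) by linarith
qed

definition alv :: "nat => nat => nat => nat" where
  "alv x = al(2 := %i. if i < x then of_bool (v i) else al 2 i, 3 := %i. if i < x then 0 else al 3 i)"

lemma readv_loop:
  assumes "par sg"
  shows "hsure W inp (For 14 0 readv) sg al z (%t sg' al' z'. t \<le> 50 * n + 6 \<and> agr 13 sg sg' \<and> al' = alv n \<and> z' = z)"
proof (rule hsure_For[where n=n and Inv="%x t sg' al' z'. t \<le> 50 * x \<and> agr 13 sg sg' \<and> al' = alv x \<and> z' = z"])
  fix x t sg' al' z' assume a: "x < n" "t \<le> 50 * x \<and> agr 13 sg sg' \<and> al' = alv x \<and> z' = z" "sg' 14 = x" "sg' 0 = n"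
  have "x < q" using a(1) q_facts(1) by simp
  have i: "x < length inp" "inp ! x = of_bool (v x)" using a(1) by (auto simp: inp encode_vec_def)
  have tb: "take_bit W (of_bool (v x)) = (of_bool (v x) :: nat)" using one_lt_W by (intro take_bit_small) auto
  have up: "alv (Suc x) = al'(2 := (al' 2)(x := of_bool (v x)), 3 := (al' 3)(x := 0))"
    using a(2) by (auto simp: alv_def fun_eq_iff less_Suc_eq)
  show "hsure W inp readv sg' al' z' (%t' sg'' al'' z''. sg'' 14 = x \<and> sg'' 0 = n \<and> t + t' + 8 \<le> 50 * Suc x \<and> agr 13 sg (sg''(14 := Suc x)) \<and> al'' = alv (Suc x) \<and> z'' = z)"
    unfolding readv_def using a \<open>x < q\<close> i tb q2 q_consts(9)
    by (intro hrules) (auto simp: up)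
qed (use assms qW[OF q_facts(1)] one_lt_W in \<open>auto simp: par_def alv_def\<close>)

lemma alv_facts: "VECok v (alv n)" "alv n 3 = (%_. 0)" "alv n 0 = al 0" "alv n 1 = al 1" "alv n 4 = al 4" "RV (alv n)" "IC ph0 (alv n)" "MATok (alv n)" "BO (alv n)"
proof -
  have m: "\<And>i. al 2 i \<noteq> 0 \<or> al 3 i \<noteq> 0 ==> i < n" "RV al" "IC ph0 al" "MATok al" "BO al" using M(1) by (auto simp: MInv_def)
  show "VECok v (alv n)" using m(1) by (force simp: VECok_def alv_def)
  show "alv n 3 = (%_. 0)" using m(1) by (force simp: alv_def fun_eq_iff)
  show 4: "alv n 4 = al 4" by (simp add: alv_def)
  show "alv n 0 = al 0" "alv n 1 = al 1" by (simp_all add: alv_def)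
  show "RV (alv n)" using m(2) by (auto simp: RV_def alv_def)
  show "IC ph0 (alv n)" using m(3) by (simp add: IC_def alv_def)
  show "MATok (alv n)" using m(4) by (simp add: MATok_def alv_def)
  show "BO (alv n)" using m(5) BO_cong[of "alv n" al] 4 by simp
qed

definition LB :: "nat => (nat => nat) => (nat => nat => nat) => bool" where
  "LB b sg al' \<longleftrightarrow> par sg \<and> sg 11 = 5 \<and> sg 12 = ph0 + b * r \<and> sg 13 \<le> n \<and> al' 0 = al 0 \<and> al' 1 = al 1 \<and> al' 2 = alv n 2 \<and> al' 4 = al 4 \<and>
     RV al' \<and> IC (ph0 + b * r) al' \<and> (\<forall>i. al' 3 i \<noteq> 0 --> i < n)"

lemma LB_BP:
  assumes "LB b sg al'" "b < g * g" "sg 14 = b"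
  shows "BP b sg al'"
proof -
  have "Suc b * r \<le> g * g * r" using assms(2) by (intro mult_le_mono1) simp
  then have "ph0 + (b * r + r) < q" by (intro ph_lt) simp
  moreover have "MATok al'" using assms(1) M(1) by (simp add: LB_def MInv_def MATok_def)
  moreover have "BO al'" using assms(1) M(1) BO_cong[of al' al] by (auto simp: LB_def MInv_def)
  ultimately show ?thesis using assms unfolding LB_def BP_def by auto
qed

lemma LB_step:
  assumes "LB b sg al'" "b < g * g" "sg 14 = b"
  shows "hsure W inp blk sg al' z (%t sg' al'' z'. sg' 14 = b \<and> sg' 6 = g * g \<and> LB (Suc b) (sg'(14 := Suc b)) al'' \<and>
     t + sg 13 * BT \<le> PT + 80 + sg' 13 * BT \<and> z' = z)"
proof (rule hsure_mono[OF blk_sure[OF LB_BP[OF assms]]], elim conjE)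
  fix t sg' al'' z' assume q: "BQ b sg al' t sg' al''" "z' = z"
  then show "sg' 14 = b \<and> sg' 6 = g * g \<and> LB (Suc b) (sg'(14 := Suc b)) al'' \<and> t + sg 13 * BT \<le> PT + 80 + sg' 13 * BT \<and> z' = z"
    using assms(1) unfolding BQ_def LB_def par_def by (auto simp: algebra_simps)
qed

context
  fixes sg :: "nat => nat"
  assumes s: "par sg" "sg 11 = 5" "sg 12 = ph0" "sg 13 = 0"
begin

lemma LB_init: "LB 0 (sg(14 := 0)) (alv n)"
  using s alv_facts unfolding LB_def par_def by auto

lemma blocks_sure:
  "hsure W inp (For 14 6 blk) sg (alv n) z (%t sg' al' z'. t \<le> g * g * (PT + 88) + n * BT + 6 \<and> LB (g * g) sg' al' \<and> z' = z)"
proof (rule hsure_For[where n="g * g" and Inv="%b t sg' al' z'. t \<le> b * (PT + 88) + sg' 13 * BT \<and> LB b sg' al' \<and> z' = z"])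
  fix b t sg' al' z' assume a: "b < g * g" "t \<le> b * (PT + 88) + sg' 13 * BT \<and> LB b sg' al' \<and> z' = z" "sg' 14 = b"
  have "hsure W inp blk sg' al' z (%t sg'' al'' z'. sg'' 14 = b \<and> sg'' 6 = g * g \<and> LB (Suc b) (sg''(14 := Suc b)) al'' \<and>
     t + sg' 13 * BT \<le> PT + 80 + sg'' 13 * BT \<and> z' = z)" by (rule LB_step) (use a in auto)
  then show "hsure W inp blk sg' al' z' (%t' sg'' al'' z''. sg'' 14 = b \<and> sg'' 6 = g * g \<and>
     t + t' + 8 \<le> Suc b * (PT + 88) + (sg''(14 := Suc b)) 13 * BT \<and> LB (Suc b) (sg''(14 := Suc b)) al'' \<and> z'' = z)"
    using a(2) by (auto elim!: hsure_mono)
next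
  fix t sg' al' z' assume a: "t \<le> g * g * (PT + 88) + sg' 13 * BT \<and> LB (g * g) sg' al' \<and> z' = z"
  then have "sg' 13 * BT \<le> n * BT" by (simp add: LB_def)
  then show "t + 6 \<le> g * g * (PT + 88) + n * BT + 6 \<and> LB (g * g) sg' al' \<and> z' = z" using a by linarith
qed (use s LB_init qW[OF q_facts(5)] one_lt_W in \<open>auto simp: par_def\<close>)

text \<open>Union bound in the form of a supermartingale: the indicator of having left the
  error-free run plus the error bounds of the blocks to come.\<close>

lemma blocks_hew:
  "hew W inp (For 14 6 blk) sg (alv n) z (%sg' al' z'. of_bool (\<not> Good v (g * g) sg' al')) (\<Sum>b<g * g. eps v b al)"
proof -
  let ?F = "%b sg' al' (z'::nat list). of_bool (\<not> Good v b sg' al') + (\<Sum>b'=b..<g * g. eps v b' al)"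
  have g0: "Good v 0 (sg(14 := 0)) (alv n)" using s alv_facts(2) by (auto simp: Good_def ex_def)
  have "hew W inp (For 14 6 blk) sg (alv n) z (?F (g * g)) (\<Sum>b<g * g. eps v b al)"
  proof (rule hew_For[where n="g * g" and Inv="%b sg' al' z'. LB b sg' al' \<and> z' = z" and F="?F"])
    fix b sg' al' z' assume a: "b < g * g" "LB b sg' al' \<and> z' = z" "sg' 14 = b"
    have l: "LB b sg' al'" using a by simp
    have st: "hsure W inp blk sg' al' z (%t sg'' al'' z'. sg'' 14 = b \<and> sg'' 6 = g * g \<and> LB (Suc b) (sg''(14 := Suc b)) al'' \<and>
       t + sg' 13 * BT \<le> PT + 80 + sg'' 13 * BT \<and> z' = z)" by (rule LB_step[OF l a(1,3)])
    then show "hsure W inp blk sg' al' z' (%t' sg'' al'' z''. sg'' 14 = b \<and> sg'' 6 = g * g \<and> LB (Suc b) (sg''(14 := Suc b)) al'' \<and> z'' = z)"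
      using a(2) by (auto elim!: hsure_mono)
    let ?S = "\<Sum>b'=Suc b..<g * g. eps v b' al"
    have S: "(\<Sum>b'=b..<g * g. eps v b' al) = eps v b al + ?S" using a(1) by (simp add: sum.atLeast_Suc_lessThan)
    have G: "Good v c (sg''(14 := d)) al'' = Good v c sg'' al''" for c d sg'' al'' by (simp add: Good_def)
    have "hew W inp blk sg' al' z (%sg'' al'' z'. of_bool (\<not> Good v (Suc b) sg'' al'')) (of_bool (\<not> Good v b sg' al') + eps v b al)"
    proof (cases "Good v b sg' al'")
      case True
      have vec: "VECok v al'" using l alv_facts(1) by (simp add: LB_def VECok_def)
      have "eps v b al' = eps v b al" using l by (intro eps_cong) (simp add: LB_def)
      then show ?thesis using blk_hew[OF LB_BP[OF l a(1,3)] vec True, of inp z] True by simp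
    next
      case False
      then show ?thesis by (intro hew_sure[OF st]) (auto simp: add_increasing2)
    qed
    from hew_add_const[OF this, of ?S]
    show "hew W inp blk sg' al' z' (%sg''. ?F (Suc b) (sg''(14 := Suc b))) (?F b sg' al' z')"
      unfolding G S using a(2) by (simp add: add.assoc)
  qed (use s LB_init g0 qW[OF q_facts(5)] one_lt_W in \<open>auto simp: par_def lessThan_atLeast0\<close>)
  then show ?thesis by simp
qed

end

lemma outv_loop:
  assumes "LB (g * g) sg al'"
  shows "hsure W inp (For 14 0 outv) sg al' [] (%t sg' al'' z'. t \<le> 30 * n + 6 \<and> agr 13 sg sg' \<and> al'' = al' \<and> z' = map (al' 3) [0..<n])"
proof (rule hsure_For[where n=n and Inv="%x t sg' al'' z'. t \<le> 30 * x \<and> agr 13 sg sg' \<and> al'' = al' \<and> z' = map (al' 3) [0..<x]"])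
  fix x t sg' al'' z' assume a: "x < n" "t \<le> 30 * x \<and> agr 13 sg sg' \<and> al'' = al' \<and> z' = map (al' 3) [0..<x]" "sg' 14 = x" "sg' 0 = n"
  have "x < q" using a(1) q_facts(1) by simp
  have "al' 3 x < q" using assms q2 by (auto simp: LB_def RV_def intro: le_less_trans)
  then show "hsure W inp outv sg' al'' z' (%t' sg'' al'' z''. sg'' 14 = x \<and> sg'' 0 = n \<and> t + t' + 8 \<le> 30 * Suc x \<and> agr 13 sg (sg''(14 := Suc x)) \<and> al'' = al' \<and> z'' = map (al' 3) [0..<Suc x])"
    unfolding outv_def using a \<open>x < q\<close> q_consts(9)
    by (intro hrules) auto
qed (use assms qW[OF q_facts(1)] one_lt_W in \<open>auto simp: par_def LB_def\<close>)

text \<open>After the last block, \<open>b div g = g\<close> exceeds the block row of every index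
  below \<open>n\<close>, so all columns of every row have been examined.\<close>

lemma enc: "Good v (g * g) sg al' ==> map (al' 3) [0..<n] = encode_vec n (bool_mult n M v)"
proof -
  assume G: "Good v (g * g) sg al'"
  have "ex v (g * g) i \<longleftrightarrow> bool_mult n M v i" if "i < n" for i
  proof -
    have "i < g * k" using that n_lt_gk by simp
    then have "i div k < g" by (rule less_mult_imp_div_less)
    then show ?thesis using that g_pos by (auto simp: ex_def bool_mult_def MM_def)
  qed
  then show ?thesis using G by (auto simp: encode_vec_def Good_def)
qed

lemma mult_pre:
  "hsure W inp (aload 0 0 (C 0) ;; params ;; aload 12 0 (C 1) ;; assign 11 (C 5) ;; For 14 0 readv ;; assign 13 (C 0)) (%_. 0) al []
    (%t sg al' z. t \<le> 80 * n + 200 \<and> par sg \<and> sg 11 = 5 \<and> sg 12 = ph0 \<and> sg 13 = 0 \<and> al' = alv n \<and> z = [])"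
proof -
  have m: "al 0 0 = n" "al 0 (Suc 0) = ph0" using M(1) by (auto simp: MInv_def)
  show ?thesis
    apply (rule hsure_Seq, rule hsure_aload, rule sb, simp add: q_consts, simp, simp, simp)
    apply (rule hsure_Seq, rule hsure_mono, rule hsure_params, simp add: m)
    apply (elim conjE, hypsubst)
    apply (rule hsure_Seq, rule hsure_aload, rule sb, simp add: q_consts, simp, simp, simp)
    apply (rule hsure_Seq, rule hsure_assign, rule sb, simp add: q_consts, simp, simp)
    apply (rule hsure_Seq, rule hsure_mono, rule readv_loop, simp add: par_def)
    apply (elim conjE, hypsubst)
    apply (rule hsure_assign, rule sb, simp add: q_consts, simp, simp)
    apply (simp add: m agr_def par_def)
    done
qed

lemma multc_eq: "hsure W inp ((aload 0 0 (C 0) ;; params ;; aload 12 0 (C 1) ;; assign 11 (C 5) ;; For 14 0 readv ;; assign 13 (C 0)) ;;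
   (For 14 6 blk ;; For 14 0 outv ;; astore 0 (C 1) (V 12))) sg al' z Q ==> hsure W inp multc sg al' z Q"
  "hew W inp ((aload 0 0 (C 0) ;; params ;; aload 12 0 (C 1) ;; assign 11 (C 5) ;; For 14 0 readv ;; assign 13 (C 0)) ;;
   (For 14 6 blk ;; For 14 0 outv ;; astore 0 (C 1) (V 12))) sg al' z f x ==> hew W inp multc sg al' z f x"
  unfolding multc_def by (drule hsure_assoc6, assumption) (drule hew_assoc6, assumption)

lemma mult_post:
  assumes "LB (g * g) sg al'"
  shows "hsure W inp (For 14 0 outv ;; astore 0 (C 1) (V 12)) sg al' []
    (%t sg' al'' z. t \<le> 30 * n + 50 \<and> MInv (Suc T) al'' \<and> al'' 4 = al 4 \<and> z = map (al' 3) [0..<n])"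
proof (rule hsure_Seq, rule hsure_mono[OF outv_loop[OF assms]], clarify)
  fix t sg' assume t: "t \<le> 30 * n + 6" "agr 13 sg sg'"
  have e: "sg' 12 = ph0 + g * g * r" using t(2) assms by (auto simp: agr_def LB_def)
  have q: "sg' 12 < q" unfolding e by (rule ph_lt) simp
  let ?a = "al'(0 := (al' 0)(1 := sg' 12))"
  have l: "al' 0 = al 0" "al' 1 = al 1" "al' 2 = alv n 2" "al' 4 = al 4" "RV al'" "IC (ph0 + g * g * r) al'" "\<And>i. al' 3 i \<noteq> 0 ==> i < n"
    using assms by (auto simp: LB_def)
  have m: "al 0 0 = n" "MATok al" "BO al" "\<And>i. al 2 i \<noteq> 0 \<or> al 3 i \<noteq> 0 ==> i < n" using M(1) by (auto simp: MInv_def)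
  have "MATok ?a" using m(2) l(2) by (simp add: MATok_def)
  moreover have "BO ?a" using m(3) l(4) BO_cong[of ?a al] by simp
  moreover have "RV ?a" using l(5) by (simp add: RV_def)
  moreover have "IC (Suc T * (g * g * r)) ?a" using l(6) by (simp add: IC_def add.commute)
  moreover have "?a 2 i \<noteq> 0 \<or> ?a 3 i \<noteq> 0 ==> i < n" for i
    using l(3,7) m(4) by (auto simp: alv_def split: if_splits)
  ultimately have "MInv (Suc T) ?a"
    using l(1) m(1) e unfolding MInv_def by (simp add: add.commute)
  then show "hsure W inp (astore 0 (C 1) (V 12)) sg' al' (map (al' 3) [0..<n])
     (%t' sg' al'' z. t + t' \<le> 30 * n + 50 \<and> MInv (Suc T) al'' \<and> al'' 4 = al 4 \<and> z = map (al' 3) [0..<n])"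
    using t(1) q q2 assms q_consts(9) by (intro hsure_astore sb) (auto simp: LB_def)
qed

lemma mult_sure:
  "hsure W inp multc (%_. 0) al [] (%t sg' al' z'. t \<le> MT \<and> MInv (Suc T) al' \<and> al' 4 = al 4)"
proof (rule multc_eq(1), rule hsure_Seq, rule hsure_mono[OF mult_pre], clarify, rule hsure_Seq,
    rule hsure_mono[OF blocks_sure], assumption+, clarify, rule hsure_mono[OF mult_post], assumption, clarify)
qed (auto simp: MT_def)

lemma mult_hew:
  "hew W inp multc (%_. 0) al [] (%sg' al' z'. of_bool (z' \<noteq> encode_vec n (bool_mult n M v))) (\<Sum>b<g * g. eps v b al)"
proof (rule multc_eq(2), rule hew_Seq_det, rule hsure_mono[OF mult_pre], clarify)
  fix t sg assume s: "par sg" "sg 11 = 5" "sg 12 = ph0" "sg 13 = 0"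
  show "hew W inp (For 14 6 blk ;; For 14 0 outv ;; astore 0 (C 1) (V 12)) sg (alv n) []
     (%sg' al' z'. of_bool (z' \<noteq> encode_vec n (bool_mult n M v))) (\<Sum>b<g * g. eps v b al)"
  proof (rule hew_Seq[OF blocks_sure[OF s] _ blocks_hew[OF s]], clarify)
    fix t sg' al' assume l: "LB (g * g) sg' al'"
    show "hew W inp (For 14 0 outv ;; astore 0 (C 1) (V 12)) sg' al' [] (%sg' al' z'. of_bool (z' \<noteq> encode_vec n (bool_mult n M v)))
       (of_bool (\<not> Good v (g * g) sg' al'))"
      by (rule hew_sure[OF mult_post[OF l]]) (use enc in auto)
  qed
qed

end

end

subsection \<open>Preprocessing\<close>

lemma nth_concat_regular:
  assumes "\<And>i. i < m ==> length (f i) = L" "x < m * L"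
  shows "concat (map f [0..<m]) ! x = f (x div L) ! (x mod L)"
  using assms
proof (induction m)
  case (Suc m)
  have len: "length (concat (map f [0..<m])) = m * L" using Suc.prems(1)
    by (simp add: length_concat o_def sum_list_sum_nth)
  have L: "0 < L" using Suc.prems(2) by (cases L) auto
  show ?case
  proof (cases "x < m * L")
    case True
    then show ?thesis using Suc len by (simp add: nth_append)
  next
    case False
    then have x: "x = m * L + (x - m * L)" "x - m * L < L" using Suc.prems(2) by auto
    then have "x div L = m" "x mod L = x - m * L" using L by (metis div_mult_self3 add.commute div_less plus_nat.add_0 neq0_conv, metis mod_mult_self3 mod_less)
    then show ?thesis using False len by (simp add: nth_append)
  qed
qed simp

lemma nth_concat_pairs:
  assumes "i < length es"
  shows "concat (map (%(u, v). [u, v]) es) ! (2 * i) = fst (es ! i)"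
    and "concat (map (%(u, v). [u, v]) es) ! Suc (2 * i) = snd (es ! i)"
  using assms by (induction es arbitrary: i) (auto simp: nth_Cons split: nat.splits prod.splits)

lemma length_concat_pairs: "length (concat (map (%(u, v). [u, v]) es)) = 2 * length es"
  by (induction es) auto

lemma length_tedges: "length (tedges tms k M) = k * k * length tms"
  by (simp add: tedges_def length_concat o_def sum_list_sum_nth)

lemma nth_tedges: "x < k * k ==> h < length tms ==> tedges tms k M ! (x * length tms + h) = tedge k M x (tms ! h)"
proof -
  assume a: "x < k * k" "h < length tms"
  have "x * length tms + h < Suc x * length tms" using a(2) by simp
  also have "\<dots> \<le> k * k * length tms" using a(1) by (intro mult_le_mono1) simp
  finally have "x * length tms + h < k * k * length tms" .
  moreover have "(x * length tms + h) div length tms = x" using a(2) by (intro div_nat_eqI) auto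
  ultimately show ?thesis unfolding tedges_def using a(2)
    by (subst nth_concat_regular[where L="length tms"]) auto
qed

lemma hew_sum:
  assumes "finite I" "\<And>i. i \<in> I ==> hew w inp c sg al z (f i) (b i)"
  shows "hew w inp c sg al z (%sg al z. \<Sum>i\<in>I. f i sg al z) (\<Sum>i\<in>I. b i)"
  unfolding hew_def
proof (intro allI impI)
  fix s assume s: "rg s = sg \<and> ar s = al \<and> out s = z"
  have "ew w inp c s (%s'. \<Sum>i\<in>I. f i (rg s') (ar s') (out s')) = (\<Sum>i\<in>I. ew w inp c s (%s'. f i (rg s') (ar s') (out s')))"
    unfolding ew_def by (rule nn_integral_sum) simp
  also have "\<dots> \<le> (\<Sum>i\<in>I. b i)" using assms(2) s by (intro sum_mono) (auto simp: hew_def)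
  finally show "ew w inp c s (%s'. \<Sum>i\<in>I. f i (rg s') (ar s') (out s')) \<le> (\<Sum>i\<in>I. b i)" .
qed

context runl
begin

lemma length_pinp: "length (pinp k N) = rt + 2 + 2 * length tms * (k * k)"
  by (simp add: pinp_def length_concat_pairs length_tedges)

lemma nth_pinp:
  assumes "x < k * k" "h < length tms"
  shows "pinp k N ! (rt + 2 + 2 * (x * length tms + h)) = fst (tedge k N x (tms ! h))"
    and "pinp k N ! Suc (rt + 2 + 2 * (x * length tms + h)) = snd (tedge k N x (tms ! h))"
proof -
  have "x * length tms + h < Suc x * length tms" using assms(2) by simp
  also have "\<dots> \<le> k * k * length tms" using assms(1) by (intro mult_le_mono1) simp
  finally have i: "x * length tms + h < length (tedges tms k N)" by (simp add: length_tedges)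
  note e = nth_concat_pairs[OF i, unfolded nth_tedges[OF assms]]
  show "pinp k N ! (rt + 2 + 2 * (x * length tms + h)) = fst (tedge k N x (tms ! h))"
    using e(1) by (simp add: pinp_def nth_append)
  show "pinp k N ! Suc (rt + 2 + 2 * (x * length tms + h)) = snd (tedge k N x (tms ! h))"
    using e(2) by (simp add: pinp_def nth_append)
qed

lemma pinp_lt: "length (pinp k N) < q"
proof -
  let ?L = "length tms"
  have "2 * ?L * (k * k) \<le> 2 ^ (2 * ?L) * 2 ^ (lg + lg)"
    using less_exp[of "2 * ?L"] pow_prod_le[OF k_le k_le] by (intro mult_le_mono) linarith+
  also have "\<dots> = 2 ^ (2 * ?L + (lg + lg))" by (simp only: power_add)
  finally have 1: "2 * ?L * (k * k) \<le> 2 ^ (2 * ?L + (lg + lg))" .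
  have "1 \<le> (2::nat) ^ (2 * ?L + (lg + lg))" by simp
  then have "rt + 2 + 2 * ?L * (k * k) \<le> 4 * 2 ^ (2 * ?L + (lg + lg))" using 1 rt by linarith
  also have "\<dots> = 2 ^ (2 + (2 * ?L + (lg + lg)))" by (simp only: power_add) simp
  also have "\<dots> < q"
  proof (rule q_le)
    have "(2 * ?L + 100) * (lg + 1) \<le> Qc * (lg + 1)" by (intro mult_le_mono1) (simp add: Qc_def)
    then show "2 + (2 * ?L + (lg + lg)) < Qc * (lg + 1)" by (simp add: algebra_simps)
  qed
  finally show ?thesis by (simp add: length_pinp)
qed

definition bufok :: "(nat => nat => bool) => (nat => nat => nat) => nat => bool" where
  "bufok N al m \<longleftrightarrow> (\<forall>p<m. al 7 p = pinp k N ! p)"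

abbreviation "pos x h \<equiv> rt + 2 + 2 * (x * length tms + h)"

context
  fixes N :: "nat => nat => bool" and sg :: "nat => nat" and x :: nat
  assumes e: "sg 28 = x" "x < k * k" "sg 30 = x div k" "sg 31 = x mod k" "sg 29 = of_bool (N (x div k) (x mod k))" "sg 4 = k * k"
begin

lemma xq: "x < q" "x div k < q" "x mod k < q" "k * k < q" "sg 29 < q"
  using e(2) q_facts(3) q2 le_less_trans[OF div_le_dividend, of x q k] le_less_trans[OF mod_less_eq_dividend, of x q k] by (auto simp: e(5))

lemma emit1_sure:
  assumes "h < length tms" "a < NA" "b < NA"
  shows "hsure W inp (emit1 h (a, s, b, t)) sg al z (%tt sg' al' z'. tt \<le> 80 \<and> sg' = sg \<and> z' = z \<and>
    al' = al(7 := (al 7)(pos x h := fst (tev k x (a, s, b, t)), Suc (pos x h) := snd (tev k x (a, s, b, t)))))"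
proof -
  have sx: "small q sg (sexp s)" "deg (sexp s) = 1" "nv sg (sexp s) = selv k x s" "ecost (sexp s) = 1" for s
    using xq e q_consts(9)[of 0] by (cases s; simp)+
  have ax: "small q sg (aexp h d)" "deg (aexp h d) = 5" "nv sg (aexp h d) = pos x h + d" "ecost (aexp h d) = 9" if "d \<le> 1" for d
    using that xq(1) e(1) assms(1) q_consts by (auto simp: aexp_def algebra_simps le_Suc_eq)
  have c: "a < q" "b < q" "8 < q" "7 < q" using assms q_consts by auto
  show ?thesis unfolding emit1.simps
    apply (rule hsure_Seq, rule hsure_astore)
    apply (rule sb, simp add: ax c, simp add: ax)
    apply (rule sb, simp add: sx c xq e, simp add: sx, simp)
    apply (rule hsure_astore)
    apply (rule sb, simp add: ax c, simp add: ax)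
    apply (rule sb, simp add: sx c xq e, simp add: sx, simp)
    apply (simp add: ax sx e)
    done
qed

lemma emit_sure:
  assumes "h < length tms" "tms ! h = \<tau>"
  shows "hsure W inp (emit h \<tau>) sg al z (%tt sg' al' z'. tt \<le> 90 \<and> sg' = sg \<and> z' = z \<and>
    al' = al(7 := (al 7)(pos x h := fst (tedge k N x \<tau>), Suc (pos x h) := snd (tedge k N x \<tau>))))"
proof -
  obtain c e1 e2 where t: "\<tau> = (c, e1, e2)" by (cases \<tau>) auto
  obtain a1 s1 b1 t1 where e1: "e1 = (a1, s1, b1, t1)" by (cases e1) auto
  obtain a2 s2 b2 t2 where e2: "e2 = (a2, s2, b2, t2)" by (cases e2) auto
  have "(c, (a1, s1, b1, t1), (a2, s2, b2, t2)) \<in> set tms" using assms t e1 e2 nth_mem by metis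
  from tms[OF this] have l: "a1 < NA" "b1 < NA" "a2 < NA" "b2 < NA" by auto
  have cx: "small q sg (cexp c)" "deg (cexp c) = 1" "nv sg (cexp c) \<noteq> 0 \<longleftrightarrow> cndv k N x c" "ecost (cexp c) \<le> 3"
    using xq e q_consts(9) by (cases c; simp)+
  show ?thesis unfolding t emit.simps
  proof (rule hsure_ife)
    show "bnd (2 ^ W) sg (cexp c)" by (rule sb) (use cx in auto)
    assume "nv sg (cexp c) \<noteq> 0"
    then have "tedge k N x (c, e1, e2) = tev k x e1" using cx(3) by simp
    then show "hsure W inp (emit1 h e1) sg al z (%tt sg' al' z'. tt + ecost (cexp c) + 1 \<le> 90 \<and> sg' = sg \<and> z' = z \<and>
      al' = al(7 := (al 7)(pos x h := fst (tedge k N x (c, e1, e2)), Suc (pos x h) := snd (tedge k N x (c, e1, e2)))))"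
      unfolding e1 using cx(4) by (intro hsure_mono[OF emit1_sure[OF assms(1) l(1,2)]]) auto
  next
    assume "nv sg (cexp c) = 0"
    then have "tedge k N x (c, e1, e2) = tev k x e2" using cx(3) by simp
    then show "hsure W inp (emit1 h e2) sg al z (%tt sg' al' z'. tt + ecost (cexp c) + 1 \<le> 90 \<and> sg' = sg \<and> z' = z \<and>
      al' = al(7 := (al 7)(pos x h := fst (tedge k N x (c, e1, e2)), Suc (pos x h) := snd (tedge k N x (c, e1, e2)))))"
      unfolding e2 using cx(4) by (intro hsure_mono[OF emit1_sure[OF assms(1) l(3,4)]]) auto
  qed
qed

text \<open>The buffer is filled from left to right, so correctness up to the current position is
  preserved when the next two words are written.\<close>

lemma emits_sure:
  assumes "drop h tms = ts" "h \<le> length tms" "bufok N al (pos x h)"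
  shows "hsure W inp (emits h ts) sg al z (%tt sg' al' z'. tt \<le> 90 * length ts + 1 \<and> sg' = sg \<and> z' = z \<and>
    (\<exists>f. al' = al(7 := f)) \<and> bufok N al' (pos x (length tms)))"
  using assms
proof (induction ts arbitrary: h al)
  case Nil
  then have "h = length tms" by simp
  then show ?case using Nil by (auto intro!: hsure_Skip exI[of _ "al 7"])
next
  case (Cons \<tau> ts)
  have h: "h < length tms" using Cons.prems(1) by (cases "h < length tms") auto
  then have n: "tms ! h = \<tau>" "drop (Suc h) tms = ts"
    using Cons.prems(1) by (auto simp: Cons_nth_drop_Suc[symmetric])
  let ?a = "al(7 := (al 7)(pos x h := fst (tedge k N x \<tau>), Suc (pos x h) := snd (tedge k N x \<tau>)))"
  have b: "bufok N ?a (pos x (Suc h))"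
    unfolding bufok_def
  proof (intro allI impI)
    fix p assume "p < pos x (Suc h)"
    then consider "p < pos x h" | "p = pos x h" | "p = Suc (pos x h)" by fastforce
    then show "?a 7 p = pinp k N ! p"
    proof cases
      case 1 then show ?thesis using Cons.prems(3) by (auto simp: bufok_def)
    next
      case 2 then show ?thesis using nth_pinp(1)[OF e(2) h, of N] n(1) by simp
    next
      case 3 then show ?thesis using nth_pinp(2)[OF e(2) h, of N] n(1) by simp
    qed
  qed
  show ?case unfolding emits.simps
  proof (rule hsure_Seq, rule hsure_mono[OF emit_sure[OF h n(1)]], elim conjE)
    fix t1 :: nat and sg1 al1 z1 assume a: "t1 \<le> 90" "sg1 = sg" "z1 = z" "al1 = ?a"
    show "hsure W inp (emits (Suc h) ts) sg1 al1 z1 (%t' sg' al' z'. t1 + t' \<le> 90 * length (\<tau> # ts) + 1 \<and> sg' = sg \<and> z' = z \<and>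
      (\<exists>f. al' = al(7 := f)) \<and> bufok N al' (pos x (length tms)))"
      unfolding a(2-4)
    proof (rule hsure_mono[OF Cons.IH[OF n(2) _ b]])
      show "Suc h \<le> length tms" using h by simp
      fix t' sg' al' z'
      assume i: "t' \<le> 90 * length ts + 1 \<and> sg' = sg \<and> z' = z \<and> (\<exists>f. al' = ?a(7 := f)) \<and> bufok N al' (pos x (length tms))"
      then obtain f where "al' = ?a(7 := f)" by blast
      then have "al' = al(7 := f)" by (simp only: fun_upd_upd)
      then show "t1 + t' \<le> 90 * length (\<tau> # ts) + 1 \<and> sg' = sg \<and> z' = z \<and> (\<exists>f. al' = al(7 := f)) \<and> bufok N al' (pos x (length tms))"
        using i a(1) by auto
    qed
  qed
qed

end

definition KT :: nat where "KT = 90 * length tms + 100"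

lemma build_loop:
  assumes p: "par sg" "sg 15 = b div g" "sg 16 = b mod g" "b < g * g" "MATok al" "RV al" "bufok (bM b) al (rt + 2)"
  shows "hsure W inp (For 28 4 build) sg al z (%t sg' al' z'. t \<le> k * k * KT + 6 \<and> agr 25 sg sg' \<and> (\<exists>f. al' = al(7 := f)) \<and>
     bufok (bM b) al' (length (pinp k (bM b))) \<and> z' = z)"
proof (rule hsure_For[where n="k * k" and Inv="%x T sg' al' z'. T \<le> x * KT \<and> agr 25 sg sg' \<and> (\<exists>f. al' = al(7 := f)) \<and> bufok (bM b) al' (pos x 0) \<and> z' = z"])
  fix x T sg' al' z'
  assume a: "x < k * k" "T \<le> x * KT \<and> agr 25 sg sg' \<and> (\<exists>f. al' = al(7 := f)) \<and> bufok (bM b) al' (pos x 0) \<and> z' = z" "sg' 28 = x" "sg' 4 = k * k"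
  then obtain f where f: "al' = al(7 := f)" by blast
  have e: "sg' 3 = k" "sg' 10 = g * k" "sg' 15 = b div g" "sg' 16 = b mod g" using a(2) p by (auto simp: agr_def par_def)
  have I: "b div g < g" using p(4) by (simp add: less_mult_imp_div_less)
  have J: "b mod g < g" using g_pos by simp
  have d: "x div k < k" "x mod k < k" using a(1) k_pos by (simp_all add: less_mult_imp_div_less)
  have q: "x < q" "k < q" "g * k < q" "b div g < q" "b mod g < q" "x div k < q" "x mod k < q"
    using a(1) I J d q_facts(2,3,4,8) by linarith+
  have lt: "A * k + i < g * k" if "A < g" "i < k" for A i
  proof -
    have "A * k + i < Suc A * k" using that by simp
    also have "\<dots> \<le> g * k" using that by (intro mult_le_mono1) simp
    finally show ?thesis .
  qed
  let ?R = "(b div g * k + x div k) * (g * k) + (b mod g * k + x mod k)"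
  have m: "al 1 ?R = of_bool (bM b (x div k) (x mod k))"
    using p(5) lt[OF I d(1)] lt[OF J d(2)] by (simp add: MATok_def bM_def)
  let ?s = "sg'(30 := x div k, 31 := x mod k, 29 := of_bool (bM b (x div k) (x mod k)))"
  have pre: "hsure W inp (assign 30 (B Div (V 28) (V 3)) ;; assign 31 (B Mod (V 28) (V 3)) ;; aload 29 1 mexp) sg' al' z'
     (%t sg'' al'' z''. t \<le> 50 \<and> sg'' = ?s \<and> al'' = al' \<and> z'' = z')"
    using q e a(3) m f q_consts(9) by (intro hrules) (auto simp: mexp_def)
  show "hsure W inp build sg' al' z' (%t sg'' al'' z''. sg'' 28 = x \<and> sg'' 4 = k * k \<and> T + t + 8 \<le> Suc x * KT \<and> agr 25 sg (sg''(28 := Suc x)) \<and>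
      (\<exists>f. al'' = al(7 := f)) \<and> bufok (bM b) al'' (pos (Suc x) 0) \<and> z'' = z)"
    unfolding build_def
  proof (rule hsure_assoc3, rule hsure_Seq, rule hsure_mono[OF pre], elim conjE)
    fix t1 :: nat and sg1 al1 z1 assume b: "t1 \<le> 50" "sg1 = ?s" "al1 = al'" "z1 = z'"
    have "hsure W inp (emits 0 tms) ?s al' z' (%tt sg' al'' z'. tt \<le> 90 * length tms + 1 \<and> sg' = ?s \<and> z' = z \<and>
      (\<exists>f. al'' = al'(7 := f)) \<and> bufok (bM b) al'' (pos x (length tms)))"
      using emits_sure[of ?s x "bM b" 0 tms al' inp z'] a d by simp
    then show "hsure W inp (emits 0 tms) sg1 al1 z1 (%t sg'' al'' z''. sg'' 28 = x \<and> sg'' 4 = k * k \<and> T + (t1 + t) + 8 \<le> Suc x * KT \<and> agr 25 sg (sg''(28 := Suc x)) \<and>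
      (\<exists>f. al'' = al(7 := f)) \<and> bufok (bM b) al'' (pos (Suc x) 0) \<and> z'' = z)"
      unfolding b(2-4)
    proof (rule hsure_mono, elim conjE exE)
      fix t2 sg2 al2 z2 f2
      assume h: "t2 \<le> 90 * length tms + 1" "sg2 = ?s" "z2 = z" "al2 = al'(7 := f2)" "bufok (bM b) al2 (pos x (length tms))"
      have "T + (t1 + t2) + 8 \<le> Suc x * KT" using h(1) b(1) a(2) by (simp add: KT_def)
      moreover have "al2 = al(7 := f2)" using h(4) f by simp
      moreover have "bufok (bM b) al2 (pos (Suc x) 0)" using h(5) by (simp add: add.commute)
      ultimately show "sg2 28 = x \<and> sg2 4 = k * k \<and> T + (t1 + t2) + 8 \<le> Suc x * KT \<and> agr 25 sg (sg2(28 := Suc x)) \<and>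
        (\<exists>f. al2 = al(7 := f)) \<and> bufok (bM b) al2 (pos (Suc x) 0) \<and> z2 = z"
        using h(2,3) a by auto
    qed
  qed
next
  fix T sg' al' z'
  assume a: "T \<le> k * k * KT \<and> agr 25 sg sg' \<and> (\<exists>f. al' = al(7 := f)) \<and> bufok (bM b) al' (pos (k * k) 0) \<and> z' = z"
  have "pos (k * k) 0 = length (pinp k (bM b))" by (simp add: length_pinp algebra_simps)
  then show "T + 6 \<le> k * k * KT + 6 \<and> agr 25 sg sg' \<and> (\<exists>f. al' = al(7 := f)) \<and> bufok (bM b) al' (length (pinp k (bM b))) \<and> z' = z"
    using a by simp
qed (use p qW[OF q_facts(3)] one_lt_W in \<open>auto simp: par_def intro!: exI[of _ "al 7"]\<close>)

definition IT :: nat where "IT = k * k * KT + 12 * Bp k + bd + 300"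

text \<open>Copies are preprocessed in order. The regions from copy \<open>idx\<close> on are still
  zero, so each copy starts from the empty memory that the dynamic algorithm expects, uninfluenced
  by earlier copies.\<close>

definition PV :: "nat => (nat => nat) => (nat => nat => nat) => bool" where
  "PV idx sg al \<longleftrightarrow> par sg \<and> sg 11 = 4 \<and> sg 12 = 0 \<and> sg 13 = g * g * r \<and> al 0 = (%_. 0)(0 := n) \<and> MATok al \<and> RV al \<and>
     al 2 = (%_. 0) \<and> al 3 = (%_. 0) \<and> al 5 = (%_. 0) \<and> al 6 = (%_. 0) \<and> (\<forall>i. al 4 i < 2 ^ w) \<and> (\<forall>i\<ge>idx * 2 ^ w. al 4 i = 0) \<and>
     (\<forall>c<idx. \<forall>u v. stm w (rest k u v 0) (bmem al c) (Bs k))"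

abbreviation "D0 b \<equiv> exec w (pinp k (bM b)) cpre (ini (%_. 0))"

context
  fixes idx sg al b
  assumes pv: "PV idx sg al" "idx < g * g * r" "sg 14 = idx" "b = idx div r"
begin

lemma inst_b: "b < g * g"
  using pv(2,4) by (simp add: less_mult_imp_div_less)

lemma inst_q: "idx * 2 ^ w + 2 ^ w < q"
proof -
  have "idx * 2 ^ w + 2 ^ w \<le> g * g * r * 2 ^ w + 2 ^ w" using pv(2) by simp
  then show ?thesis using q_facts(12) by linarith
qed

definition CS :: "(nat => nat) => (nat => nat => nat) => bool" where
  "CS sg' al' \<longleftrightarrow> agr 15 sg sg' \<and> sg' 19 = idx * 2 ^ w \<and> sg' 25 = length (pinp k (bM b)) \<and> (\<exists>f. al' = al(7 := f)) \<and>
     bufok (bM b) al' (length (pinp k (bM b)))"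

lemma inst_pre:
  "hsure W inp (assign 15 (B Div (V 14) (V 7)) ;; assign 16 (B Mod (V 15) (V 5)) ;; assign 15 (B Div (V 15) (V 5)) ;;
     assign 19 (etimes (V 14) (V 9)) ;; astore 7 (C 0) (C 0) ;; astore 7 (C rt) (etimes (C NA) (V 4)) ;;
     astore 7 (C (rt + 1)) (etimes (C (length tms)) (V 4)) ;; For 28 4 build ;;
     assign 25 (eplus (C (rt + 2)) (etimes (C (2 * length tms)) (V 4)))) sg al z
     (%t sg' al' z'. t \<le> k * k * KT + 200 \<and> CS sg' al' \<and> z' = z)"
proof -
  let ?f = "(al 7)(0 := 0, rt := NA * (k * k), rt + 1 := length tms * (k * k))"
  let ?al = "al(7 := ?f)"
  let ?s = "sg(16 := b mod g, 15 := b div g, 19 := idx * 2 ^ w)"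
  have e: "sg 7 = r" "sg 5 = g" "sg 9 = 2 ^ w" "sg 4 = k * k" "par sg" "MATok al" "RV al" using pv by (auto simp: PV_def par_def)
  have b: "b < q" "b div g < q" "idx < q"
    using inst_b pv(2) q_facts(5,11) le_less_trans[OF div_le_dividend, of b q g] by linarith+
  have q: "sg 14 < q" "r < q" "g < q" "2 ^ w < q" "k * k < q" using b pv(3) q_facts by auto
  have bo: "bufok (bM b) ?al (rt + 2)"
    unfolding bufok_def using rt by (auto simp: pinp_def nth_append less_Suc_eq le_Suc_eq numeral_2_eq_2)
  have loop: "hsure W inp (For 28 4 build) ?s ?al z (%t sg' al' z'. t \<le> k * k * KT + 6 \<and> agr 25 ?s sg' \<and> (\<exists>f. al' = ?al(7 := f)) \<and>
     bufok (bM b) al' (length (pinp k (bM b))) \<and> z' = z)"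
    by (rule build_loop) (use e inst_b bo in \<open>auto simp: par_def MATok_def RV_def\<close>)
  have s: "sg(15 := b, 16 := b mod g, 15 := b div g, 19 := idx * 2 ^ w) = ?s" by (simp add: fun_upd_twist)
  show ?thesis
    apply (rule hsure_Seq, rule hsure_assign'[where v=b], rule sb, simp add: q e, simp, simp add: e pv, simp)
    apply (rule hsure_Seq, rule hsure_assign'[where v="b mod g"], rule sb, simp add: q e b, simp, simp add: e, simp)
    apply (rule hsure_Seq, rule hsure_assign'[where v="b div g"], rule sb, simp add: q e b, simp, simp add: e, simp)
    apply (rule hsure_Seq, rule hsure_assign'[where v="idx * 2 ^ w"], rule sb, simp add: q e, simp, simp add: e pv, simp)
    apply (subst s)
    apply (rule hsure_Seq, rule hsure_astore, rule sb, simp add: q_consts, simp, rule sb, simp add: q_consts, simp, simp)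
    apply (rule hsure_Seq, rule hsure_astore, rule sb, simp add: q_consts, simp, rule sb, simp add: q_consts q e, simp, simp)
    apply (rule hsure_Seq, rule hsure_astore, rule sb, simp add: q_consts, simp, rule sb, simp add: q_consts q e, simp, simp)
    apply (rule hsure_Seq, rule hsure_mono, rule loop[THEN iffD2[OF arg_cong[where f="%a. hsure W inp (For 28 4 build) ?s a z _"], rotated]])
    subgoal by (simp add: e)
    apply (elim conjE exE)
    apply (rule hsure_assign'[where v="length (pinp k (bM b))"], rule sb)
    subgoal by (simp add: q_consts e q agr_def)
    subgoal by simp
    subgoal by (simp add: length_pinp e agr_def)
    subgoal by simp
    subgoal by (auto simp: CS_def agr_def bufok_def)
    done
qed

lemma CS_facts:
  assumes "CS sg' al'"
  shows "sg' 9 = 2 ^ w" "sg' 11 = 4" "sg' 12 = 0" "sg' 19 = idx * 2 ^ w" "sg' 13 = g * g * r" "sg' 14 = idx" "par sg'"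
    "simu w W (pinp k (bM b)) sg' al'" "imem w sg' al' = (%_. 0)"
proof -
  have a: "agr 15 sg sg'" and 19: "sg' 19 = idx * 2 ^ w" and l: "sg' 25 = length (pinp k (bM b))"
    and bf: "bufok (bM b) al' (length (pinp k (bM b)))" using assms by (auto simp: CS_def)
  obtain f where f: "al' = al(7 := f)" using assms by (auto simp: CS_def)
  show e: "sg' 9 = 2 ^ w" "sg' 11 = 4" "sg' 12 = 0" "sg' 19 = idx * 2 ^ w" "sg' 13 = g * g * r" "sg' 14 = idx" "par sg'"
    using a 19 pv by (auto simp: agr_def PV_def par_def)
  show "simu w W (pinp k (bM b)) sg' al'"
    by (intro simuI) (use e l bf inst_q q2 pinp_lt in \<open>auto simp: bufok_def\<close>)
  show "imem w sg' al' = (%_. 0)"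
    using e pv(1) by (auto simp: imem_def fun_eq_iff f PV_def)
qed

lemma inst_post:
  assumes cs: "CS sg' al'" and s1: "(t1, s1) \<in> set_spmf (D0 b)" "mem s1 = imem w sg' al''" "frame w sg' al' al''"
  shows "PV (Suc idx) (sg'(26 := l, 14 := Suc idx)) al''"
proof -
  note c = CS_facts[OF cs]
  have fr: "\<And>h. h \<noteq> 6 ==> h \<noteq> 4 ==> al'' h = al' h" "\<And>i. i < idx * 2 ^ w \<or> idx * 2 ^ w + 2 ^ w \<le> i ==> al'' 4 i = al' 4 i"
    "\<And>i. al'' 6 i = al' 6 i \<or> al'' 6 i = 0" "\<And>i. al'' 4 i = al' 4 i \<or> al'' 4 i < 2 ^ w"
    using s1(3) unfolding frame_def c by auto
  obtain f where f: "al' = al(7 := f)" using cs by (auto simp: CS_def)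
  have p: "al 0 = (%_. 0)(0 := n)" "MATok al" "RV al" "al 2 = (%_. 0)" "al 3 = (%_. 0)" "al 5 = (%_. 0)" "al 6 = (%_. 0)" "\<And>i. al 4 i < 2 ^ w"
    "\<And>i. idx * 2 ^ w \<le> i ==> al 4 i = 0" "\<And>c u v. c < idx ==> stm w (rest k u v 0) (bmem al c) (Bs k)"
    using pv(1) by (auto simp: PV_def)
  have 6: "al'' 6 = (%_. 0)" using fr(3) p(7) by (auto simp: fun_eq_iff f)
  have b1: "bmem al'' idx = mem s1" unfolding s1(2) by (auto simp: bmem_def imem_def c 6 fun_eq_iff)
  have b2: "bmem al'' j = bmem al j" if "j < idx" for j
  proof
    fix a
    have "j * 2 ^ w + a < idx * 2 ^ w" if "a < 2 ^ w"
    proof -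
      have "j * 2 ^ w + a < Suc j * 2 ^ w" using that by simp
      also have "\<dots> \<le> idx * 2 ^ w" using \<open>j < idx\<close> by (intro mult_le_mono1) simp
      finally show ?thesis .
    qed
    then show "bmem al'' j a = bmem al j a" using fr(2) by (simp add: bmem_def f)
  qed
  have st: "stm w (rest k u v 0) (bmem al'' j) (Bs k)" if "j < Suc idx" for j u v
  proof (cases "j = idx")
    case True
    then show ?thesis using ses[of k t1 s1 "bM b" u v] s1(1) k_pos b1 by (simp add: w_def)
  next
    case False
    then show ?thesis using that p(10)[of j u v] b2[of j] by simp
  qed
  have z4: "al'' 4 i = 0" if "Suc idx * 2 ^ w \<le> i" for i
  proof -
    have "idx * 2 ^ w + 2 ^ w \<le> i" using that by simp
    then show ?thesis using fr(2)[of i] p(9)[of i] by (simp add: f)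
  qed
  have l4: "al'' 4 i < 2 ^ w" for i using fr(4)[of i] p(8)[of i] by (auto simp: f)
  have o: "al'' 0 = al 0" "al'' 1 = al 1" "al'' 2 = al 2" "al'' 3 = al 3" "al'' 5 = al 5" using fr(1) by (simp_all add: f)
  have "MATok al''" "RV al''" using p(2,3) o by (simp_all add: MATok_def RV_def)
  then show ?thesis unfolding PV_def using c o p(1,4,5,6) 6 l4 z4 st by (auto simp: par_def)
qed

text \<open>Preprocessing a copy writes only inside its own region; the other factors of the product
  over copies therefore stay fixed.\<close>

lemma inst_bmem:
  assumes cs: "CS sg' al'" and s1: "mem s1 = imem w sg' al''" "frame w sg' al' al''"
  shows "bmem al'' idx = mem s1" and "j \<noteq> idx ==> bmem al'' j = bmem al j"
proof -
  note c = CS_facts[OF cs]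
  have fr: "\<And>i. i < idx * 2 ^ w \<or> idx * 2 ^ w + 2 ^ w \<le> i ==> al'' 4 i = al' 4 i" "\<And>i. al'' 6 i = al' 6 i \<or> al'' 6 i = 0"
    using s1(2) unfolding frame_def c by auto
  obtain f where f: "al' = al(7 := f)" using cs by (auto simp: CS_def)
  have "al 6 = (%_. 0)" using pv(1) by (auto simp: PV_def)
  then have 6: "al'' 6 = (%_. 0)" using fr(2) by (auto simp: fun_eq_iff f)
  show "bmem al'' idx = mem s1" unfolding s1(1) by (auto simp: bmem_def imem_def c 6 fun_eq_iff)
  assume j: "j \<noteq> idx"
  show "bmem al'' j = bmem al j"
  proof
    fix a
    have "j * 2 ^ w + a < idx * 2 ^ w \<or> idx * 2 ^ w + 2 ^ w \<le> j * 2 ^ w + a" if a: "a < 2 ^ w"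
    proof (cases "j < idx")
      case True
      have "j * 2 ^ w + a < Suc j * 2 ^ w" using a by simp
      also have "\<dots> \<le> idx * 2 ^ w" using True by (intro mult_le_mono1) simp
      finally show ?thesis by simp
    next
      case False
      then have "Suc idx * 2 ^ w \<le> j * 2 ^ w" using j by (intro mult_le_mono1) simp
      then show ?thesis by simp
    qed
    then show "bmem al'' j a = bmem al j a" using fr(1) by (simp add: bmem_def f)
  qed
qed

lemma Seq9: "hsure W inp ((a1 ;; a2 ;; a3 ;; a4 ;; a5 ;; a6 ;; a7 ;; a8 ;; a9) ;; e) sg al z Q ==>
   hsure W inp (a1 ;; a2 ;; a3 ;; a4 ;; a5 ;; a6 ;; a7 ;; a8 ;; a9 ;; e) sg al z Q"
  "hew W inp ((a1 ;; a2 ;; a3 ;; a4 ;; a5 ;; a6 ;; a7 ;; a8 ;; a9) ;; e) sg al z f x ==>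
   hew W inp (a1 ;; a2 ;; a3 ;; a4 ;; a5 ;; a6 ;; a7 ;; a8 ;; a9 ;; e) sg al z f x"
  by (simp_all add: hsure_def hew_def ew_Seq add.assoc)

lemma instc_sure:
  "hsure W inp instc sg al z (%t sg' al' z'. t \<le> IT \<and> sg' 14 = idx \<and> sg' 13 = g * g * r \<and> PV (Suc idx) (sg'(14 := Suc idx)) al' \<and>
     (\<forall>j. j \<noteq> idx --> bmem al' j = bmem al j) \<and> z' = z)"
  unfolding instc_def
proof (rule Seq9(1), rule hsure_Seq, rule hsure_mono[OF inst_pre], elim conjE)
  fix t sg' al' z' assume a: "t \<le> k * k * KT + 200" "CS sg' al'" "z' = z"
  note c = CS_facts[OF a(2)]
  show "hsure W inp (call bd cpre) sg' al' z' (%t' sg' al' z'. t + t' \<le> IT \<and> sg' 14 = idx \<and> sg' 13 = g * g * r \<and>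
     PV (Suc idx) (sg'(14 := Suc idx)) al' \<and> (\<forall>j. j \<noteq> idx --> bmem al' j = bmem al j) \<and> z' = z)"
    unfolding a(3)
  proof (rule simu.hsure_call[OF c(8) bd(1)])
    show "\<And>a. imem w sg' al' a < 2 ^ w" by (simp add: c(9))
    show "lossless_spmf (exec w (pinp k (bM b)) cpre (ini (imem w sg' al')))"
      unfolding c(9) using pre_ll[of k "bM b"] k_pos by (simp add: w_def)
    fix t1 s1 t' al'' l
    assume h: "(t1, s1) \<in> set_spmf (exec w (pinp k (bM b)) cpre (ini (imem w sg' al')))" "t' \<le> 12 * t1 + bd + 1"
      "mem s1 = imem w sg' al''" "frame w sg' al' al''"
    note h1 = h(1)[unfolded c(9)]
    have "t1 \<le> Bp k" using pre_t[of k t1 s1 "bM b"] h1 k_pos by (simp add: w_def)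
    then have "t + t' \<le> IT" using a(1) h(2) by (simp add: IT_def)
    then show "t + t' \<le> IT \<and> (sg'(26 := l)) 14 = idx \<and> (sg'(26 := l)) 13 = g * g * r \<and>
       PV (Suc idx) ((sg'(26 := l))(14 := Suc idx)) al'' \<and> (\<forall>j. j \<noteq> idx --> bmem al'' j = bmem al j) \<and> z = z"
      using inst_post[OF a(2) h1 h(3,4), of l] inst_bmem(2)[OF a(2) h(3,4)] c(5,6) by simp
  qed
qed

text \<open>The factor of this copy is integrated over its own preprocessing, with all other factors
  collected in \<open>Aa\<close>.\<close>

lemma instc_hew:
  assumes f: "\<And>sg' al'. (\<And>j. j \<noteq> idx ==> bmem al' j = bmem al j) ==> f sg' al' z \<le> Aa * (1 + E (bmem al' idx))"
    and E: "Ex (D0 b) (%q. E (mem (snd q))) \<le> e"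
  shows "hew W inp instc sg al z f (Aa * (1 + e))"
  unfolding instc_def
proof (rule Seq9(2), rule hew_Seq_det, rule hsure_mono[OF inst_pre], elim conjE)
  fix t sg' al' z' assume a: "CS sg' al'" "z' = z"
  note c = CS_facts[OF a(1)]
  show "hew W inp (call bd cpre) sg' al' z' f (Aa * (1 + e))"
    unfolding a(2)
  proof (rule simu.hew_call[OF c(8) bd(1), where g="%s. Aa * (1 + E (mem s))"])
    show "\<And>a. imem w sg' al' a < 2 ^ w" by (simp add: c(9))
    have "Ex (exec w (pinp k (bM b)) cpre (ini (imem w sg' al'))) (%r. Aa * (1 + E (mem (snd r)))) \<le> Aa * (1 + Ex (D0 b) (%q. E (mem (snd q))))"
      unfolding c(9) by (rule Ex_affine)
    also have "\<dots> \<le> Aa * (1 + e)" using E by (intro mult_left_mono add_left_mono) auto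
    finally show "Ex (exec w (pinp k (bM b)) cpre (ini (imem w sg' al'))) (%r. Aa * (1 + E (mem (snd r)))) \<le> Aa * (1 + e)" .
    fix s1 al'' l assume h: "mem s1 = imem w sg' al''" "frame w sg' al' al''"
    show "f (sg'(26 := l)) al'' z \<le> Aa * (1 + E (mem s1))"
      using f[of al'' "sg'(26 := l)"] inst_bmem[OF a(1) h] by simp
  qed
qed

end

end

subsection \<open>Correctness and running time of the reduction\<close>

context runl
begin

abbreviation "inpO \<equiv> n # concat (map (%i. encode_vec n (M i)) [0..<n])"

lemma inpO_nth: "x < n * n ==> Suc x < length inpO \<and> inpO ! Suc x = of_bool (M (x div n) (x mod n))"
proof -
  assume x: "x < n * n"
  then have n: "0 < n" by (cases n) auto
  have l: "length (concat (map (%i. encode_vec n (M i)) [0..<n])) = n * n"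
    by (simp add: length_concat o_def encode_vec_def sum_list_sum_nth)
  have "concat (map (%i. encode_vec n (M i)) [0..<n]) ! x = encode_vec n (M (x div n)) ! (x mod n)"
    by (rule nth_concat_regular) (use x in \<open>auto simp: encode_vec_def\<close>)
  also have "\<dots> = of_bool (M (x div n) (x mod n))" using n by (simp add: encode_vec_def)
  finally show ?thesis using l x by simp
qed

text \<open>Array 1 after \<open>x\<close> entries of the matrix have been copied: the input has
  rows of length \<open>n\<close>, the array has rows of length \<open>g k\<close>.\<close>

definition mt :: "nat => nat => nat" where
  "mt x a = of_bool (\<exists>y<x. a = (y div n) * (g * k) + y mod n \<and> M (y div n) (y mod n))"

lemma addr_inj:
  assumes "i * (g * k) + j = i' * (g * k) + j'" "j < g * k" "j' < g * k"
  shows "i = i' \<and> j = j'"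
proof -
  have *: "(i * m + j) div m = i" if "j < m" for i j m :: nat using that by simp
  have "i = (i * (g * k) + j) div (g * k)" using *[OF assms(2)] by simp
  also have "\<dots> = i'" unfolding assms(1) by (rule *[OF assms(3)])
  finally show ?thesis using assms(1) by simp
qed

lemma mt_Suc:
  assumes "x < n * n"
  shows "mt (Suc x) = (mt x)((x div n) * (g * k) + x mod n := of_bool (M (x div n) (x mod n)))"
proof
  fix a
  have n: "0 < n" using assms by (cases n) auto
  have inj: "y = x" if "(x div n) * (g * k) + x mod n = (y div n) * (g * k) + y mod n" for y
  proof -
    have "x mod n < g * k" "y mod n < g * k" using n n_lt_gk mod_less_divisor[OF n] less_trans by blast+
    then have "x div n = y div n \<and> x mod n = y mod n" using addr_inj[OF that] by simp
    then show ?thesis by (metis div_mult_mod_eq)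
  qed
  show "mt (Suc x) a = ((mt x)((x div n) * (g * k) + x mod n := of_bool (M (x div n) (x mod n)))) a"
    using inj by (auto simp: mt_def less_Suc_eq)
qed

lemma copy_sure:
  assumes "par sg" "sg 13 = n * n" "al 1 = (%_. 0)"
  shows "hsure W inpO (For 14 13 copym) sg al z (%t sg' al' z'. t \<le> 60 * (n * n) + 6 \<and> agr 14 sg sg' \<and> al' = al(1 := mt (n * n)) \<and> z' = z)"
proof (rule hsure_For[where n="n * n" and Inv="%x t sg' al' z'. t \<le> 60 * x \<and> agr 14 sg sg' \<and> al' = al(1 := mt x) \<and> z' = z"])
  fix x t sg' al' z' assume a: "x < n * n" "t \<le> 60 * x \<and> agr 14 sg sg' \<and> al' = al(1 := mt x) \<and> z' = z" "sg' 14 = x" "sg' 13 = n * n"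
  have q: "x < q" "n < q" "g * k < q" "1 < q" "8 < q" using a(1) q_facts(1,8,9) q_consts(9) by auto
  have e: "sg' 0 = n" "sg' 10 = g * k" using a(2) assms(1) by (auto simp: agr_def par_def)
  have tb: "take_bit W (of_bool P) = (of_bool P :: nat)" "of_bool P < q" for P using one_lt_W q2 by (auto intro!: take_bit_small)
  let ?e = "eplus (etimes (B Div (V 14) (V 0)) (V 10)) (B Mod (V 14) (V 0))"
  show "hsure W inpO copym sg' al' z' (%t' sg'' al'' z''. sg'' 14 = x \<and> sg'' 13 = n * n \<and> t + t' + 8 \<le> 60 * Suc x \<and> agr 14 sg (sg''(14 := Suc x)) \<and> al'' = al(1 := mt (Suc x)) \<and> z'' = z)"
    unfolding copym_def
  proof (rule hsure_Seq, rule hsure_aread)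
    show "bnd (2 ^ W) sg' (eplus (V 14) (C 1))" by (rule sb) (use q a(3) in auto)
    let ?v = "if nv sg' (eplus (V 14) (C 1)) < length inpO then take_bit W (inpO ! nv sg' (eplus (V 14) (C 1))) else 0"
    have v: "?v = of_bool (M (x div n) (x mod n))" using inpO_nth[OF a(1)] a(3) tb by simp
    show "hsure W inpO (astore 1 ?e (V 15)) (sg'(15 := ?v)) al' z' (%t' sg'' al'' z''. sg'' 14 = x \<and> sg'' 13 = n * n \<and>
       t + (ecost (eplus (V 14) (C 1)) + 1 + t') + 8 \<le> 60 * Suc x \<and> agr 14 sg (sg''(14 := Suc x)) \<and> al'' = al(1 := mt (Suc x)) \<and> z'' = z)"
      unfolding v by (rule hsure_astore, rule sb) (use q a e tb mt_Suc[OF a(1)] one_lt_W in \<open>auto intro!: sb\<close>)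
  qed simp
qed (use assms qW[OF q_facts(9)] one_lt_W in \<open>auto simp: mt_def fun_eq_iff\<close>)

lemma mt_MAT:
  assumes "i < g * k" "j < g * k"
  shows "mt (n * n) (i * (g * k) + j) = of_bool (MM i j)"
proof -
  have "(\<exists>y<n * n. i * (g * k) + j = (y div n) * (g * k) + y mod n \<and> M (y div n) (y mod n)) \<longleftrightarrow> MM i j" (is "?L = _")
  proof
    assume ?L
    then obtain y where y: "y < n * n" "i * (g * k) + j = (y div n) * (g * k) + y mod n" "M (y div n) (y mod n)" by blast
    have n: "0 < n" using y(1) by (cases n) auto
    have "y mod n < g * k" using n n_lt_gk mod_less_divisor[OF n] less_trans by blast
    then have "i = y div n \<and> j = y mod n" using addr_inj[OF y(2) assms(2)] by simp
    then show "MM i j" using y n by (auto simp: MM_def less_mult_imp_div_less)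
  next
    assume m: "MM i j"
    let ?y = "i * n + j"
    have ij: "i < n" "j < n" "M i j" using m by (auto simp: MM_def)
    have "?y < Suc i * n" using ij by simp
    also have "\<dots> \<le> n * n" using ij by (intro mult_le_mono1) simp
    finally show ?L using ij by (intro exI[of _ ?y]) auto
  qed
  then show ?thesis by (simp add: mt_def)
qed

lemma prec_pre:
  "hsure W inpO (aread 0 (C 0) ;; astore 0 (C 0) (V 0) ;; params ;; assign 13 (etimes (V 0) (V 0)) ;; For 14 13 copym ;;
     assign 12 (C 0) ;; assign 11 (C 4) ;; assign 13 (etimes (V 6) (V 7))) (%_. 0) (%_ _. 0) []
    (%t sg al z. t \<le> 60 * (n * n) + 30 * n + 250 \<and> PV 0 (sg(14 := 0)) al \<and> sg 13 = g * g * r \<and> z = [])"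
proof -
  have tb: "take_bit W n = n" using qW[OF q_facts(1)] by (rule take_bit_small)
  show ?thesis
    apply (rule hsure_Seq, rule hsure_aread, rule sb, simp add: q_consts, simp, simp)
    apply (rule hsure_Seq, rule hsure_astore, rule sb, simp add: q_consts, simp, rule sb, simp add: tb q_facts, simp, simp)
    apply (rule hsure_Seq, rule hsure_mono, rule hsure_params, simp add: tb)
    apply (elim conjE, hypsubst)
    apply (rule hsure_Seq, rule hsure_assign'[where v="n * n"], rule sb, simp add: par_def q_facts, simp, simp add: par_def, simp)
    apply (rule hsure_Seq, rule hsure_mono, rule copy_sure, simp add: par_def, simp, simp add: fun_eq_iff)
    apply (elim conjE, hypsubst)
    apply (rule hsure_Seq, rule hsure_assign'[where v=0], rule sb, simp add: q_consts, simp, simp, simp)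
    apply (rule hsure_Seq, rule hsure_assign'[where v=4], rule sb, simp add: q_consts, simp, simp, simp)
    apply (rule hsure_assign'[where v="g * g * r"], rule sb)
    subgoal by (simp add: par_def q_facts agr_def)
    subgoal by simp
    subgoal by (simp add: par_def agr_def)
    subgoal by simp
    subgoal by (simp add: PV_def par_def agr_def MATok_def mt_MAT RV_def tb) (simp add: mt_def fun_eq_iff)
    done
qed

lemma Seq8: "hsure W inp ((a1 ;; a2 ;; a3 ;; a4 ;; a5 ;; a6 ;; a7 ;; a8) ;; e) sg al z Q ==>
   hsure W inp (a1 ;; a2 ;; a3 ;; a4 ;; a5 ;; a6 ;; a7 ;; a8 ;; e) sg al z Q"
  "hew W inp ((a1 ;; a2 ;; a3 ;; a4 ;; a5 ;; a6 ;; a7 ;; a8) ;; e) sg al z f x ==>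
   hew W inp (a1 ;; a2 ;; a3 ;; a4 ;; a5 ;; a6 ;; a7 ;; a8 ;; e) sg al z f x"
  by (simp_all add: hsure_def hew_def ew_Seq add.assoc)

definition QT :: nat where "QT = g * g * r * (IT + 8) + 60 * (n * n) + 30 * n + 300"

context
  fixes sg :: "nat => nat" and al :: "nat => nat => nat"
  assumes pv0: "PV 0 (sg(14 := 0)) al" "sg 13 = g * g * r"
begin

lemma inst_loop:
  "hsure W inp (For 14 13 instc) sg al z (%t sg' al' z'. t \<le> g * g * r * (IT + 8) + 6 \<and> PV (g * g * r) sg' al' \<and> z' = z)"
proof (rule hsure_For[where n="g * g * r" and Inv="%x t sg' al' z'. t \<le> x * (IT + 8) \<and> PV x sg' al' \<and> z' = z"])
  fix x t sg' al' z' assume a: "x < g * g * r" "t \<le> x * (IT + 8) \<and> PV x sg' al' \<and> z' = z" "sg' 14 = x"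
  then have p: "PV x sg' al'" "z' = z" by auto
  show "hsure W inp instc sg' al' z' (%t' sg'' al'' z''. sg'' 14 = x \<and> sg'' 13 = g * g * r \<and> t + t' + 8 \<le> Suc x * (IT + 8) \<and> PV (Suc x) (sg''(14 := Suc x)) al'' \<and> z'' = z)"
    unfolding p(2) by (rule hsure_mono[OF instc_sure[OF p(1) a(1,3) refl]]) (use a(2) in auto)
qed (use pv0 qW[OF q_facts(11)] one_lt_W in auto)

text \<open>A copy not yet preprocessed is represented by the number 4/3, which bounds the expected
  value of its factor, since the error is at most 1/3 on average. Preprocessing a copy of block
  \<open>b\<close> replaces the placeholder by the actual factor.\<close>

lemma inst_loop_hew:
  assumes b: "b < g * g"
  shows "hew W inp (For 14 13 instc) sg al z (%sg' al' z'. eps v b al') (kap * ennreal (4 / 3) ^ r)"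
proof -
  define E where "E = serr w (rest k (us v b) (vs v b) 0) (val k (bM b) (us v b) (vs v b))"
  let ?J = "{b * r..<b * r + r}"
  let ?F = "%x (sg'::nat => nat) al' (z'::nat list). kap * (\<Prod>j\<in>?J. if j < x then 1 + E (bmem al' j) else ennreal (4 / 3))"
  have "hew W inp (For 14 13 instc) sg al z (?F (g * g * r)) (kap * ennreal (4 / 3) ^ r)"
  proof (rule hew_For[where n="g * g * r" and Inv="%x sg' al' z'. PV x sg' al' \<and> z' = z" and F="?F"])
    fix x sg' al' z' assume a: "x < g * g * r" "PV x sg' al' \<and> z' = z" "sg' 14 = x"
    then have p: "PV x sg' al'" "z' = z" by auto
    show "hsure W inp instc sg' al' z' (%t' sg'' al'' z''. sg'' 14 = x \<and> sg'' 13 = g * g * r \<and> PV (Suc x) (sg''(14 := Suc x)) al'' \<and> z'' = z)"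
      unfolding p(2) by (rule hsure_mono[OF instc_sure[OF p(1) a(1,3) refl]]) auto
    show "hew W inp instc sg' al' z' (%sg''. ?F (Suc x) (sg''(14 := Suc x))) (?F x sg' al' z')"
    proof (cases "x \<in> ?J")
      case True
      have xb: "x div r = b" using True by (intro div_nat_eqI) (auto simp: mult.commute)
      let ?A = "kap * (\<Prod>j\<in>?J - {x}. if j < x then 1 + E (bmem al' j) else ennreal (4 / 3))"
      have F: "?F x sg' al' z' = ?A * (1 + ennreal (1 / 3))"
      proof -
        have "1 + ennreal (1 / 3) = ennreal (4 / 3)" by (simp flip: ennreal_1 ennreal_plus)
        then show ?thesis by (subst prod.remove[OF _ True]) (simp_all add: ac_simps)
      qed
      show ?thesis unfolding p(2) F[unfolded p(2)]
      proof (rule instc_hew[OF p(1) a(1,3) refl, where E=E])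
        fix sg'' al'' assume bm: "\<And>j. j \<noteq> x ==> bmem al'' j = bmem al' j"
        have "(\<Prod>j\<in>?J - {x}. if j < Suc x then 1 + E (bmem al'' j) else ennreal (4 / 3))
           = (\<Prod>j\<in>?J - {x}. if j < x then 1 + E (bmem al' j) else ennreal (4 / 3))"
          by (rule prod.cong) (auto simp: bm less_Suc_eq)
        then show "?F (Suc x) (sg''(14 := Suc x)) al'' z \<le> ?A * (1 + E (bmem al'' x))"
          by (subst prod.remove[OF _ True]) (simp_all add: ac_simps)
      next
        show "Ex (D0 (x div r)) (%q. E (mem (snd q))) \<le> ennreal (1 / 3)"
          unfolding xb E_def w_def using err[of k] k_pos by simp
      qed
    next
      case False
      have "?F (Suc x) (sg''(14 := Suc x)) al'' z'' \<le> ?F x sg' al' z'" if "\<And>j. j \<noteq> x --> bmem al'' j = bmem al' j" for sg'' al'' z''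
      proof -
        have "(\<Prod>j\<in>?J. if j < Suc x then 1 + E (bmem al'' j) else ennreal (4 / 3))
           = (\<Prod>j\<in>?J. if j < x then 1 + E (bmem al' j) else ennreal (4 / 3))"
          by (rule prod.cong) (use that False in \<open>auto simp: less_Suc_eq\<close>)
        then show ?thesis by simp
      qed
      then show ?thesis unfolding p(2) by (intro hew_sure[OF instc_sure[OF p(1) a(1,3) refl]]) blast
    qed
  qed (use pv0 qW[OF q_facts(11)] one_lt_W in auto)
  moreover have "?F (g * g * r) sg' al' z' = eps v b al'" for sg' al' z'
  proof -
    have "(b + 1) * r \<le> g * g * r" using b by (intro mult_le_mono1) simp
    then have "(\<Prod>j\<in>?J. if j < g * g * r then 1 + E (bmem al' j) else ennreal (4 / 3)) = (\<Prod>j\<in>?J. 1 + E (bmem al' j))"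
      by (intro prod.cong) auto
    also have "\<dots> = (\<Prod>c<r. 1 + E (bmem al' (b * r + c)))"
      using prod.shift_bounds_nat_ivl[of "%j. 1 + E (bmem al' j)" 0 "b * r" r] by (simp add: lessThan_atLeast0 add.commute)
    finally show ?thesis by (simp add: eps_def E_def)
  qed
  ultimately show ?thesis by simp
qed

end

lemma PV_MInv: "PV (g * g * r) sg al ==> MInv 0 al"
  by (auto simp: PV_def MInv_def BO_def IC_def)

lemma prec_sure: "hsure W inpO prec (%_. 0) (%_ _. 0) [] (%t sg al z. t \<le> QT \<and> MInv 0 al)"
  unfolding prec_def
  by (rule Seq8(1), rule hsure_Seq, rule hsure_mono[OF prec_pre], elim conjE, hypsubst, rule hsure_mono[OF inst_loop])
    (auto simp: QT_def intro: PV_MInv)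

lemma prec_hew: "b < g * g ==> hew W inpO prec (%_. 0) (%_ _. 0) [] (%sg al z. eps v b al) (kap * ennreal (4 / 3) ^ r)"
  unfolding prec_def
  by (rule Seq8(2), rule hew_Seq_det, rule hsure_mono[OF prec_pre], elim conjE, hypsubst, rule inst_loop_hew) auto

abbreviation "am m \<equiv> ar (ini m)"

lemma ar_am: "ar s = am (mem s)" by (simp add: ar_def fun_eq_iff)

lemma sess_sure:
  assumes "T + d = n" "MInv T (am m)"
  shows "lossless_spmf (session W (map (%t. (multc, encode_vec n (v t))) [T..<n]) m) \<and>
    (\<forall>tr\<in>set_spmf (session W (map (%t. (multc, encode_vec n (v t))) [T..<n]) m). sum_list (map fst tr) \<le> d * MT)"
  using assms
proof (induction d arbitrary: T m)
  case (Suc d)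
  then have T: "T < n" "[T..<n] = T # [Suc T..<n]" by (auto simp: upt_conv_Cons)
  have ms: "sure W (encode_vec n (v T)) multc (ini m) (%t s'. t \<le> MT \<and> MInv (Suc T) (ar s') \<and> ar s' 4 = am m 4)"
    using mult_sure[OF Suc.prems(2) T(1) refl, of "v T"] unfolding hsure_def by (auto simp: rg_def fun_eq_iff)
  have IH: "lossless_spmf (session W (map (%t. (multc, encode_vec n (v t))) [Suc T..<n]) (mem (snd x))) \<and>
    (\<forall>tr\<in>set_spmf (session W (map (%t. (multc, encode_vec n (v t))) [Suc T..<n]) (mem (snd x))). sum_list (map fst tr) \<le> d * MT)"
    if "x \<in> set_spmf (exec W (encode_vec n (v T)) multc (ini m))" for x
    by (rule Suc.IH) (use that ms Suc.prems(1) in \<open>auto simp: sure_def ar_am[symmetric]\<close>)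
  show ?case unfolding T(2) using ms IH
    by (auto simp: sure_def set_bind_spmf bind_UNION dest!: bspec intro: add_mono)
qed simp

text \<open>Union bound over the products. The summands refer to the memory before the first of
  them, because no product changes array 4.\<close>

lemma sess_err:
  assumes "T + d = n" "MInv T (am m)"
  shows "Ex (session W (map (%t. (multc, encode_vec n (v t))) [T..<n]) m)
    (%tr. of_bool (\<exists>i<d. snd (tr ! i) \<noteq> encode_vec n (bool_mult n M (v (T + i))))) \<le> (\<Sum>t=T..<n. \<Sum>b<g * g. eps (v t) b (am m))"
  using assms
proof (induction d arbitrary: T m)
  case (Suc d)
  then have T: "T < n" "[T..<n] = T # [Suc T..<n]" by (auto simp: upt_conv_Cons)
  let ?e = "%t. encode_vec n (bool_mult n M (v t))"
  let ?S = "\<Sum>t=Suc T..<n. \<Sum>b<g * g. eps (v t) b (am m)"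
  have hs: "hsure W (encode_vec n (v T)) multc (%_. 0) (am m) [] (%t sg' al' z'. t \<le> MT \<and> MInv (Suc T) al' \<and> al' 4 = am m 4)"
    by (rule mult_sure[OF Suc.prems(2) T(1) refl])
  have rg0: "rg (ini m) = (%_. 0)" by (simp add: rg_def fun_eq_iff)
  have ms: "sure W (encode_vec n (v T)) multc (ini m) (%t s'. MInv (Suc T) (ar s') \<and> ar s' 4 = am m 4)"
    using hs rg0 unfolding hsure_def by (auto elim!: sure_mono)
  have me: "Ex (exec W (encode_vec n (v T)) multc (ini m)) (%r. of_bool (out (snd r) \<noteq> ?e T)) \<le> (\<Sum>b<g * g. eps (v T) b (am m))"
    using mult_hew[OF Suc.prems(2) T(1) refl, of "v T"] rg0 unfolding hew_def ew_def by auto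
  have inner: "Ex (map_spmf (%tr. (fst x, out (snd x)) # tr) (session W (map (%t. (multc, encode_vec n (v t))) [Suc T..<n]) (mem (snd x))))
       (%tr. of_bool (\<exists>i<Suc d. snd (tr ! i) \<noteq> ?e (T + i))) \<le> of_bool (out (snd x) \<noteq> ?e T) + ?S"
    if x: "x \<in> set_spmf (exec W (encode_vec n (v T)) multc (ini m))" for x
  proof -
    let ?p = "session W (map (%t. (multc, encode_vec n (v t))) [Suc T..<n]) (mem (snd x))"
    have mi: "MInv (Suc T) (am (mem (snd x)))" "am (mem (snd x)) 4 = am m 4"
      using ms x by (auto simp: sure_def ar_am[symmetric])
    have "Ex ?p (%tr. of_bool (\<exists>i<Suc d. snd (((fst x, out (snd x)) # tr) ! i) \<noteq> ?e (T + i)))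
      \<le> Ex ?p (%tr. of_bool (out (snd x) \<noteq> ?e T) + of_bool (\<exists>i<d. snd (tr ! i) \<noteq> ?e (Suc T + i)))"
    proof (rule Ex_mono)
      fix tr
      have "(\<exists>i<Suc d. snd (((fst x, out (snd x)) # tr) ! i) \<noteq> ?e (T + i)) \<longleftrightarrow> out (snd x) \<noteq> ?e T \<or> (\<exists>i<d. snd (tr ! i) \<noteq> ?e (Suc T + i))"
        by (simp add: Ex_less_Suc2)
      then show "of_bool (\<exists>i<Suc d. snd (((fst x, out (snd x)) # tr) ! i) \<noteq> ?e (T + i))
         \<le> (of_bool (out (snd x) \<noteq> ?e T) + of_bool (\<exists>i<d. snd (tr ! i) \<noteq> ?e (Suc T + i)) :: ennreal)"
        by (simp only: of_bool_def) (auto simp: add_increasing2)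
    qed
    also have "\<dots> = Ex ?p (%tr. of_bool (out (snd x) \<noteq> ?e T)) + Ex ?p (%tr. of_bool (\<exists>i<d. snd (tr ! i) \<noteq> ?e (Suc T + i)))"
      by (rule nn_integral_add) auto
    also have "\<dots> \<le> of_bool (out (snd x) \<noteq> ?e T) + (\<Sum>t=Suc T..<n. \<Sum>b<g * g. eps (v t) b (am (mem (snd x))))"
      by (intro add_mono Ex_le_const Suc.IH) (use Suc.prems(1) mi in auto)
    also have "(\<Sum>t=Suc T..<n. \<Sum>b<g * g. eps (v t) b (am (mem (snd x)))) = ?S"
      using eps_cong[of "am (mem (snd x))" "am m"] mi(2) by simp
    finally show ?thesis by (simp add: o_def)
  qed
  have "Ex (session W (map (%t. (multc, encode_vec n (v t))) [T..<n]) m) (%tr. of_bool (\<exists>i<Suc d. snd (tr ! i) \<noteq> ?e (T + i)))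
    \<le> Ex (exec W (encode_vec n (v T)) multc (ini m)) (%x. of_bool (out (snd x) \<noteq> ?e T) + ?S)"
    unfolding T(2) list.map session.simps Ex_bind fst_conv snd_conv by (rule Ex_mono) (rule inner)
  also have "\<dots> = Ex (exec W (encode_vec n (v T)) multc (ini m)) (%x. of_bool (out (snd x) \<noteq> ?e T)) + Ex (exec W (encode_vec n (v T)) multc (ini m)) (%x. ?S)"
    by (rule nn_integral_add) auto
  also have "\<dots> \<le> (\<Sum>b<g * g. eps (v T) b (am m)) + ?S" by (intro add_mono me Ex_le_const) auto
  also have "\<dots> = (\<Sum>t=T..<n. \<Sum>b<g * g. eps (v t) b (am m))" using T(1) by (simp add: sum.atLeast_Suc_lessThan)
  finally show ?case .
qed simp

lemma run_eq: "omv_run omv n M v = session W ((prec, inpO) # map (%t. (multc, encode_vec n (v t))) [0..<n]) (%_. 0)"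
  by (simp add: omv_run_def omv_def W_def)

lemma am0: "am (%_. 0) = (%_ _. 0)" "rg (ini (%_. 0)) = (%_. 0)" by (simp_all add: ar_def rg_def fun_eq_iff)

lemma pre_S: "sure W inpO prec (ini (%_. 0)) (%t s. t \<le> QT \<and> MInv 0 (ar s))"
  using prec_sure am0 unfolding hsure_def by auto

lemma run_sure:
  "lossless_spmf (omv_run omv n M v)" "tr \<in> set_spmf (omv_run omv n M v) ==> sum_list (map fst tr) \<le> QT + n * MT"
proof -
  have s: "lossless_spmf (session W (map (%t. (multc, encode_vec n (v t))) [0..<n]) (mem (snd x))) \<and>
    (\<forall>tr\<in>set_spmf (session W (map (%t. (multc, encode_vec n (v t))) [0..<n]) (mem (snd x))). sum_list (map fst tr) \<le> n * MT)"
    "fst x \<le> QT" if "x \<in> set_spmf (exec W inpO prec (ini (%_. 0)))" for x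
    using sess_sure[of 0 n "mem (snd x)" v] pre_S that by (auto simp: sure_def ar_am[symmetric])
  show "lossless_spmf (omv_run omv n M v)" unfolding run_eq using s pre_S by (auto simp: sure_def)
  show "tr \<in> set_spmf (omv_run omv n M v) ==> sum_list (map fst tr) \<le> QT + n * MT" unfolding run_eq using s
    by (fastforce simp: set_bind_spmf bind_UNION intro: add_mono)
qed

lemma eps_total: "real n * (real (g * g) * ((1 / 2) ^ rho * (4 / 3) ^ r)) \<le> 1 / 3"
proof -
  \<comment> \<open>Two copies contribute \<open>1 / 2 * 4 / 3 * 4 / 3 = 8 / 9\<close>, and six such
    pairs less than 1/2.\<close>
  have "(1 / 2) ^ rho * (4 / 3) ^ r = ((1 / 2) * (4 / 3 :: real)\<^sup>2) ^ rho" by (simp only: r_rho power_mult power_mult_distrib)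
  also have "\<dots> = (8 / 9 :: real) ^ (6 * (3 * lg + 2))" by (simp add: rho_def power2_eq_square algebra_simps)
  also have "\<dots> = ((8 / 9) ^ 6) ^ (3 * lg + 2)" by (rule power_mult)
  also have "\<dots> \<le> (1 / 2) ^ (3 * lg + 2)" by (rule power_mono) (simp_all add: power_divide)
  finally have 1: "(1 / 2) ^ rho * (4 / 3 :: real) ^ r \<le> (1 / 2) ^ (3 * lg + 2)" .
  have "n * (g * g) \<le> 2 ^ (lg + (lg + lg))" by (rule pow_prod_le[OF _ gg_le]) (use n_lt in simp)
  then have "n * (g * g) \<le> 2 ^ (3 * lg)" by (simp add: mult_2 numeral_3_eq_3)
  then have "real (n * (g * g)) \<le> 2 ^ (3 * lg)" by (metis of_nat_le_iff of_nat_numeral of_nat_power)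
  with 1 have "real (n * (g * g)) * ((1 / 2) ^ rho * (4 / 3) ^ r) \<le> 2 ^ (3 * lg) * (1 / 2) ^ (3 * lg + 2)"
    by (intro mult_mono) auto
  also have "\<dots> = 1 / 4" by (simp add: power_add power_one_over)
  finally show ?thesis by simp
qed

lemma run_err: "measure (measure_spmf (omv_run omv n M v)) {tr. \<not> omv_correct n M v tr} \<le> 1 / 3"
proof -
  let ?e = "%t. encode_vec n (bool_mult n M (v t))"
  let ?P = "exec W inpO prec (ini (%_. 0))"
  let ?k = "kap * ennreal (4 / 3) ^ r"
  have "Ex (omv_run omv n M v) (%tr. of_bool (\<not> omv_correct n M v tr))
    = Ex ?P (%x. Ex (session W (map (%t. (multc, encode_vec n (v t))) [0..<n]) (mem (snd x))) (%tr. of_bool (\<exists>i<n. snd (tr ! i) \<noteq> ?e i)))"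
    unfolding run_eq session.simps Ex_bind by (simp add: o_def omv_correct_def)
  also have "\<dots> \<le> Ex ?P (%x. \<Sum>t<n. \<Sum>b<g * g. eps (v t) b (ar (snd x)))"
  proof (rule Ex_mono)
    fix x assume "x \<in> set_spmf ?P"
    then have "MInv 0 (am (mem (snd x)))" using pre_S by (auto simp: sure_def ar_am[symmetric])
    from sess_err[OF _ this, of n v]
    show "Ex (session W (map (%t. (multc, encode_vec n (v t))) [0..<n]) (mem (snd x))) (%tr. of_bool (\<exists>i<n. snd (tr ! i) \<noteq> ?e i))
      \<le> (\<Sum>t<n. \<Sum>b<g * g. eps (v t) b (ar (snd x)))"
      by (simp add: ar_am[of "snd x"] lessThan_atLeast0)
  qed
  also have "\<dots> \<le> (\<Sum>t<n. \<Sum>b<g * g. ?k)"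
  proof -
    have "hew W inpO prec (%_. 0) (%_ _. 0) [] (%sg al z. \<Sum>t<n. \<Sum>b<g * g. eps (v t) b al) (\<Sum>t<n. \<Sum>b<g * g. ?k)"
      by (intro hew_sum prec_hew) auto
    then show ?thesis unfolding hew_def ew_def using am0 by auto
  qed
  also have "\<dots> = of_nat n * (of_nat (g * g) * ?k)" by simp
  also have "\<dots> = ennreal (real n * (real (g * g) * ((1 / 2) ^ rho * (4 / 3) ^ r)))"
    by (simp add: kap_def ennreal_of_nat_eq_real_of_nat ennreal_mult ennreal_power)
  also have "\<dots> \<le> ennreal (1 / 3)" by (rule ennreal_leI[OF eps_total])
  finally show ?thesis unfolding Ex_of_bool by simp
qed

end

subsection \<open>Gadgets for triangle-based patterns\<close>

text \<open>Patterns are handled through injective maps whose images are the copies of the pattern,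
  whereas \<open>isomorphic\<close> asks for a map in the other direction, from the copy to the
  pattern.\<close>

definition embeds :: "(nat => nat) => ugraph => ugraph => bool" where
  "embeds f P G \<longleftrightarrow> inj_on f (fst P) \<and> f ` fst P \<subseteq> fst G \<and> (\<forall>e\<in>snd P. f ` e \<in> snd G)"

lemma embeds_subgraph:
  assumes "embeds f P G" "\<Union> (snd P) \<subseteq> fst P"
  shows "subgraph (f ` fst P, (`) f ` snd P) G" "isomorphic (f ` fst P, (`) f ` snd P) P"
proof -
  have inj: "inj_on f (fst P)" using assms(1) by (simp add: embeds_def)
  show "subgraph (f ` fst P, (`) f ` snd P) G" using assms by (auto simp: subgraph_def embeds_def)
  show "isomorphic (f ` fst P, (`) f ` snd P) P" unfolding isomorphic_def
  proof (intro exI conjI)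
    show "bij_betw (inv_into (fst P) f) (fst (f ` fst P, (`) f ` snd P)) (fst P)"
      using inj by (simp add: bij_betw_inv_into inj_on_imp_bij_betw)
    have "inv_into (fst P) f ` f ` e = e" if "e \<in> snd P" for e
      using that assms(2) inj by (intro inv_into_image_cancel) auto
    then show "(%e. inv_into (fst P) f ` e) ` snd (f ` fst P, (`) f ` snd P) = snd P"
      by (auto simp: image_image image_iff)
  qed
qed

lemma subgraph_embeds:
  assumes "subgraph H G" "isomorphic H P"
  obtains f where "embeds f P G" "f ` fst P = fst H" "snd H = (`) f ` snd P"
proof -
  obtain h where h: "bij_betw h (fst H) (fst P)" "(%e. h ` e) ` snd H = snd P"
    using assms(2) by (auto simp: isomorphic_def)
  let ?f = "inv_into (fst H) h"
  have i: "?f ` h ` e = e" if "e \<in> snd H" for e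
    using that assms(1) h(1) by (intro inv_into_image_cancel) (auto simp: subgraph_def bij_betw_def)
  have H: "snd H = (`) ?f ` snd P" unfolding h(2)[symmetric] using i by (auto simp: image_image image_iff)
  have b: "bij_betw ?f (fst P) (fst H)" using h(1) by (rule bij_betw_inv_into)
  have "embeds ?f P G" using b H assms(1) by (auto simp: embeds_def bij_betw_def subgraph_def)
  then show ?thesis using that b H by (auto simp: bij_betw_def)
qed

lemma finite_subgraphs: "finite vs ==> finite {H. subgraph H (vs, E) \<and> Q H}"
proof -
  assume vs: "finite vs"
  have "{H. subgraph H (vs, E) \<and> Q H} \<subseteq> Pow vs \<times> Pow (Pow vs)" by (fastforce simp: subgraph_def)
  then show ?thesis using vs by (meson finite_Pow_iff finite_SigmaI finite_subset)
qed

lemma detect_iff: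
  assumes "finite vs" "\<Union> (snd P) \<subseteq> fst P"
  shows "subgraph_count (vs, E) P > 0 \<longleftrightarrow> (\<exists>f. embeds f P (vs, E))"
    and "subgraph_count_at s (vs, E) P > 0 \<longleftrightarrow> (\<exists>f. embeds f P (vs, E) \<and> s \<in> f ` fst P)"
proof -
  have "subgraph_count (vs, E) P > 0 \<longleftrightarrow> (\<exists>H. subgraph H (vs, E) \<and> isomorphic H P)"
    using finite_subgraphs[OF assms(1), of E "%H. isomorphic H P"] by (simp add: subgraph_count_def card_gt_0_iff)
  also have "\<dots> \<longleftrightarrow> (\<exists>f. embeds f P (vs, E))"
    using embeds_subgraph[OF _ assms(2)] subgraph_embeds by metis
  finally show "subgraph_count (vs, E) P > 0 \<longleftrightarrow> (\<exists>f. embeds f P (vs, E))" .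
  have "subgraph_count_at s (vs, E) P > 0 \<longleftrightarrow> (\<exists>H. subgraph H (vs, E) \<and> isomorphic H P \<and> s \<in> fst H)"
    using finite_subgraphs[OF assms(1), of E "%H. isomorphic H P \<and> s \<in> fst H"]
    by (simp add: subgraph_count_at_def card_gt_0_iff) blast
  also have "\<dots> \<longleftrightarrow> (\<exists>f. embeds f P (vs, E) \<and> s \<in> f ` fst P)"
    using embeds_subgraph[OF _ assms(2)] subgraph_embeds by (metis fst_conv)
  finally show "subgraph_count_at s (vs, E) P > 0 \<longleftrightarrow> (\<exists>f. embeds f P (vs, E) \<and> s \<in> f ` fst P)" .
qed

text \<open>
  The quadruple \<open>(a, x, b, y)\<close> stands for the edge between vertex \<open>x\<close> of class \<open>a\<close> and vertex \<open>y\<close> of class \<open>b\<close>. The root is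
  in class 0, the rows are class 1 and the columns class 2.
\<close>

type_synonym cedge = "nat \<times> nat \<times> nat \<times> nat"

definition E2 :: "nat => cedge set => nat set set" where
  "E2 k Q = {{a * (k * k) + x, b * (k * k) + y} | a x b y. (a, x, b, y) \<in> Q}"

definition wfQ :: "nat => nat => cedge set => bool" where
  "wfQ k N Q \<longleftrightarrow> (\<forall>a x b y. (a, x, b, y) \<in> Q --> a < b \<and> b < N \<and> x < k * k \<and> y < k * k)"

lemma vx_div: "x < (m::nat) ==> (a * m + x) div m = a" "x < m ==> (a * m + x) mod m = x"
  by simp_all

lemma vx_inj: "x < (m::nat) ==> y < m ==> a * m + x = b * m + y \<longleftrightarrow> a = b \<and> x = y"
  by (metis vx_div)

lemma vx_lt: "x < (m::nat) ==> y < m ==> a < b ==> a * m + x < b * m + y"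
proof -
  assume "x < m" "a < b"
  then have "a * m + x < Suc a * m" by simp
  also have "\<dots> \<le> b * m" using \<open>a < b\<close> by (intro mult_le_mono1) simp
  finally show ?thesis by simp
qed

lemma adj_iff:
  assumes "wfQ k N Q" "x < k * k" "y < k * k"
  shows "{a * (k * k) + x, b * (k * k) + y} \<in> E2 k Q \<longleftrightarrow> (a, x, b, y) \<in> Q \<or> (b, y, a, x) \<in> Q"
proof
  assume "{a * (k * k) + x, b * (k * k) + y} \<in> E2 k Q"
  then obtain a' x' b' y' where e: "{a * (k * k) + x, b * (k * k) + y} = {a' * (k * k) + x', b' * (k * k) + y'}" "(a', x', b', y') \<in> Q"
    unfolding E2_def by blast
  then have "x' < k * k" "y' < k * k" using assms(1) by (auto simp: wfQ_def)
  then show "(a, x, b, y) \<in> Q \<or> (b, y, a, x) \<in> Q"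
    using e vx_inj[OF assms(2)] vx_inj[OF assms(3)] by (auto simp: doubleton_eq_iff)
next
  assume "(a, x, b, y) \<in> Q \<or> (b, y, a, x) \<in> Q"
  then show "{a * (k * k) + x, b * (k * k) + y} \<in> E2 k Q" unfolding E2_def by (auto simp: insert_commute)
qed

text \<open>Edges are listed by increasing class, so the column edges start at the root if
  \<open>ta = 0\<close> and otherwise end at a second root in class \<open>ta\<close>.\<close>

definition dynQ :: "nat => nat => (nat => bool) => (nat => bool) => cedge set" where
  "dynQ k ta u v = {(0, 0, 1, i) | i. i < k \<and> u i} \<union>
     (if ta = 0 then {(0, 0, 2, j) | j. j < k \<and> v j} else {(2, j, ta, 0) | j. j < k \<and> v j})"

text \<open>The classes from \<open>\<delta>\<close> on are matched in pairs, and a vertex there has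
  at most one dummy neighbour. This is the set of all possible dummy edges; a graph may contain any
  part of it.\<close>

definition dumQ :: "nat => cedge set" where
  "dumQ \<delta> = {(a, x, Suc a, x) | a x. \<delta> \<le> a \<and> even (a - \<delta>)}"

definition hitp :: "nat => (nat => nat => bool) => (nat => bool) => (nat => bool) => bool" where
  "hitp k M u v \<longleftrightarrow> (\<exists>i<k. \<exists>j<k. u i \<and> M i j \<and> v j)"

text \<open>The edge set is only sandwiched, so that one analysis of a pattern serves all matrices
  and both ways of updating, whichever dummy edges are present.\<close>

locale fin_graph =
  fixes k N :: nat and Q :: "cedge set" and M :: "nat => nat => bool" and u v :: "nat => bool"
    and core :: "cedge set" and ta \<delta> :: nat
  assumes k: "1 \<le> k" and wf: "wfQ k N Q" and low: "core \<union> dynQ k ta u v \<subseteq> Q"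
    and up: "Q \<subseteq> core \<union> dynQ k ta u v \<union> dumQ \<delta>" and N: "3 \<le> N"
begin

abbreviation "G \<equiv> ({..<N * (k * k)}, E2 k Q)"
abbreviation "vt a x \<equiv> a * (k * k) + x"

lemma edge_cases:
  assumes "{p, p'} \<in> E2 k Q"
  obtains a x b y where "p = vt a x" "p' = vt b y" "x < k * k" "y < k * k" "(a, x, b, y) \<in> Q \<or> (b, y, a, x) \<in> Q"
proof -
  obtain a x b y where e: "{p, p'} = {vt a x, vt b y}" "(a, x, b, y) \<in> Q"
    using assms unfolding E2_def by blast
  then have "x < k * k" "y < k * k" using wf by (auto simp: wfQ_def)
  then show ?thesis using e that[of a x b y] that[of b y a x] by (auto simp: doubleton_eq_iff)
qed

lemma kk: "i < k ==> i < k * k" "0 < k * k"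
proof -
  have "k \<le> k * k" using k by (cases k) auto
  then show "i < k ==> i < k * k" by (rule order_less_le_trans[rotated])
  show "0 < k * k" using k by simp
qed

text \<open>Every edge joins different classes, so a triangle may be listed by increasing class.\<close>

lemma triangle_cases:
  assumes "{p, p'} \<in> E2 k Q" "{p', p''} \<in> E2 k Q" "{p, p''} \<in> E2 k Q"
  obtains a x b y c z where "(a, x, b, y) \<in> Q" "(b, y, c, z) \<in> Q" "(a, x, c, z) \<in> Q"
    "{p, p', p''} = {vt a x, vt b y, vt c z}"
proof -
  obtain a x b y where 1: "p = vt a x" "p' = vt b y" "x < k * k" "y < k * k" "(a, x, b, y) \<in> Q \<or> (b, y, a, x) \<in> Q"
    using edge_cases[OF assms(1)] by blast
  obtain b' y' c z where 2: "p' = vt b' y'" "p'' = vt c z" "y' < k * k" "z < k * k" "(b', y', c, z) \<in> Q \<or> (c, z, b', y') \<in> Q"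
    using edge_cases[OF assms(2)] by blast
  have b': "b' = b" "y' = y" using 1(2,4) 2(1,3) vx_inj by auto
  have 3: "(a, x, c, z) \<in> Q \<or> (c, z, a, x) \<in> Q"
    using assms(3) adj_iff[OF wf 1(3) 2(4)] by (simp add: 1(1) 2(2))
  have lt: "(a, x, b, y) \<in> Q ==> a < b" for a x b y using wf by (auto simp: wfQ_def)
  show ?thesis
    using 1(5) 2(5) 3 unfolding b'
    apply (elim disjE)
    subgoal using that[of a x b y c z] by (auto simp: 1(1,2) 2(2))
    subgoal by (meson lt less_asym less_trans)
    subgoal using that[of a x c z b y] by (auto simp: 1(1,2) 2(2))
    subgoal using that[of c z a x b y] by (auto simp: 1(1,2) 2(2))
    subgoal using that[of b y a x c z] by (auto simp: 1(1,2) 2(2))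
    subgoal using that[of b y c z a x] by (auto simp: 1(1,2) 2(2))
    subgoal by (meson lt less_asym less_trans)
    subgoal using that[of c z b y a x] by (auto simp: 1(1,2) 2(2))
    done
qed

text \<open>Dummy edges are isolated, so they are in no triangle.\<close>

lemma triangle_core:
  assumes lt: "\<And>a x b y. (a, x, b, y) \<in> core \<union> dynQ k ta u v ==> b < \<delta>"
    and e: "{p, p'} \<in> E2 k Q" "{p', p''} \<in> E2 k Q" "{p, p''} \<in> E2 k Q"
  obtains a x b y c z where "a < b" "b < c" "(a, x, b, y) \<in> core \<union> dynQ k ta u v" "(b, y, c, z) \<in> core \<union> dynQ k ta u v"
    "(a, x, c, z) \<in> core \<union> dynQ k ta u v" "{p, p', p''} = {vt a x, vt b y, vt c z}"
proof -
  obtain a x b y c z where t: "(a, x, b, y) \<in> Q" "(b, y, c, z) \<in> Q" "(a, x, c, z) \<in> Q"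
    "{p, p', p''} = {vt a x, vt b y, vt c z}" using e by (rule triangle_cases)
  have l: "a < b" "b < c" using t(1,2) wf by (auto simp: wfQ_def)
  have dd: "b = Suc a \<and> even (a - \<delta>) \<and> \<delta> \<le> a \<or> (a, x, b, y) \<in> core \<union> dynQ k ta u v \<and> b < \<delta>" if "(a, x, b, y) \<in> Q" for a x b y
    using subsetD[OF up that] lt[of a x b y] by (auto simp: dumQ_def)
  \<comment> \<open>A dummy edge ends in a class of odd offset from \<open>\<delta>\<close>, where
    no edge to a higher class begins; so the lowest edge of the triangle is not a dummy.\<close>
  have "b < \<delta>" using dd[OF t(1)] dd[OF t(2)] l by (auto simp: Suc_diff_le)
  then show ?thesis using that[OF l _ _ _ t(4)] dd[OF t(1)] dd[OF t(2)] dd[OF t(3)] l by auto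
qed

lemma edgeI: "(a, x, b, y) \<in> Q ==> {vt a x, vt b y} \<in> E2 k Q \<and> {vt b y, vt a x} \<in> E2 k Q"
  unfolding E2_def by (auto simp: insert_commute)

lemma vertex: "(a, x, b, y) \<in> Q ==> vt a x < N * (k * k) \<and> vt b y < N * (k * k)"
proof -
  assume "(a, x, b, y) \<in> Q"
  then have "x < k * k" "y < k * k" "a < N" "b < N" using wf by (force simp: wfQ_def)+
  then show ?thesis using vx_lt[of x "k * k" 0 a N] vx_lt[of y "k * k" 0 b N] kk(2) by simp
qed

end

section \<open>Paws, triangles, diamonds and 4-cliques\<close>

definition coreM :: "nat => (nat => nat => bool) => cedge set" where
  "coreM k M = {(1, i, 2, j) | i j. i < k \<and> j < k \<and> M i j}"

lemma coreM_iff: "(a, x, b, y) \<in> coreM k M \<longleftrightarrow> a = 1 \<and> b = 2 \<and> x < k \<and> y < k \<and> M x y"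
  by (auto simp: coreM_def)

lemma dynQ0_iff: "(a, x, b, y) \<in> dynQ k 0 u v \<longleftrightarrow> a = 0 \<and> x = 0 \<and> (b = 1 \<and> y < k \<and> u y \<or> b = 2 \<and> y < k \<and> v y)"
  by (auto simp: dynQ_def)

lemma embeds4:
  assumes "distinct [p0, p1, p2, p3]" "{p0, p1, p2, p3} \<subseteq> fst G" "fst P = {0, 1, 2, 3}"
    "\<forall>e\<in>snd P. (%n. if n = 0 then p0 else if n = 1 then p1 else if n = 2 then p2 else p3) ` e \<in> snd G"
  shows "\<exists>f. embeds f P G \<and> f ` fst P = {p0, p1, p2, p3}"
  using assms by (intro exI[of _ "%n. if n = 0 then p0 else if n = 1 then p1 else if n = 2 then p2 else p3"])
    (auto simp: embeds_def inj_on_def)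

lemma two_common:
  assumes "p \<in> {a, b, c}" "p \<in> {a', b', c'}" "p' \<in> {a, b, c}" "p' \<in> {a', b', c'}" "p \<noteq> p'"
    "p \<noteq> c" "p' \<noteq> c" "p \<noteq> c'" "p' \<noteq> c'" "a \<noteq> b'" "a' \<noteq> b"
  shows "a = a' \<and> b = b'"
  using assms by auto

text \<open>Each of four distinct vertices is missing from one of the four triples; this excludes a
  vertex shared by all triangles of a 4-clique.\<close>

lemma four_common:
  assumes "w \<in> {a, b, c}" "w \<in> {a, b, d}" "w \<in> {a, c, d}" "w \<in> {b, c, d}"
  shows "\<not> distinct [a, b, c, d]"
  using assms by auto

context fin_graph
begin

lemma vt_ne: "x < k * k ==> y < k * k ==> a \<noteq> b ==> vt a x \<noteq> vt b y"
  using vx_inj by blast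

text \<open>The copy found after a hit contains the root, which is vertex 0, and any copy at all
  proves a hit; so one gadget serves detection with and without a given vertex.\<close>

lemma detect:
  assumes w: "\<Union> (snd P) \<subseteq> fst P"
    and 1: "\<And>f. embeds f P G ==> hitp k M u v"
    and 2: "\<And>i j. i < k ==> j < k ==> u i ==> M i j ==> v j ==> \<exists>f. embeds f P G \<and> vt 0 0 \<in> f ` fst P"
  shows "(subgraph_count G P > 0) = hitp k M u v \<and> (subgraph_count_at 0 G P > 0) = hitp k M u v"
proof -
  have 3: "\<exists>f. embeds f P G \<and> 0 \<in> f ` fst P" if "hitp k M u v" using that 2 by (auto simp: hitp_def)
  show ?thesis using 1 3 detect_iff[OF _ w] by (metis finite_lessThan)
qed

text \<open>The pendant edge at the root is always there, so a paw exists as soon as a triangle at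
  the root does; without a hit there is no triangle.\<close>

lemma paw:
  assumes core: "core = insert (0, 0, 3, 0) (coreM k M)" and d: "\<delta> = 4" "ta = 0"
  shows "(subgraph_count G paw > 0) = hitp k M u v \<and> (subgraph_count_at 0 G paw > 0) = hitp k M u v"
proof (rule detect)
  fix f assume "embeds f paw G"
  then have "{f 0, f 1} \<in> E2 k Q" "{f 1, f 2} \<in> E2 k Q" "{f 0, f 2} \<in> E2 k Q" by (auto simp: embeds_def paw_def)
  then obtain a x b y c z where t: "a < b" "b < c" "(a, x, b, y) \<in> core \<union> dynQ k ta u v"
    "(b, y, c, z) \<in> core \<union> dynQ k ta u v" "(a, x, c, z) \<in> core \<union> dynQ k ta u v"
    by (rule triangle_core[rotated]) (auto simp: core d coreM_iff dynQ0_iff)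
  show "hitp k M u v"
    using t by (auto simp: core d coreM_iff dynQ0_iff hitp_def)
next
  fix i j assume ij: "i < k" "j < k" "u i" "M i j" "v j"
  have q: "(0, 0, 1, i) \<in> Q" "(0, 0, 2, j) \<in> Q" "(1, i, 2, j) \<in> Q" "(0, 0, 3, 0) \<in> Q"
    using ij low d by (auto simp: core coreM_def dynQ_def)
  have "\<exists>f. embeds f paw G \<and> f ` fst paw = {vt 0 0, vt 1 i, vt 2 j, vt 3 0}"
    apply (rule embeds4)
    subgoal using vt_ne kk(1)[OF ij(1)] kk(1)[OF ij(2)] kk(2) by simp
    subgoal using q[THEN vertex] by simp
    subgoal by (simp add: paw_def)
    subgoal using q[THEN edgeI] by (simp add: paw_def insert_commute)
    done
  then show "\<exists>f. embeds f paw G \<and> vt 0 0 \<in> f ` fst paw" by auto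
qed (auto simp: paw_def)

lemma triangle:
  assumes core: "core = coreM k M" and d: "\<delta> = 3" "ta = 0"
  shows "(subgraph_count G (cycle 3) > 0) = hitp k M u v \<and> (subgraph_count_at 0 G (cycle 3) > 0) = hitp k M u v"
proof (rule detect)
  have c3: "cycle 3 = ({0, 1, 2}, {{0, 1}, {1, 2}, {2, 0}})"
  proof -
    have 1: "{..<3::nat} = {0, 1, 2}" by (auto simp: less_Suc_eq numeral_3_eq_3 numeral_2_eq_2)
    have 2: "{{i, Suc i mod 3} | i. i < 3} = (%i. {i, Suc i mod 3}) ` {..<3}" by blast
    show ?thesis unfolding cycle_def 2 unfolding 1 by (simp add: insert_commute numeral_2_eq_2)
  qed
  show "\<Union> (snd (cycle 3)) \<subseteq> fst (cycle 3)" by (auto simp: c3)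
  show "hitp k M u v" if "embeds f (cycle 3) G" for f
  proof -
    have "{f 0, f 1} \<in> E2 k Q" "{f 1, f 2} \<in> E2 k Q" "{f 0, f 2} \<in> E2 k Q"
      using that by (auto simp: embeds_def c3 insert_commute)
    then obtain a x b y c z where t: "a < b" "b < c" "(a, x, b, y) \<in> core \<union> dynQ k ta u v"
    "(b, y, c, z) \<in> core \<union> dynQ k ta u v" "(a, x, c, z) \<in> core \<union> dynQ k ta u v"
    by (rule triangle_core[rotated]) (auto simp: core d coreM_iff dynQ0_iff)
    show "hitp k M u v"
      using t by (auto simp: core d coreM_iff dynQ0_iff hitp_def)
  qed
  fix i j assume ij: "i < k" "j < k" "u i" "M i j" "v j"
  have q: "(0, 0, 1, i) \<in> Q" "(0, 0, 2, j) \<in> Q" "(1, i, 2, j) \<in> Q"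
    using ij low d by (auto simp: core coreM_def dynQ_def)
  have ne: "vt 0 0 \<noteq> vt 1 i" "vt 0 0 \<noteq> vt 2 j" "vt 1 i \<noteq> vt 2 j"
    using vt_ne kk(1)[OF ij(1)] kk(1)[OF ij(2)] kk(2) by auto
  have "embeds (%n. if n = 0 then vt 0 0 else if n = 1 then vt 1 i else vt 2 j) (cycle 3) G"
    using ne q[THEN vertex] q[THEN edgeI] by (auto simp: embeds_def c3 inj_on_def)
  then show "\<exists>f. embeds f (cycle 3) G \<and> vt 0 0 \<in> f ` fst (cycle 3)"
    by (intro exI conjI, assumption, simp add: c3)
qed

text \<open>Every entry \<open>x\<close> owns a vertex joined to its row and its column. A hit gives
  two triangles on the same matrix edge, one through the root and one through this vertex. Without a
  hit all triangles are of the second kind, and two of them sharing an edge are equal.\<close>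

lemma diamond:
  assumes core: "core = coreM k M \<union> ({(1, x div k, 3, x) | x. x < k * k} \<union> {(2, x mod k, 3, x) | x. x < k * k})"
    and d: "\<delta> = 4" "ta = 0"
  shows "(subgraph_count G diamond > 0) = hitp k M u v \<and> (subgraph_count_at 0 G diamond > 0) = hitp k M u v"
proof (rule detect)
  let ?T = "%x. {vt 1 (x div k), vt 2 (x mod k), vt 3 x}"
  have tri: "hitp k M u v \<or> (\<exists>x<k * k. {p, p', p''} = ?T x)"
    if T: "{p, p'} \<in> E2 k Q" "{p', p''} \<in> E2 k Q" "{p, p''} \<in> E2 k Q" for p p' p''
  proof -
    obtain a x b y c z where t: "a < b" "b < c" "(a, x, b, y) \<in> core \<union> dynQ k ta u v"
      "(b, y, c, z) \<in> core \<union> dynQ k ta u v" "(a, x, c, z) \<in> core \<union> dynQ k ta u v"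
      "{p, p', p''} = {vt a x, vt b y, vt c z}"
      using T by (rule triangle_core[rotated]) (auto simp: core d coreM_iff dynQ0_iff)
    have I: "(a, x, b, y) \<in> core \<union> dynQ k ta u v \<longleftrightarrow> a = 1 \<and> b = 2 \<and> x < k \<and> y < k \<and> M x y \<or>
      a = 1 \<and> b = 3 \<and> x = y div k \<and> y < k * k \<or> a = 2 \<and> b = 3 \<and> x = y mod k \<and> y < k * k \<or>
      a = 0 \<and> x = 0 \<and> b = 1 \<and> y < k \<and> u y \<or> a = 0 \<and> x = 0 \<and> b = 2 \<and> y < k \<and> v y" for a x b y
      unfolding core d Un_iff coreM_iff dynQ0_iff by blast
    have "a = 0 \<and> b = 1 \<and> c = 2 \<and> y < k \<and> z < k \<and> u y \<and> M y z \<and> v z \<or>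
        a = 1 \<and> b = 2 \<and> c = 3 \<and> x = z div k \<and> y = z mod k \<and> z < k * k"
      using t(1-5) unfolding I by (elim disjE conjE; simp)
    then show ?thesis unfolding t(6) hitp_def by blast
  qed
  have lt: "x div k < k * k" "x mod k < k * k" if "x < k * k" for x
    using that k kk(1)[of "x mod k"] le_less_trans[OF div_le_dividend] by (blast, simp)
  \<comment> \<open>Two vertices of such a triangle determine the entry: the private vertex alone
    does, and so do row and column together.\<close>
  have uniq: "x = y" if "x < k * k" "y < k * k" "p \<in> ?T x" "p \<in> ?T y" "p' \<in> ?T x" "p' \<in> ?T y" "p \<noteq> p'" for x y p p'
  proof -
    have h: "x = y" if "vt 3 x \<in> ?T y" "x < k * k" "y < k * k" for x y
      using that vt_ne[of x "y div k" 3 1] vt_ne[of x "y mod k" 3 2] lt[of y] by auto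
    consider "p = vt 3 x \<or> p' = vt 3 x" | "p = vt 3 y \<or> p' = vt 3 y" | "p \<noteq> vt 3 x" "p' \<noteq> vt 3 x" "p \<noteq> vt 3 y" "p' \<noteq> vt 3 y" by blast
    then show ?thesis
    proof cases
      case 1 then show ?thesis using that h[of x y] by metis
    next
      case 2 then show ?thesis using that h[of y x] by metis
    next
      case 3
      have "vt 1 (x div k) \<noteq> vt 2 (y mod k)"
        by (rule vt_ne[OF lt(1)[OF that(1)] lt(2)[OF that(2)]]) simp
      moreover have "vt 1 (y div k) \<noteq> vt 2 (x mod k)"
        by (rule vt_ne[OF lt(1)[OF that(2)] lt(2)[OF that(1)]]) simp
      ultimately have "vt 1 (x div k) = vt 1 (y div k)" "vt 2 (x mod k) = vt 2 (y mod k)"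
        using two_common[OF that(3-7) 3] by blast+
      then show ?thesis by (metis add_left_cancel div_mod_decomp)
    qed
  qed
  fix f assume f: "embeds f diamond G"
  have "f 2 \<noteq> f 3" "f 0 \<noteq> f 1" "f 0 \<noteq> f 2" "f 0 \<noteq> f 3" "f 1 \<noteq> f 2" "f 1 \<noteq> f 3"
    using f by (auto simp: embeds_def diamond_def inj_on_def)
  note ne = this
  have e: "{f 0, f 1} \<in> E2 k Q" "{f 1, f 2} \<in> E2 k Q" "{f 0, f 2} \<in> E2 k Q" "{f 1, f 3} \<in> E2 k Q" "{f 0, f 3} \<in> E2 k Q"
    using f by (auto simp: embeds_def diamond_def)
  show "hitp k M u v"
  proof (rule ccontr)
    assume n: "\<not> ?thesis"
    obtain x where x: "x < k * k" "{f 0, f 1, f 2} = ?T x" using tri[OF e(1,2,3)] n by blast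
    obtain y where y: "y < k * k" "{f 0, f 1, f 3} = ?T y" using tri[OF e(1,4,5)] n by blast
    have "f 0 \<in> ?T x" "f 1 \<in> ?T x" "f 0 \<in> ?T y" "f 1 \<in> ?T y" unfolding x(2)[symmetric] y(2)[symmetric] by auto
    then have "x = y" using uniq[OF x(1) y(1), of "f 0" "f 1"] ne(2) by blast
    then have "{f 0, f 1, f 2} = {f 0, f 1, f 3}" using x(2) y(2) by simp
    then have "f 2 \<in> {f 0, f 1, f 3}" by blast
    then show False using ne by simp
  qed
next
  fix i j assume ij: "i < k" "j < k" "u i" "M i j" "v j"
  let ?x = "i * k + j"
  have x: "?x < k * k" "?x div k = i" "?x mod k = j" using vx_lt[of j k 0 i k] ij by auto
  have "(1, i, 3, ?x) \<in> core" "(2, j, 3, ?x) \<in> core" unfolding core using x by force+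
  then have q: "(0, 0, 1, i) \<in> Q" "(0, 0, 2, j) \<in> Q" "(1, i, 2, j) \<in> Q" "(1, i, 3, ?x) \<in> Q" "(2, j, 3, ?x) \<in> Q"
    using ij low d by (auto simp: core coreM_def dynQ_def)
  have "\<exists>f. embeds f diamond G \<and> f ` fst diamond = {vt 1 i, vt 2 j, vt 0 0, vt 3 ?x}"
    apply (rule embeds4)
    subgoal using vt_ne kk(1)[OF ij(1)] kk(1)[OF ij(2)] kk(2) x(1) by simp
    subgoal using q[THEN vertex] by simp
    subgoal by (simp add: diamond_def)
    subgoal using q[THEN edgeI] by (simp add: diamond_def insert_commute)
    done
  then show "\<exists>f. embeds f diamond G \<and> vt 0 0 \<in> f ` fst diamond" by auto
qed (auto simp: diamond_def)

text \<open>The vertex of class 3 is joined to the root, all rows and all columns, and forms a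
  4-clique with the triangle of a hit. Without a hit it lies in every triangle, but no vertex lies
  in all four triangles of a 4-clique.\<close>

lemma clique4:
  assumes core: "core = insert (0, 0, 3, 0) (coreM k M \<union> ({(1, i, 3, 0) | i. i < k} \<union> {(2, i, 3, 0) | i. i < k}))"
    and d: "\<delta> = 4" "ta = 0"
  shows "(subgraph_count G clique4 > 0) = hitp k M u v \<and> (subgraph_count_at 0 G clique4 > 0) = hitp k M u v"
proof (rule detect)
  have tri: "hitp k M u v \<or> vt 3 0 \<in> {p, p', p''}"
    if T: "{p, p'} \<in> E2 k Q" "{p', p''} \<in> E2 k Q" "{p, p''} \<in> E2 k Q" for p p' p''
  proof -
    obtain a x b y c z where t: "a < b" "b < c" "(a, x, b, y) \<in> core \<union> dynQ k ta u v"
      "(b, y, c, z) \<in> core \<union> dynQ k ta u v" "(a, x, c, z) \<in> core \<union> dynQ k ta u v"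
      "{p, p', p''} = {vt a x, vt b y, vt c z}"
      using T by (rule triangle_core[rotated]) (auto simp: core d coreM_iff dynQ0_iff)
    have "hitp k M u v \<or> c = 3 \<and> z = 0"
      using t(1-5) by (auto simp: core d coreM_iff dynQ0_iff hitp_def)
    then show ?thesis unfolding t(6) by blast
  qed
  fix f assume f: "embeds f clique4 G"
  have ne: "f 2 \<noteq> f 3" "f 0 \<noteq> f 1" "f 0 \<noteq> f 2" "f 0 \<noteq> f 3" "f 1 \<noteq> f 2" "f 1 \<noteq> f 3"
    using f by (auto simp: embeds_def clique4_def inj_on_def)
  have e: "{f 0, f 1} \<in> E2 k Q" "{f 1, f 2} \<in> E2 k Q" "{f 0, f 2} \<in> E2 k Q" "{f 1, f 3} \<in> E2 k Q" "{f 0, f 3} \<in> E2 k Q" "{f 2, f 3} \<in> E2 k Q"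
    using f by (auto simp: embeds_def clique4_def)
  show "hitp k M u v"
    using tri[OF e(1,2,3)] tri[OF e(1,4,5)] tri[OF e(3,6,5)] tri[OF e(2,6,4)] ne
      four_common[of "vt 3 0" "f 0" "f 1" "f 2" "f 3"] by (metis distinct_length_2_or_more distinct_singleton)
next
  fix i j assume ij: "i < k" "j < k" "u i" "M i j" "v j"
  have q: "(0, 0, 1, i) \<in> Q" "(0, 0, 2, j) \<in> Q" "(1, i, 2, j) \<in> Q" "(1, i, 3, 0) \<in> Q" "(2, j, 3, 0) \<in> Q" "(0, 0, 3, 0) \<in> Q"
    using ij low d by (auto simp: core coreM_def dynQ_def)
  have "\<exists>f. embeds f clique4 G \<and> f ` fst clique4 = {vt 0 0, vt 1 i, vt 2 j, vt 3 0}"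
    apply (rule embeds4)
    subgoal using vt_ne kk(1)[OF ij(1)] kk(1)[OF ij(2)] kk(2) by simp
    subgoal using q[THEN vertex] by simp
    subgoal by (simp add: clique4_def)
    subgoal using q[THEN edgeI] by (simp add: clique4_def insert_commute)
    done
  then show "\<exists>f. embeds f clique4 G \<and> vt 0 0 \<in> f ` fst clique4" by auto
qed (auto simp: clique4_def)

end

subsection \<open>Gadgets for long cycles\<close>

text \<open>Every entry becomes a path of \<open>q - 2\<close> edges from its row to its column,
  through private vertices in the classes 3 to \<open>q - 1\<close>; only the last edge depends on
  the matrix. With two edges at the root, a hit closes a cycle of length \<open>q\<close>.\<close>

definition coreC :: "nat => nat => (nat => nat => bool) => cedge set" where
  "coreC q k M = {(1, y div k, 3, y) | y. y < k * k} \<union> {(2 + b, y, 3 + b, y) | b y. 1 \<le> b \<and> b < q - 3 \<and> y < k * k} \<union>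
     {(2, y mod k, q - 1, y) | y. y < k * k \<and> M (y div k) (y mod k)}"

lemma coreC_iff: "(a, x, b, y) \<in> coreC q k M \<longleftrightarrow>
   a = 1 \<and> b = 3 \<and> x = y div k \<and> y < k * k \<or> 3 \<le> a \<and> a < q - 1 \<and> b = Suc a \<and> x = y \<and> y < k * k \<or>
   a = 2 \<and> b = q - 1 \<and> x = y mod k \<and> y < k * k \<and> M (y div k) (y mod k)"
proof -
  have "(\<exists>b' y'. (a, x, b, y) = (2 + b', y', 3 + b', y') \<and> 1 \<le> b' \<and> b' < q - 3 \<and> y' < k * k) \<longleftrightarrow>
      3 \<le> a \<and> a < q - 1 \<and> b = Suc a \<and> x = y \<and> y < k * k"
  proof
    assume "3 \<le> a \<and> a < q - 1 \<and> b = Suc a \<and> x = y \<and> y < k * k"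
    then show "\<exists>b' y'. (a, x, b, y) = (2 + b', y', 3 + b', y') \<and> 1 \<le> b' \<and> b' < q - 3 \<and> y' < k * k"
      by (intro exI[of _ "a - 2"] exI[of _ y]) auto
  qed auto
  then show ?thesis unfolding coreC_def Un_iff mem_Collect_eq by blast
qed

locale cyc_graph = fin_graph +
  fixes q :: nat
  assumes q: "4 \<le> q" and core: "core = coreC q k M" and ta: "ta = 0" and dl: "\<delta> = q"
begin

abbreviation "A p p' \<equiv> {p, p'} \<in> E2 k Q"

text \<open>The vertices of the path from \<open>L\<^sub>i\<close> to \<open>R\<^sub>j\<close> that subdivides the matrix entry \<open>y = i k + j\<close>.\<close>

definition PP :: "nat => nat => nat" where
  "PP b y = (if b = 0 then vt 1 (y div k) else if b = q - 2 then vt 2 (y mod k) else vt (2 + b) y)"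

lemma lt: assumes "y < k * k" shows "y div k < k" "y mod k < k" "y div k < k * k" "y mod k < k * k"
proof -
  show 1: "y div k < k" using assms by (simp add: less_mult_imp_div_less)
  show 2: "y mod k < k" using k by simp
  show "y div k < k * k" "y mod k < k * k" using 1 2 kk(1) by blast+
qed

definition nonD :: "cedge => bool" where
  "nonD e \<longleftrightarrow> e \<in> coreC q k M \<union> dynQ k 0 u v"

lemma Q_cases:
  assumes "(a, x, b, y) \<in> Q"
  shows "nonD (a, x, b, y) \<or> q \<le> a \<and> b = Suc a \<and> x = y \<and> even (a - q)"
  using subsetD[OF up assms] by (auto simp: nonD_def core ta dl dumQ_def)

lemma nonD_iff: "nonD (a, x, b, y) \<longleftrightarrow>
   a = 1 \<and> b = 3 \<and> x = y div k \<and> y < k * k \<or> 3 \<le> a \<and> a < q - 1 \<and> b = Suc a \<and> x = y \<and> y < k * k \<or>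
   a = 2 \<and> b = q - 1 \<and> x = y mod k \<and> y < k * k \<and> M (y div k) (y mod k) \<or>
   a = 0 \<and> x = 0 \<and> b = 1 \<and> y < k \<and> u y \<or> a = 0 \<and> x = 0 \<and> b = 2 \<and> y < k \<and> v y"
  unfolding nonD_def Un_iff coreC_iff dynQ0_iff by blast

lemma nonD_lt: "nonD (a, x, b, y) ==> a < b \<and> b < q"
  unfolding nonD_iff using q by (elim disjE conjE; simp)

lemma dummy_nbr:
  assumes "(a, x, b, y) \<in> Q \<or> (b, y, a, x) \<in> Q" "q \<le> a"
  shows "b = (if even (a - q) then Suc a else a - 1) \<and> y = x \<and> q \<le> b"
  using assms(1)
proof
  assume "(a, x, b, y) \<in> Q"
  from Q_cases[OF this] nonD_lt[of a x b y] show ?thesis using assms(2) by auto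
next
  assume "(b, y, a, x) \<in> Q"
  from Q_cases[OF this] nonD_lt[of b y a x] have "q \<le> b \<and> a = Suc b \<and> y = x \<and> even (b - q)" using assms(2) by auto
  then show ?thesis by (auto simp: Suc_diff_le)
qed

lemma nbr:
  assumes "A (vt a x) p" "x < k * k" "a < q"
  obtains b y where "p = vt b y" "y < k * k" "b < q" "nonD (a, x, b, y) \<or> nonD (b, y, a, x)"
proof -
  obtain a' x' b y where e: "vt a x = vt a' x'" "p = vt b y" "x' < k * k" "y < k * k" "(a', x', b, y) \<in> Q \<or> (b, y, a', x') \<in> Q"
    using edge_cases[OF assms(1)] by blast
  then have ax: "a' = a" "x' = x" using assms(2) vx_inj by metis+
  have "nonD (a, x, b, y) \<or> nonD (b, y, a, x)"
    using e(5) Q_cases[of a x b y] Q_cases[of b y a x] assms(3) unfolding ax by auto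
  moreover have "b < q" using calculation nonD_lt[of a x b y] nonD_lt[of b y a x] assms(3) by auto
  ultimately show ?thesis using that e by blast
qed

lemma nbr_internal:
  assumes "A (PP b y) p" "1 \<le> b" "b \<le> q - 3" "y < k * k"
  shows "p = PP (b - 1) y \<or> p = PP (b + 1) y \<and> (b = q - 3 --> M (y div k) (y mod k))"
proof -
  have b: "PP b y = vt (2 + b) y" using assms(2,3) q by (auto simp: PP_def)
  obtain c z where c: "p = vt c z" "nonD (2 + b, y, c, z) \<or> nonD (c, z, 2 + b, y)"
    by (rule nbr[OF assms(1)[unfolded b] assms(4)]) (use assms(2,3) q in linarith, blast)
  from c(2) show ?thesis
  proof
    assume "nonD (2 + b, y, c, z)"
    then have "c = 2 + (b + 1)" "z = y" "b + 1 \<noteq> 0" "b + 1 \<noteq> q - 2" "b \<noteq> q - 3" using assms(2) unfolding nonD_iff by auto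
    then show ?thesis using c(1) by (simp add: PP_def)
  next
    assume "nonD (c, z, 2 + b, y)"
    then consider "c = 1" "b = 1" "z = y div k" | "3 \<le> c" "2 + b = Suc c" "z = y" |
        "c = 2" "2 + b = q - 1" "z = y mod k" "M (y div k) (y mod k)"
      using assms(2) unfolding nonD_iff by auto
    then show ?thesis
    proof cases
      case 1 then show ?thesis using c(1) by (simp add: PP_def)
    next
      case 2 then have "c = 2 + (b - 1)" "b - 1 \<noteq> 0" "b - 1 \<noteq> q - 2" using assms(2,3) q by auto
      then show ?thesis using c(1) 2(3) by (simp add: PP_def)
    next
      case 3 then have "b + 1 = q - 2" "b = q - 3" by auto
      then show ?thesis using c(1) 3 by (simp add: PP_def)
    qed
  qed
qed

text \<open>Interior path vertices have degree at most 2, so a walk that does not turn back and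
  enters a path at its row end must follow it to the column. Two steps remain to close the walk, and
  the vertex in between is adjacent to both the column and the row, hence the root.\<close>

lemma up_hit:
  assumes adj: "\<And>t. A (c t) (c (Suc t))" and ne: "\<And>t. c t \<noteq> c (t + 2)" and per: "c q = c 0"
    and c0: "c 0 = PP 0 y" and c1: "c 1 = PP 1 y" and y: "y < k * k"
  shows "hitp k M u v"
proof -
  have st: "c s = PP s y \<and> c (Suc s) = PP (Suc s) y" if "s \<le> q - 3" for s
    using that
  proof (induction s)
    case 0 show ?case using c0 c1 by simp
  next
    case (Suc s)
    then have IH: "c s = PP s y" "c (Suc s) = PP (Suc s) y" by auto
    have "c (Suc (Suc s)) = PP s y \<or> c (Suc (Suc s)) = PP (Suc (Suc s)) y"
      using nbr_internal[of "Suc s" y "c (Suc (Suc s))"] adj[of "Suc s"] Suc.prems y IH(2) by auto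
    moreover have "c (Suc (Suc s)) \<noteq> PP s y" using ne[of s] IH(1) by simp
    ultimately show ?case using IH by simp
  qed
  have q3: "Suc (q - 3) = q - 2" "Suc (q - 2) = q - 1" "Suc (q - 1) = q" using q by auto
  have r: "c (q - 3) = PP (q - 3) y" "c (q - 2) = PP (q - 2) y" using st[of "q - 3"] q3 by auto
  have "A (PP (q - 3) y) (PP (q - 2) y)" using adj[of "q - 3"] r q3 by simp
  moreover have "PP (q - 2) y \<noteq> PP (q - 3 - 1) y"
    using ne[of "q - 4"] st[of "q - 4"] r(2) q by (auto simp: numeral_eq_Suc Suc_diff_Suc)
  ultimately have My: "M (y div k) (y mod k)" using nbr_internal[of "q - 3" y "PP (q - 2) y"] y q by auto
  have P: "PP 0 y = vt 1 (y div k)" "PP (q - 2) y = vt 2 (y mod k)" using q by (auto simp: PP_def)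
  have e1: "A (vt 2 (y mod k)) (c (q - 1))" using adj[of "q - 2"] r(2) q3 P by simp
  obtain a x where a: "c (q - 1) = vt a x" "x < k * k" "nonD (2, y mod k, a, x) \<or> nonD (a, x, 2, y mod k)"
    by (rule nbr[OF e1 lt(4)[OF y]]) (use q in linarith, blast)
  have e2: "A (vt 1 (y div k)) (c (q - 1))" using adj[of "q - 1"] per c0 q3 P by (simp add: insert_commute)
  obtain a' x' where a': "c (q - 1) = vt a' x'" "x' < k * k" "nonD (1, y div k, a', x') \<or> nonD (a', x', 1, y div k)"
    by (rule nbr[OF e2 lt(3)[OF y]]) (use q in linarith, blast)
  have aa: "a' = a" "x' = x" using a(1,2) a'(1,2) vx_inj by metis+
  have "a = 0 \<and> x = 0 \<and> v (y mod k) \<or> a = q - 1 \<and> y mod k = x mod k" using a(3) unfolding nonD_iff by auto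
  moreover have "a = 0 \<and> x = 0 \<and> u (y div k) \<or> a = 3 \<and> y div k = x div k" using a'(3) q unfolding nonD_iff aa by auto
  \<comment> \<open>For \<open>q = 4\<close> the middle vertex of the path itself is adjacent to
    both ends, but going there would be turning back.\<close>
  moreover have "\<not> (a = q - 1 \<and> y mod k = x mod k \<and> a = 3 \<and> y div k = x div k)"
  proof
    assume h: "a = q - 1 \<and> y mod k = x mod k \<and> a = 3 \<and> y div k = x div k"
    then have "x = y" by (metis div_mod_decomp)
    moreover have "q - 1 = 3" using h by simp
    moreover have "PP 1 y = vt 3 y" using q by (simp add: PP_def)
    ultimately have "c 3 = PP 1 y" using a(1) h by metis
    moreover have "c 1 \<noteq> c 3" using ne[of 1] by (simp add: numeral_eq_Suc)
    ultimately show False using c1 by metis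
  qed
  ultimately have "u (y div k)" "v (y mod k)" using q by auto
  then show ?thesis unfolding hitp_def using My lt[OF y] by blast
qed

text \<open>A cycle is treated as a periodic walk without turning back, which allows its starting
  point and direction to be chosen freely.\<close>

lemma cyc_hit:
  assumes adj: "\<And>t. A (c t) (c (Suc t))" and ne: "\<And>t. c t \<noteq> c (t + 2)" and per: "\<And>t. c (t + q) = c t"
  shows "hitp k M u v"
proof -
  \<comment> \<open>A vertex in a dummy class has at most one neighbour, so the walk would have to
    turn back there.\<close>
  have low: "\<exists>a x. c t = vt a x \<and> x < k * k \<and> a < q" for t
  proof -
    obtain a x b y where e: "c t = vt a x" "c (Suc t) = vt b y" "x < k * k" "y < k * k" "(a, x, b, y) \<in> Q \<or> (b, y, a, x) \<in> Q"
      using edge_cases[OF adj] by blast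
    have adj2: "A (c (Suc t)) (c (t + 2))" using adj[of "Suc t"] by simp
    obtain b' y' d z where f: "c (Suc t) = vt b' y'" "c (t + 2) = vt d z" "y' < k * k" "z < k * k" "(b', y', d, z) \<in> Q \<or> (d, z, b', y') \<in> Q"
      by (rule edge_cases[OF adj2])
    have b': "b' = b" "y' = y" using e f vx_inj by metis+
    have n: "\<not> (d = a \<and> z = x)" using ne[of t] e f by auto
    have "a < q"
    proof (rule ccontr)
      assume "\<not> a < q"
      then have 1: "b = (if even (a - q) then Suc a else a - 1) \<and> y = x \<and> q \<le> b" using dummy_nbr e(5) by simp
      then have "d = (if even (b - q) then Suc b else b - 1) \<and> z = y" using dummy_nbr[of b y d z] f(5) unfolding b' by simp
      then show False using 1 n \<open>\<not> a < q\<close> by (auto simp: Suc_diff_le split: if_splits)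
    qed
    then show ?thesis using e by blast
  qed
  \<comment> \<open>Otherwise the walk stays on the root, rows and columns, which form a star and
    force it to turn back.\<close>
  have int: "\<exists>t b y. 1 \<le> b \<and> b \<le> q - 3 \<and> y < k * k \<and> c t = PP b y"
  proof (rule ccontr)
    assume n: "\<not> ?thesis"
    have cl: "\<exists>a x. c t = vt a x \<and> x < k * k \<and> a \<le> 2" for t
    proof -
      obtain a x where a: "c t = vt a x" "x < k * k" "a < q" using low by blast
      have "a \<le> 2"
      proof (rule ccontr)
        assume "\<not> a \<le> 2"
        then obtain b where b: "a = 2 + b" "1 \<le> b" by (intro that[of "a - 2"]) simp_all
        then have "b \<le> q - 3" "PP b x = c t" using a(1,3) by (simp_all add: PP_def)
        then have "1 \<le> b \<and> b \<le> q - 3 \<and> x < k * k \<and> c t = PP b x" using b(2) a(2) by metis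
        then have "\<exists>t b y. 1 \<le> b \<and> b \<le> q - 3 \<and> y < k * k \<and> c t = PP b y" by blast
        with n show False by contradiction
      qed
      then show ?thesis using a by blast
    qed
    have star: "c t = 0 \<or> c (Suc t) = 0" for t
    proof -
      obtain a x where a: "c t = vt a x" "x < k * k" "a \<le> 2" using cl by blast
      obtain b y where b: "c (Suc t) = vt b y" "y < k * k" "b \<le> 2" using cl by blast
      obtain b' y' where b': "c (Suc t) = vt b' y'" "y' < k * k" "nonD (a, x, b', y') \<or> nonD (b', y', a, x)"
        by (rule nbr[OF adj[of t, unfolded a(1)] a(2)]) (use a(3) q in linarith, blast)
      have "b' = b" "y' = y" using b b' vx_inj by metis+
      then have "a = 0 \<and> x = 0 \<or> b = 0 \<and> y = 0" using b'(3) a(3) b(3) q unfolding nonD_iff by auto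
      then show ?thesis using a b by auto
    qed
    have n2: "c 0 \<noteq> c 2" "c 1 \<noteq> c 3" using ne[of 0] ne[of 1] by (simp_all add: numeral_eq_Suc)
    have st: "c 0 = 0 \<or> c 1 = 0" "c 1 = 0 \<or> c 2 = 0" "c 2 = 0 \<or> c 3 = 0"
      using star[of 0] star[of 1] star[of 2] by (simp_all add: numeral_eq_Suc)
    have n1: "c t \<noteq> c (Suc t)" for t
    proof -
      obtain a x b y where e: "c t = vt a x" "c (Suc t) = vt b y" "x < k * k" "y < k * k" "(a, x, b, y) \<in> Q \<or> (b, y, a, x) \<in> Q"
        using edge_cases[OF adj] by blast
      then have "a \<noteq> b" using wf by (auto simp: wfQ_def)
      then show ?thesis using e vt_ne by metis
    qed
    have "c 0 \<noteq> c 1" "c 1 \<noteq> c 2" using n1[of 0] n1[of 1] by (simp_all add: numeral_eq_Suc)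
    then show False using n2 st by metis
  qed
  \<comment> \<open>At a visited interior vertex of least position, the walk has a neighbour one
    position lower on the same path; by minimality that neighbour is the row end, so the position is
    1.\<close>
  define R where "R b \<longleftrightarrow> 1 \<le> b \<and> b \<le> q - 3 \<and> (\<exists>t y. y < k * k \<and> c t = PP b y)" for b
  define b where "b = (LEAST b. R b)"
  have "\<exists>b. R b" using int unfolding R_def by blast
  then have Rb: "R b" unfolding b_def by (rule LeastI_ex)
  then obtain t y where b: "1 \<le> b" "b \<le> q - 3" "y < k * k" "c t = PP b y" unfolding R_def by blast
  have pr: "A (c t) (c (t + q - 1))" using adj[of "t + q - 1"] per[of t] q by (simp add: insert_commute)
  have "c (t + q - 1) \<noteq> c (t + 1)" using ne[of "t + q - 1"] per[of "t + 1"] q by (simp add: eval_nat_numeral)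
  then have nb: "c (t + q - 1) = PP (b - 1) y \<and> c (t + 1) = PP (b + 1) y \<or> c (t + 1) = PP (b - 1) y \<and> c (t + q - 1) = PP (b + 1) y"
    using nbr_internal[of b y "c (t + q - 1)"] nbr_internal[of b y "c (t + 1)"] pr adj[of t] b by auto
  have "b = 1"
  proof (rule ccontr)
    assume "b \<noteq> 1"
    then have "R (b - 1)" unfolding R_def using nb b by auto
    then have "b \<le> b - 1" unfolding b_def by (rule Least_le)
    then show False using b(1) by simp
  qed
  from nb show ?thesis
  proof
    assume h: "c (t + q - 1) = PP (b - 1) y \<and> c (t + 1) = PP (b + 1) y"
    let ?d = "%s. c (t + q - 1 + s)"
    show ?thesis
    proof (rule up_hit[of ?d y])
      show "?d 1 = PP 1 y" using b(4) \<open>b = 1\<close> per[of t] q by (simp add: add.commute)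
    qed (use adj ne per[of "t + q - 1"] h \<open>b = 1\<close> b in \<open>auto simp del: One_nat_def simp: add.assoc\<close>)
  next
    assume h: "c (t + 1) = PP (b - 1) y \<and> c (t + q - 1) = PP (b + 1) y"
    \<comment> \<open>Steps of \<open>q - 1\<close> modulo the period \<open>q\<close> traverse the
      walk backwards.\<close>
    let ?d = "%s. c (t + 1 + (q - 1) * s)"
    have pm: "c (z + m * q) = c z" for z m
    proof (induction m)
      case (Suc m) then show ?case using per[of "z + m * q"] by (simp add: algebra_simps)
    qed simp
    show ?thesis
    proof (rule up_hit[of ?d y])
      fix s
      let ?x = "t + 1 + (q - 1) * s"
      have x1: "t + 1 + (q - 1) * Suc s = ?x + (q - 1)" by simp
      have x2: "t + 1 + (q - 1) * (s + 2) = ?x + 2 * (q - 1)" by simp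
      show "A (?d s) (?d (Suc s))"
        unfolding x1 using adj[of "?x + (q - 1)"] per[of ?x] q by (simp add: insert_commute)
      have "?x + 2 * (q - 1) + 2 = ?x + 2 * q" using q by simp
      then show "?d s \<noteq> ?d (s + 2)"
        unfolding x2 using ne[of "?x + 2 * (q - 1)"] pm[of ?x 2] by metis
    next
      show "?d q = ?d 0" using pm[of "t + 1" "q - 1"] by simp
      have "t + 1 + (q - 1) * 1 = t + q" using q by simp
      then show "?d 1 = PP 1 y" using b(4) \<open>b = 1\<close> per[of t] by simp
    qed (use h \<open>b = 1\<close> b in auto)
  qed
qed

lemma cycle_detect:
  "(subgraph_count G (cycle q) > 0) = hitp k M u v \<and> (subgraph_count_at 0 G (cycle q) > 0) = hitp k M u v"
proof (rule detect)
  have sm: "Suc i mod q < q" for i using q by simp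
  show "\<Union> (snd (cycle q)) \<subseteq> fst (cycle q)" unfolding cycle_def using sm by auto
  fix f assume f: "embeds f (cycle q) G"
  let ?c = "%t. f (t mod q)"
  have inj: "i = j" if "f i = f j" "i < q" "j < q" for i j
    using f that unfolding embeds_def cycle_def inj_on_def by auto
  have e: "{f i, f (Suc i mod q)} \<in> E2 k Q" if "i < q" for i
  proof -
    have "f ` {i, Suc i mod q} \<in> E2 k Q" using f that unfolding embeds_def cycle_def snd_conv by blast
    then show ?thesis by simp
  qed
  show "hitp k M u v"
  proof (rule cyc_hit[of ?c])
    fix t
    show "A (?c t) (?c (Suc t))" using e[of "t mod q"] q by (simp add: mod_Suc_eq)
    show "?c t \<noteq> ?c (t + 2)"
    proof
      assume "?c t = ?c (t + 2)"
      then have "t mod q = (t + 2) mod q" using inj q by simp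
      then have "q dvd (t + 2) - t" by (metis mod_eq_dvd_iff_nat le_add1)
      then show False using q by (auto dest: dvd_imp_le)
    qed
    show "?c (t + q) = ?c t" by simp
  qed
next
  fix i j assume ij: "i < k" "j < k" "u i" "M i j" "v j"
  let ?y = "i * k + j"
  have y: "?y < k * k" "?y div k = i" "?y mod k = j" using vx_lt[of j k 0 i k] ij by auto
  \<comment> \<open>The cycle runs from the root through the row, the private vertices in classes 3
    to \<open>q - 1\<close> and the column; \<open>?cl\<close> and \<open>?ix\<close> give class and
    index at position \<open>n\<close>.\<close>
  let ?cl = "%n. if n = 0 then 0 else if n = 1 then 1 else if n = q - 1 then 2 else Suc n"
  let ?ix = "%n. if n = 0 then 0 else if n = 1 then i else if n = q - 1 then j else ?y"
  let ?f = "%n. vt (?cl n) (?ix n)"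
  have ix: "?ix n < k * k" for n using y(1) kk(1)[OF ij(1)] kk(1)[OF ij(2)] kk(2) by simp
  have Q: "(a, x, b, z) \<in> Q" if "nonD (a, x, b, z)" for a x b z using that low unfolding nonD_def core ta by blast
  have q4: "q - 1 \<noteq> 0" "q - 1 \<noteq> 1" "Suc 0 \<noteq> q - 1" using q by auto
  have e: "(?cl n, ?ix n, ?cl (Suc n mod q), ?ix (Suc n mod q)) \<in> Q \<or> (?cl (Suc n mod q), ?ix (Suc n mod q), ?cl n, ?ix n) \<in> Q"
    if n: "n < q" for n
  proof -
    consider "n = 0" | "n = 1" | "2 \<le> n" "n < q - 2" | "2 \<le> n" "n = q - 2" | "n = q - 1" using n q by linarith
    then show ?thesis
    proof cases
      case 1 then have "Suc n mod q = 1" using q by simp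
      then show ?thesis using 1 q4 ij by (intro disjI1 Q) (simp add: nonD_iff)
    next
      case 2 then have "Suc n mod q = 2" "2 \<noteq> q - 1" "(1::nat) \<noteq> q - 1" using q by auto
      then show ?thesis using 2 y by (intro disjI1 Q) (simp add: nonD_iff)
    next
      case 3 then have "Suc n mod q = Suc n" by simp
      then show ?thesis using 3 y by (intro disjI1 Q) (auto simp: nonD_iff)
    next
      case 4 then have "Suc n mod q = q - 1" using q by simp
      then show ?thesis using 4 y ij q by (intro disjI2 Q) (auto simp: nonD_iff)
    next
      case 5 then have "Suc n mod q = 0" using q by simp
      then show ?thesis using 5 q4 ij by (intro disjI2 Q) (simp add: nonD_iff)
    qed
  qed
  have cl_inj: "n = m" if "?cl n = ?cl m" "n < q" "m < q" for n m
  proof -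
    let ?d = "%c. if c = 0 then 0 else if c = 1 then 1 else if c = 2 then q - 1 else c - 1"
    have d: "?d (?cl n) = n" if "n < q" for n using that q by simp
    show ?thesis using arg_cong[OF that(1), of ?d] unfolding d[OF that(2)] d[OF that(3)] .
  qed
  have "embeds ?f (cycle q) G" unfolding embeds_def
  proof (intro conjI ballI)
    show "inj_on ?f (fst (cycle q))"
    proof (rule inj_onI)
      fix n m assume nm: "n \<in> fst (cycle q)" "m \<in> fst (cycle q)" "?f n = ?f m"
      have "?cl n = ?cl m" using vx_inj[OF ix[of n] ix[of m], THEN iffD1, OF nm(3)] by (rule conjunct1)
      moreover have "n < q" "m < q" using nm(1,2) by (simp_all add: cycle_def)
      ultimately show "n = m" by (rule cl_inj)
    qed
    show "?f ` fst (cycle q) \<subseteq> fst G"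
    proof (rule image_subsetI)
      fix n assume "n \<in> fst (cycle q)"
      then have "n < q" by (simp add: cycle_def)
      from e[OF this] show "?f n \<in> fst G" using vertex unfolding fst_conv lessThan_iff by blast
    qed
    fix d assume "d \<in> snd (cycle q)"
    then obtain n where n: "n < q" "d = {n, Suc n mod q}" by (auto simp: cycle_def)
    have "{?f n, ?f (Suc n mod q)} \<in> E2 k Q" using e[OF n(1)] edgeI by blast
    then show "?f ` d \<in> snd G" unfolding n(2) image_insert image_empty snd_conv .
  qed
  moreover have "vt 0 0 \<in> ?f ` fst (cycle q)"
    using q by (intro image_eqI[of _ _ 0]) (auto simp: cycle_def)
  ultimately show "\<exists>f. embeds f (cycle q) G \<and> vt 0 0 \<in> f ` fst (cycle q)" by blast
qed

end

subsection \<open>The gadget for paths with three edges\<close>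

text \<open>\<open>S\<close> selects by vertex set, so that the same count serves all paths and
  those through the root.\<close>

definition walks3 :: "nat set set => (nat set => bool) => (nat \<times> nat \<times> nat \<times> nat) set" where
  "walks3 E S = {(a, b, c, d). b < c \<and> distinct [a, b, c, d] \<and> {a, b} \<in> E \<and> {b, c} \<in> E \<and> {c, d} \<in> E \<and> S {a, b, c, d}}"

text \<open>The middle edge is the only one that meets all three, so it can be recovered from the
  edge set of the path.\<close>

lemma middle_edge:
  assumes "distinct [a, b, c, d]"
  shows "e \<in> {{a, b}, {b, c}, {c, d}} \<and> (\<forall>e' \<in> {{a, b}, {b, c}, {c, d}}. e \<inter> e' \<noteq> {}) \<longleftrightarrow> e = {b, c}"
  using assms by auto

text \<open>A path with three edges is listed so that its middle edge is traversed upwards.\<close>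

lemma path3_count:
  assumes ends: "\<And>e. e \<in> E ==> e \<subseteq> vs"
  shows "card {H. subgraph H (vs, E) \<and> isomorphic H path3 \<and> S (fst H)} = card (walks3 E S)"
proof -
  define h where "h w = (case w of (a, b, c, d) => ({a, b, c, d}, {{a, b}, {b, c}, {c, d}}))" for w :: "nat \<times> nat \<times> nat \<times> nat"
  have inj: "inj_on h (walks3 E S)"
  proof (rule inj_onI)
    fix w w' assume w: "w \<in> walks3 E S" "w' \<in> walks3 E S" "h w = h w'"
    obtain a b c d where 1: "w = (a, b, c, d)" by (cases w) auto
    obtain a' b' c' d' where 2: "w' = (a', b', c', d')" by (cases w') auto
    have d: "distinct [a, b, c, d]" "b < c" "distinct [a', b', c', d']" "b' < c'" using w(1,2) unfolding 1 2 walks3_def by auto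
    have E: "{{a, b}, {b, c}, {c, d}} = {{a', b'}, {b', c'}, {c', d'}}" using w(3) unfolding 1 2 h_def by simp
    have "{b, c} = {b', c'}" using middle_edge[OF d(1), of "{b, c}"] middle_edge[OF d(3), of "{b, c}"] unfolding E by blast
    then have bc: "b' = b" "c' = c" using d(2,4) by (auto simp: doubleton_eq_iff)
    have "{a, b} \<in> {{a', b}, {b, c}, {c, d'}}" "{c, d} \<in> {{a', b}, {b, c}, {c, d'}}" using E unfolding bc by (metis insertCI)+
    moreover have "a \<noteq> b" "a \<noteq> c" "b \<noteq> c" "b \<noteq> d" "c \<noteq> d" "a' \<noteq> b" "b \<noteq> d'" "c \<noteq> d'" "a' \<noteq> c" using d(1,3) unfolding bc by simp_all
    ultimately have "a' = a" "d' = d" unfolding insert_iff empty_iff doubleton_eq_iff by blast+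
    then show "w = w'" using 1 2 bc by simp
  qed
  have "h ` walks3 E S = {H. subgraph H (vs, E) \<and> isomorphic H path3 \<and> S (fst H)}"
  proof (intro equalityI subsetI)
    fix H assume "H \<in> h ` walks3 E S"
    then obtain a b c d where H: "H = ({a, b, c, d}, {{a, b}, {b, c}, {c, d}})" and d: "distinct [a, b, c, d]"
      and e: "{a, b} \<in> E" "{b, c} \<in> E" "{c, d} \<in> E" "S {a, b, c, d}" unfolding walks3_def h_def by auto
    let ?f = "%n::nat. if n = 0 then a else if n = 1 then b else if n = 2 then c else d"
    have m: "embeds ?f path3 (vs, E)"
      using d e ends[OF e(1)] ends[OF e(3)] by (auto simp: embeds_def path3_def inj_on_def insert_commute)
    have "(?f ` fst path3, (`) ?f ` snd path3) = H" unfolding H path3_def by (simp add: insert_commute)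
    then show "H \<in> {H. subgraph H (vs, E) \<and> isomorphic H path3 \<and> S (fst H)}"
      using embeds_subgraph[OF m] e(4) by (simp add: H path3_def)
  next
    fix H assume "H \<in> {H. subgraph H (vs, E) \<and> isomorphic H path3 \<and> S (fst H)}"
    then have H: "subgraph H (vs, E)" "isomorphic H path3" "S (fst H)" by auto
    obtain f where f: "embeds f path3 (vs, E)" "f ` fst path3 = fst H" "snd H = (`) f ` snd path3"
      using subgraph_embeds[OF H(1,2)] by blast
    have H1: "H = ({f 0, f 1, f 2, f 3}, {{f 0, f 1}, {f 1, f 2}, {f 2, f 3}})"
      by (rule prod_eqI) (simp_all add: f(2)[symmetric] f(3) path3_def)
    have d: "distinct [f 0, f 1, f 2, f 3]" using f(1) by (simp add: embeds_def path3_def inj_on_def)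
    have e: "{f 0, f 1} \<in> E" "{f 1, f 2} \<in> E" "{f 2, f 3} \<in> E" using f(1) by (simp_all add: embeds_def path3_def)
    have S: "S {f 0, f 1, f 2, f 3}" using H(3) H1 by simp
    show "H \<in> h ` walks3 E S"
    proof (cases "f 1 < f 2")
      case True
      then have "(f 0, f 1, f 2, f 3) \<in> walks3 E S" using d e S by (simp add: walks3_def)
      then show ?thesis by (rule rev_image_eqI) (simp add: H1 h_def)
    next
      case False
      then have "(f 3, f 2, f 1, f 0) \<in> walks3 E S" using d e S by (auto simp: walks3_def insert_commute)
      then show ?thesis by (rule rev_image_eqI) (auto simp: H1 h_def insert_commute)
    qed
  qed
  then show ?thesis using card_image[OF inj] by simp
qed

text \<open>Classes 4 and 5 are second copies of rows and columns. A 1 joins equal copies and a 0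
  joins opposite ones, so that every vertex here has degree \<open>k\<close> before root edges are
  added, and row \<open>i\<close> meets column \<open>j\<close> within the first copies only at a
  1.\<close>

definition coreP :: "nat => (nat => nat => bool) => cedge set" where
  "coreP k M = (%(i, j). (1, i, if M i j then 2 else 5, j)) ` ({..<k} \<times> {..<k}) \<union>
     (%(i, j). if M i j then (4, i, 5, j) else (2, j, 4, i)) ` ({..<k} \<times> {..<k})"

lemma coreP_iff: "(a, x, b, y) \<in> coreP k M \<longleftrightarrow> a = 1 \<and> b = 2 \<and> x < k \<and> y < k \<and> M x y \<or> a = 1 \<and> b = 5 \<and> x < k \<and> y < k \<and> \<not> M x y \<or>
   a = 4 \<and> b = 5 \<and> x < k \<and> y < k \<and> M x y \<or> a = 2 \<and> b = 4 \<and> x < k \<and> y < k \<and> \<not> M y x"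
proof -
  have "(a, x, b, y) \<in> (%(i, j). (1, i, if M i j then 2 else 5, j)) ` ({..<k} \<times> {..<k}) \<longleftrightarrow>
    a = 1 \<and> b = (if M x y then 2 else 5) \<and> x < k \<and> y < k" by (auto simp: image_iff)
  moreover have "(a, x, b, y) \<in> (%(i, j). if M i j then (4, i, 5, j) else (2, j, 4, i)) ` ({..<k} \<times> {..<k}) \<longleftrightarrow>
    a = 4 \<and> b = 5 \<and> x < k \<and> y < k \<and> M x y \<or> a = 2 \<and> b = 4 \<and> x < k \<and> y < k \<and> \<not> M y x"
    unfolding image_iff by (auto split: if_splits)
  ultimately show ?thesis unfolding coreP_def Un_iff by auto
qed

lemma dynQ3_iff: "(a, x, b, y) \<in> dynQ k 3 u v \<longleftrightarrow> a = 0 \<and> x = 0 \<and> b = 1 \<and> y < k \<and> u y \<or> a = 2 \<and> b = 3 \<and> y = 0 \<and> x < k \<and> v x"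
  by (auto simp: dynQ_def)

text \<open>Columns hang on a second root in class 3; with a common root, rows and columns could
  form triangles with it, and walks of three edges could close up.\<close>

locale path_graph = fin_graph +
  assumes core: "core = coreP k M" and ta: "ta = 3" and dl: "\<delta> = 6"
begin

text \<open>A folded name for vertex numbers keeps the simplifier from evaluating expressions such
  as \<open>vt 0 0\<close>.\<close>

definition W :: "nat => nat => nat" where "W a x = vt a x"

lemmas edge_casesW = edge_cases[folded W_def]
lemmas edgeIW = edgeI[folded W_def]
lemmas vertexW = vertex[folded W_def]
lemmas W_ne = vt_ne[folded W_def]
lemmas adj_iffW = adj_iff[OF wf, folded W_def]

lemma W_inj: "x < k * k ==> y < k * k ==> W a x = W b y \<longleftrightarrow> a = b \<and> x = y"
  unfolding W_def by (rule vx_inj)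

lemma W_lt: "x < k * k ==> y < k * k ==> a < b ==> W a x < W b y"
  unfolding W_def by (rule vx_lt)

lemma W00: "W 0 0 = 0" by (simp add: W_def)

definition "X = coreP k M \<union> dynQ k 3 u v"

lemma X_iff: "(a, x, b, y) \<in> X \<longleftrightarrow> a = 1 \<and> b = 2 \<and> x < k \<and> y < k \<and> M x y \<or> a = 1 \<and> b = 5 \<and> x < k \<and> y < k \<and> \<not> M x y \<or>
   a = 4 \<and> b = 5 \<and> x < k \<and> y < k \<and> M x y \<or> a = 2 \<and> b = 4 \<and> x < k \<and> y < k \<and> \<not> M y x \<or>
   a = 0 \<and> x = 0 \<and> b = 1 \<and> y < k \<and> u y \<or> a = 2 \<and> b = 3 \<and> y = 0 \<and> x < k \<and> v x"
  by (simp only: X_def Un_iff coreP_iff dynQ3_iff disj_assoc)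

lemma X_lt: "(a, x, b, y) \<in> X ==> a < b \<and> b < 6 \<and> x < k \<and> y < k"
  unfolding X_iff using k by (elim disjE conjE; simp)

lemma X_Q: "X \<subseteq> Q" using low by (simp add: X_def core ta)

lemma Q_X: "(a, x, b, y) \<in> Q ==> (a, x, b, y) \<in> X \<or> 6 \<le> a \<and> b = Suc a \<and> x = y \<and> even (a - 6)"
  using subsetD[OF up, of "(a, x, b, y)"] by (auto simp: X_def core ta dl dumQ_def)

definition "Nb p = {p'. {p, p'} \<in> E2 k Q}"

lemma Nb_iff:
  assumes "a < 6" "x < k * k"
  shows "p \<in> Nb (W a x) \<longleftrightarrow> (\<exists>b y. p = W b y \<and> ((a, x, b, y) \<in> X \<or> (b, y, a, x) \<in> X))"
proof
  assume "p \<in> Nb (W a x)"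
  then have "{W a x, p} \<in> E2 k Q" by (simp add: Nb_def)
  then obtain a' x' b y where e: "W a x = W a' x'" "p = W b y" "x' < k * k" "y < k * k" "(a', x', b, y) \<in> Q \<or> (b, y, a', x') \<in> Q"
    by (rule edge_casesW)
  then have ax: "a' = a" "x' = x" using assms(2) W_inj by metis+
  then have "(a, x, b, y) \<in> X \<or> (b, y, a, x) \<in> X" using e(5) Q_X[of a x b y] Q_X[of b y a x] assms(1) by auto
  then show "\<exists>b y. p = W b y \<and> ((a, x, b, y) \<in> X \<or> (b, y, a, x) \<in> X)" using e(2) by blast
next
  assume "\<exists>b y. p = W b y \<and> ((a, x, b, y) \<in> X \<or> (b, y, a, x) \<in> X)"
  then show "p \<in> Nb (W a x)" using X_Q edgeIW unfolding Nb_def by blast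
qed

lemma Nb0: "Nb (W 0 0) = W 1 ` {i. i < k \<and> u i}"
  by (rule set_eqI, subst Nb_iff) (use k in \<open>auto simp: image_iff kk X_iff\<close>)

lemma Nb1: "i < k ==> Nb (W 1 i) = (if u i then {W 0 0} else {}) \<union> (%j. W (if M i j then 2 else 5) j) ` {..<k}"
  by (rule set_eqI, subst Nb_iff) (use k in \<open>auto simp: image_iff kk X_iff\<close>)

lemma Nb2: "j < k ==> Nb (W 2 j) = (if v j then {W 3 0} else {}) \<union> (%i. W (if M i j then 1 else 4) i) ` {..<k}"
  by (rule set_eqI, subst Nb_iff) (use k in \<open>auto simp: image_iff kk X_iff\<close>)

lemma Nb3: "Nb (W 3 0) = W 2 ` {j. j < k \<and> v j}"
  by (rule set_eqI, subst Nb_iff) (use k in \<open>auto simp: image_iff kk X_iff\<close>)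

lemma Nb4: "i < k ==> Nb (W 4 i) = (%j. W (if M i j then 5 else 2) j) ` {..<k}"
  by (rule set_eqI, subst Nb_iff) (use k in \<open>auto simp: image_iff kk X_iff\<close>)

lemma Nb5: "j < k ==> Nb (W 5 j) = (%i. W (if M i j then 4 else 1) i) ` {..<k}"
  by (rule set_eqI, subst Nb_iff) (use k in \<open>auto simp: image_iff kk X_iff\<close>)

lemma card_vt: "A \<subseteq> {..<k} ==> card ((%j. W (g j) j) ` A) = card A"
  by (rule card_image, rule inj_onI) (metis kk(1) lessThan_iff subsetD W_inj)

lemma vt_notin: "x < k ==> \<forall>j<k. g j \<noteq> a ==> W a x \<notin> (%j. W (g j) j) ` {..<k}"
  by (auto simp: W_inj kk)

lemma dg0: "card (Nb (W 0 0)) = cnt u k" unfolding Nb0 cnt_def by (rule card_vt) auto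
lemma dg3: "card (Nb (W 3 0)) = cnt v k" unfolding Nb3 cnt_def by (rule card_vt) auto
lemma dg4: "i < k ==> card (Nb (W 4 i)) = k" by (simp only: Nb4 card_vt subset_refl card_lessThan)
lemma dg5: "i < k ==> card (Nb (W 5 i)) = k" by (simp only: Nb5 card_vt subset_refl card_lessThan)
lemma dg1: "i < k ==> card (Nb (W 1 i)) = k + of_bool (u i)"
proof -
  assume i: "i < k"
  have "W 0 0 \<notin> (%j. W (if M i j then 2 else 5) j) ` {..<k}" by (rule vt_notin) (use k in auto)
  then show ?thesis unfolding Nb1[OF i] using card_vt[of "{..<k}" "%j. if M i j then 2 else 5"] by (cases "u i") simp_all
qed
lemma dg2: "j < k ==> card (Nb (W 2 j)) = k + of_bool (v j)"
proof -
  assume j: "j < k"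
  have "W 3 0 \<notin> (%i. W (if M i j then 1 else 4) i) ` {..<k}" by (rule vt_notin) (use k in auto)
  then show ?thesis unfolding Nb2[OF j] using card_vt[of "{..<k}" "%i. if M i j then 1 else 4"] by (cases "v j") simp_all
qed

lemma Nb0_iff: "a < 6 ==> x < k ==> W 0 0 \<in> Nb (W a x) \<longleftrightarrow> a = 1 \<and> u x"
proof -
  assume a: "a < 6" "x < k"
  have "W 0 0 \<in> Nb (W a x) \<longleftrightarrow> {W a x, W 0 0} \<in> E2 k Q" by (simp add: Nb_def)
  also have "\<dots> \<longleftrightarrow> (a, x, 0, 0) \<in> Q \<or> (0, 0, a, x) \<in> Q" by (rule adj_iffW[OF kk(1)[OF a(2)] kk(2)])
  also have "\<dots> \<longleftrightarrow> a = 1 \<and> u x"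
    using Q_X[of a x 0 0] Q_X[of 0 0 a x] subsetD[OF X_Q, of "(0, 0, 1, x)"] a unfolding X_iff by auto
  finally show ?thesis .
qed

text \<open>Counts the ways to extend edge \<open>e\<close> at both ends. The graph has no triangle,
  so the two new ends are distinct and this is the number of paths with middle edge
  \<open>e\<close>.\<close>

definition fS :: "(nat set => bool) => cedge => nat" where
  "fS S e = (case e of (a, x, b, y) => card {(p, p'). p \<in> Nb (W a x) - {W b y} \<and> p' \<in> Nb (W b y) - {W a x} \<and> S {p, W a x, W b y, p'}})"

lemma finite_X: "finite X"
  unfolding X_def coreP_def dynQ_def by simp

lemma finite_Nb: "finite (Nb p)"
proof (rule finite_subset)
  show "Nb p \<subseteq> {..<N * (k * k)}"
  proof
    fix p' assume "p' \<in> Nb p"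
    then have "{p, p'} \<in> E2 k Q" by (simp add: Nb_def)
    then show "p' \<in> {..<N * (k * k)}" by (rule edge_casesW) (use vertexW in fastforce)
  qed
qed simp

lemma walks_sum: "card (walks3 (E2 k Q) S) = sum (fS S) X"
proof -
  define T where "T e = (case e of (a, x, b, y) => {(p, p'). p \<in> Nb (W a x) - {W b y} \<and> p' \<in> Nb (W b y) - {W a x} \<and> S {p, W a x, W b y, p'}})" for e :: cedge
  define h where "h = (%((a, x, b, y), (p, p')). (p::nat, W a x, W b y, p'::nat))"
  have ne: "p \<noteq> p'" if "{p, p'} \<in> E2 k Q" for p p'
  proof -
    obtain a x b y where "p = W a x" "p' = W b y" "x < k * k" "y < k * k" "(a, x, b, y) \<in> Q \<or> (b, y, a, x) \<in> Q"
      using edge_casesW[OF \<open>{p, p'} \<in> E2 k Q\<close>] by blast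
    moreover have "a \<noteq> b" using calculation(5) wf by (auto simp: wfQ_def)
    ultimately show ?thesis using W_ne by metis
  qed
  have notri: "\<not> ({p, p'} \<in> E2 k Q \<and> {p', p''} \<in> E2 k Q \<and> {p, p''} \<in> E2 k Q)" for p p' p''
  proof
    assume e: "{p, p'} \<in> E2 k Q \<and> {p', p''} \<in> E2 k Q \<and> {p, p''} \<in> E2 k Q"
    have lt: "\<And>a x b y. (a, x, b, y) \<in> core \<union> dynQ k ta u v ==> b < \<delta>"
      using X_lt unfolding core ta dl X_def by blast
    obtain a x b y c z where t: "(a, x, b, y) \<in> core \<union> dynQ k ta u v" "(b, y, c, z) \<in> core \<union> dynQ k ta u v"
      "(a, x, c, z) \<in> core \<union> dynQ k ta u v"
      by (rule triangle_core[OF lt e[THEN conjunct1] e[THEN conjunct2, THEN conjunct1] e[THEN conjunct2, THEN conjunct2]])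
    show False using t unfolding core ta X_def[symmetric] X_iff by (elim disjE conjE; simp)
  qed
  have "walks3 (E2 k Q) S = h ` Sigma X T"
  proof (intro equalityI subsetI)
    fix w assume "w \<in> walks3 (E2 k Q) S"
    then obtain p a b p' where w: "w = (p, a, b, p')" "a < b" "distinct [p, a, b, p']" "{p, a} \<in> E2 k Q" "{a, b} \<in> E2 k Q" "{b, p'} \<in> E2 k Q" "S {p, a, b, p'}"
      unfolding walks3_def by auto
    obtain c x d y where e: "a = W c x" "b = W d y" "x < k * k" "y < k * k" "(c, x, d, y) \<in> Q \<or> (d, y, c, x) \<in> Q"
      using edge_casesW[OF w(5)] by blast
    have "(d, y, c, x) \<notin> Q"
    proof
      assume "(d, y, c, x) \<in> Q"
      then have "d < c" using wf by (auto simp: wfQ_def)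
      then have "b < a" unfolding e(1,2) by (rule W_lt[OF e(4,3)])
      then show False using w(2) by simp
    qed
    then have Q: "(c, x, d, y) \<in> Q" using e(5) by blast
    \<comment> \<open>A dummy edge is isolated and cannot be extended, so it is not a middle
      edge.\<close>
    have X: "(c, x, d, y) \<in> X"
    proof (rule ccontr)
      assume "(c, x, d, y) \<notin> X"
      then have c: "6 \<le> c" "d = Suc c" "even (c - 6)" "x = y" using Q_X[OF Q] by auto
      have w4: "{a, p} \<in> E2 k Q" using w(4) by (simp add: insert_commute)
      obtain c' x' f z where f: "a = W c' x'" "p = W f z" "x' < k * k" "z < k * k" "(c', x', f, z) \<in> Q \<or> (f, z, c', x') \<in> Q"
        by (rule edge_casesW[OF w4])
      have "c' = c" "x' = x" using e f W_inj by metis+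
      moreover have "(c, x, f, z) \<in> Q ==> f = Suc c \<and> z = x" using Q_X[of c x f z] X_lt[of c x f z] c by auto
      moreover have "(f, z, c, x) \<notin> Q"
      proof
        assume "(f, z, c, x) \<in> Q"
        then have "6 \<le> f \<and> c = Suc f \<and> even (f - 6)" using Q_X[of f z c x] X_lt[of f z c x] c by auto
        then show False using c by (auto simp: Suc_diff_le)
      qed
      ultimately have "p = b" using f(5) e f(2) c by auto
      then show False using w(3) by simp
    qed
    have "(p, p') \<in> T (c, x, d, y)" using w unfolding T_def e Nb_def by (auto simp: insert_commute)
    then show "w \<in> h ` Sigma X T" using X w(1) e by (intro image_eqI[of _ _ "((c, x, d, y), (p, p'))"]) (auto simp: h_def)
  next
    fix w assume "w \<in> h ` Sigma X T"
    then obtain a x b y p p' where w: "w = (p, W a x, W b y, p')" "(a, x, b, y) \<in> X" "(p, p') \<in> T (a, x, b, y)"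
      unfolding h_def by auto
    have e: "{W a x, p} \<in> E2 k Q" "{W b y, p'} \<in> E2 k Q" "{W a x, W b y} \<in> E2 k Q" "p \<noteq> W b y" "p' \<noteq> W a x" "S {p, W a x, W b y, p'}"
      using w(2,3) X_Q edgeIW unfolding T_def Nb_def by auto
    have "p \<noteq> p'" using e notri[of "W a x" "W b y" p] by (auto simp: insert_commute)
    moreover have "W a x < W b y" using X_lt[OF w(2)] kk(1) W_lt by blast
    ultimately show "w \<in> walks3 (E2 k Q) S"
      unfolding walks3_def w(1) using e ne[OF e(1)] ne[OF e(2)] ne[OF e(3)] by (simp add: insert_commute)
  qed
  moreover have "inj_on h (Sigma X T)"
  proof (rule inj_onI)
    fix s s' assume s: "s \<in> Sigma X T" "s' \<in> Sigma X T" "h s = h s'"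
    obtain a x b y p p' where 1: "s = ((a, x, b, y), (p, p'))" by (metis surj_pair)
    obtain a' x' b' y' q q' where 2: "s' = ((a', x', b', y'), (q, q'))" by (metis surj_pair)
    have l: "x < k * k" "y < k * k" "x' < k * k" "y' < k * k" using s(1,2) X_lt kk(1) unfolding 1 2 by blast+
    have "W a x = W a' x'" "W b y = W b' y'" "p = q" "p' = q'" using s(3) unfolding 1 2 h_def by simp_all
    then show "s = s'" using W_inj l unfolding 1 2 by metis
  qed
  moreover have "finite (T e)" for e
  proof -
    obtain a x b y where e: "e = (a, x, b, y)" by (metis surj_pair)
    have "T e \<subseteq> Nb (W a x) \<times> Nb (W b y)" unfolding T_def e by auto
    then show ?thesis using finite_Nb by (metis finite_SigmaI finite_subset)
  qed
  moreover have "card (T e) = fS S e" for e unfolding T_def fS_def by (simp split: prod.split)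
  ultimately show ?thesis by (simp add: card_image finite_X)
qed

lemma sum_X: "sum F X = (\<Sum>i<k. \<Sum>j<k. F (1, i, if M i j then 2 else 5, j) + F (if M i j then (4, i, 5, j) else (2, j, 4, i))) +
    ((\<Sum>i | i < k \<and> u i. F (0, 0, 1, i)) + (\<Sum>j | j < k \<and> v j. F (2, j, 3, 0)))"
proof -
  let ?K = "{..<k} \<times> {..<k}"
  let ?f = "%(i, j). (1, i, if M i j then 2 else 5, j)" and ?g = "%(i, j). if M i j then (4, i, 5, j) else (2, j, 4, i)"
  let ?c = "(%i. (0, 0, 1, i)) ` {i. i < k \<and> u i}" and ?d = "(%j. (2, j, 3, 0)) ` {j. j < k \<and> v j}"
  have X: "X = (?f ` ?K \<union> ?g ` ?K) \<union> (?c \<union> ?d)" unfolding X_def coreP_def dynQ_def by auto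
  have cd: "sum F (?c \<union> ?d) = sum F ?c + sum F ?d" by (rule sum.union_disjoint) auto
  have fg: "sum F (?f ` ?K \<union> ?g ` ?K) = sum F (?f ` ?K) + sum F (?g ` ?K)"
    by (rule sum.union_disjoint) (auto split: if_splits)
  have al: "sum F X = sum F (?f ` ?K \<union> ?g ` ?K) + sum F (?c \<union> ?d)"
    unfolding X by (rule sum.union_disjoint) (auto split: if_splits)
  have f: "sum F (?f ` ?K) = (\<Sum>i<k. \<Sum>j<k. F (1, i, if M i j then 2 else 5, j))"
    by (subst sum.reindex) (auto simp: inj_on_def sum.cartesian_product intro!: sum.cong)
  have g: "sum F (?g ` ?K) = (\<Sum>i<k. \<Sum>j<k. F (if M i j then (4, i, 5, j) else (2, j, 4, i)))"
    by (subst sum.reindex) (auto simp: inj_on_def sum.cartesian_product intro!: sum.cong split: if_splits)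
  have c: "sum F ?c = (\<Sum>i | i < k \<and> u i. F (0, 0, 1, i))" by (subst sum.reindex) (auto simp: inj_on_def)
  have d: "sum F ?d = (\<Sum>j | j < k \<and> v j. F (2, j, 3, 0))" by (subst sum.reindex) (auto simp: inj_on_def)
  show ?thesis unfolding al fg cd f g c d by (simp add: sum.distrib)
qed

lemma X_Nb: "(a, x, b, y) \<in> X ==> W b y \<in> Nb (W a x) \<and> W a x \<in> Nb (W b y)"
  using X_Q edgeIW unfolding Nb_def by blast

lemma fS_True:
  assumes "(a, x, b, y) \<in> X"
  shows "fS (%_. True) (a, x, b, y) = (card (Nb (W a x)) - 1) * (card (Nb (W b y)) - 1)"
proof -
  have "{(p, p'). p \<in> Nb (W a x) - {W b y} \<and> p' \<in> Nb (W b y) - {W a x} \<and> True} = (Nb (W a x) - {W b y}) \<times> (Nb (W b y) - {W a x})" by auto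
  then show ?thesis unfolding fS_def using X_Nb[OF assms] finite_Nb by (simp add: card_cartesian_product)
qed

text \<open>The root lies on the path either in the middle edge, when \<open>a = 0\<close>, or next
  to a chosen row of class 1. For \<open>a \<noteq> 0\<close> the upper vertex of the middle edge is
  not a row of class 1, and the root has no other neighbours.\<close>

lemma fS_root:
  assumes "(a, x, b, y) \<in> X"
  shows "fS (%A. W 0 0 \<in> A) (a, x, b, y) =
    (if a = 0 then (card (Nb (W a x)) - 1) * (card (Nb (W b y)) - 1) else if a = 1 \<and> u x then card (Nb (W b y)) - 1 else 0)"
proof (cases "a = 0")
  case True
  then have "W a x = W 0 0" using assms unfolding X_iff by auto
  then show ?thesis using fS_True[OF assms] True unfolding fS_def by simp
next
  case False
  note l = X_lt[OF assms]
  have b: "b \<noteq> 0" "b \<noteq> 1" using False l assms unfolding X_iff by auto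
  have n: "W a x \<noteq> W 0 0" "W b y \<noteq> W 0 0" "W 0 0 \<notin> Nb (W b y)"
    using W_ne[OF kk(1) kk(2)] False b(1) l apply blast
    using W_ne[OF kk(1) kk(2)] False b(1) l apply blast
    using Nb0_iff[of b y] l b by blast
  have "{(p, p'). p \<in> Nb (W a x) - {W b y} \<and> p' \<in> Nb (W b y) - {W a x} \<and> W 0 0 \<in> {p, W a x, W b y, p'}} =
      (Nb (W a x) \<inter> {W 0 0}) \<times> (Nb (W b y) - {W a x})"
    using n by (auto simp del: mult_0 add_0)
  moreover have "card (Nb (W a x) \<inter> {W 0 0}) = of_bool (a = 1 \<and> u x)" using Nb0_iff[of a x] l by (auto simp del: mult_0 add_0)
  ultimately show ?thesis unfolding fS_def using X_Nb[OF assms] finite_Nb False by (simp add: card_cartesian_product)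
qed

definition "Hs = (\<Sum>i<k. \<Sum>j<k. of_bool (u i \<and> M i j \<and> v j) :: nat)"

lemma Hs_hit: "Hs \<noteq> 0 \<longleftrightarrow> hitp k M u v"
  unfolding Hs_def hitp_def by (auto simp: lessThan_def)

lemma sum_u: "(\<Sum>i<k. of_bool (w i)) = cnt w k"
  by (simp add: cnt_def of_bool_def sum.If_cases Int_def)

text \<open>Rows and columns have degree \<open>k\<close>, plus 1 for the chosen ones among the
  first copies. A product of two such surpluses occurs exactly at a 1 between a chosen row and a
  chosen column; all other terms depend on \<open>k\<close> and the two cardinalities alone.\<close>

lemma count_path: "subgraph_count G path3 + (4 * (k * (k * k)) + (2 * (k * cnt u k) + 2 * (k * cnt v k))) =
    2 * (k * k * (k * k) + k * k) + (k * (cnt u k * (k + cnt u k)) + k * (cnt v k * (k + cnt v k))) + Hs"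
proof -
  \<comment> \<open>\<open>m\<close> is the number of ways to extend a middle edge at a vertex
    without a root edge.\<close>
  obtain m where m: "k = Suc m" using k by (cases k) auto
  let ?F = "fS (%_. True)"
  have e: "e \<in> E2 k Q ==> e \<subseteq> {..<N * (k * k)}" for e unfolding E2_def W_def[symmetric] using vertexW by fastforce
  have "subgraph_count G path3 = sum ?F X"
    using path3_count[OF e, where S = "%_. True"] walks_sum[of "%_. True"] by (simp add: subgraph_count_def)
  also have "\<dots> = (\<Sum>i<k. \<Sum>j<k. 2 * (m * m) + m * of_bool (u i) + m * of_bool (v j) + of_bool (u i \<and> M i j \<and> v j)) +
      ((\<Sum>i | i < k \<and> u i. (cnt u k - 1) * k) + (\<Sum>j | j < k \<and> v j. k * (cnt v k - 1)))"
    unfolding sum_X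
  proof (rule arg_cong2[where f = "(+)"], rule sum.cong[OF refl], rule sum.cong[OF refl],
      rule_tac[2] arg_cong2[where f = "(+)"], rule_tac[2-3] sum.cong[OF refl])
    fix i j assume ij: "i \<in> {..<k}" "j \<in> {..<k}"
    show "?F (1, i, if M i j then 2 else 5, j) + ?F (if M i j then (4, i, 5, j) else (2, j, 4, i)) =
        2 * (m * m) + m * of_bool (u i) + m * of_bool (v j) + of_bool (u i \<and> M i j \<and> v j)"
    proof (cases "M i j")
      case True
      then have "(1, i, 2, j) \<in> X" "(4, i, 5, j) \<in> X" using ij by (auto simp: X_iff)
      then show ?thesis using True ij
        by (simp only: fS_True if_True lessThan_iff dg1 dg2 dg4 dg5) (simp add: m algebra_simps of_bool_conj)
    next
      case False
      then have "(1, i, 5, j) \<in> X" "(2, j, 4, i) \<in> X" using ij by (auto simp: X_iff)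
      then show ?thesis using False ij
        by (simp only: fS_True if_False lessThan_iff dg1 dg2 dg4 dg5) (simp add: m algebra_simps)
    qed
  next
    fix i assume "i \<in> {i. i < k \<and> u i}"
    moreover from this have "(0, 0, 1, i) \<in> X" by (auto simp: X_iff)
    ultimately show "?F (0, 0, 1, i) = (cnt u k - 1) * k" by (simp only: fS_True mem_Collect_eq dg0 dg1) simp
  next
    fix j assume "j \<in> {j. j < k \<and> v j}"
    moreover from this have "(2, j, 3, 0) \<in> X" by (auto simp: X_iff)
    ultimately show "?F (2, j, 3, 0) = k * (cnt v k - 1)" by (simp only: fS_True mem_Collect_eq dg2 dg3) simp
  qed
  also have "\<dots> = k * k * (2 * (m * m)) + k * m * cnt u k + k * m * cnt v k + Hs + (cnt u k * ((cnt u k - 1) * k) + cnt v k * (k * (cnt v k - 1)))"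
    by (simp add: sum.distrib sum_distrib_left[symmetric] sum_u Hs_def) (simp add: cnt_def algebra_simps)
  finally show ?thesis unfolding m by (cases "cnt u (Suc m)"; cases "cnt v (Suc m)"; simp add: algebra_simps)
qed

text \<open>A middle edge above the root contributes only at a chosen row, with the degree of its
  upper end; a column surplus is seen only across a 1. The edges at the second root are never middle
  edges of such a path.\<close>

lemma count_path_at: "subgraph_count_at 0 G path3 + 2 * (k * cnt u k) = k * (cnt u k * (k + cnt u k)) + Hs"
proof -
  obtain m where m: "k = Suc m" using k by (cases k) auto
  let ?F = "fS (%A. W 0 0 \<in> A)"
  have e: "e \<in> E2 k Q ==> e \<subseteq> {..<N * (k * k)}" for e unfolding E2_def W_def[symmetric] using vertexW by fastforce
  have "subgraph_count_at 0 G path3 = sum ?F X"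
    using path3_count[OF e, where S = "%A. 0 \<in> A"] walks_sum[of "%A. 0 \<in> A"] by (simp add: subgraph_count_at_def W00)
  also have "\<dots> = (\<Sum>i<k. \<Sum>j<k. m * of_bool (u i) + of_bool (u i \<and> M i j \<and> v j)) +
      ((\<Sum>i | i < k \<and> u i. (cnt u k - 1) * k) + (\<Sum>j | j < k \<and> v j. 0))"
    unfolding sum_X
  proof (rule arg_cong2[where f = "(+)"], rule sum.cong[OF refl], rule sum.cong[OF refl],
      rule_tac[2] arg_cong2[where f = "(+)"], rule_tac[2-3] sum.cong[OF refl])
    fix i j assume ij: "i \<in> {..<k}" "j \<in> {..<k}"
    show "?F (1, i, if M i j then 2 else 5, j) + ?F (if M i j then (4, i, 5, j) else (2, j, 4, i)) =
        m * of_bool (u i) + of_bool (u i \<and> M i j \<and> v j)"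
    proof (cases "M i j")
      case True
      then have "(1, i, 2, j) \<in> X" "(4, i, 5, j) \<in> X" using ij by (auto simp: X_iff)
      then show ?thesis using True ij
        by (simp only: fS_root if_True lessThan_iff dg1 dg2 dg4 dg5) (simp add: m)
    next
      case False
      then have "(1, i, 5, j) \<in> X" "(2, j, 4, i) \<in> X" using ij by (auto simp: X_iff)
      then show ?thesis using False ij
        by (simp only: fS_root if_False lessThan_iff dg1 dg2 dg4 dg5) (simp add: m)
    qed
  next
    fix i assume "i \<in> {i. i < k \<and> u i}"
    moreover from this have "(0, 0, 1, i) \<in> X" by (auto simp: X_iff)
    ultimately show "?F (0, 0, 1, i) = (cnt u k - 1) * k" by (simp only: fS_root mem_Collect_eq dg0 dg1) simp
  next
    fix j assume "j \<in> {j. j < k \<and> v j}"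
    then have "(2, j, 3, 0) \<in> X" by (auto simp: X_iff)
    then show "?F (2, j, 3, 0) = 0" by (simp only: fS_root) simp
  qed
  also have "\<dots> = k * m * cnt u k + Hs + cnt u k * ((cnt u k - 1) * k)"
    by (simp add: sum.distrib sum_distrib_left[symmetric] sum_u Hs_def) (simp add: cnt_def algebra_simps)
  finally show ?thesis unfolding m by (cases "cnt u (Suc m)"; simp add: algebra_simps)
qed

end

subsection \<open>Edge templates and update sequences\<close>

fun tq :: "nat => nat => tedge => cedge" where
  "tq k x (a, s, b, t) = (a, selv k x s, b, selv k x t)"

fun ev :: "nat => cedge => nat \<times> nat" where
  "ev k (a, x, b, y) = (a * (k * k) + x, b * (k * k) + y)"

fun cp :: "nat \<times> 'a \<times> nat \<times> 'b => nat \<times> nat" where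
  "cp (a, s, b, t) = (a, b)"

definition pick :: "nat => (nat => nat => bool) => nat => tmpl => tedge" where
  "pick k M x t = (if cndv k M x (fst t) then fst (snd t) else snd (snd t))"

definition tqs :: "tmpl list => nat => (nat => nat => bool) => cedge list" where
  "tqs tms k M = concat (map (%x. map (%t. tq k x (pick k M x t)) tms) [0..<k * k])"

definition tQ :: "tmpl list => nat => (nat => nat => bool) => cedge set" where
  "tQ tms k M = (\<Union>x<k * k. (%t. tq k x (pick k M x t)) ` set tms)"

text \<open>Does the edge determine the parameter \<open>x\<close> of the template, given which branch was taken?\<close>

fun det :: "cnd => bool => tedge => bool" where
  "det c br (a, s, b, t) \<longleftrightarrow> s = SX \<or> t = SX \<or> s = SI \<and> t = SJ \<or> s = SJ \<and> t = SI \<or> br \<and> (c = KJ \<and> (s = SI \<or> t = SI) \<or> c = KX)"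

definition cps :: "tmpl list => (nat \<times> nat) list" where
  "cps tms = concat (map (%t. [cp (fst (snd t)), cp (snd (snd t))]) tms)"

text \<open>All branches of all templates use different pairs of classes, so edges of different
  branches cannot coincide, and \<open>det\<close> separates the edges of one branch.\<close>

definition tok :: "nat => tmpl list => bool" where
  "tok N tms \<longleftrightarrow> distinct (cps tms) \<and> (\<forall>(a, b) \<in> set (cps tms). a < b \<and> b < N) \<and>
     (\<forall>t \<in> set tms. det (fst t) True (fst (snd t)) \<and> det (fst t) False (snd (snd t)))"

lemma tev_tq: "tev k x e = ev k (tq k x e)"
  by (cases e) simp

lemma tedge_tq: "tedge k M x = (%t. ev k (tq k x (pick k M x t)))"
proof
  show "tedge k M x t = ev k (tq k x (pick k M x t))" for t by (cases t) (simp add: tev_tq pick_def)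
qed

lemma tedges_tqs: "tedges tms k M = map (ev k) (tqs tms k M)"
  by (simp add: tedges_def tqs_def map_concat o_def tedge_tq)

lemma set_tqs: "set (tqs tms k M) = tQ tms k M"
  by (simp add: tqs_def tQ_def atLeast0LessThan)

lemma length_tqs: "length (tqs tms k M) = length tms * (k * k)"
  by (simp add: tqs_def length_concat o_def sum_list_triv)

lemma selv_lt: "1 \<le> k ==> x < k * k ==> selv k x s < k * k"
proof (cases s)
  case SJ
  assume "1 \<le> k"
  then have "x mod k < k" "k \<le> k * k" by auto
  then show ?thesis using SJ order_less_le_trans[of "x mod k" k "k * k"] by simp
qed (auto intro: le_less_trans[OF div_le_dividend])

lemma det_inj:
  assumes "det c br e" "cndv k M x c = br" "cndv k M x' c = br" "tq k x e = tq k x' e"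
  shows "x = x'"
proof -
  have dm: "x div k = x' div k ==> x mod k = x' mod k ==> x = x'" by (metis div_mod_decomp)
  obtain a s b t where e: "e = (a, s, b, t)" by (metis surj_pair)
  show ?thesis using assms dm unfolding e by (cases c) auto
qed

lemma cps_Cons: "cps (t # ts) = cp (fst (snd t)) # cp (snd (snd t)) # cps ts"
  by (simp add: cps_def)

lemma cps_mem: "t \<in> set ts ==> cp (fst (snd t)) \<in> set (cps ts) \<and> cp (snd (snd t)) \<in> set (cps ts)"
  by (induction ts) (auto simp: cps_Cons)

lemma cps_append: "cps (ts @ ts') = cps ts @ cps ts'"
  by (simp add: cps_def)

lemma cps_inj:
  assumes "distinct (cps ts)" "t \<in> set ts" "t' \<in> set ts"
    "cp (if b then fst (snd t) else snd (snd t)) = cp (if b' then fst (snd t') else snd (snd t'))"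
  shows "t = t' \<and> b = b'"
  using assms
proof (induction ts)
  case (Cons s ts)
  then show ?case using cps_mem[of t ts] cps_mem[of t' ts] by (auto simp: cps_Cons split: if_splits)
qed (simp add: cps_def)

lemma distinct_concat_map:
  assumes "distinct xs" "\<And>x. x \<in> set xs ==> distinct (F x)"
    "\<And>x y. x \<in> set xs ==> y \<in> set xs ==> x \<noteq> y ==> set (F x) \<inter> set (F y) = {}"
  shows "distinct (concat (map F xs))"
  using assms
proof (induction xs)
  case (Cons a xs)
  have "distinct (concat (map F xs))" using Cons by simp
  moreover have "set (F a) \<inter> set (concat (map F xs)) = {}" using Cons.prems(1) Cons.prems(3)[of a] by fastforce
  ultimately show ?case using Cons.prems(2)[of a] by simp
qed simp

lemma cp_tq: "cp (tq k x e) = cp e"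
  by (cases e) simp

lemma distinct_tqs:
  assumes "tok N tms"
  shows "distinct (tqs tms k M)"
  unfolding tqs_def
proof (rule distinct_concat_map)
  have d: "distinct (cps tms)" using assms by (simp add: tok_def)
  have dt: "distinct ts" if "distinct (cps ts)" for ts
    using that by (induction ts) (auto simp: cps_Cons dest: cps_mem)
  show "distinct (map (%t. tq k x (pick k M x t)) tms)" for x
    unfolding distinct_map
  proof (intro conjI inj_onI)
    show "distinct tms" using dt[OF d] .
    fix t t' assume "t \<in> set tms" "t' \<in> set tms" "tq k x (pick k M x t) = tq k x (pick k M x t')"
    then show "t = t'" using cps_inj[OF d] unfolding pick_def by (metis cp_tq)
  qed
  fix x y :: nat assume xy: "x \<noteq> y"
  show "set (map (%t. tq k x (pick k M x t)) tms) \<inter> set (map (%t. tq k y (pick k M y t)) tms) = {}"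
  proof (rule ccontr)
    assume "\<not> ?thesis"
    then obtain t t' where t: "t \<in> set tms" "t' \<in> set tms" "tq k x (pick k M x t) = tq k y (pick k M y t')"
      unfolding set_map by blast
    then have "cp (pick k M x t) = cp (pick k M y t')" by (metis cp_tq)
    then have tt: "t = t'" "cndv k M x (fst t) = cndv k M y (fst t')"
      using cps_inj[OF d t(1,2)] unfolding pick_def by blast+
    have p: "pick k M y t' = pick k M x t" using tt by (simp add: pick_def)
    have "x = y"
    proof (rule det_inj[of "fst t" "cndv k M x (fst t)" "pick k M x t" k M x y])
      show "det (fst t) (cndv k M x (fst t)) (pick k M x t)" using assms t(1) by (simp add: tok_def pick_def)
      show "cndv k M y (fst t) = cndv k M x (fst t)" using tt by simp
      show "tq k x (pick k M x t) = tq k y (pick k M x t)" using t(3) unfolding p .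
    qed simp
    then show False using xy by simp
  qed
qed simp

lemma wf_tQ:
  assumes "tok N tms" "1 \<le> k"
  shows "wfQ k N (tQ tms k M)"
  unfolding wfQ_def
proof (intro allI impI)
  fix a x b y assume "(a, x, b, y) \<in> tQ tms k M"
  then obtain z t where t: "(a, x, b, y) = tq k z (pick k M z t)" "z < k * k" "t \<in> set tms" by (auto simp: tQ_def)
  obtain a' s b' s' where p: "pick k M z t = (a', s, b', s')" by (metis surj_pair)
  have "cp (pick k M z t) \<in> set (cps tms)" using cps_mem[OF t(3)] by (simp add: pick_def)
  then have "a < b \<and> b < N" using assms(1) t(1) p by (auto simp: tok_def)
  then show "a < b \<and> b < N \<and> x < k * k \<and> y < k * k" using t(1,2) p selv_lt[OF assms(2)] by simp
qed

text \<open>The strict order of the classes fixes the orientation, so an undirected edge has only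
  one description.\<close>

lemma ue_inj:
  assumes "wfQ k N Q" "q \<in> Q" "q' \<in> Q" "uedge (ev k q) = uedge (ev k q')"
  shows "q = q'"
proof -
  obtain a x b y where q: "q = (a, x, b, y)" by (metis surj_pair)
  obtain a' x' b' y' where q': "q' = (a', x', b', y')" by (metis surj_pair)
  have w: "a < b" "x < k * k" "y < k * k" "a' < b'" "x' < k * k" "y' < k * k" using assms(1-3) unfolding q q' wfQ_def by blast+
  have "{a * (k * k) + x, b * (k * k) + y} = {a' * (k * k) + x', b' * (k * k) + y'}" using assms(4) by (simp add: q q' uedge_def)
  then show ?thesis unfolding doubleton_eq_iff q q'
    using vx_inj[OF w(2,5)] vx_inj[OF w(2,6)] vx_inj[OF w(3,5)] vx_inj[OF w(3,6)] w(1,4) by auto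
qed

lemma E2_image: "E2 k Q = (%q. uedge (ev k q)) ` Q"
  by (force simp: E2_def uedge_def image_iff)

lemma ev_lt:
  assumes "wfQ k N Q" "q \<in> Q"
  shows "fst (ev k q) < N * (k * k) \<and> snd (ev k q) < N * (k * k) \<and> fst (ev k q) \<noteq> snd (ev k q)"
proof -
  obtain a x b y where q: "q = (a, x, b, y)" by (metis surj_pair)
  have w: "a < b" "b < N" "x < k * k" "y < k * k" using assms unfolding q wfQ_def by blast+
  then have "a * (k * k) + x < b * (k * k) + y" by (intro vx_lt)
  moreover have "b * (k * k) + y < N * (k * k) + 0" by (rule vx_lt[OF w(4) le_less_trans[OF le0 w(3)] w(2)])
  ultimately show ?thesis by (simp add: q)
qed

lemma tedges_ok:
  assumes "tok N tms" "1 \<le> k"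
  shows "edge_list (N * (k * k)) (tedges tms k M)" "uedge ` set (tedges tms k M) = E2 k (tQ tms k M)"
proof -
  note w = wf_tQ[OF assms, of M]
  show "uedge ` set (tedges tms k M) = E2 k (tQ tms k M)"
    by (simp add: tedges_tqs set_tqs E2_image image_image)
  have "distinct (map (%q. uedge (ev k q)) (tqs tms k M))"
    unfolding distinct_map using distinct_tqs[OF assms(1)] ue_inj[OF w] by (auto simp: set_tqs intro!: inj_onI)
  moreover have "\<forall>q\<in>tQ tms k M. case ev k q of (a, b) => a < N * (k * k) \<and> b < N * (k * k) \<and> a \<noteq> b"
    using ev_lt[OF w] by (simp add: case_prod_beta)
  ultimately show "edge_list (N * (k * k)) (tedges tms k M)"
    unfolding edge_list_def tedges_tqs by (simp add: set_tqs o_def)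
qed

lemma E2_Un: "E2 k (Q \<union> Q') = E2 k Q \<union> E2 k Q'"
  by (simp add: E2_image image_Un)

lemma E2_Diff: "wfQ k N Q ==> Q' \<subseteq> Q ==> E2 k (Q - Q') = E2 k Q - E2 k Q'"
  unfolding E2_image using ue_inj by (intro inj_on_image_set_diff[of _ Q] inj_onI) auto

lemma card_E2: "wfQ k N Q ==> card (E2 k Q) = card Q"
  unfolding E2_image using ue_inj by (intro card_image inj_onI) auto

lemma card_tQ: "tok N tms ==> card (tQ tms k M) = length tms * (k * k)"
  using distinct_card[OF distinct_tqs] by (simp add: set_tqs length_tqs)

section \<open>Update sequences and their edge sets\<close>

lemma fold_Insert: "fold apply_op (map (%(a, b). Insert a b) ps) E = E \<union> uedge ` set ps"
  by (induction ps arbitrary: E) (auto simp: uedge_def)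

lemma fold_Delete: "fold apply_op (map (%(a, b). Delete a b) ps) E = E - uedge ` set ps"
  by (induction ps arbitrary: E) (auto simp: uedge_def)

lemma take_ops: "take i (map f ps @ [Query]) = map f (take i ps) @ (if i \<le> length ps then [] else [Query])"
  by (auto simp: take_map)

lemma edges_Insert: "edges_before es (map (%(a, b). Insert a b) ps @ [Query]) i = uedge ` set es \<union> uedge ` set (take i ps)"
  unfolding edges_before_def take_ops by (simp add: fold_Insert)

lemma edges_Delete: "edges_before es (map (%(a, b). Delete a b) ps @ [Query]) i = uedge ` set es - uedge ` set (take i ps)"
  unfolding edges_before_def take_ops by (simp add: fold_Delete)

lemma nth_notin_take: "distinct xs ==> i < length xs ==> xs ! i \<notin> set (take i xs)"
  by (auto simp: in_set_conv_nth nth_eq_iff_index_eq)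

lemma valid_Insert:
  assumes "edge_list n es" "distinct (map uedge ps)" "uedge ` set ps \<inter> uedge ` set es = {}"
    "\<And>p. p \<in> set ps ==> fst p < n \<and> snd p < n \<and> fst p \<noteq> snd p" "0 < n" "md \<noteq> Decremental"
  shows "valid_instance md p n 0 es (map (%(a, b). Insert a b) ps @ [Query])"
  unfolding valid_instance_def
proof (intro conjI allI impI)
  fix i assume "i < length (map (%(a, b). Insert a b) ps @ [Query])"
  then have i: "i < length ps \<or> i = length ps" by auto
  show "legal_op md n (edges_before es (map (%(a, b). Insert a b) ps @ [Query]) i) ((map (%(a, b). Insert a b) ps @ [Query]) ! i)"
  proof (cases "i < length ps")
    case True
    obtain a b where ab: "ps ! i = (a, b)" by fastforce
    have m: "(a, b) \<in> set ps" using True ab by (metis nth_mem)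
    have "{a, b} = map uedge ps ! i" using True ab by (simp add: uedge_def)
    then have "{a, b} \<notin> set (take i (map uedge ps))" using nth_notin_take[OF assms(2), of i] True by simp
    then have "{a, b} \<notin> uedge ` set (take i ps)" by (simp add: take_map)
    moreover have "{a, b} \<in> uedge ` set ps" using imageI[OF m, of uedge] by (simp add: uedge_def)
    moreover from this have "{a, b} \<notin> uedge ` set es" using assms(3) by blast
    ultimately show ?thesis using assms(4)[OF m] assms(6) True ab by (simp add: nth_append edges_Insert)
  qed (use i in \<open>simp add: nth_append\<close>)
qed (use assms in auto)

lemma valid_Delete:
  assumes "edge_list n es" "distinct (map uedge ps)" "uedge ` set ps \<subseteq> uedge ` set es" "0 < n" "md \<noteq> Incremental"
  shows "valid_instance md p n 0 es (map (%(a, b). Delete a b) ps @ [Query])"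
  unfolding valid_instance_def
proof (intro conjI allI impI)
  fix i assume "i < length (map (%(a, b). Delete a b) ps @ [Query])"
  then have i: "i < length ps \<or> i = length ps" by auto
  show "legal_op md n (edges_before es (map (%(a, b). Delete a b) ps @ [Query]) i) ((map (%(a, b). Delete a b) ps @ [Query]) ! i)"
  proof (cases "i < length ps")
    case True
    obtain a b where ab: "ps ! i = (a, b)" by fastforce
    have m: "(a, b) \<in> set ps" using True ab by (metis nth_mem)
    have "{a, b} = map uedge ps ! i" using True ab by (simp add: uedge_def)
    then have "{a, b} \<notin> set (take i (map uedge ps))" using nth_notin_take[OF assms(2), of i] True by simp
    then have "{a, b} \<notin> uedge ` set (take i ps)" by (simp add: take_map)
    moreover have "{a, b} \<in> uedge ` set es" using assms(3) imageI[OF m, of uedge] by (auto simp: uedge_def)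
    ultimately show ?thesis using assms(5) True ab by (simp add: nth_append edges_Delete)
  qed (use i in \<open>simp add: nth_append\<close>)
qed (use assms in auto)

text \<open>Quadruples have the lower class first, whereas the update of a column names class
  \<open>ta\<close> first; as undirected edges the two agree.\<close>

definition dq :: "nat => nat => cedge" where
  "dq ta i = (if ta = 0 then (0, 0, 2, i) else (2, i, ta, 0))"

definition dqs :: "nat => nat => (nat => bool) => (nat => bool) => cedge list" where
  "dqs k ta u v = concat (map (%i. (if u i then [(0, 0, 1, i)] else []) @ (if v i then [dq ta i] else [])) [0..<k])"

definition dps :: "nat => nat => (nat => bool) => (nat => bool) => (nat \<times> nat) list" where
  "dps k ta u v = concat (map (%i. (if u i then [(0, k * k + i)] else []) @ (if v i then [(ta * (k * k), 2 * (k * k) + i)] else [])) [0..<k])"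

lemma set_dqs: "set (dqs k ta u v) = dynQ k ta u v"
  by (auto simp: dqs_def dynQ_def dq_def)

lemma distinct_dqs: "distinct (dqs k ta u v)"
  unfolding dqs_def by (rule distinct_concat_map) (auto simp: dq_def)

lemma dps_dqs: "map uedge (dps k ta u v) = map (%q. uedge (ev k q)) (dqs k ta u v)"
proof -
  have "uedge (ta * (k * k), 2 * (k * k) + i) = uedge (ev k (dq ta i))" for i
    by (auto simp: dq_def uedge_def)
  moreover have "uedge (0, k * k + i) = uedge (ev k (0, 0, 1, i))" for i by (simp add: uedge_def)
  ultimately show ?thesis
    unfolding dps_def dqs_def map_concat map_map by (intro arg_cong[of _ _ concat] map_cong) auto
qed

lemma length_dps: "length (dps k ta u v) \<le> 2 * k"
proof -
  have "length (dps k ta u v) = (\<Sum>i\<leftarrow>[0..<k]. length ((if u i then [(0, k * k + i)] else []) @ (if v i then [(ta * (k * k), 2 * (k * k) + i)] else [])))"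
    by (simp only: dps_def length_concat map_map o_def)
  also have "\<dots> \<le> (\<Sum>i\<leftarrow>[0..<k]. 2)" by (rule sum_list_mono) auto
  finally show ?thesis by (simp add: sum_list_triv)
qed

lemma wf_dynQ:
  assumes "1 \<le> k" "ta = 0 \<or> ta = 3" "4 \<le> N"
  shows "wfQ k N (dynQ k ta u v)"
proof -
  have "i < k ==> i < k * k" for i using assms(1) order_less_le_trans[of i k "k * k"] by auto
  then show ?thesis using assms by (auto simp: wfQ_def dynQ_def)
qed

lemma dynQ_split: "dynQ k ta (%_. True) (%_. True) = dynQ k ta u v \<union> dynQ k ta (%i. \<not> u i) (%i. \<not> v i)"
  by (auto simp: dynQ_def)

lemma dynQ_disj: "dynQ k ta u v \<inter> dynQ k ta (%i. \<not> u i) (%i. \<not> v i) = {}"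
  by (auto simp: dynQ_def)

definition dynp :: "nat => nat \<times> nat" where "dynp ta = (if ta = 0 then (0, 2) else (2, ta))"

lemma cp_dynQ: "q \<in> dynQ k ta u v ==> cp q = (0, 1) \<or> cp q = dynp ta"
  by (auto simp: dynQ_def dynp_def split: if_splits)

lemma cp_tQ: "q \<in> tQ tms k M ==> cp q \<in> set (cps tms)"
  unfolding tQ_def UN_iff image_iff using cps_mem by (metis cp_tq pick_def)

text \<open>Templates for the root edges, all present initially when updates are deletions. They
  occur for one entry per row, and the other entries contribute dummies in two further pairs of
  classes.\<close>

definition dtl :: "nat => nat => tmpl list" where
  "dtl d ta = [(KJ, (0, SZ, 1, SI), (d, SX, Suc d, SX)),
     (KJ, if ta = 0 then (0, SZ, 2, SI) else (2, SI, ta, SZ), (Suc (Suc d), SX, Suc (Suc (Suc d)), SX))]"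

definition Tc :: "nat => (nat => nat => bool) => cnd => tedge => cedge set" where
  "Tc k M c e = {tq k x e | x. x < k * k \<and> cndv k M x c}"

lemma tQ_Nil: "tQ [] k M = {}"
  by (simp add: tQ_def)

lemma tQ_append: "tQ (ts @ ts') k M = tQ ts k M \<union> tQ ts' k M"
  by (auto simp: tQ_def)

lemma tQ_dummy:
  assumes "\<delta> \<le> d" "even (d - \<delta>)" "Z \<subseteq> tQ ts k M" "tQ ts k M \<subseteq> Z \<union> dumQ \<delta>"
  shows "Tc k M c e \<union> Z \<subseteq> tQ ((c, e, (d, SX, Suc d, SX)) # ts) k M \<and>
    tQ ((c, e, (d, SX, Suc d, SX)) # ts) k M \<subseteq> Tc k M c e \<union> Z \<union> dumQ \<delta>"
proof (intro conjI subsetI)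
  fix q assume "q \<in> Tc k M c e \<union> Z"
  then show "q \<in> tQ ((c, e, (d, SX, Suc d, SX)) # ts) k M"
  proof
    assume "q \<in> Tc k M c e"
    then obtain x where "x < k * k" "cndv k M x c" "q = tq k x e" by (auto simp: Tc_def)
    then have "q = tq k x (pick k M x (c, e, (d, SX, Suc d, SX)))" by (simp add: pick_def)
    then show ?thesis using \<open>x < k * k\<close> unfolding tQ_def by auto
  next
    assume "q \<in> Z"
    then show ?thesis using assms(3) tQ_append[of "[(c, e, (d, SX, Suc d, SX))]" ts] by auto
  qed
next
  fix q assume "q \<in> tQ ((c, e, (d, SX, Suc d, SX)) # ts) k M"
  then consider x where "x < k * k" "q = tq k x (pick k M x (c, e, (d, SX, Suc d, SX)))" | "q \<in> tQ ts k M"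
    by (auto simp: tQ_def)
  then show "q \<in> Tc k M c e \<union> Z \<union> dumQ \<delta>"
  proof cases
    case 1 then show ?thesis using assms(1,2) by (auto simp: pick_def Tc_def dumQ_def split: if_splits)
  next
    case 2 then show ?thesis using assms(4) by auto
  qed
qed

lemma KJ_iff: "1 \<le> k ==> (\<exists>x<k * k. x mod k = 0 \<and> i = x div k) \<longleftrightarrow> i < (k::nat)"
proof
  assume "\<exists>x<k * k. x mod k = 0 \<and> i = x div k"
  then show "i < k" by (auto simp: less_mult_imp_div_less)
next
  assume "1 \<le> k" "i < k"
  then show "\<exists>x<k * k. x mod k = 0 \<and> i = x div k" by (intro exI[of _ "i * k"]) auto
qed

lemma KJ_set: "1 \<le> k ==> (%x. x div k) ` {x. x < k * k \<and> x mod k = 0} = {..<k::nat}"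
  unfolding set_eq_iff image_iff lessThan_iff using KJ_iff[of k] by simp

lemma Tc_KJ1: "1 \<le> k ==> Tc k M KJ (a, SZ, b, SI) = {(a, 0, b, i) | i. i < k}"
proof -
  assume k: "1 \<le> k"
  have "Tc k M KJ (a, SZ, b, SI) = (%i. (a, 0, b, i)) ` (%x. x div k) ` {x. x < k * k \<and> x mod k = 0}"
    unfolding Tc_def setcompr_eq_image image_image by simp
  then show ?thesis unfolding KJ_set[OF k] by (simp add: setcompr_eq_image lessThan_def)
qed

lemma Tc_KJ2: "1 \<le> k ==> Tc k M KJ (a, SI, b, SZ) = {(a, i, b, 0) | i. i < k}"
proof -
  assume k: "1 \<le> k"
  have "Tc k M KJ (a, SI, b, SZ) = (%i. (a, i, b, 0)) ` (%x. x div k) ` {x. x < k * k \<and> x mod k = 0}"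
    unfolding Tc_def setcompr_eq_image image_image by simp
  then show ?thesis unfolding KJ_set[OF k] by (simp add: setcompr_eq_image lessThan_def)
qed

lemma Tc_KX: "1 \<le> k ==> Tc k M KX (a, SZ, b, SZ) = {(a, 0, b, 0)}"
  by (auto simp: Tc_def)

lemma Tc_KM: "1 \<le> k ==> Tc k M KM (1, SI, 2, SJ) = coreM k M"
proof (intro equalityI subsetI)
  fix q assume k: "1 \<le> k" and "q \<in> Tc k M KM (1, SI, 2, SJ)"
  then show "q \<in> coreM k M" by (auto simp: Tc_def coreM_def less_mult_imp_div_less)
next
  fix q assume k: "1 \<le> k" and "q \<in> coreM k M"
  then obtain i j where q: "q = (1, i, 2, j)" "i < k" "j < k" "M i j" by (auto simp: coreM_def)
  then have "i * k + j < k * k" "(i * k + j) div k = i" "(i * k + j) mod k = j" using vx_lt[of j k 0 i k] by auto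
  then show "q \<in> Tc k M KM (1, SI, 2, SJ)" using q unfolding Tc_def by (auto intro!: exI[of _ "i * k + j"])
qed

lemma Tc_KA: "Tc k M KA e = {tq k x e | x. x < k * k}"
  by (simp add: Tc_def)

lemma dtl_Q:
  assumes "1 \<le> k" "\<delta> \<le> d" "even (d - \<delta>)"
  shows "dynQ k ta (%_. True) (%_. True) \<subseteq> tQ (dtl d ta) k M \<and> tQ (dtl d ta) k M \<subseteq> dynQ k ta (%_. True) (%_. True) \<union> dumQ \<delta>"
proof -
  have 2: "\<delta> \<le> Suc (Suc d)" "even (Suc (Suc d) - \<delta>)" using assms(2,3) by (simp_all add: Suc_diff_le)
  let ?e = "if ta = 0 then (0, SZ, 2, SI) else (2, SI, ta, SZ)"
  have "Tc k M KJ (0, SZ, 1, SI) \<union> (Tc k M KJ ?e \<union> {}) = dynQ k ta (%_. True) (%_. True)"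
    using assms(1) by (auto simp: Tc_KJ1 Tc_KJ2 dynQ_def split: if_splits)
  then show ?thesis
    using tQ_dummy[OF assms(2,3) tQ_dummy[OF 2, of "{}" "[]" k M KJ ?e, THEN conjunct1] tQ_dummy[OF 2, of "{}" "[]" k M KJ ?e, THEN conjunct2], of KJ "(0, SZ, 1, SI)"]
    by (simp add: tQ_Nil dtl_def)
qed

subsection \<open>The gadgets as templates\<close>

text \<open>Every template gets its own pair of dummy classes, so that dummies of different
  templates remain disjoint.\<close>

primrec mk :: "nat => (cnd \<times> tedge) list => tmpl list" where
  "mk d [] = []"
| "mk d (ce # cs) = (fst ce, snd ce, (d, SX, Suc d, SX)) # mk (Suc (Suc d)) cs"

lemma mk_cps: "set (cps (mk d cs)) \<subseteq> (%ce. cp (snd ce)) ` set cs \<union> {(a, b). d \<le> a \<and> b = Suc a \<and> a < d + 2 * length cs}"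
proof (induction cs arbitrary: d)
  case (Cons ce cs)
  show ?case using Cons[of "Suc (Suc d)"] by (auto simp: cps_Cons)
qed (simp add: cps_def)

lemma mk_distinct:
  assumes "distinct (map (%ce. cp (snd ce)) cs)" "\<forall>ce\<in>set cs. fst (cp (snd ce)) < d"
  shows "distinct (cps (mk d cs))"
  using assms
proof (induction cs arbitrary: d)
  case (Cons ce cs)
  have "distinct (cps (mk (Suc (Suc d)) cs))" using Cons.prems by (intro Cons.IH) auto
  moreover have "cp (snd ce) \<notin> set (cps (mk (Suc (Suc d)) cs))" using mk_cps[where d = "Suc (Suc d)" and cs = cs] Cons.prems by fastforce
  moreover have "(d, Suc d) \<notin> set (cps (mk (Suc (Suc d)) cs))" using mk_cps[where d = "Suc (Suc d)" and cs = cs] Cons.prems by fastforce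
  moreover have "cp (snd ce) \<noteq> (d, Suc d)" using Cons.prems by auto
  ultimately show ?case by (simp add: cps_Cons)
qed (simp add: cps_def)

lemma mk_det: "t \<in> set (mk d cs) ==> \<forall>ce\<in>set cs. det (fst ce) True (snd ce) ==> det (fst t) True (fst (snd t)) \<and> det (fst t) False (snd (snd t))"
  by (induction cs arbitrary: d) auto

lemma mk_tok:
  assumes "distinct (map (%ce. cp (snd ce)) cs)"
    "\<forall>ce\<in>set cs. fst (cp (snd ce)) < snd (cp (snd ce)) \<and> snd (cp (snd ce)) < d \<and> det (fst ce) True (snd ce)"
  shows "tok (d + 2 * length cs) (mk d cs)"
  unfolding tok_def
proof (intro conjI ballI)
  show "distinct (cps (mk d cs))" using assms by (intro mk_distinct) auto
  show "case p of (a, b) => a < b \<and> b < d + 2 * length cs" if p: "p \<in> set (cps (mk d cs))" for p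
  proof -
    obtain a b where ab: "p = (a, b)" by fastforce
    consider ce where "ce \<in> set cs" "(a, b) = cp (snd ce)" | i where "b = Suc (d + i)" "a = d + i" "i < 2 * length cs" 
      using subsetD[OF mk_cps p] unfolding ab by (auto simp: le_iff_add)
    then show ?thesis
    proof cases
      case 1 then have "fst (a, b) < snd (a, b)" "snd (a, b) < d" using assms(2) by simp_all
      then show ?thesis using ab by simp
    next
      case 2 
      have "p \<in> set (cps (mk d cs)) ==> snd p < d + 2 * length cs"
        using assms(2)
      proof (induction cs arbitrary: d)
        case (Cons ce cs)
        then show ?case using Cons.IH[of "Suc (Suc d)"] by (fastforce simp: cps_Cons)
      qed (simp add: cps_def)
      then show ?thesis using 2 p ab by simp
    qed
  qed
qed (use assms mk_det in blast)+

lemma mk_Q: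
  assumes "\<delta> \<le> d" "even (d - \<delta>)"
  shows "(\<Union>ce\<in>set cs. Tc k M (fst ce) (snd ce)) \<subseteq> tQ (mk d cs) k M \<and>
    tQ (mk d cs) k M \<subseteq> (\<Union>ce\<in>set cs. Tc k M (fst ce) (snd ce)) \<union> dumQ \<delta>"
  using assms
proof (induction cs arbitrary: d)
  case (Cons ce cs)
  have IH: "(\<Union>ce\<in>set cs. Tc k M (fst ce) (snd ce)) \<subseteq> tQ (mk (Suc (Suc d)) cs) k M \<and>
    tQ (mk (Suc (Suc d)) cs) k M \<subseteq> (\<Union>ce\<in>set cs. Tc k M (fst ce) (snd ce)) \<union> dumQ \<delta>"
    using Cons.prems by (intro Cons.IH) (simp_all add: Suc_diff_le)
  show ?case
    using tQ_dummy[OF Cons.prems IH[THEN conjunct1] IH[THEN conjunct2], of "fst ce" "snd ce"] by simp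
qed (simp add: tQ_Nil)

text \<open>What the reduction requires of a gadget. \<open>\<delta>\<close> is the first dummy
  class and \<open>d\<close> the first class free for the templates of \<open>dtl\<close>; the
  template edges match \<open>core\<close> up to dummies.\<close>

definition gad :: "problem => tmpl list => nat => nat => nat => nat => nat => nat =>
    (nat => (nat => nat => bool) => cedge set) => bool" where
  "gad p gt \<delta> d ta c1 c2 c3 core \<longleftrightarrow>
     \<delta> \<le> d \<and> even (d - \<delta>) \<and> 4 \<le> d \<and> (ta = 0 \<or> ta = 3) \<and> c1 \<le> 1 \<and> c2 \<le> 1 \<and> c3 \<le> 1 \<and> gt \<noteq> [] \<and> tok d gt \<and>
     (0, 1) \<notin> set (cps gt) \<and> dynp ta \<notin> set (cps gt) \<and>
     (\<forall>k M. 1 \<le> k --> core k M \<subseteq> tQ gt k M \<and> tQ gt k M \<subseteq> core k M \<union> dumQ \<delta>) \<and>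
     (\<forall>k N Q M u v. fin_graph k N Q u v (core k M) ta \<delta> -->
        (answer p 0 ({..<N * (k * k)}, E2 k Q) + (4 * c1 * (k * (k * k)) + (2 * c2 * (k * cnt u k) + 2 * c3 * (k * cnt v k)))
           \<noteq> 2 * c1 * (k * k * (k * k) + k * k) + (c2 * (k * (cnt u k * (k + cnt u k))) + c3 * (k * (cnt v k * (k + cnt v k))))
         \<longleftrightarrow> hitp k M u v))"

lemma gad_mk:
  assumes "p = Detect P \<or> p = Detect_At P" "3 \<le> \<delta>" "cs \<noteq> []"
    and "distinct (map (%ce. cp (snd ce)) cs)"
    and "\<forall>ce\<in>set cs. fst (cp (snd ce)) < snd (cp (snd ce)) \<and> snd (cp (snd ce)) < \<delta> \<and> det (fst ce) True (snd ce)"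
    and "\<forall>ce\<in>set cs. cp (snd ce) \<noteq> (0, 1) \<and> cp (snd ce) \<noteq> (0, 2)"
    and core: "\<And>k M. 1 \<le> k ==> core k M = (\<Union>ce\<in>set cs. Tc k M (fst ce) (snd ce))"
    and det: "\<And>k N Q M u v. fin_graph k N Q u v (core k M) 0 \<delta> ==>
      (subgraph_count ({..<N * (k * k)}, E2 k Q) P > 0) = hitp k M u v \<and> (subgraph_count_at 0 ({..<N * (k * k)}, E2 k Q) P > 0) = hitp k M u v"
  shows "gad p (mk \<delta> cs) \<delta> (\<delta> + 2 * length cs) 0 0 0 0 core"
proof -
  have "cs \<noteq> [] ==> mk \<delta> cs \<noteq> []" by (cases cs) auto
  moreover have "4 \<le> \<delta> + 2 * length cs" using assms(2,3) by (cases cs) auto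
  moreover have "(0, 1) \<notin> set (cps (mk \<delta> cs)) \<and> dynp 0 \<notin> set (cps (mk \<delta> cs))"
    using mk_cps[where d = \<delta> and cs = cs] assms(2,6) by (fastforce simp: dynp_def)
  moreover have "answer p 0 ({..<N * (k * k)}, E2 k Q) \<noteq> 0 \<longleftrightarrow> hitp k M u v" if "fin_graph k N Q u v (core k M) 0 \<delta>" for k N Q M u v
    using det[OF that] assms(1) by auto
  ultimately show ?thesis
    unfolding gad_def using mk_tok[OF assms(4,5)] mk_Q[where \<delta> = \<delta> and d = \<delta> and cs = cs] core assms(3) by simp
qed

lemma gad_paw:
  assumes "p = Detect paw \<or> p = Detect_At paw"
  shows "gad p (mk 4 [(KM, (1, SI, 2, SJ)), (KX, (0, SZ, 3, SZ))]) 4 (4 + 2 * length ([(KM, (1, SI, 2, SJ)), (KX, (0, SZ, 3, SZ))] :: (cnd \<times> tedge) list)) 0 0 0 0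
    (%k M. insert (0, 0, 3, 0) (coreM k M))"
proof (rule gad_mk[OF assms])
  fix k N Q M u v assume "fin_graph k N Q u v ((%k M. insert (0, 0, 3, 0) (coreM k M)) k M) 0 4"
  then show "(subgraph_count ({..<N * (k * k)}, E2 k Q) paw > 0) = hitp k M u v \<and> (subgraph_count_at 0 ({..<N * (k * k)}, E2 k Q) paw > 0) = hitp k M u v"
    by (rule fin_graph.paw) simp_all
qed (auto simp: Tc_KM[simplified] Tc_KX Tc_KJ2[simplified] Tc_KA)

lemma gad_clique4:
  assumes "p = Detect clique4 \<or> p = Detect_At clique4"
  shows "gad p (mk 4 [(KM, (1, SI, 2, SJ)), (KJ, (1, SI, 3, SZ)), (KJ, (2, SI, 3, SZ)), (KX, (0, SZ, 3, SZ))]) 4 (4 + 2 * length ([(KM, (1, SI, 2, SJ)), (KJ, (1, SI, 3, SZ)), (KJ, (2, SI, 3, SZ)), (KX, (0, SZ, 3, SZ))] :: (cnd \<times> tedge) list)) 0 0 0 0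
    (%k M. insert (0, 0, 3, 0) (coreM k M \<union> ({(1, i, 3, 0) | i. i < k} \<union> {(2, i, 3, 0) | i. i < k})))"
proof (rule gad_mk[OF assms])
  fix k N Q M u v assume "fin_graph k N Q u v ((%k M. insert (0, 0, 3, 0) (coreM k M \<union> ({(1, i, 3, 0) | i. i < k} \<union> {(2, i, 3, 0) | i. i < k}))) k M) 0 4"
  then show "(subgraph_count ({..<N * (k * k)}, E2 k Q) clique4 > 0) = hitp k M u v \<and> (subgraph_count_at 0 ({..<N * (k * k)}, E2 k Q) clique4 > 0) = hitp k M u v"
    by (rule fin_graph.clique4) simp_all
qed (auto simp: Tc_KM[simplified] Tc_KX Tc_KJ2[simplified] Tc_KA)

lemma gad_diamond:
  assumes "p = Detect diamond \<or> p = Detect_At diamond"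
  shows "gad p (mk 4 [(KM, (1, SI, 2, SJ)), (KA, (1, SI, 3, SX)), (KA, (2, SJ, 3, SX))]) 4 (4 + 2 * length ([(KM, (1, SI, 2, SJ)), (KA, (1, SI, 3, SX)), (KA, (2, SJ, 3, SX))] :: (cnd \<times> tedge) list)) 0 0 0 0
    (%k M. coreM k M \<union> ({(1, x div k, 3, x) | x. x < k * k} \<union> {(2, x mod k, 3, x) | x. x < k * k}))"
proof (rule gad_mk[OF assms])
  fix k N Q M u v assume "fin_graph k N Q u v ((%k M. coreM k M \<union> ({(1, x div k, 3, x) | x. x < k * k} \<union> {(2, x mod k, 3, x) | x. x < k * k})) k M) 0 4"
  then show "(subgraph_count ({..<N * (k * k)}, E2 k Q) diamond > 0) = hitp k M u v \<and> (subgraph_count_at 0 ({..<N * (k * k)}, E2 k Q) diamond > 0) = hitp k M u v"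
    by (rule fin_graph.diamond) simp_all
qed (auto simp: Tc_KM[simplified] Tc_KX Tc_KJ2[simplified] Tc_KA)

lemma gad_triangle:
  assumes "p = Detect (cycle 3) \<or> p = Detect_At (cycle 3)"
  shows "gad p (mk 3 [(KM, (1, SI, 2, SJ))]) 3 (3 + 2 * length ([(KM, (1, SI, 2, SJ))] :: (cnd \<times> tedge) list)) 0 0 0 0
    (coreM)"
proof (rule gad_mk[OF assms])
  fix k N Q M u v assume "fin_graph k N Q u v ((coreM) k M) 0 3"
  then show "(subgraph_count ({..<N * (k * k)}, E2 k Q) (cycle 3) > 0) = hitp k M u v \<and> (subgraph_count_at 0 ({..<N * (k * k)}, E2 k Q) (cycle 3) > 0) = hitp k M u v"
    by (rule fin_graph.triangle) simp_all
qed (auto simp: Tc_KM[simplified] Tc_KX Tc_KJ2[simplified] Tc_KA)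

definition csC :: "nat => (cnd \<times> tedge) list" where
  "csC q = (KA, (1, SI, 3, SX)) # map (%b. (KA, (2 + b, SX, 3 + b, SX))) [1..<q - 3] @ [(KM, (2, SJ, q - 1, SX))]"

lemma gad_cycle: 
  assumes "p = Detect (cycle q) \<or> p = Detect_At (cycle q)" "4 \<le> q"
  shows "gad p (mk q (csC q)) q (q + 2 * length (csC q)) 0 0 0 0 (coreC q)"
proof (rule gad_mk[OF assms(1)])
  show "distinct (map (%ce. cp (snd ce)) (csC q))"
    by (auto simp: csC_def distinct_map o_def inj_on_def)
  show "\<forall>ce\<in>set (csC q). fst (cp (snd ce)) < snd (cp (snd ce)) \<and> snd (cp (snd ce)) < q \<and> det (fst ce) True (snd ce)"
    using assms(2) by (auto simp: csC_def)
  show "\<forall>ce\<in>set (csC q). cp (snd ce) \<noteq> (0, 1) \<and> cp (snd ce) \<noteq> (0, 2)" by (auto simp: csC_def)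
  show "coreC q k M = (\<Union>ce\<in>set (csC q). Tc k M (fst ce) (snd ce))" for k M
  proof -
    have "(\<Union>ce\<in>set (csC q). Tc k M (fst ce) (snd ce)) = Tc k M KA (1, SI, 3, SX) \<union>
       (\<Union>b\<in>{1..<q - 3}. Tc k M KA (2 + b, SX, 3 + b, SX)) \<union> Tc k M KM (2, SJ, q - 1, SX)" by (auto simp: csC_def)
    moreover have "(\<Union>b\<in>{1..<q - 3}. Tc k M KA (2 + b, SX, 3 + b, SX)) = {(2 + b, y, 3 + b, y) | b y. 1 \<le> b \<and> b < q - 3 \<and> y < k * k}"
      unfolding Tc_def by fastforce
    moreover have "Tc k M KA (1, SI, 3, SX) = {(1, y div k, 3, y) | y. y < k * k}" by (auto simp: Tc_def)
    moreover have "Tc k M KM (2, SJ, q - 1, SX) = {(2, y mod k, q - 1, y) | y. y < k * k \<and> M (y div k) (y mod k)}" by (auto simp: Tc_def)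
    ultimately show ?thesis unfolding coreC_def by simp
  qed
  fix k N Q M u v assume "fin_graph k N Q u v (coreC q k M) 0 q"
  then have "cyc_graph k N Q M u v (coreC q k M) 0 q q"
    using assms(2) by (simp add: cyc_graph_def cyc_graph_axioms_def)
  then show "(subgraph_count ({..<N * (k * k)}, E2 k Q) (cycle q) > 0) = hitp k M u v \<and> (subgraph_count_at 0 ({..<N * (k * k)}, E2 k Q) (cycle q) > 0) = hitp k M u v"
    by (rule cyc_graph.cycle_detect)
qed (use assms(2) in \<open>simp_all add: csC_def\<close>)

text \<open>No dummies here: both branches of each template are edges of the gadget.\<close>

definition gtP :: "tmpl list" where
  "gtP = [(KM, (1, SI, 2, SJ), (1, SI, 5, SJ)), (KM, (4, SI, 5, SJ), (2, SJ, 4, SI))]"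

lemma divmod_image: "(%x. F (x div k) (x mod k)) ` {..<k * k} = (%(i, j). F i j) ` ({..<k} \<times> {..<k::nat})"
proof (intro equalityI subsetI)
  fix q assume "q \<in> (%x. F (x div k) (x mod k)) ` {..<k * k}"
  then obtain x where x: "x < k * k" "q = F (x div k) (x mod k)" by auto
  moreover have "0 < k" using x(1) by (cases k) auto
  ultimately show "q \<in> (%(i, j). F i j) ` ({..<k} \<times> {..<k})"
    by (intro image_eqI[of _ _ "(x div k, x mod k)"]) (auto simp: less_mult_imp_div_less)
next
  fix q assume "q \<in> (%(i, j). F i j) ` ({..<k} \<times> {..<k})"
  then obtain i j where q: "q = F i j" "i < k" "j < k" by auto
  then have "i * k + j < k * k" "(i * k + j) div k = i" "(i * k + j) mod k = j" using vx_lt[of j k 0 i k] by auto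
  then show "q \<in> (%x. F (x div k) (x mod k)) ` {..<k * k}" using q(1) by (intro image_eqI[of _ _ "i * k + j"]) auto
qed

lemma tQ_gtP: "tQ gtP k M = coreP k M"
proof -
  have "tQ gtP k M = (%x. tq k x (pick k M x (gtP ! 0))) ` {..<k * k} \<union> (%x. tq k x (pick k M x (gtP ! 1))) ` {..<k * k}"
    unfolding tQ_def gtP_def by (auto simp: image_iff)
  also have "(%x. tq k x (pick k M x (gtP ! 0))) = (%x. (%i j. (1, i, if M i j then 2 else 5, j)) (x div k) (x mod k))"
    by (auto simp: gtP_def pick_def)
  also have "(%x. tq k x (pick k M x (gtP ! 1))) = (%x. (%i j. if M i j then (4, i, 5, j) else (2, j, 4, i)) (x div k) (x mod k))"
    by (auto simp: gtP_def pick_def)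
  finally show ?thesis unfolding coreP_def divmod_image[symmetric] .
qed

lemma gad_path:
  assumes "p = Count path3 \<and> c1 = 1 \<and> c3 = 1 \<or> p = Count_At path3 \<and> c1 = 0 \<and> c3 = 0"
  shows "gad p gtP 6 6 3 c1 1 c3 coreP"
proof -
  have "tok 6 gtP" "(0, 1) \<notin> set (cps gtP)" "dynp 3 \<notin> set (cps gtP)" "gtP \<noteq> []"
    by (auto simp: tok_def gtP_def cps_def dynp_def)
  moreover have "answer p 0 ({..<N * (k * k)}, E2 k Q) + (4 * c1 * (k * (k * k)) + (2 * 1 * (k * cnt u k) + 2 * c3 * (k * cnt v k)))
           \<noteq> 2 * c1 * (k * k * (k * k) + k * k) + (1 * (k * (cnt u k * (k + cnt u k))) + c3 * (k * (cnt v k * (k + cnt v k))))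
         \<longleftrightarrow> hitp k M u v" if "fin_graph k N Q u v (coreP k M) 3 6" for k N Q M u v
  proof -
    interpret path_graph k N Q M u v "coreP k M" 3 6
      using that by (simp add: path_graph_def path_graph_axioms_def)
    show ?thesis using count_path count_path_at Hs_hit assms by auto
  qed
  ultimately show ?thesis unfolding gad_def using assms by (auto simp: tQ_gtP)
qed

lemma gad_exists:
  assumes "p \<in> {Detect paw, Detect diamond, Detect clique4} \<union> {Detect (cycle k) | k. 3 \<le> k} \<union>
          {Detect_At paw, Detect_At diamond, Detect_At clique4} \<union>
          {Detect_At (cycle k) | k. 3 \<le> k \<and> odd k} \<union>
          {Count path3, Count_At path3}"
  shows "\<exists>gt \<delta> d ta c1 c2 c3 core. gad p gt \<delta> d ta c1 c2 c3 core"
proof -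
  have cyc: "\<exists>gt \<delta> d ta c1 c2 c3 core. gad p gt \<delta> d ta c1 c2 c3 core" if "p = Detect (cycle q) \<or> p = Detect_At (cycle q)" "3 \<le> q" for q
  proof (cases "q = 3")
    case True then show ?thesis using that gad_triangle by blast
  next
    case False then show ?thesis using that gad_cycle[of p q] by fastforce
  qed
  consider "p = Detect paw \<or> p = Detect_At paw" | "p = Detect diamond \<or> p = Detect_At diamond" | "p = Detect clique4 \<or> p = Detect_At clique4" |
    q where "p = Detect (cycle q) \<or> p = Detect_At (cycle q)" "3 \<le> q" | "p = Count path3" | "p = Count_At path3"
    using assms by blast
  then show ?thesis
  proof cases
    case 1 from gad_paw[OF 1] show ?thesis by blast
  next
    case 2 from gad_diamond[OF 2] show ?thesis by blast
  next
    case 3 from gad_clique4[OF 3] show ?thesis by blast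
  next
    case 4 from cyc[OF 4] show ?thesis .
  next
    case 5 then show ?thesis using gad_path[of p 1 1] by blast
  next
    case 6 then show ?thesis using gad_path[of p 0 0] by blast
  qed
qed

text \<open>\<open>Fully_Dynamic\<close> is treated like \<open>Incremental\<close>, with insertions
  only; for deletions the initial graph contains all root edges.\<close>

definition tmsm :: "update_mode => tmpl list => nat => nat => tmpl list" where
  "tmsm md gt d ta = (if md = Decremental then gt @ dtl d ta else gt)"

definition opsm :: "update_mode => nat => nat => (nat => bool) => (nat => bool) => graph_op list" where
  "opsm md ta k u v = (if md = Decremental then map (%(a, b). Delete a b) (dps k ta (%i. \<not> u i) (%i. \<not> v i)) @ [Query]
     else map (%(a, b). Insert a b) (dps k ta u v) @ [Query])"

lemma tok_dtl:
  assumes "tok d gt" "(0, 1) \<notin> set (cps gt)" "dynp ta \<notin> set (cps gt)" "4 \<le> d" "ta = 0 \<or> ta = 3"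
  shows "tok (d + 4) (gt @ dtl d ta)"
proof -
  have c: "cps (dtl d ta) = [(0, 1), (d, Suc d), dynp ta, (Suc (Suc d), Suc (Suc (Suc d)))]"
    using assms(5) by (auto simp: dtl_def cps_def dynp_def)
  have b: "a < b \<and> b < d" if "(a, b) \<in> set (cps gt)" for a b using assms(1) that by (auto simp: tok_def)
  have "distinct (cps (gt @ dtl d ta))"
    unfolding cps_append c using assms b[of d "Suc d"] b[of "Suc (Suc d)" "Suc (Suc (Suc d))"] by (auto simp: tok_def dynp_def)
  moreover have "\<forall>(a, b)\<in>set (cps (gt @ dtl d ta)). a < b \<and> b < d + 4"
    unfolding cps_append c using b assms(4,5) by (fastforce simp: dynp_def)
  moreover have "\<forall>t\<in>set (gt @ dtl d ta). det (fst t) True (fst (snd t)) \<and> det (fst t) False (snd (snd t))"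
    using assms(1) by (auto simp: tok_def dtl_def)
  ultimately show ?thesis by (simp add: tok_def)
qed

lemma gad_run:
  fixes md :: update_mode and p :: problem and k i :: nat and M :: "nat => nat => bool" and u v :: "nat => bool"
  assumes g: "gad p gt \<delta> d ta c1 c2 c3 core" and k: "1 \<le> k"
  defines "tms \<equiv> tmsm md gt d ta" and "N \<equiv> d + 4" and "ops \<equiv> opsm md ta k u v"
  shows "valid_instance md p (N * (k * k)) 0 (tedges tms k M) ops"
    and "i \<le> length ops ==> k * k \<le> card (edges_before (tedges tms k M) ops i) \<and>
      card (edges_before (tedges tms k M) ops i) \<le> (length tms + 2) * (k * k)"
    and "answer p 0 ({..<N * (k * k)}, edges_before (tedges tms k M) ops (length ops - 1)) +
          (4 * c1 * (k * (k * k)) + (2 * c2 * (k * cnt u k) + 2 * c3 * (k * cnt v k)))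
           \<noteq> 2 * c1 * (k * k * (k * k) + k * k) + (c2 * (k * (cnt u k * (k + cnt u k))) + c3 * (k * (cnt v k * (k + cnt v k))))
         \<longleftrightarrow> hitp k M u v"
proof -
  note G = g[unfolded gad_def]
  have ta: "ta = 0 \<or> ta = 3" and d: "4 \<le> d" "\<delta> \<le> d" "even (d - \<delta>)" and gt: "gt \<noteq> []" "tok d gt" "(0, 1) \<notin> set (cps gt)" "dynp ta \<notin> set (cps gt)"
    and core: "core k M \<subseteq> tQ gt k M" "tQ gt k M \<subseteq> core k M \<union> dumQ \<delta>" using G k by blast+
  have ans: "fin_graph k N Q u v (core k M) ta \<delta> ==> (answer p 0 ({..<N * (k * k)}, E2 k Q) +
          (4 * c1 * (k * (k * k)) + (2 * c2 * (k * cnt u k) + 2 * c3 * (k * cnt v k)))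
           \<noteq> 2 * c1 * (k * k * (k * k) + k * k) + (c2 * (k * (cnt u k * (k + cnt u k))) + c3 * (k * (cnt v k * (k + cnt v k))))
         \<longleftrightarrow> hitp k M u v)" for Q using G by blast
  have mono: "tok d gt ==> tok (d + 4) gt" by (fastforce simp: tok_def)
  have tok: "tok N tms" unfolding tms_def tmsm_def N_def using tok_dtl[OF gt(2,3,4) d(1) ta] mono[OF gt(2)] by simp
  note es = tedges_ok[OF tok k, of M]
  have N: "4 \<le> N" "3 \<le> N" using d by (auto simp: N_def)
  have n0: "0 < N * (k * k)" using N k by simp
  note wfd = wf_dynQ[OF k ta N(1)]
  have kk: "k \<le> k * k" "1 \<le> length gt" using k gt(1) by (auto simp: Suc_leI)
  have c0: "card (uedge ` set (tedges tms k M)) = length tms * (k * k)"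
    unfolding es(2) card_E2[OF wf_tQ[OF tok k]] by (rule card_tQ[OF tok])
  have fin: "finite (uedge ` set (tedges tms k M))" by simp
  have dist: "distinct (map uedge (dps k ta u v))" for u v
    unfolding dps_dqs distinct_map using distinct_dqs ue_inj[OF wfd] by (auto simp: set_dqs intro!: inj_onI)
  have sd: "uedge ` set (dps k ta u v) = E2 k (dynQ k ta u v)" for u v
    by (metis dps_dqs E2_image list.set_map set_dqs)
  have ln: "length ops = Suc (length (dps k ta (%i. u i = (md \<noteq> Decremental)) (%i. v i = (md \<noteq> Decremental))))"
    by (simp add: ops_def opsm_def)
  have "valid_instance md p (N * (k * k)) 0 (tedges tms k M) ops \<and>
    (i \<le> length ops --> k * k \<le> card (edges_before (tedges tms k M) ops i) \<and>
      card (edges_before (tedges tms k M) ops i) \<le> (length tms + 2) * (k * k)) \<and>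
    (\<exists>Q. edges_before (tedges tms k M) ops (length ops - 1) = E2 k Q \<and> fin_graph k N Q u v (core k M) ta \<delta>)"
  proof (cases "md = Decremental")
    case False
    then have t: "tms = gt" and o: "ops = map (%(a, b). Insert a b) (dps k ta u v) @ [Query]" by (simp_all add: tms_def tmsm_def ops_def opsm_def)
    have dj: "dynQ k ta u v \<inter> tQ gt k M = {}" using cp_dynQ cp_tQ gt(3,4) by (metis disjoint_iff)
    have w: "wfQ k N (tQ gt k M \<union> dynQ k ta u v)" using wf_tQ[OF tok k, of M] wfd unfolding t wfQ_def by blast
    have "E2 k (dynQ k ta u v) \<inter> E2 k (tQ gt k M) = {}"
    proof (rule ccontr)
      assume "\<not> ?thesis"
      then obtain q q' where "q \<in> dynQ k ta u v" "q' \<in> tQ gt k M" "uedge (ev k q) = uedge (ev k q')" unfolding E2_image by blast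
      then show False using ue_inj[OF w, of q q'] dj by blast
    qed
    then have "uedge ` set (dps k ta u v) \<inter> uedge ` set (tedges tms k M) = {}" unfolding sd es(2) unfolding t .
    moreover have "fst p < N * (k * k) \<and> snd p < N * (k * k) \<and> fst p \<noteq> snd p" if "p \<in> set (dps k ta u v)" for p
    proof -
      have "uedge p \<in> E2 k (dynQ k ta u v)" using that sd by blast
      then obtain q where q: "q \<in> dynQ k ta u v" "uedge p = uedge (ev k q)" unfolding E2_image by blast
      from ev_lt[OF wfd q(1)] q(2) show ?thesis by (auto simp: uedge_def doubleton_eq_iff)
    qed
    ultimately have 1: "valid_instance md p (N * (k * k)) 0 (tedges tms k M) ops"
      unfolding o using valid_Insert[OF es(1) dist _ _ n0 False] by blast
    have e: "edges_before (tedges tms k M) ops i = uedge ` set (tedges tms k M) \<union> uedge ` set (take i (dps k ta u v))" for i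
      unfolding o by (rule edges_Insert)
    have "card (uedge ` set (take i (dps k ta u v))) \<le> 2 * k"
      using card_length[of "map uedge (take i (dps k ta u v))"] length_dps[of k ta u v] by simp
    then have "card (edges_before (tedges tms k M) ops i) \<le> length tms * (k * k) + 2 * k"
      unfolding e using card_Un_le[of "uedge ` set (tedges tms k M)" "uedge ` set (take i (dps k ta u v))"] c0 by linarith
    moreover have "\<dots> \<le> (length tms + 2) * (k * k)"
      unfolding add_mult_distrib by (rule add_left_mono[OF mult_le_mono2[OF kk(1)]])
    moreover have "length tms * (k * k) \<le> card (edges_before (tedges tms k M) ops i)"
      unfolding e c0[symmetric] by (rule card_mono) auto
    moreover have "1 * (k * k) \<le> length tms * (k * k)" unfolding t by (rule mult_le_mono1[OF kk(2)])
    ultimately have 2: "k * k \<le> card (edges_before (tedges tms k M) ops i) \<and> card (edges_before (tedges tms k M) ops i) \<le> (length tms + 2) * (k * k)"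
      by linarith
    have "edges_before (tedges tms k M) ops (length ops - 1) = E2 k (tQ gt k M \<union> dynQ k ta u v)"
      unfolding e es(2) by (simp add: ln False sd E2_Un t)
    moreover have "fin_graph k N (tQ gt k M \<union> dynQ k ta u v) u v (core k M) ta \<delta>"
      using k w core N by (auto simp: fin_graph_def)
    ultimately show ?thesis using 1 2 by blast
  next
    case True
    then have t: "tms = gt @ dtl d ta" and o: "ops = map (%(a, b). Delete a b) (dps k ta (%i. \<not> u i) (%i. \<not> v i)) @ [Query]"
      by (simp_all add: tms_def tmsm_def ops_def opsm_def)
    let ?D = "dynQ k ta (%i. \<not> u i) (%i. \<not> v i)" and ?P = "dps k ta (%i. \<not> u i) (%i. \<not> v i)"
    have dt: "dynQ k ta u v \<union> ?D \<subseteq> tQ (dtl d ta) k M" "tQ (dtl d ta) k M \<subseteq> dynQ k ta u v \<union> ?D \<union> dumQ \<delta>"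
      using dtl_Q[OF k d(2,3), of ta M] dynQ_split[of k ta u v] by blast+
    have T: "tQ tms k M = tQ gt k M \<union> tQ (dtl d ta) k M" unfolding t by (rule tQ_append)
    have dj: "?D \<inter> tQ gt k M = {}" using cp_dynQ cp_tQ gt(3,4) by (metis disjoint_iff)
    have w: "wfQ k N (tQ tms k M)" by (rule wf_tQ[OF tok k])
    have sub: "?D \<subseteq> tQ tms k M" using dt(1) T by blast
    have "uedge ` set ?P \<subseteq> uedge ` set (tedges tms k M)" unfolding sd es(2) E2_image using sub by blast
    then have 1: "valid_instance md p (N * (k * k)) 0 (tedges tms k M) ops"
      unfolding o using valid_Delete[OF es(1) dist _ n0] True by blast
    have e: "edges_before (tedges tms k M) ops i = uedge ` set (tedges tms k M) - uedge ` set (take i ?P)" for i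
      unfolding o by (rule edges_Delete)
    have "card (edges_before (tedges tms k M) ops i) \<le> length tms * (k * k)"
      unfolding e c0[symmetric] by (rule card_mono) auto
    moreover have "\<dots> \<le> (length tms + 2) * (k * k)" by (rule mult_le_mono1) simp
    \<comment> \<open>The edges of \<open>gt\<close> are never deleted, so at least
      \<open>k * k\<close> edges remain.\<close>
    moreover have "card (E2 k (tQ gt k M)) \<le> card (edges_before (tedges tms k M) ops i)"
    proof (rule card_mono)
      show "finite (edges_before (tedges tms k M) ops i)" unfolding e by simp
      have "E2 k (tQ gt k M) \<subseteq> E2 k (tQ tms k M - ?D)" unfolding E2_image using T dj by blast
      also have "\<dots> = E2 k (tQ tms k M) - E2 k ?D" by (rule E2_Diff[OF w sub])
      also have "\<dots> \<subseteq> edges_before (tedges tms k M) ops i" unfolding e es(2) sd[symmetric] using set_take_subset[of i ?P] by blast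
      finally show "E2 k (tQ gt k M) \<subseteq> edges_before (tedges tms k M) ops i" .
    qed
    moreover have "card (E2 k (tQ gt k M)) = length gt * (k * k)"
      using card_E2[OF wf_tQ[OF gt(2) k]] card_tQ[OF gt(2)] by simp
    moreover have "1 * (k * k) \<le> length gt * (k * k)" by (rule mult_le_mono1[OF kk(2)])
    ultimately have 2: "k * k \<le> card (edges_before (tedges tms k M) ops i) \<and> card (edges_before (tedges tms k M) ops i) \<le> (length tms + 2) * (k * k)"
      by linarith
    have "edges_before (tedges tms k M) ops (length ops - 1) = E2 k (tQ tms k M - ?D)"
      unfolding e es(2) E2_Diff[OF w sub] by (simp add: ln True sd)
    moreover have "fin_graph k N (tQ tms k M - ?D) u v (core k M) ta \<delta>"
    proof -
      have "wfQ k N (tQ tms k M - ?D)" using w by (auto simp: wfQ_def)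
      moreover have "core k M \<union> dynQ k ta u v \<subseteq> tQ tms k M - ?D" using core dt(1) dj dynQ_disj[of k ta u v] unfolding T by blast
      moreover have "tQ tms k M - ?D \<subseteq> core k M \<union> dynQ k ta u v \<union> dumQ \<delta>" using core dt(2) unfolding T by blast
      ultimately show ?thesis using k N by (simp add: fin_graph_def)
    qed
    ultimately show ?thesis using 1 2 by blast
  qed
  then show "valid_instance md p (N * (k * k)) 0 (tedges tms k M) ops"
    "i \<le> length ops ==> k * k \<le> card (edges_before (tedges tms k M) ops i) \<and>
      card (edges_before (tedges tms k M) ops i) \<le> (length tms + 2) * (k * k)"
    "answer p 0 ({..<N * (k * k)}, edges_before (tedges tms k M) ops (length ops - 1)) +
          (4 * c1 * (k * (k * k)) + (2 * c2 * (k * cnt u k) + 2 * c3 * (k * cnt v k)))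
           \<noteq> 2 * c1 * (k * k * (k * k) + k * k) + (c2 * (k * (cnt u k * (k + cnt u k))) + c3 * (k * (cnt v k * (k + cnt v k))))
         \<longleftrightarrow> hitp k M u v"
    using ans by (blast, blast, metis)
qed

subsection \<open>Asymptotics\<close>

lemma nat_floor_ge: "real x \<le> y ==> x \<le> nat \<lfloor>y\<rfloor>"
  by (simp add: le_nat_iff le_floor_iff)

lemma nat_floor_le: "0 \<le> y ==> real (nat \<lfloor>y\<rfloor>) \<le> y"
  by simp

text \<open>The finitely many arguments before the asymptotic bound sets in are absorbed by adding
  the sum of their ratios to the constant.\<close>

lemma bigo_bound:
  fixes f g :: "nat => real"
  assumes "f \<in> O(g)" "\<And>m. 1 \<le> m ==> 0 < g m"
  shows "\<exists>C>0. \<forall>m\<ge>1. f m \<le> C * g m"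
proof -
  obtain c where c: "0 < c" "eventually (%m. norm (f m) \<le> c * norm (g m)) at_top"
    using assms(1) by (elim landau_o.bigE)
  obtain m0 where m0: "\<And>m. m0 \<le> m ==> norm (f m) \<le> c * norm (g m)" using c(2) by (auto simp: eventually_at_top_linorder)
  define S where "S = (\<Sum>m<m0. \<bar>f m\<bar> / \<bar>g m\<bar>)"
  have S: "0 \<le> S" unfolding S_def by (intro sum_nonneg) auto
  have "f m \<le> (c + S) * g m" if m: "1 \<le> m" for m
  proof (cases "m0 \<le> m")
    case True
    then have "f m \<le> c * g m" using m0[of m] assms(2)[OF m] by simp
    also have "\<dots> \<le> (c + S) * g m" using S assms(2)[OF m] by (intro mult_right_mono) auto
    finally show ?thesis .
  next
    case False
    have "\<bar>f m\<bar> / \<bar>g m\<bar> \<le> S" unfolding S_def using False by (intro member_le_sum) auto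
    then have "\<bar>f m\<bar> \<le> S * g m" using assms(2)[OF m] by (simp add: field_simps)
    also have "\<dots> \<le> (c + S) * g m" using c(1) assms(2)[OF m] by (intro mult_right_mono) auto
    finally show ?thesis by simp
  qed
  then show ?thesis using c(1) S by (intro exI[of _ "c + S"]) auto
qed

context runl
begin

lemma k_bounds:
  assumes n: "1 \<le> n" and D2: "2 \<le> D"
  shows "k ^ D \<le> 2 * n" "n < (2 * k) ^ D" "g * k \<le> 2 * n" "g \<le> 2 * n" "1 \<le> k" "1 \<le> lg" "2 ^ (lg - 1) \<le> n"
proof -
  show lg: "1 \<le> lg" using n pow_le_floorlog[of 0 n] by (simp add: lg_def)
  show l1: "2 ^ (lg - 1) \<le> n" using lg pow_le_floorlog[of "lg - 1" n] by (simp add: lg_def)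
  have "k ^ D = 2 ^ (lg div D * D)" by (simp add: k_def power_mult)
  also have "\<dots> \<le> 2 ^ lg" by (intro power_increasing) auto
  also have "\<dots> = 2 * 2 ^ (lg - 1)" using lg by (simp add: power_eq_if)
  also have "\<dots> \<le> 2 * n" using l1 by simp
  finally show "k ^ D \<le> 2 * n" .
  have "n < 2 ^ lg" using less_floorlog by (simp add: lg_def)
  also have "\<dots> \<le> 2 ^ (Suc (lg div D) * D)"
    using dividend_less_div_times[of D lg] D2 by (intro power_increasing) auto
  also have "\<dots> = (2 * k) ^ D" by (simp add: k_def power_mult[symmetric] flip: power_Suc)
  finally show "n < (2 * k) ^ D" .
  have "lg div D < lg" using lg D2 by (intro div_less_dividend) auto
  then have kn: "k \<le> n" unfolding k_def using pow_le_floorlog[of "lg div D" n] by (simp add: lg_def)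
  show k1: "1 \<le> k" by (simp add: k_def)
  have "g * k = n div k * k + k" by (simp add: g_def)
  also have "\<dots> \<le> n + n" using kn by (intro add_mono) auto
  finally show gk: "g * k \<le> 2 * n" by simp
  have "g * 1 \<le> g * k" using k1 by (intro mult_le_mono2)
  then show "g \<le> 2 * n" using gk by linarith
qed

text \<open>The votes dominate: \<open>n\<close> products, \<open>g * g\<close> blocks and
  \<open>r\<close> copies of order \<open>k powr (2 - 2 * \<epsilon>)\<close> steps each, where
  \<open>g * k\<close> is of order \<open>n\<close>. The saving in \<open>k\<close> amounts to
  \<open>n powr (2 * sg)\<close>, of which \<open>r\<close> uses up \<open>n powr sg\<close>.
  Searches and preprocessing stay near \<open>n powr (5 / 2)\<close>.\<close>

lemma time_bound:
  fixes d :: nat and \<epsilon> sg Cs Cp :: real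
  assumes n: "1 \<le> n" and Dd: "D = 4 * d + 4" and e: "0 < \<epsilon>" "\<epsilon> \<le> 1 / 4" and s: "sg = \<epsilon> / D" and C0: "0 \<le> Cs" "0 \<le> Cp"
    and Bs: "real (Bs k) \<le> Cs * real k powr (2 - 2 * \<epsilon>)" and Bp: "real (Bp k) \<le> Cp * real k ^ (2 * d)"
  shows "real (QT + n * MT) \<le> (8 * (12 * Cs + 3 * bd + 802) * (60 + 72 / sg) + 750 +
      8 * (90 * length tms + 100 + 12 * Cp + bd + 308) * (60 + 72 / sg) + 390) * real n powr (3 - sg)"
proof -
  define K G R m where "K = real k" and "G = real g" and "R = real r" and "m = real n"
  define P where "P = m powr sg"
  define H where "H = m powr (1 / 2)"
  define Y where "Y = m powr (3 - sg)"
  define Z where "Z = K powr (2 - 2 * \<epsilon>)"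
  define Cr where "Cr = 60 + 72 / sg"
  define c2 where "c2 = 12 * Cs + 3 * bd + 802"
  define c3 where "c3 = 90 * length tms + 100 + 12 * Cp + bd + 308"
  have D2: "2 \<le> D" "4 \<le> D" using Dd by auto
  note kb = k_bounds[OF n D2(1)]
  have K1: "1 \<le> K" and m1: "1 \<le> m" using kb(5) n by (simp_all add: K_def m_def)
  have s0: "0 < sg" using e D2 by (simp add: s)
  have "\<epsilon> / real D \<le> (1 / 4) / 4" using e D2 by (intro frac_le) auto
  then have s1: "sg \<le> 1 / 16" by (simp add: s)
  have P1: "1 \<le> P" and H1: "1 \<le> H" using m1 s0 by (simp_all add: P_def H_def ge_one_powr_ge_zero)
  have Cr1: "0 \<le> Cr" using s0 by (simp add: Cr_def)
  have c23: "0 \<le> c2" "0 \<le> c3" using C0 by (simp_all add: c2_def c3_def)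
  have gk: "G * K \<le> 2 * m" using kb(3) unfolding G_def K_def m_def by (metis of_nat_le_iff of_nat_mult of_nat_numeral)
  have g2: "G \<le> 2 * m" using kb(4) unfolding G_def m_def by linarith
  have G0: "0 \<le> G" by (simp add: G_def)
  \<comment> \<open>\<open>D = 2 * (2 * d + 2)\<close>, so the bound
    \<open>k ^ D \<le> 2 * n\<close> is one on a square.\<close>
  have kH: "K ^ (2 * d + 2) \<le> 2 * H"
  proof (rule power2_le_imp_le)
    have "k ^ D = (k ^ (2 * d + 2)) ^ 2" 
      unfolding power_mult[symmetric] by (rule arg_cong[where f = "%e. k ^ e"]) (use Dd in simp)
    then have "(K ^ (2 * d + 2)) ^ 2 \<le> 2 * m" using kb(1) unfolding K_def m_def by (metis of_nat_le_iff of_nat_mult of_nat_numeral of_nat_power)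
    also have "\<dots> \<le> 4 * m" using m1 by simp
    also have "\<dots> = (2 * H) ^ 2" using m1 by (simp add: H_def powr_half_sqrt)
    finally show "(K ^ (2 * d + 2)) ^ 2 \<le> (2 * H) ^ 2" .
  qed (use H1 in simp)
  have Kp: "K ^ i \<le> 2 * H" if "i \<le> 2 * d + 2" for i
    using power_increasing[OF that K1] kH by linarith
  \<comment> \<open>The lower bound \<open>n < (2 * k) ^ D\<close>, raised to the power
    \<open>2 * \<epsilon> / D\<close>, turns the saving in \<open>k\<close> into one in
    \<open>n\<close>.\<close>
  have Z: "Z * m powr (2 * sg) \<le> 2 * K ^ 2"
  proof -
    have "m \<le> (2 * K) ^ D" using kb(2) unfolding m_def K_def by (metis less_imp_le of_nat_le_iff of_nat_mult of_nat_numeral of_nat_power)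
    then have "m powr (1 / D) \<le> ((2 * K) ^ D) powr (1 / D)" using m1 by (intro powr_mono2) auto
    also have "\<dots> = 2 * K"
    proof -
      have gen: "0 < x ==> (x ^ D) powr (1 / D) = x" for x :: real using D2 by (simp add: powr_realpow[symmetric] powr_powr)
      show ?thesis by (rule gen) (use K1 in simp)
    qed
    finally have "(m powr (1 / D)) powr (2 * \<epsilon>) \<le> (2 * K) powr (2 * \<epsilon>)" using e by (intro powr_mono2) auto
    then have "m powr (2 * sg) \<le> 2 powr (2 * \<epsilon>) * K powr (2 * \<epsilon>)" using K1 by (simp add: powr_powr s powr_mult mult.commute)
    also have "2 powr (2 * \<epsilon>) \<le> 2 powr 1" using e by (intro powr_mono) auto
    finally have "m powr (2 * sg) \<le> 2 * K powr (2 * \<epsilon>)" using K1 by (simp add: mult_right_mono)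
    then have "Z * m powr (2 * sg) \<le> Z * (2 * K powr (2 * \<epsilon>))" by (intro mult_left_mono) (auto simp: Z_def)
    also have "\<dots> = 2 * (K powr (2 - 2 * \<epsilon>) * K powr (2 * \<epsilon>))" by (simp add: Z_def)
    also have "\<dots> = 2 * K powr 2" by (simp add: powr_add[symmetric])
    also have "\<dots> = 2 * K ^ 2" using K1 by (simp add: powr_numeral)
    finally show ?thesis .
  qed
  have KZ: "K \<le> Z" using powr_mono[of 1 "2 - 2 * \<epsilon>" K] K1 e by (simp add: Z_def)
  have R: "R \<le> Cr * P" "1 \<le> R"
  proof -
    have "real (2 ^ (lg - 1)) \<le> m" unfolding m_def using kb(7) by (simp only: of_nat_le_iff)
    then have "ln (2 ^ (lg - 1)) \<le> ln m" using m1 by simp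
    then have "real (lg - 1) * ln 2 \<le> ln m" by (simp add: ln_realpow)
    moreover have "real (lg - 1) * (1 / 2) \<le> real (lg - 1) * ln 2" using ln2_ge_two_thirds by (intro mult_left_mono) auto
    \<comment> \<open>A logarithm is at most \<open>m powr sg / sg\<close>. With 36 copies per unit
      of \<open>lg\<close> and a factor 2 for the passage to the natural logarithm, this is the
      origin of \<open>72 / sg\<close>.\<close>
    moreover have "ln m \<le> P / sg" unfolding P_def using m1 s0 by (rule ln_powr_bound)
    ultimately have "real (lg - 1) \<le> 2 * (P / sg)" by linarith
    then have "R \<le> 36 * (1 + 2 * (P / sg)) + 24" unfolding R_def r_def using kb(6) by simp
    also have "\<dots> \<le> Cr * P" using P1 by (simp add: Cr_def algebra_simps)
    finally show "R \<le> Cr * P" .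
    show "1 \<le> R" by (simp add: R_def r_def)
  qed
  have Yeq: "m ^ 3 * P = Y * m powr (2 * sg)"
  proof -
    have "m ^ 3 * P = m powr (3 + sg)" using m1 by (simp add: P_def powr_add)
    also have "3 + sg = (3 - sg) + 2 * sg" by simp
    also have "m powr \<dots> = Y * m powr (2 * sg)" unfolding Y_def by (rule powr_add)
    finally show ?thesis .
  qed
  have mH: "m ^ 2 * H * P \<le> Y"
  proof -
    have "m ^ 2 = m powr 2" using m1 by (simp add: powr_numeral)
    then have "m ^ 2 * H * P = m powr (2 + 1 / 2 + sg)" unfolding H_def P_def by (simp only: powr_add)
    also have "\<dots> \<le> Y" unfolding Y_def using m1 s1 by (intro powr_mono) auto
    finally show ?thesis .
  qed
  have mH2: "m ^ 2 * H \<le> Y" "m ^ 2 \<le> Y"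
  proof -
    have "m ^ 2 * H * 1 \<le> m ^ 2 * H * P" using P1 H1 m1 by (intro mult_left_mono) auto
    then show "m ^ 2 * H \<le> Y" using mH by simp
    moreover have "m ^ 2 * 1 \<le> m ^ 2 * H" using H1 by (intro mult_left_mono) auto
    ultimately show "m ^ 2 \<le> Y" by simp
  qed
  have ct: "real CT + 102 \<le> c2 * Z"
  proof -
    have "real CT + 102 = 12 * real (Bs k) + K * (2 * bd + 400) + (bd + 402)" by (simp add: CT_def K_def)
    also have "\<dots> \<le> 12 * (Cs * Z) + Z * (2 * bd + 400) + Z * (bd + 402)"
      using Bs KZ K1 mult_right_mono[of 1 Z "real bd + 402"] by (intro add_mono mult_left_mono mult_right_mono) (auto simp: Z_def K_def)
    finally show ?thesis by (simp add: c2_def algebra_simps)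
  qed
  have 1: "m * (G * G * (R * (real CT + 102))) \<le> 8 * c2 * Cr * Y"
  proof -
    have pos: "0 < m powr (2 * sg)" using m1 by simp
    have "m * (G * G * (R * (real CT + 102))) * m powr (2 * sg) \<le> m * (G * G * (R * (c2 * Z))) * m powr (2 * sg)"
      using ct G0 m1 R(2) by (intro mult_right_mono mult_left_mono) auto
    also have "\<dots> = m * (G * G * (R * c2)) * (Z * m powr (2 * sg))" by simp
    also have "\<dots> \<le> m * (G * G * (R * c2)) * (2 * K ^ 2)"
      using Z G0 m1 R(2) c23 by (intro mult_left_mono) auto
    also have "\<dots> = 2 * m * c2 * (G * K) ^ 2 * R" by (simp add: power2_eq_square)
    also have "\<dots> \<le> 2 * m * c2 * (2 * m) ^ 2 * (Cr * P)"
    proof (rule mult_mono[OF _ R(1)])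
      have "(G * K) ^ 2 \<le> (2 * m) ^ 2" using gk G0 K1 by (intro power_mono) auto
      then show "2 * m * c2 * (G * K) ^ 2 \<le> 2 * m * c2 * (2 * m) ^ 2" using m1 c23 by (intro mult_left_mono) auto
    qed (use m1 c23 R(2) in auto)
    also have "\<dots> = 8 * c2 * Cr * (m ^ 3 * P)" by (simp add: power2_eq_square power3_eq_cube)
    also have "\<dots> = (8 * c2 * Cr * Y) * m powr (2 * sg)" unfolding Yeq by simp
    finally show ?thesis using pos by simp
  qed
  have 2: "m * (m * (100 * K ^ 2 + 50) + 200 * m + 300) \<le> 750 * Y"
  proof -
    have "m * 1 \<le> m * m" using m1 by (intro mult_left_mono) auto
    then have "m * (m * (100 * K ^ 2 + 50) + 200 * m + 300) \<le> m ^ 2 * (100 * K ^ 2 + 550)"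
      by (simp add: algebra_simps power2_eq_square)
    also have "\<dots> \<le> m ^ 2 * (100 * (2 * H) + 550 * H)" using Kp[of 2] H1 by (intro mult_left_mono) auto
    also have "\<dots> = 750 * (m ^ 2 * H)" by simp
    finally show ?thesis using mH2(1) by linarith
  qed
  have 3: "G * G * (R * (real IT + 8)) \<le> 8 * c3 * Cr * Y"
  proof -
    have "real IT + 8 = K ^ 2 * (90 * length tms + 100) + 12 * real (Bp k) + (bd + 308)"
      by (simp add: IT_def KT_def K_def power2_eq_square algebra_simps)
    also have "\<dots> \<le> (2 * H) * (90 * length tms + 100) + 12 * (Cp * (2 * H)) + (2 * H) * (bd + 308)"
    proof (rule add_mono[OF add_mono])
      show "K ^ 2 * (90 * length tms + 100) \<le> (2 * H) * (90 * length tms + 100)"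
        using Kp[of 2] by (intro mult_right_mono) auto
      show "12 * real (Bp k) \<le> 12 * (Cp * (2 * H))"
        using Bp mult_left_mono[OF Kp[of "2 * d"] C0(2)] by (simp add: K_def)
      show "real (bd + 308) \<le> 2 * H * real (bd + 308)" using mult_right_mono[of 1 "2 * H" "real (bd + 308)"] H1 by simp
    qed
    also have "\<dots> = 2 * c3 * H" by (simp add: c3_def algebra_simps)
    finally have i: "real IT + 8 \<le> 2 * c3 * H" .
    have "G * G * (R * (real IT + 8)) \<le> (2 * m) * (2 * m) * ((Cr * P) * (2 * c3 * H))"
      using g2 G0 R i m1 c23 H1 Cr1 P1 by (intro mult_mono mult_nonneg_nonneg) auto
    also have "\<dots> = 8 * c3 * Cr * (m ^ 2 * H * P)" by (simp add: power2_eq_square)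
    also have "\<dots> \<le> 8 * c3 * Cr * Y" using mH c23 Cr1 by (intro mult_left_mono) auto
    finally show ?thesis .
  qed
  have 4: "60 * (m * m) + 30 * m + 300 \<le> 390 * Y"
  proof -
    have "m * 1 \<le> m * m" using m1 by (intro mult_left_mono) auto
    then have "60 * (m * m) + 30 * m + 300 \<le> 390 * m ^ 2" using m1 unfolding power2_eq_square by linarith
    then show ?thesis using mH2(2) by linarith
  qed
  have pt: "real (PT + 88) \<le> R * (real CT + 102)"
    using R(2) by (simp add: PT_def R_def algebra_simps)
  have "real (QT + n * MT) = (G * G * (R * (real IT + 8)) + (60 * (m * m) + 30 * m + 300)) +
      (m * (G * G * real (PT + 88)) + m * (m * (100 * K ^ 2 + 50) + 200 * m + 300))"
    by (simp add: QT_def MT_def BT_def G_def R_def m_def K_def power2_eq_square algebra_simps)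
  also have "m * (G * G * real (PT + 88)) \<le> m * (G * G * (R * (real CT + 102)))"
    using pt m1 G0 by (intro mult_left_mono) auto
  finally have "real (QT + n * MT) \<le> 8 * c3 * Cr * Y + 390 * Y + (8 * c2 * Cr * Y + 750 * Y)"
    using 1 2 3 4 by linarith
  then show ?thesis unfolding c2_def c3_def Cr_def Y_def m_def by (simp add: algebra_simps)
qed

end

context redok
begin

lemma omv_bounds:
  fixes d :: nat and \<epsilon> Cs Cp :: real
  assumes "D = 4 * d + 4" "0 < \<epsilon>" "\<epsilon> \<le> 1 / 4" "0 \<le> Cs" "0 \<le> Cp"
    and Bs: "\<And>k. 1 \<le> k ==> real (Bs k) \<le> Cs * real k powr (2 - 2 * \<epsilon>)"
    and Bp: "\<And>k. 1 \<le> k ==> real (Bp k) \<le> Cp * real k ^ (2 * d)"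
  shows "solves_omv omv \<and> omv_time omv (%n. real n powr (3 - \<epsilon> / D))"
proof
  have I: "runl cpre cupd cqry bd cw tms NA rt ta c1 c2 c3 D md val Bp Bs" by unfold_locales
  show "solves_omv omv" unfolding solves_omv_def
  proof (intro allI conjI)
    fix n M v
    interpret R: runl cpre cupd cqry bd cw tms NA rt ta c1 c2 c3 D md val Bp Bs n M by (rule I)
    show "lossless_spmf (omv_run omv n M v)" by (rule R.run_sure)
    show "measure (measure_spmf (omv_run omv n M v)) {tr. \<not> omv_correct n M v tr} \<le> 1 / 3" by (rule R.run_err)
  qed
  obtain C where C: "\<exists>b. (\<forall>M v. \<forall>tr\<in>set_spmf (omv_run omv n M v). sum_list (map fst tr) \<le> b) \<and>
      (1 \<le> n --> real b \<le> C * real n powr (3 - \<epsilon> / D))" for n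
  proof
    fix n
    \<comment> \<open>The time bounds do not mention the matrix, so an arbitrary one serves to name
      them.\<close>
    interpret R0: runl cpre cupd cqry bd cw tms NA rt ta c1 c2 c3 D md val Bp Bs n "%_ _. False" by (rule I)
    show "\<exists>b. (\<forall>M v. \<forall>tr\<in>set_spmf (omv_run omv n M v). sum_list (map fst tr) \<le> b) \<and>
      (1 \<le> n --> real b \<le> (8 * (12 * Cs + 3 * bd + 802) * (60 + 72 / (\<epsilon> / D)) + 750 +
      8 * (90 * length tms + 100 + 12 * Cp + bd + 308) * (60 + 72 / (\<epsilon> / D)) + 390) * real n powr (3 - \<epsilon> / D))"
    proof (intro exI[of _ "R0.QT + n * R0.MT"] conjI allI ballI impI)
      fix M v tr assume tr: "tr \<in> set_spmf (omv_run omv n M v)"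
      interpret R: runl cpre cupd cqry bd cw tms NA rt ta c1 c2 c3 D md val Bp Bs n M by (rule I)
      show "sum_list (map fst tr) \<le> R0.QT + n * R0.MT" using R.run_sure(2)[OF tr] .
    next
      assume n: "1 \<le> n"
      show "real (R0.QT + n * R0.MT) \<le> (8 * (12 * Cs + 3 * bd + 802) * (60 + 72 / (\<epsilon> / D)) + 750 +
      8 * (90 * length tms + 100 + 12 * Cp + bd + 308) * (60 + 72 / (\<epsilon> / D)) + 390) * real n powr (3 - \<epsilon> / D)"
        by (rule R0.time_bound[OF n assms(1,2,3) refl assms(4,5) Bs Bp]) (simp_all add: R0.k_def)
    qed
  qed
  obtain b where b: "\<And>n M v tr. tr \<in> set_spmf (omv_run omv n M v) ==> sum_list (map fst tr) \<le> b n"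
    "\<And>n. 1 \<le> n ==> real (b n) \<le> C * real n powr (3 - \<epsilon> / D)" using C by metis
  have "(%n. real (b n)) \<in> O(%n. real n powr (3 - \<epsilon> / D))"
  proof (rule bigoI[of _ C])
    show "eventually (%n. norm (real (b n)) \<le> C * norm (real n powr (3 - \<epsilon> / D))) at_top"
      using eventually_ge_at_top[of 1] by eventually_elim (simp add: b(2))
  qed
  then show "omv_time omv (%n. real n powr (3 - \<epsilon> / D))"
    unfolding omv_time_def using b(1) by (intro bexI[of _ "%n. real (b n)"]) auto
qed

end

subsection \<open>The reduction\<close>

lemma worst_imp_amortized:
  assumes "worst_case_update_time md p A f"
  shows "amortized_update_time md p A f"
proof -
  obtain U where U: "U \<in> O(f)" "\<And>n s es ops tr i. valid_instance md p n s es ops ==> tr \<in> set_spmf (dyn_run A p n s es ops) ==>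
      i < length ops ==> ops ! i \<noteq> Query ==> real (fst (tr ! Suc i)) \<le> U (card (edges_before es ops i))"
    using assms unfolding worst_case_update_time_def by blast
  show ?thesis unfolding amortized_update_time_def
    by (intro bexI[OF _ U(1)] allI impI ballI sum_mono) (use U(2) in auto)
qed

lemma powr_bound:
  assumes "0 \<le> a" "a \<le> 1" "1 \<le> k" "1 \<le> l" "m \<le> l * (k * k)" "1 \<le> m"
  shows "real m powr a \<le> real l * real k powr (2 * a)"
proof -
  have "real m powr a \<le> real (l * (k * k)) powr a" using assms by (intro powr_mono2) (auto simp del: of_nat_mult)
  also have "\<dots> = real l powr a * real k powr (2 * a)" by (simp add: powr_mult powr_add[symmetric])
  also have "\<dots> \<le> real l powr 1 * real k powr (2 * a)" using assms by (intro mult_right_mono powr_mono) auto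
  finally show ?thesis using assms(4) by simp
qed

lemma opsm_split: "\<exists>us. opsm md ta k u v = us @ [Query] \<and> length us \<le> 2 * k \<and> Query \<notin> set us"
proof (cases "md = Decremental")
  case True
  then show ?thesis unfolding opsm_def using length_dps[of k ta]
    by (intro exI[of _ "map (%(a, b). Delete a b) (dps k ta (%i. \<not> u i) (%i. \<not> v i))"]) auto
next
  case False
  then show ?thesis unfolding opsm_def using length_dps[of k ta]
    by (intro exI[of _ "map (%(a, b). Insert a b) (dps k ta u v)"]) auto
qed

context red
begin

text \<open>Identifies the calls made by the reduction with graph operations, to which the
  guarantees of the dynamic algorithm apply.\<close>

lemma rest_opsm:
  assumes "cpre = preprocess A" "cqry = query A" "cupd = (if m = Decremental then deletion A else insertion A)" "md = (m \<noteq> Decremental)"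
  shows "rest k u v 0 = map (op_call A) (opsm m ta k u v)"
proof (cases "m = Decremental")
  case True
  have "map (op_call A) (opsm m ta k u v) = concat (map (%i. map (%(a, b). op_call A (Delete a b)) ((if \<not> u i then [(0, k * k + i)] else []) @
      (if \<not> v i then [(ta * (k * k), 2 * (k * k) + i)] else []))) [0..<k]) @ [(query A, [])]"
    using True by (simp add: opsm_def dps_def map_concat o_def case_prod_unfold)
  then show ?thesis unfolding rest_def upd1_def upd2_def using True assms by (auto intro!: arg_cong[where f = concat])
next
  case False
  have "map (op_call A) (opsm m ta k u v) = concat (map (%i. map (%(a, b). op_call A (Insert a b)) ((if u i then [(0, k * k + i)] else []) @
      (if v i then [(ta * (k * k), 2 * (k * k) + i)] else []))) [0..<k]) @ [(query A, [])]"
    using False by (simp add: opsm_def dps_def map_concat o_def case_prod_unfold)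
  then show ?thesis unfolding rest_def upd1_def upd2_def using False assms by (auto intro!: arg_cong[where f = concat])
qed

end

text \<open>Every vote runs one operation sequence from the initial graph, so a bound on the total
  time of a sequence is all that is needed of the updates.\<close>

lemma reduction:
  assumes omv: OMv_conjecture and \<delta>: "\<delta> > 0" and gad: "gad p gt dl d ta c1 c2 c3 core"
    and mt: "maintains md p A" and pp: "polynomial_preprocessing md p A"
    and ut: "amortized_update_time md p A (%m. real m powr (1 / 2 - \<delta>))" and qt: "query_time md p A (%m. real m powr (1 - \<delta>))"
  shows False
proof -
  \<comment> \<open>The minimum with 1/4 keeps both exponents positive, so that bounds in the number
    of edges are monotone.\<close>
  define \<epsilon> where "\<epsilon> = min \<delta> (1 / 4)"
  have e: "0 < \<epsilon>" "\<epsilon> \<le> 1 / 4" "\<epsilon> \<le> \<delta>" using \<delta> by (auto simp: \<epsilon>_def)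
  define tms where "tms = tmsm md gt d ta"
  define N where "N = d + 4"
  define L where "L = length tms + 2"
  define es where "es = tedges tms"
  define ops where "ops = opsm md ta"
  define rt where "rt = length (root_input p 0)"
  define cupd where "cupd = (if md = Decremental then deletion A else insertion A)"
  define val where "val k M u v = answer p 0 ({..<N * (k * k)}, edges_before (es k M) (ops k u v) (length (ops k u v) - 1))" for k M u v
  note G = gad[unfolded gad_def]
  have gd: "4 \<le> d" "ta = 0 \<or> ta = 3" "c1 \<le> 1" "c2 \<le> 1" "c3 \<le> 1" "tok d gt" "(0, 1) \<notin> set (cps gt)" "dynp ta \<notin> set (cps gt)" using G by blast+
  have V: "valid_instance md p (N * (k * k)) 0 (es k M) (ops k u v)"
    and crd: "i \<le> length (ops k u v) ==> k * k \<le> card (edges_before (es k M) (ops k u v) i) \<and> card (edges_before (es k M) (ops k u v) i) \<le> L * (k * k)"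
    and dec: "val k M u v + (4 * c1 * (k * (k * k)) + (2 * c2 * (k * cnt u k) + 2 * c3 * (k * cnt v k)))
           \<noteq> 2 * c1 * (k * k * (k * k) + k * k) + (c2 * (k * (cnt u k * (k + cnt u k))) + c3 * (k * (cnt v k * (k + cnt v k))))
         \<longleftrightarrow> hitp k M u v" if "1 \<le> k" for k M u v i
    using gad_run[OF gad that, where md = md] unfolding es_def ops_def N_def tms_def L_def val_def by blast+
  have sp: "\<exists>us. ops k u v = us @ [Query] \<and> length us \<le> 2 * k \<and> Query \<notin> set us" for k u v
    unfolding ops_def by (rule opsm_split)

  obtain dp :: nat and T where T: "T \<in> O(%n. real n ^ dp)" "\<And>n s es ops tr. valid_instance md p n s es ops ==>
      tr \<in> set_spmf (dyn_run A p n s es ops) ==> real (fst (tr ! 0)) \<le> T n"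
    using pp unfolding polynomial_preprocessing_def by blast
  obtain CT where CT: "0 < CT" "\<And>n. 1 \<le> n ==> T n \<le> CT * real n ^ dp"
    using bigo_bound[OF T(1)] by auto
  obtain U where U: "U \<in> O(%m. real m powr (1 / 2 - \<delta>))" "\<And>n s es ops tr. valid_instance md p n s es ops ==>
      tr \<in> set_spmf (dyn_run A p n s es ops) ==>
      (\<Sum>i | i < length ops \<and> ops ! i \<noteq> Query. real (fst (tr ! Suc i))) \<le> (\<Sum>i | i < length ops \<and> ops ! i \<noteq> Query. U (card (edges_before es ops i)))"
    using ut unfolding amortized_update_time_def by blast
  obtain CU where CU: "0 < CU" "\<And>m. 1 \<le> m ==> U m \<le> CU * real m powr (1 / 2 - \<delta>)"
    using bigo_bound[OF U(1)] by auto
  obtain Q where Q: "Q \<in> O(%m. real m powr (1 - \<delta>))" "\<And>n s es ops tr i. valid_instance md p n s es ops ==>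
      tr \<in> set_spmf (dyn_run A p n s es ops) ==> i < length ops ==> ops ! i = Query ==> real (fst (tr ! Suc i)) \<le> Q (card (edges_before es ops i))"
    using qt unfolding query_time_def by blast
  obtain CQ where CQ: "0 < CQ" "\<And>m. 1 \<le> m ==> Q m \<le> CQ * real m powr (1 - \<delta>)"
    using bigo_bound[OF Q(1)] by auto

  \<comment> \<open>With order \<open>k * k\<close> edges there are at most \<open>2 * k\<close>
    updates of cost \<open>k powr (1 - 2 * \<epsilon>)\<close> and one query of cost
    \<open>k powr (2 - 2 * \<epsilon>)\<close>; \<open>L\<close> comes from the number of
    edges.\<close>
  define Cs where "Cs = (2 * CU + CQ) * L"
  define Cp where "Cp = CT * real N ^ dp"
  have C0: "0 \<le> Cs" "0 \<le> Cp" using CT(1) CU(1) CQ(1) by (simp_all add: Cs_def Cp_def)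
  define Bs where "Bs k = nat \<lfloor>Cs * real k powr (2 - 2 * \<epsilon>)\<rfloor>" for k
  define Bp where "Bp k = nat \<lfloor>Cp * real k ^ (2 * dp)\<rfloor>" for k
  \<comment> \<open>Chosen so that \<open>k ^ (2 * dp + 2)\<close>, which covers preprocessing of a
    graph with order \<open>k * k\<close> vertices, is at most of the order of the square root of
    \<open>n\<close>.\<close>
  define D where "D = 4 * dp + 4"
  have L1: "1 \<le> L" by (simp add: L_def)

  have t_pre: "fst (tr ! 0) \<le> Bp k" if k: "1 \<le> k" and tr: "tr \<in> set_spmf (dyn_run A p (N * (k * k)) 0 (es k M) (ops k u v))" for k M u v tr
  proof -
    have "1 \<le> N * (k * k)" using k by (simp add: N_def)
    then have "real (fst (tr ! 0)) \<le> CT * real (N * (k * k)) ^ dp" using T(2)[OF V[OF k] tr] CT(2) by fastforce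
    also have "\<dots> = Cp * real k ^ (2 * dp)" by (simp add: Cp_def power_mult_distrib power_mult power2_eq_square)
    finally show ?thesis unfolding Bp_def by (rule nat_floor_ge)
  qed
  have t_ses: "sum_list (map fst (tl tr)) \<le> Bs k" if k: "1 \<le> k" and tr: "tr \<in> set_spmf (dyn_run A p (N * (k * k)) 0 (es k M) (ops k u v))" for k M u v tr
  proof -
    obtain us where us: "ops k u v = us @ [Query]" "length us \<le> 2 * k" "Query \<notin> set us" using sp by blast
    let ?o = "ops k u v" and ?c = "%i. card (edges_before (es k M) (ops k u v) i)"
    have len: "length tr = Suc (Suc (length us))" using session_nonempty tr us(1) unfolding dyn_run_def by fastforce
    have Us: "{i. i < length ?o \<and> ?o ! i \<noteq> Query} = {..<length us}"
      using us(1,3) by (auto simp: nth_append less_Suc_eq dest: nth_mem)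
    have m1: "1 \<le> ?c i" if "i \<le> length ?o" for i
      using crd[OF k that, of M] k by (metis le_trans mult_le_mono nat_mult_1)
    have u1: "U (?c i) \<le> CU * (L * real k powr (1 - 2 * \<epsilon>))" if i: "i < length us" for i
    proof -
      have il: "i \<le> length ?o" using i us(1) by simp
      have "U (?c i) \<le> CU * real (?c i) powr (1 / 2 - \<delta>)" by (rule CU(2)[OF m1[OF il]])
      also have "\<dots> \<le> CU * real (?c i) powr (1 / 2 - \<epsilon>)" using e m1[OF il] CU(1) by (intro mult_left_mono powr_mono) auto
      also have "\<dots> \<le> CU * (L * real k powr (2 * (1 / 2 - \<epsilon>)))"
        using e k L1 m1[OF il] crd[OF k il, of M] CU(1) by (intro mult_left_mono powr_bound) auto
      finally show ?thesis by (simp add: right_diff_distrib)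
    qed
    have q1: "Q (?c (length us)) \<le> CQ * (L * real k powr (2 - 2 * \<epsilon>))"
    proof -
      have il: "length us \<le> length ?o" using us(1) by simp
      have "Q (?c (length us)) \<le> CQ * real (?c (length us)) powr (1 - \<delta>)" by (rule CQ(2)[OF m1[OF il]])
      also have "\<dots> \<le> CQ * real (?c (length us)) powr (1 - \<epsilon>)" using e m1[OF il] CQ(1) by (intro mult_left_mono powr_mono) auto
      also have "\<dots> \<le> CQ * (L * real k powr (2 * (1 - \<epsilon>)))"
        using e k L1 m1[OF il] crd[OF k il, of M] CQ(1) by (intro mult_left_mono powr_bound) auto
      finally show ?thesis by (simp add: right_diff_distrib)
    qed
    have "real (sum_list (map fst (tl tr))) = (\<Sum>i<Suc (length us). real (fst (tr ! Suc i)))"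
      using len by (simp add: sum_list_sum_nth nth_tl atLeast0LessThan)
    also have "\<dots> = (\<Sum>i<length us. real (fst (tr ! Suc i))) + real (fst (tr ! Suc (length us)))" by simp
    also have "\<dots> \<le> (\<Sum>i<length us. U (?c i)) + Q (?c (length us))"
      using U(2)[OF V[OF k] tr] Q(2)[OF V[OF k] tr, of "length us"] us(1) unfolding Us by (intro add_mono) auto
    also have "\<dots> \<le> (\<Sum>i<length us. CU * (L * real k powr (1 - 2 * \<epsilon>))) + CQ * (L * real k powr (2 - 2 * \<epsilon>))"
      using u1 q1 by (intro add_mono sum_mono) auto
    also have "\<dots> = real (length us) * (CU * (L * real k powr (1 - 2 * \<epsilon>))) + CQ * (L * real k powr (2 - 2 * \<epsilon>))" by simp
    also have "\<dots> \<le> (2 * real k) * (CU * (L * real k powr (1 - 2 * \<epsilon>))) + CQ * (L * real k powr (2 - 2 * \<epsilon>))"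
      using us(2) CU(1) by (intro add_mono mult_right_mono) auto
    also have "\<dots> = 2 * CU * L * (real k powr 1 * real k powr (1 - 2 * \<epsilon>)) + CQ * (L * real k powr (2 - 2 * \<epsilon>))"
      using k by simp
    also have "\<dots> = Cs * real k powr (2 - 2 * \<epsilon>)" unfolding powr_add[symmetric] by (simp add: Cs_def algebra_simps)
    finally show ?thesis unfolding Bs_def by (rule nat_floor_ge)
  qed

  obtain b1 b2 b3 where b: "regs_below b1 (preprocess A)" "regs_below b2 cupd" "regs_below b3 (query A)"
    using regs_below_ex by metis
  define bd where "bd = max b1 (max b2 b3)"
  have tk: "tok N tms"
    using tok_dtl[OF gd(6,7,8,1,2)] gd(6) unfolding tms_def tmsm_def N_def by (fastforce simp: tok_def)
  interpret red "preprocess A" cupd "query A" bd "dyn_word A" tms N rt ta c1 c2 c3 D "md \<noteq> Decremental" val Bp Bs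
  proof
    show "regs_below bd (preprocess A)" "regs_below bd cupd" "regs_below bd (query A)"
      using b regs_below_mono by (simp_all add: bd_def)
    show "1 \<le> N" "ta < N" "3 \<le> N" using gd(1,2) by (auto simp: N_def)
    show "rt \<le> 1" by (cases p) (simp_all add: rt_def)
    show "1 \<le> D" by (simp add: D_def)
    fix c a s b t a' s' b' t' assume m: "(c, (a, s, b, t), (a', s', b', t')) \<in> set tms"
    show "a < N \<and> b < N \<and> a' < N \<and> b' < N" using cps_mem[OF m] tk by (force simp: tok_def)
  qed (use gd in auto)
  have rr: "replicate rt 0 = root_input p 0" by (cases p) (simp_all add: rt_def)
  have run: "dyn_run A p (N * (k * k)) 0 (es k M) (ops k u v) = session (wk k) ((preprocess A, pinp k M) # rest k u v 0) (%_. 0)" for k M u v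
    unfolding dyn_run_def wk_def pinp_def rr es_def ops_def rest_opsm[OF refl refl cupd_def refl]
    by (simp add: tedges_tqs length_tqs)
  have ll: "lossless_spmf (dyn_run A p (N * (k * k)) 0 (es k M) (ops k u v))" if "1 \<le> k" for k M u v
    using mt V[OF that] unfolding maintains_def by blast
  have whole: "stm (wk k) ((preprocess A, pinp k M) # rest k u v 0) (%_. 0) (Bp k + Bs k)" if k: "1 \<le> k" for k M u v
    unfolding stm_def run[symmetric]
  proof (intro conjI ballI ll[OF k])
    fix tr assume tr: "tr \<in> set_spmf (dyn_run A p (N * (k * k)) 0 (es k M) (ops k u v))"
    have "tr \<noteq> []" using tr session_nonempty unfolding dyn_run_def by fastforce
    then have "sum_list (map fst tr) = fst (tr ! 0) + sum_list (map fst (tl tr))" by (cases tr) auto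
    then show "sum_list (map fst tr) \<le> Bp k + Bs k" using t_pre[OF k tr] t_ses[OF k tr] by simp
  qed
  interpret redok "preprocess A" cupd "query A" bd "dyn_word A" tms N rt ta c1 c2 c3 D "md \<noteq> Decremental" val Bp Bs
  proof
    fix k :: nat and M u v t s assume k: "1 \<le> k"
    show "lossless_spmf (exec (wk k) (pinp k M) (preprocess A) (ini (%_. 0)))"
      by (rule stm_Cons(1)[OF whole[OF k]])
    show "val k M u v + lhs k (cnt u k) (cnt v k) \<noteq> rhs k (cnt u k) (cnt v k) \<longleftrightarrow> hit k M u v"
      unfolding lhs_def rhs_def hit_def dec[OF k] hitp_def ..
    show "Ex (exec (wk k) (pinp k M) (preprocess A) (ini (%_. 0))) (%q. serr (wk k) (rest k u v 0) (val k M u v) (mem (snd q))) \<le> ennreal (1 / 3)"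
    proof -
      obtain us where us: "ops k u v = us @ [Query]" using sp by blast
      have "Ex (exec (wk k) (pinp k M) (preprocess A) (ini (%_. 0))) (%q. serr (wk k) (rest k u v 0) (val k M u v) (mem (snd q)))
        = serr (wk k) ((preprocess A, pinp k M) # rest k u v 0) (val k M u v) (%_. 0)"
        by (rule serr_Cons[symmetric]) simp
      also have "\<dots> = Ex (dyn_run A p (N * (k * k)) 0 (es k M) (ops k u v)) (%tr. of_bool (snd (last tr) \<noteq> [val k M u v]))"
        unfolding serr_def run ..
      also have "\<dots> = Ex (dyn_run A p (N * (k * k)) 0 (es k M) (ops k u v)) (%tr. of_bool (snd (tr ! Suc (length us)) \<noteq> [val k M u v]))"
      proof (rule Ex_cong)
        fix tr assume "tr \<in> set_spmf (dyn_run A p (N * (k * k)) 0 (es k M) (ops k u v))"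
        then have "length tr = Suc (Suc (length us))" using session_nonempty us unfolding dyn_run_def by fastforce
        then have "last tr = tr ! Suc (length us)" by (metis diff_Suc_1 last_conv_nth length_0_conv nat.distinct(1))
        then show "of_bool (snd (last tr) \<noteq> [val k M u v]) = (of_bool (snd (tr ! Suc (length us)) \<noteq> [val k M u v]) :: ennreal)" by simp
      qed
      also have "\<dots> = ennreal (measure (measure_spmf (dyn_run A p (N * (k * k)) 0 (es k M) (ops k u v))) {tr. snd (tr ! Suc (length us)) \<noteq> [val k M u v]})"
        by (rule Ex_of_bool)
      also have "\<dots> \<le> ennreal (1 / 3)"
      proof (rule ennreal_leI)
        have i: "length us < length (ops k u v)" "ops k u v ! length us = Query" "length (ops k u v) - 1 = length us" using us by simp_all
        have "\<forall>i<length (ops k u v). ops k u v ! i = Query -->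
           measure (measure_spmf (dyn_run A p (N * (k * k)) 0 (es k M) (ops k u v)))
             {tr. snd (tr ! Suc i) \<noteq> [answer p 0 ({..<N * (k * k)}, edges_before (es k M) (ops k u v) i)]} \<le> 1 / 3"
          using mt V[OF k] unfolding maintains_def by blast
        then show "measure (measure_spmf (dyn_run A p (N * (k * k)) 0 (es k M) (ops k u v))) {tr. snd (tr ! Suc (length us)) \<noteq> [val k M u v]} \<le> 1 / 3"
          unfolding val_def i(3) using i(1,2) by blast
      qed
      finally show ?thesis .
    qed
    assume ts: "(t, s) \<in> set_spmf (exec (wk k) (pinp k M) (preprocess A) (ini (%_. 0)))"
    \<comment> \<open>A trace that continues one outcome of preprocessing extends to a trace of the
      whole run, so the sure time bounds hold from every reachable memory.\<close>
    have sub: "(t, out s) # tr \<in> set_spmf (dyn_run A p (N * (k * k)) 0 (es k M) (ops k u v))"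
      if "tr \<in> set_spmf (session (wk k) (rest k u v 0) (mem s))" for tr u v
      unfolding run using ts that by (force simp: set_bind_spmf bind_UNION)
    have l2: "lossless_spmf (session (wk k) (rest k u v 0) (mem s))" for u v
      using stm_Cons(2)[OF whole[OF k] ts] by (simp add: stm_def)
    show "stm (wk k) (rest k u v 0) (mem s) (Bs k)"
      unfolding stm_def using l2 t_ses[OF k sub] by auto
    obtain tr where "tr \<in> set_spmf (session (wk k) (rest k u v 0) (mem s))"
      using l2 measure_spmf_zero_iff[of "session (wk k) (rest k u v 0) (mem s)" UNIV] by (auto simp: lossless_spmf_def space_measure_spmf)
    then show "t \<le> Bp k" using t_pre[OF k sub] by fastforce
  qed
  have "solves_omv omv \<and> omv_time omv (%n. real n powr (3 - \<epsilon> / D))"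
  proof (rule omv_bounds[OF D_def e(1,2) C0])
    show "real (Bs k) \<le> Cs * real k powr (2 - 2 * \<epsilon>)" for k unfolding Bs_def using C0 by (intro nat_floor_le) simp
    show "real (Bp k) \<le> Cp * real k ^ (2 * dp)" for k unfolding Bp_def using C0 by (intro nat_floor_le) simp
  qed
  moreover have "0 < \<epsilon> / D" using e by (simp add: D_def)
  ultimately show False using \<open>OMv_conjecture\<close> unfolding OMv_conjecture_def by blast
qed

theorem theorem4p6:
  fixes \<delta> :: real and p :: problem
  assumes "OMv_conjecture"
    and "\<delta> > 0"
    and "p \<in> {Detect paw, Detect diamond, Detect clique4} \<union> {Detect (cycle k) | k. 3 \<le> k} \<union>
          {Detect_At paw, Detect_At diamond, Detect_At clique4} \<union>
          {Detect_At (cycle k) | k. 3 \<le> k \<and> odd k} \<union>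
          {Count path3, Count_At path3}"
  shows "(\<forall>md \<in> {Incremental, Decremental}.
      \<not> (\<exists>A. maintains md p A \<and>
             polynomial_preprocessing md p A \<and>
             worst_case_update_time md p A (\<lambda>m. real m powr (1 / 2 - \<delta>)) \<and>
             query_time md p A (\<lambda>m. real m powr (1 - \<delta>)))) \<and>
      \<not> (\<exists>A. maintains Fully_Dynamic p A \<and>
             polynomial_preprocessing Fully_Dynamic p A \<and>
             amortized_update_time Fully_Dynamic p A (\<lambda>m. real m powr (1 / 2 - \<delta>)) \<and>
             query_time Fully_Dynamic p A (\<lambda>m. real m powr (1 - \<delta>)))"
proof -
  obtain gt dl d ta c1 c2 c3 core where "gad p gt dl d ta c1 c2 c3 core"
    using gad_exists[OF assms(3)] by blast
  note r = reduction[OF assms(1,2) this]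
  \<comment> \<open>Worst-case bounds are amortised bounds, so the same reduction refutes an
    algorithm in each of the three modes.\<close>
  show ?thesis using r worst_imp_amortized by blast
qed

end
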